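(* The Wagner position of an FDFA using normalization can be computed in NLOGSPACE: given a saturated FDFA $\mathcal F$ using normalized acceptance, the position of the language recognized by $\mathcal F$ in the Wagner hierarchy (equivalently, deciding, for given $k\ge 1$, membership of this language in $\mathbb{DM}_k^{+}$, $\mathbb{DM}_k^{-}$, $\mathbb{DM}_k^{\pm}$) can be computed in non-deterministic logarithmic space.
   Context: $\Sigma$ is a finite alphabet. For a (complete deterministic) automaton $\mathcal A$ and $w\in\Sigma^*$, $\mathcal A(w)$ is the state reached from the initial state on reading $w$; $[\![\mathcal D]\!]$ is the language of a DFA $\mathcal D$. An FDFA is a pair $\mathcal F=(\mathcal Q,\{\mathcal P_q\}_{q\in Q})$ of a leading automaton structure $\mathcal Q$ (a complete deterministic automaton without acceptance, with state set $Q$) and a complete progress DFA $\mathcal P_q$ for each $q\in Q$; write $\mathcal P_u=\mathcal P_{\mathcal Q(u)}$ for $u\in\Sigma^*$. For $u\in\Sigma^*,v\in\Sigma^+$: $(u,v)$ is a decomposition of $w$ if $uv^\omega=w$; normalized if $\mathcal Q(uv)=\mathcal Q(u)$. With normalized acceptance, $(u,v)\in[\![\mathcal F]\!]$ iff there is a normalized decomposition $(x,y)$ of $uv^\omega$ with $y\in[\![\mathcal P_x]\!]$. $\mathcal F$ is saturated if, for every ultimately periodic word $w$, all normalized decompositions $(x,y)$ of $w$ agree on whether $y\in[\![\mathcal P_x]\!]$. The language recognized by $\mathcal F$ is the unique $\omega$-regular language whose ultimately periodic words are the $uv^\omega$ with $(u,v)\in[\![\mathcal F]\!]$. Wagner hierarchy.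 A DMA is a complete deterministic Muller automaton $\mathcal M$ with acceptance $\alpha\subseteq 2^{Q}$ (a run is accepting iff the set of states visited infinitely often is in $\alpha$). An SCC is a nonempty set $S$ of states, not necessarily maximal, such that there is a path within $S$ between every pair of its states (a singleton must have a self-loop); it is accepting if $S\in\alpha$, otherwise rejecting. $|\mathcal M|_{\subseteq}^{+}$ (resp. $|\mathcal M|_{\subseteq}^{-}$) is the maximal length $k$ of a strict inclusion chain $S_1\subset S_2\subset\dots\subset S_k$ of (reachable) SCCs of alternating acceptance with $S_1$ accepting (resp. rejecting). $\mathbb{DM}_k^{+}$ (resp. $\mathbb{DM}_k^{-}$, $\mathbb{DM}_k^{\pm}$) is the class of languages recognized by some DMA $\mathcal M$ with $|\mathcal M|_{\subseteq}^{+}\le k$ and $|\mathcal M|_{\subseteq}^{-}<k$ (resp. $|\mathcal M|_{\subseteq}^{+}<k$ and $|\mathcal M|_{\subseteq}^{-}\le k$; $|\mathcal M|_{\subseteq}^{+}\le k$ and $|\mathcal M|_{\subseteq}^{-}\le k$). The position of a language is the smallest such class containing it. *)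

theory Defs
  imports Complex_Main "HOL-Library.Omega_Words_Fun"
begin

section \<open>Deterministic automata\<close>

record ('q, 'a) aut =
  states :: "'q set"
  init :: 'q
  trans :: "'q \<Rightarrow> 'a \<Rightarrow> 'q"

record ('q, 'a) dfa = "('q, 'a) aut" +
  final :: "'q set"

record ('q, 'a) dma = "('q, 'a) aut" +
  table :: "'q set set"

definition complete_aut :: "'a set \<Rightarrow> ('q, 'a, 'm) aut_scheme \<Rightarrow> bool" where
  "complete_aut \<Sigma> A \<longleftrightarrow> finite (states A) \<and> init A \<in> states A \<and>
     (\<forall>q\<in>states A. \<forall>a\<in>\<Sigma>. trans A q a \<in> states A)"

definition reach :: "('q, 'a, 'm) aut_scheme \<Rightarrow> 'a list \<Rightarrow> 'q" where
  "reach A w = foldl (trans A) (init A) w"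

definition complete_dfa :: "'a set \<Rightarrow> ('q, 'a) dfa \<Rightarrow> bool" where
  "complete_dfa \<Sigma> D \<longleftrightarrow> complete_aut \<Sigma> D \<and> final D \<subseteq> states D"

definition dfa_lang :: "'a set \<Rightarrow> ('q, 'a) dfa \<Rightarrow> 'a list set" where
  "dfa_lang \<Sigma> D = {w \<in> lists \<Sigma>. reach D w \<in> final D}"

definition complete_dma :: "'a set \<Rightarrow> ('q, 'a) dma \<Rightarrow> bool" where
  "complete_dma \<Sigma> M \<longleftrightarrow> complete_aut \<Sigma> M \<and> table M \<subseteq> Pow (states M)"

definition run :: "('q, 'a, 'm) aut_scheme \<Rightarrow> 'a word \<Rightarrow> 'q word" where
  "run A w = (\<lambda>i. reach A (prefix i w))"

definition dma_lang :: "'a set \<Rightarrow> ('q, 'a) dma \<Rightarrow> 'a word set" where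
  "dma_lang \<Sigma> M = {w. range w \<subseteq> \<Sigma> \<and> limit (run M w) \<in> table M}"

text \<open>Finite automata are taken up to renaming of states, so states may be natural numbers.\<close>

definition omega_regular :: "'a set \<Rightarrow> 'a word set \<Rightarrow> bool" where
  "omega_regular \<Sigma> L \<longleftrightarrow> (\<exists>M :: (nat, 'a) dma. complete_dma \<Sigma> M \<and> dma_lang \<Sigma> M = L)"


section \<open>The Wagner hierarchy\<close>

definition edges_within :: "'a set \<Rightarrow> ('q, 'a, 'm) aut_scheme \<Rightarrow> 'q set \<Rightarrow> ('q \<times> 'q) set" where
  "edges_within \<Sigma> A S = {(p, q). p \<in> S \<and> q \<in> S \<and> (\<exists>a\<in>\<Sigma>. trans A p a = q)}"

text \<open>Paths are nonempty, also from a state to itself: a singleton needs a self-loop.\<close>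

definition reachable_scc :: "'a set \<Rightarrow> ('q, 'a, 'm) aut_scheme \<Rightarrow> 'q set \<Rightarrow> bool" where
  "reachable_scc \<Sigma> A S \<longleftrightarrow> S \<noteq> {} \<and> S \<subseteq> reach A ` lists \<Sigma> \<and>
     (\<forall>p\<in>S. \<forall>q\<in>S. (p, q) \<in> (edges_within \<Sigma> A S)\<^sup>+)"

text \<open>The flag says whether the first SCC is accepting. The empty chain qualifies for either flag,
  so the maximal length below is 0 if there is no nonempty chain.\<close>

definition alternating_chain :: "'a set \<Rightarrow> ('q, 'a) dma \<Rightarrow> bool \<Rightarrow> 'q set list \<Rightarrow> bool" where
  "alternating_chain \<Sigma> M b Ss \<longleftrightarrow>
     (\<forall>S\<in>set Ss. reachable_scc \<Sigma> M S) \<and> sorted_wrt (\<subset>) Ss \<and>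
     (Ss \<noteq> [] \<longrightarrow> (hd Ss \<in> table M \<longleftrightarrow> b)) \<and>
     (\<forall>i. Suc i < length Ss \<longrightarrow> (Ss ! i \<in> table M) \<noteq> (Ss ! Suc i \<in> table M))"

definition chain_measure :: "'a set \<Rightarrow> ('q, 'a) dma \<Rightarrow> bool \<Rightarrow> nat" where
  "chain_measure \<Sigma> M b = Max {length Ss | Ss. alternating_chain \<Sigma> M b Ss}"

datatype wagner_sign = Plus | Minus | PlusMinus

fun within_measures :: "nat \<Rightarrow> wagner_sign \<Rightarrow> nat \<Rightarrow> nat \<Rightarrow> bool" where
  "within_measures k Plus m_pos m_neg \<longleftrightarrow> m_pos \<le> k \<and> m_neg < k"
| "within_measures k Minus m_pos m_neg \<longleftrightarrow> m_pos < k \<and> m_neg \<le> k"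
| "within_measures k PlusMinus m_pos m_neg \<longleftrightarrow> m_pos \<le> k \<and> m_neg \<le> k"

definition wagner_class :: "'a set \<Rightarrow> nat \<Rightarrow> wagner_sign \<Rightarrow> 'a word set set" where
  "wagner_class \<Sigma> k s = {dma_lang \<Sigma> M | M :: (nat, 'a) dma. complete_dma \<Sigma> M \<and>
     within_measures k s (chain_measure \<Sigma> M True) (chain_measure \<Sigma> M False)}"

definition is_wagner_position :: "'a set \<Rightarrow> 'a word set \<Rightarrow> nat \<Rightarrow> wagner_sign \<Rightarrow> bool" where
  "is_wagner_position \<Sigma> L k s \<longleftrightarrow> 1 \<le> k \<and> L \<in> wagner_class \<Sigma> k s \<and>
     (\<forall>k' s'. 1 \<le> k' \<and> L \<in> wagner_class \<Sigma> k' s' \<longrightarrow> wagner_class \<Sigma> k s \<subseteq> wagner_class \<Sigma> k' s')"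


section \<open>Families of DFAs with normalized acceptance\<close>

record ('q, 'p, 'a) fdfa =
  leading :: "('q, 'a) aut"
  progress :: "'q \<Rightarrow> ('p, 'a) dfa"

definition complete_fdfa :: "'a set \<Rightarrow> ('q, 'p, 'a) fdfa \<Rightarrow> bool" where
  "complete_fdfa \<Sigma> F \<longleftrightarrow> complete_aut \<Sigma> (leading F) \<and>
     (\<forall>q\<in>states (leading F). complete_dfa \<Sigma> (progress F q))"

definition decomposition :: "'a set \<Rightarrow> 'a word \<Rightarrow> 'a list \<Rightarrow> 'a list \<Rightarrow> bool" where
  "decomposition \<Sigma> w u v \<longleftrightarrow> u \<in> lists \<Sigma> \<and> v \<in> lists \<Sigma> \<and> v \<noteq> [] \<and> u \<frown> v\<^sup>\<omega> = w"

definition normalized_decomposition ::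
  "'a set \<Rightarrow> ('q, 'p, 'a) fdfa \<Rightarrow> 'a word \<Rightarrow> 'a list \<Rightarrow> 'a list \<Rightarrow> bool" where
  "normalized_decomposition \<Sigma> F w u v \<longleftrightarrow> decomposition \<Sigma> w u v \<and>
     reach (leading F) (u @ v) = reach (leading F) u"

definition progress_dfa :: "('q, 'p, 'a) fdfa \<Rightarrow> 'a list \<Rightarrow> ('p, 'a) dfa" where
  "progress_dfa F u = progress F (reach (leading F) u)"

definition fdfa_pairs :: "'a set \<Rightarrow> ('q, 'p, 'a) fdfa \<Rightarrow> ('a list \<times> 'a list) set" where
  "fdfa_pairs \<Sigma> F = {(u, v). u \<in> lists \<Sigma> \<and> v \<in> lists \<Sigma> \<and> v \<noteq> [] \<and>
     (\<exists>x y. normalized_decomposition \<Sigma> F (u \<frown> v\<^sup>\<omega>) x y \<and> y \<in> dfa_lang \<Sigma> (progress_dfa F x))}"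

definition saturated :: "'a set \<Rightarrow> ('q, 'p, 'a) fdfa \<Rightarrow> bool" where
  "saturated \<Sigma> F \<longleftrightarrow> (\<forall>w x y x' y'.
     normalized_decomposition \<Sigma> F w x y \<and> normalized_decomposition \<Sigma> F w x' y' \<longrightarrow>
     (y \<in> dfa_lang \<Sigma> (progress_dfa F x) \<longleftrightarrow> y' \<in> dfa_lang \<Sigma> (progress_dfa F x')))"

definition fdfa_lang :: "'a set \<Rightarrow> ('q, 'p, 'a) fdfa \<Rightarrow> 'a word set" where
  "fdfa_lang \<Sigma> F = (THE L. omega_regular \<Sigma> L \<and>
     {w \<in> L. \<exists>u v. decomposition \<Sigma> w u v} = {u \<frown> v\<^sup>\<omega> | u v. (u, v) \<in> fdfa_pairs \<Sigma> F})"


section \<open>Nondeterministic logarithmic space\<close>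

text \<open>
  A machine has a two-way read-only input tape with end markers, a fixed number of one-way infinite
  read-write work tapes, and a write-only output tape to which a transition appends a (usually
  empty) string. Control states and work symbols are natural numbers, 0 being the blank; only
  finitely many of them are used because the transition relation is finite.
\<close>

datatype dir = MoveLeft | Stay | MoveRight

datatype 'i cell = LeftEnd | Symbol 'i | RightEnd

type_synonym ('i, 'o) transition =
  "(nat \<times> 'i cell \<times> nat list) \<times> (nat \<times> dir \<times> (nat \<times> dir) list \<times> 'o list)"

record ('i, 'o) ntm =
  work_tapes :: nat
  start_state :: nat
  accept_state :: nat
  delta :: "('i, 'o) transition set"

definition ntm :: "('i, 'o) ntm \<Rightarrow> bool" where
  "ntm M \<longleftrightarrow> finite (delta M) \<and>
     (\<forall>((q, a, xs), (q', d, acts, ys)) \<in> delta M.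
        q \<noteq> accept_state M \<and> length xs = work_tapes M \<and> length acts = work_tapes M)"

text \<open>A configuration: control state, input head, contents and head of each work tape, output.\<close>

type_synonym 'o config = "nat \<times> nat \<times> ((nat \<Rightarrow> nat) \<times> nat) list \<times> 'o list"

fun move :: "dir \<Rightarrow> nat \<Rightarrow> nat" where
  "move MoveLeft h = h - 1"
| "move Stay h = h"
| "move MoveRight h = h + 1"

definition input_cell :: "'i list \<Rightarrow> nat \<Rightarrow> 'i cell" where
  "input_cell w h =
     (if h = 0 then LeftEnd else if h \<le> length w then Symbol (w ! (h - 1)) else RightEnd)"

inductive ntm_step :: "('i, 'o) ntm \<Rightarrow> 'i list \<Rightarrow> 'o config \<Rightarrow> 'o config \<Rightarrow> bool" for M w where
  "((q, input_cell w i, map (\<lambda>(t, h). t h) ts), (q', d, acts, ys)) \<in> delta M \<Longrightarrow>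
   ntm_step M w (q, i, ts, out)
     (q', min (move d i) (length w + 1),
      map2 (\<lambda>(t, h) (x, e). (t(h := x), move e h)) ts acts, out @ ys)"

definition start_config :: "('i, 'o) ntm \<Rightarrow> 'o config" where
  "start_config M = (start_state M, 0, replicate (work_tapes M) (\<lambda>_. 0, 0), [])"

definition ntm_reaches :: "('i, 'o) ntm \<Rightarrow> 'i list \<Rightarrow> 'o config \<Rightarrow> bool" where
  "ntm_reaches M w c \<longleftrightarrow> (ntm_step M w)\<^sup>*\<^sup>* (start_config M) c"

definition ntm_accepts :: "('i, 'o) ntm \<Rightarrow> 'i list \<Rightarrow> bool" where
  "ntm_accepts M w \<longleftrightarrow> (\<exists>i ts out. ntm_reaches M w (accept_state M, i, ts, out))"

definition ntm_outputs :: "('i, 'o) ntm \<Rightarrow> 'i list \<Rightarrow> 'o list \<Rightarrow> bool" where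
  "ntm_outputs M w out \<longleftrightarrow> (\<exists>i ts. ntm_reaches M w (accept_state M, i, ts, out))"

text \<open>Heads start at cell 0, so the head positions bound the number of work cells ever visited.
  The bound is required on every input and along every nondeterministic branch.\<close>

definition log_space :: "('i, 'o) ntm \<Rightarrow> bool" where
  "log_space M \<longleftrightarrow> (\<exists>C::real. \<forall>w q i ts out. ntm_reaches M w (q, i, ts, out) \<longrightarrow>
     (\<forall>(t, h) \<in> set ts. real h \<le> C * log 2 (real (length w) + 2)))"

text \<open>Promise problems: \<^term>\<open>D\<close> is the set of instances and \<^term>\<open>enc\<close> their encoding; nothing
  is required of the answer on other inputs.\<close>

definition nlogspace_decides :: "'x set \<Rightarrow> ('x \<Rightarrow> 'i list) \<Rightarrow> ('x \<Rightarrow> bool) \<Rightarrow> bool" where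
  "nlogspace_decides D enc P \<longleftrightarrow> (\<exists>M :: ('i, unit) ntm. ntm M \<and> log_space M \<and>
     (\<forall>x\<in>D. ntm_accepts M (enc x) \<longleftrightarrow> P x))"

text \<open>Every accepting computation must produce a correct output, and there must be at least one.\<close>

definition nlogspace_computes :: "'x set \<Rightarrow> ('x \<Rightarrow> 'i list) \<Rightarrow> ('x \<Rightarrow> 'o list \<Rightarrow> bool) \<Rightarrow> bool" where
  "nlogspace_computes D enc R \<longleftrightarrow> (\<exists>M :: ('i, 'o) ntm. ntm M \<and> log_space M \<and>
     (\<forall>x\<in>D. (\<exists>out. ntm_outputs M (enc x) out) \<and> (\<forall>out. ntm_outputs M (enc x) out \<longrightarrow> R x out)))"


section \<open>Encodings\<close>

datatype sym = Bit bool | Sep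

text \<open>Binary, most significant bit first, without leading zeros; 0 is the empty string.\<close>

fun binary :: "nat \<Rightarrow> sym list" where
  "binary n = (if n = 0 then [] else binary (n div 2) @ [Bit (odd n)])"

declare binary.simps [simp del]

definition encode :: "nat list \<Rightarrow> sym list" where
  "encode ns = concat (map (\<lambda>n. binary n @ [Sep]) ns)"

text \<open>
  An FDFA given as input has the alphabet \<open>{..<s}\<close> and initial segments of the natural numbers
  as state sets; it is listed by its transition tables, with the final states as 0/1 flags.
\<close>

type_synonym input_fdfa = "(nat, nat, nat) fdfa"

definition aut_code :: "nat \<Rightarrow> (nat, nat, 'm) aut_scheme \<Rightarrow> nat list" where
  "aut_code s A = [card (states A), init A] @
     [trans A q a. q \<leftarrow> [0..<card (states A)], a \<leftarrow> [0..<s]]"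

definition dfa_code :: "nat \<Rightarrow> (nat, nat) dfa \<Rightarrow> nat list" where
  "dfa_code s D = aut_code s D @
     [if q \<in> final D then 1 else 0. q \<leftarrow> [0..<card (states D)]]"

definition fdfa_code :: "nat \<times> input_fdfa \<Rightarrow> nat list" where
  "fdfa_code = (\<lambda>(s, F). s # aut_code s (leading F) @
     concat [dfa_code s (progress F q). q \<leftarrow> [0..<card (states (leading F))]])"

definition saturated_inputs :: "(nat \<times> input_fdfa) set" where
  "saturated_inputs = {(s, F). 0 < s \<and> complete_fdfa {..<s} F \<and>
     states (leading F) = {..<card (states (leading F))} \<and>
     (\<forall>q\<in>states (leading F). states (progress F q) = {..<card (states (progress F q))}) \<and>
     saturated {..<s} F}"

fun sign_code :: "wagner_sign \<Rightarrow> nat" where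
  "sign_code Plus = 0"
| "sign_code Minus = 1"
| "sign_code PlusMinus = 2"

end

theory Submission
  imports Defs "HOL-Library.Countable" "HOL-Library.Log_Nat"
begin

text \<open>
  Let \<open>q\<close> be a reachable leading state. Some words \<open>v\<close> loop on \<open>q\<close> and on the progress state \<open>s\<close> they
  lead to; such an \<open>s\<close> stands for the ultimately periodic words with period \<open>v\<close>. Saturation makes
  acceptance invariant under rotating and repeating loops. Therefore an alternating chain of SCCs of a
  Muller automaton for the language, read as loops around a common state each containing the previous
  ones, becomes an alternating chain of such progress states of a single \<open>q\<close>, each reachable from the
  previous one by a word that loops on \<open>q\<close>, and conversely. So the longest alternating chains are
  the same for all Muller automata of the language, and they determine its class and its position.

  In the product of the leading automaton with one or two copies of a progress DFA, such chains are
  described by reachability. Every condition is thus a formula over input positions with bounded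
  quantifiers, transitive closure and, for maximality, negation. These formulas can be evaluated in
  nondeterministic logarithmic space, which is closed under complement by inductive counting.
\<close>

section \<open>Ultimately periodic words and runs\<close>

text \<open>\<open>fdfa_lang\<close> is a definite description, so nothing can be said about it
  before a Muller automaton for it exists and its language is known to be unique. Uniqueness holds
  because two Muller automata that differ on some word differ on an ultimately periodic one. For
  existence, words are classified by their action on the leading automaton and on all progress DFAs;
  saturation makes membership of \<open>u \<frown> v\<^sup>\<omega>\<close> a function of the
  classes of \<open>u\<close> and \<open>v\<close>, and an argument about finite semigroups yields a
  deterministic automaton directly, without determinization. The obstacle in comparing chains is
  that no map relates the states of the FDFA to those of the Muller automaton; they only share the
  words. Hence all of them are driven by the same loops, replaced by powers that act idempotently on
  all of them at once. Complements are unavoidable on the machine side, since both tasks forbid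
  longer chains. A chain is no longer than the number of states of one progress DFA, hence than the
  input, so lengths, states and positions fit into a register.\<close>

declare iter_nth [simp del]

abbreviation wpow :: "'a list \<Rightarrow> nat \<Rightarrow> 'a list" where
  "wpow v n \<equiv> concat (replicate n v)"

lemma length_wpow [simp]: "length (wpow v n) = n * length v"
  by (induction n) auto

lemma wpow_Suc2: "wpow v (Suc n) = wpow v n @ v"
  by (induction n) auto

lemma wpow_add: "wpow v (m + n) = wpow v m @ wpow v n"
  by (simp add: replicate_add)

lemma wpow_in_lists [simp]: "v \<in> lists \<Sigma> \<Longrightarrow> wpow v n \<in> lists \<Sigma>"
  by (induction n) auto

lemma conc_iter_eq: "v \<noteq> [] \<Longrightarrow> u \<frown> v\<^sup>\<omega> = (u @ v) \<frown> v\<^sup>\<omega>"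
  by (metis conc_conc iter_unroll length_greater_0_conv)

lemma conc_iter_wpow: "v \<noteq> [] \<Longrightarrow> (u @ wpow v n) \<frown> v\<^sup>\<omega> = u \<frown> v\<^sup>\<omega>"
proof (induction n arbitrary: u)
  case (Suc n)
  then show ?case using conc_iter_eq[of v u] Suc.IH[of "u @ v"] by simp
qed simp

lemma prefix_iter: "v \<noteq> [] \<Longrightarrow> prefix n (v\<^sup>\<omega>) = wpow v (n div length v) @ take (n mod length v) v"
proof (induction n rule: less_induct)
  case (less n)
  show ?case
  proof (cases "n < length v")
    case True
    then show ?thesis using less.prems
      by (intro nth_equalityI) (auto simp: iter_nth)
  next
    case False
    have pos: "0 < length v" using less.prems by simp
    have "prefix n (v\<^sup>\<omega>) = v @ prefix (n - length v) (v\<^sup>\<omega>)"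
      using prefix_conc_snd[of v n "v\<^sup>\<omega>"] False iter_unroll[OF pos] by simp
    also have "prefix (n - length v) (v\<^sup>\<omega>)
        = wpow v ((n - length v) div length v) @ take ((n - length v) mod length v) v"
      by (rule less.IH) (use less.prems False pos in linarith)+
    also have "v @ \<dots> = wpow v (Suc ((n - length v) div length v)) @ take ((n - length v) mod length v) v"
      by simp
    also have "Suc ((n - length v) div length v) = n div length v" using False pos by (simp add: le_div_geq)
    also have "(n - length v) mod length v = n mod length v" using False by (simp add: le_mod_geq)
    finally show ?thesis .
  qed
qed

lemma periodic_suffix:
  assumes "\<And>n. p \<le> n \<Longrightarrow> w (n + d) = w n" "0 < d"
  shows "suffix p w = (w [p \<rightarrow> p + d])\<^sup>\<omega>"
proof
  fix n
  show "suffix p w n = (w [p \<rightarrow> p + d])\<^sup>\<omega> n"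
  proof (induction n rule: less_induct)
    case (less n)
    show ?case
    proof (cases "n < d")
      case False
      then have "suffix p w n = suffix p w (n - d)" using assms(1)[of "p + (n - d)"] by simp
      also have "\<dots> = (w [p \<rightarrow> p + d])\<^sup>\<omega> (n - d)" using less[of "n - d"] assms(2) False by simp
      also have "\<dots> = (w [p \<rightarrow> p + d])\<^sup>\<omega> n" using False assms(2) by (simp add: le_mod_geq iter_nth)
      finally show ?thesis .
    qed (use assms(2) in \<open>simp add: iter_nth\<close>)
  qed
qed

lemma iter_wpow: "v \<noteq> [] \<Longrightarrow> 0 < n \<Longrightarrow> (wpow v n)\<^sup>\<omega> = v\<^sup>\<omega>"
proof -
  assume v: "v \<noteq> []" and n: "0 < n"
  have "suffix 0 (v\<^sup>\<omega>) = (v\<^sup>\<omega> [0 \<rightarrow> 0 + n * length v])\<^sup>\<omega>"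
    by (rule periodic_suffix) (use v n in \<open>auto simp: iter_nth\<close>)
  then show ?thesis using v by (simp add: prefix_iter)
qed

text \<open>Reading the equation at positions shifted by \<open>length v\<close> shows that this
  number is a period of \<open>w\<close>, and the first block is \<open>v\<close>. Identities
  between infinite words thus reduce to fixed-point equations.\<close>

lemma iter_unique:
  assumes "w = v \<frown> w" "v \<noteq> []"
  shows "w = v\<^sup>\<omega>"
proof -
  have "w (n + length v) = w n" for n
    by (metis assms(1) conc_snd add_diff_cancel_right' not_add_less2)
  then have "suffix 0 w = (w [0 \<rightarrow> 0 + length v])\<^sup>\<omega>"
    by (rule periodic_suffix) (use assms(2) in simp)
  moreover have "prefix (length v) w = v"
    by (metis assms(1) prefix_conc_length)
  ultimately show ?thesis by simp
qed

text \<open>\<open>(x @ y)\<^sup>\<omega>\<close> and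
  \<open>x \<frown> (y @ x)\<^sup>\<omega>\<close> both solve \<open>w = (x @ y) \<frown> w\<close>,
  which has only one solution. This is the source of all invariance under conjugation below.\<close>

lemma conc_iter_rotate: "x @ y \<noteq> [] \<Longrightarrow> u \<frown> (x @ y)\<^sup>\<omega> = (u @ x) \<frown> (y @ x)\<^sup>\<omega>"
proof -
  assume xy: "x @ y \<noteq> []"
  have "(y @ x)\<^sup>\<omega> = (y @ x) \<frown> (y @ x)\<^sup>\<omega>" using xy by (intro iter_unroll) auto
  then have "x \<frown> (y @ x)\<^sup>\<omega> = x \<frown> (y @ x) \<frown> (y @ x)\<^sup>\<omega>" by metis
  also have "\<dots> = (x @ y) \<frown> (x \<frown> (y @ x)\<^sup>\<omega>)" by simp
  finally have "x \<frown> (y @ x)\<^sup>\<omega> = (x @ y) \<frown> (x \<frown> (y @ x)\<^sup>\<omega>)" .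
  from iter_unique[OF this xy] show ?thesis by (metis conc_conc)
qed

lemma range_iter: "v \<noteq> [] \<Longrightarrow> range (v\<^sup>\<omega>) = set v"
proof
  assume "v \<noteq> []"
  then show "set v \<subseteq> range (v\<^sup>\<omega>)" using limit_iter[of v] limit_in_range[of "v\<^sup>\<omega>"] by simp
qed (auto simp: iter_nth)

lemma range_conc_iter: "v \<noteq> [] \<Longrightarrow> range (u \<frown> v\<^sup>\<omega>) \<subseteq> \<Sigma> \<longleftrightarrow> u \<in> lists \<Sigma> \<and> v \<in> lists \<Sigma>"
  by (auto simp: range_iter subset_iff in_lists_conv_set)

lemma segment_in_lists: "range w \<subseteq> \<Sigma> \<Longrightarrow> w [i \<rightarrow> j] \<in> lists \<Sigma>"
  by (auto simp: in_lists_conv_set subset_iff)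

section \<open>Runs on ultimately periodic words and their limits\<close>

lemma reach_append: "reach A (u @ v) = foldl (trans A) (reach A u) v"
  by (simp add: reach_def)

lemma foldl_in_states:
  "complete_aut \<Sigma> A \<Longrightarrow> w \<in> lists \<Sigma> \<Longrightarrow> q \<in> states A \<Longrightarrow> foldl (trans A) q w \<in> states A"
  by (induction w arbitrary: q) (auto simp: complete_aut_def)

lemma reach_in_states: "complete_aut \<Sigma> A \<Longrightarrow> w \<in> lists \<Sigma> \<Longrightarrow> reach A w \<in> states A"
  unfolding reach_def by (rule foldl_in_states) (auto simp: complete_aut_def)

lemma foldl_wpow: "foldl f q v = q \<Longrightarrow> foldl f q (wpow v n) = q"
  by (induction n) auto

text \<open>Counting from 1 leaves out the start state, so that the sets of consecutive words simply
  unite (\<open>visited_append\<close>). For a nonempty loop the start state comes back as the end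
  state.\<close>

definition visited :: "('q, 'a, 'm) aut_scheme \<Rightarrow> 'q \<Rightarrow> 'a list \<Rightarrow> 'q set" where
  "visited A p x = (\<lambda>i. foldl (trans A) p (take i x)) ` {1..length x}"

lemma visited_append:
  "visited A p (x @ y) = visited A p x \<union> visited A (foldl (trans A) p x) y"
proof -
  have "(\<lambda>i. foldl (trans A) p (take i (x @ y))) ` {length x + 1..length x + length y}
      = (\<lambda>i. foldl (trans A) (foldl (trans A) p x) (take i y)) ` {1..length y}"
  proof -
    have "{length x + 1..length x + length y} = (+) (length x) ` {1..length y}" by simp
    then show ?thesis by (simp only: image_image) auto
  qed
  moreover have "(\<lambda>i. foldl (trans A) p (take i (x @ y))) ` {1..length x} = visited A p x"
    unfolding visited_def by (rule image_cong) auto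
  moreover have "{1..length (x @ y)} = {1..length x} \<union> {length x + 1..length x + length y}" by auto
  ultimately show ?thesis unfolding visited_def by (simp only: image_Un)
qed

lemma visited_Nil [simp]: "visited A p [] = {}"
  by (simp add: visited_def)

lemma visited_wpow:
  "foldl (trans A) p x = p \<Longrightarrow> 0 < n \<Longrightarrow> visited A p (wpow x n) = visited A p x"
proof (induction n)
  case (Suc n)
  then show ?case by (cases n) (auto simp: visited_append)
qed simp

lemma end_in_visited: "x \<noteq> [] \<Longrightarrow> foldl (trans A) p x \<in> visited A p x"
  unfolding visited_def by (rule image_eqI[of _ _ "length x"]) (auto simp: Suc_le_eq)

lemma limit_run_loop:
  assumes "v \<noteq> []" "foldl (trans A) (reach A u) v = reach A u"
  shows "limit (run A (u \<frown> v\<^sup>\<omega>)) = visited A (reach A u) v"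
proof -
  let ?p = "reach A u" and ?xs = "map (\<lambda>i. foldl (trans A) (reach A u) (take (Suc i) v)) [0..<length v]"
  \<comment> \<open>One position further than \<open>u\<close>, since \<open>visited\<close> starts
    after the first letter of \<open>v\<close>; from there on the run repeats the states of one
    round through \<open>v\<close>.\<close>
  have "suffix (Suc (length u)) (run A (u \<frown> v\<^sup>\<omega>)) = ?xs\<^sup>\<omega>"
  proof
    fix j
    have *: "foldl (trans A) ?p (prefix n (v\<^sup>\<omega>)) = foldl (trans A) ?p (take (n mod length v) v)" for n
      using assms by (simp add: prefix_iter foldl_wpow)
    have "foldl (trans A) ?p (take (Suc j mod length v) v) = foldl (trans A) ?p (take (Suc (j mod length v)) v)"
      using assms by (auto simp: mod_Suc)
    then show "suffix (Suc (length u)) (run A (u \<frown> v\<^sup>\<omega>)) j = ?xs\<^sup>\<omega> j"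
      using assms(1) *[of "Suc j"] by (simp add: run_def reach_append iter_nth)
  qed
  then have "limit (run A (u \<frown> v\<^sup>\<omega>)) = limit (?xs\<^sup>\<omega>)" by (metis limit_suffix)
  also have "\<dots> = set ?xs" using assms(1) by (intro limit_iter) simp
  also have "\<dots> = visited A ?p v"
  proof -
    have "{1..length v} = Suc ` {0..<length v}"
      by (simp add: image_Suc_atLeastLessThan atLeastLessThanSuc_atLeastAtMost)
    then show ?thesis by (simp only: visited_def image_image set_map set_upt)
  qed
  finally show ?thesis .
qed

lemma conc_iter_in_dma_lang:
  assumes "v \<noteq> []" "foldl (trans M) (reach M u) v = reach M u" "u \<in> lists \<Sigma>" "v \<in> lists \<Sigma>"
  shows "u \<frown> v\<^sup>\<omega> \<in> dma_lang \<Sigma> M \<longleftrightarrow> visited M (reach M u) v \<in> table M"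
  using assms by (auto simp: dma_lang_def limit_run_loop range_conc_iter simp del: range_conc)

lemma finite_range_run:
  assumes "complete_aut \<Sigma> A" "range w \<subseteq> \<Sigma>"
  shows "finite (range (run A w))"
proof -
  have "prefix i w \<in> lists \<Sigma>" for i using assms(2) by (rule segment_in_lists)
  then have "range (run A w) \<subseteq> states A"
    using reach_in_states[OF assms(1)] by (auto simp: run_def)
  then show ?thesis using assms(1) finite_subset by (auto simp: complete_aut_def)
qed

text \<open>Past \<open>k\<close> only values of the limit occur, and each of them recurs. So a
  stretch between two occurrences of one value, chosen long enough, takes exactly the values of the
  limit; iterating it forever keeps the limit.\<close>

lemma recurrent_segment:
  assumes "finite (range r)"
  obtains i j where "i < j" "r i = r j" "r ` {i<..j} = limit r"
proof -
  obtain k where k: "limit r = range (suffix k r)" using limit_is_suffix[OF assms] by blast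
  obtain a where a: "a \<in> limit r" using limit_nonempty[OF assms] by blast
  have inf: "\<exists>n>m. r n = b" if "b \<in> limit r" for b m
    using that unfolding limit_iff_frequent INFM_nat by blast
  obtain i where i: "i > k" "r i = a" using inf[OF a] by blast
  have "finite (limit r)" using k assms by (metis finite_subset limit_in_range)
  have "\<forall>b\<in>limit r. \<exists>n>i. r n = b" using inf by blast
  then obtain t where t: "\<And>b. b \<in> limit r \<Longrightarrow> i < t b \<and> r (t b) = b" by metis
  \<comment> \<open>\<open>t b\<close> is a time after \<open>i\<close> with value \<open>b\<close>;
    the sum over the finite limit serves as an upper bound of all these times.\<close>
  obtain j where j: "j > i + sum t (limit r)" "r j = a" using inf[OF a] by blast
  have "limit r \<subseteq> r ` {i<..j}"
  proof
    fix b assume b: "b \<in> limit r"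
    then have "t b \<le> sum t (limit r)" using \<open>finite (limit r)\<close> by (intro member_le_sum) auto
    then have "t b \<in> {i<..j}" using t[OF b] j(1) by simp
    then show "b \<in> r ` {i<..j}" using t[OF b] by (metis image_eqI)
  qed
  moreover have "r ` {i<..j} \<subseteq> limit r"
  proof
    fix b assume "b \<in> r ` {i<..j}"
    then obtain n where "n > i" "b = r n" by auto
    then have "b = suffix k r (n - k)" using i by simp
    then show "b \<in> limit r" unfolding k by blast
  qed
  ultimately show ?thesis using that[of i j] i j by simp
qed

text \<open>Finiteness matters for the inclusion from left to right: otherwise a value of
  \<open>f\<close> could recur through values of \<open>r\<close> none of which does.\<close>

lemma limit_comp_finite:
  assumes "finite (range r)"
  shows "limit (f \<circ> r) = f ` limit r"
proof
  show "f ` limit r \<subseteq> limit (f \<circ> r)" using limit_o by fast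
  obtain k where k: "limit r = range (suffix k r)" using limit_is_suffix[OF assms] by blast
  have "limit (f \<circ> r) \<subseteq> range (suffix k (f \<circ> r))" by (rule limit_in_range_suffix)
  also have "\<dots> = f ` limit r" unfolding k by (auto simp: suffix_def)
  finally show "limit (f \<circ> r) \<subseteq> f ` limit r" .
qed

lemma limit_run_segment:
  assumes "i < j" "run C w i = run C w j"
  shows "limit (run C (prefix i w \<frown> (w [i \<rightarrow> j])\<^sup>\<omega>)) = run C w ` {i<..j}"
proof -
  have split: "prefix (i + n) w = (prefix i w) @ (w [i \<rightarrow> i + n])" for n by (rule subsequence_append)
  have step: "foldl (trans C) (reach C (prefix i w)) (take n (w [i \<rightarrow> j])) = run C w (i + n)" if "n \<le> j - i" for n
    using that split[of n] by (simp add: run_def min_def flip: reach_append)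
  have "foldl (trans C) (reach C (prefix i w)) (w [i \<rightarrow> j]) = reach C (prefix i w)"
    using step[of "j - i"] assms by (simp add: run_def)
  then have "limit (run C ((prefix i w) \<frown> (w [i \<rightarrow> j])\<^sup>\<omega>)) = visited C (reach C (prefix i w)) (w [i \<rightarrow> j])"
    using assms(1) by (intro limit_run_loop) auto
  also have "\<dots> = (\<lambda>n. run C w (i + n)) ` {1..j - i}"
    unfolding visited_def using step by (intro image_cong) auto
  also have "\<dots> = run C w ` {i<..j}"
  proof -
    have "{i<..j} = (+) i ` {1..j - i}" using assms(1) by (auto simp: atLeastSucAtMost_greaterThanAtMost)
    then show ?thesis by (simp only: image_image)
  qed
  finally show ?thesis .
qed

text \<open>A recurrent segment of the pair of runs can be iterated without changing either limit.
  So whatever two Muller automata disagree on is visible on an ultimately periodic word.\<close>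

lemma up_word_with_limit:
  assumes "complete_aut \<Sigma> A" "complete_aut \<Sigma> B" "range w \<subseteq> \<Sigma>"
  obtains u v where "u \<in> lists \<Sigma>" "v \<in> lists \<Sigma>" "v \<noteq> []"
    "limit (run A (u \<frown> v\<^sup>\<omega>)) = limit (run A w)" "limit (run B (u \<frown> v\<^sup>\<omega>)) = limit (run B w)"
proof -
  let ?r = "\<lambda>i. (run A w i, run B w i)"
  have "range ?r \<subseteq> range (run A w) \<times> range (run B w)" by auto
  then have fin: "finite (range ?r)"
    using finite_range_run[OF assms(1,3)] finite_range_run[OF assms(2,3)] by (meson finite_SigmaI finite_subset)
  obtain i j where ij: "i < j" "?r i = ?r j" "?r ` {i<..j} = limit ?r" using recurrent_segment[OF fin] .
  let ?u = "prefix i w" and ?v = "w [i \<rightarrow> j]"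
  have lists: "?u \<in> lists \<Sigma>" "?v \<in> lists \<Sigma>" using assms(3) by (rule segment_in_lists)+
  have "run A w ` {i<..j} = fst ` ?r ` {i<..j}" "run B w ` {i<..j} = snd ` ?r ` {i<..j}"
    by (auto simp: image_image)
  then have "run A w ` {i<..j} = limit (run A w)" "run B w ` {i<..j} = limit (run B w)"
    unfolding ij(3) using limit_comp_finite[OF fin, of fst] limit_comp_finite[OF fin, of snd]
    by (simp_all add: comp_def)
  then show ?thesis
    using that[of ?u ?v] lists ij limit_run_segment[OF ij(1), of A w] limit_run_segment[OF ij(1), of B w] by simp
qed

text \<open>The uniqueness half of the description \<open>fdfa_lang\<close>: a word in only one of
  the languages can be replaced by an ultimately periodic one with the same limits in Muller
  automata for both.\<close>

lemma omega_regular_eqI: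
  assumes "omega_regular \<Sigma> L" "omega_regular \<Sigma> L'"
    and "{w \<in> L. \<exists>u v. decomposition \<Sigma> w u v} = {w \<in> L'. \<exists>u v. decomposition \<Sigma> w u v}"
  shows "L = L'"
proof -
  have "L \<subseteq> L'" if reg: "omega_regular \<Sigma> L" "omega_regular \<Sigma> L'"
    and eq: "{w \<in> L. \<exists>u v. decomposition \<Sigma> w u v} = {w \<in> L'. \<exists>u v. decomposition \<Sigma> w u v}" for L L' :: "'a word set"
  proof
    fix w assume w: "w \<in> L"
    obtain M M' :: "(nat, 'a) dma" where M: "complete_dma \<Sigma> M" "dma_lang \<Sigma> M = L"
      "complete_dma \<Sigma> M'" "dma_lang \<Sigma> M' = L'" using reg by (auto simp: omega_regular_def)
    have "range w \<subseteq> \<Sigma>" using w M by (auto simp: dma_lang_def)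
    have c: "complete_aut \<Sigma> M" "complete_aut \<Sigma> M'" using M by (auto simp: complete_dma_def)
    obtain u v where uv: "u \<in> lists \<Sigma>" "v \<in> lists \<Sigma>" "v \<noteq> []"
      "limit (run M (u \<frown> v\<^sup>\<omega>)) = limit (run M w)" "limit (run M' (u \<frown> v\<^sup>\<omega>)) = limit (run M' w)"
      by (rule up_word_with_limit[OF c \<open>range w \<subseteq> \<Sigma>\<close>])
    have "range (u \<frown> v\<^sup>\<omega>) \<subseteq> \<Sigma>" using range_conc_iter uv by blast
    then have "u \<frown> v\<^sup>\<omega> \<in> L" using uv w M by (auto simp: dma_lang_def simp del: range_conc)
    moreover have "decomposition \<Sigma> (u \<frown> v\<^sup>\<omega>) u v" using uv by (simp add: decomposition_def)
    ultimately have "u \<frown> v\<^sup>\<omega> \<in> L'" using eq by blast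
    then show "w \<in> L'" using uv \<open>range w \<subseteq> \<Sigma>\<close> M by (auto simp: dma_lang_def)
  qed
  from this[OF assms] this[OF assms(2,1) assms(3)[symmetric]] show ?thesis by (rule subset_antisym)
qed

section \<open>Languages recognized by finite morphisms\<close>

lemma segment_split: "i \<le> j \<Longrightarrow> j \<le> k \<Longrightarrow> w [i \<rightarrow> k] = w [i \<rightarrow> j] @ (w [j \<rightarrow> k])"
  using upt_add_eq_append[of i j "k - j"] by (simp add: subsequence_def flip: map_append)

text \<open>What is used is a congruence of finite index on words: \<open>mult\<close> says that the
  class of a concatenation is determined by the classes of its parts.\<close>

locale finite_morphism =
  fixes \<Sigma> :: "'a set" and \<phi> :: "'a list \<Rightarrow> 'c" and mult :: "'c \<Rightarrow> 'c \<Rightarrow> 'c"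
  assumes finite_image: "finite (\<phi> ` lists \<Sigma>)"
    and hom: "x \<in> lists \<Sigma> \<Longrightarrow> y \<in> lists \<Sigma> \<Longrightarrow> \<phi> (x @ y) = mult (\<phi> x) (\<phi> y)"
begin

lemma cong:
  assumes "\<phi> x = \<phi> x'" "\<phi> y = \<phi> y'" "x \<in> lists \<Sigma>" "x' \<in> lists \<Sigma>" "y \<in> lists \<Sigma>" "y' \<in> lists \<Sigma>"
  shows "\<phi> (x @ y) = \<phi> (x' @ y')"
  using assms by (simp add: hom)

lemma wpow_cong:
  "\<phi> x = \<phi> y \<Longrightarrow> x \<in> lists \<Sigma> \<Longrightarrow> y \<in> lists \<Sigma> \<Longrightarrow> \<phi> (wpow x n) = \<phi> (wpow y n)"
  by (induction n) (auto simp: hom)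

text \<open>The classes of the powers of \<open>x\<close> are eventually periodic by the pigeonhole
  principle, and a large enough multiple of the period is an idempotent exponent.\<close>

lemma idempotent_power:
  assumes "x \<in> lists \<Sigma>"
  obtains n where "0 < n" "\<phi> (wpow x n @ wpow x n) = \<phi> (wpow x n)"
proof -
  have "\<not> inj (\<lambda>k. \<phi> (wpow x k))"
  proof
    assume "inj (\<lambda>k. \<phi> (wpow x k))"
    moreover have "range (\<lambda>k. \<phi> (wpow x k)) \<subseteq> \<phi> ` lists \<Sigma>" using assms by auto
    ultimately show False using finite_image by (meson finite_imageD finite_subset infinite_UNIV_nat)
  qed
  then obtain i' j' where ne: "i' \<noteq> j'" "\<phi> (wpow x i') = \<phi> (wpow x j')" by (auto simp: inj_def)
  then obtain i j where ij: "i < j" "\<phi> (wpow x i) = \<phi> (wpow x j)"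
    by (cases "i' < j'") (auto simp: not_less le_less)
  define d where "d = j - i"
  have d: "0 < d" "j = i + d" using ij(1) by (auto simp: d_def)
  have step: "\<phi> (wpow x (k + d)) = \<phi> (wpow x k)" if "i \<le> k" for k
  proof -
    define r where "r = k - i"
    then have k: "k = i + r" using that by simp
    have "\<phi> (wpow x (i + d) @ wpow x r) = \<phi> (wpow x i @ wpow x r)"
      by (rule cong) (use assms ij(2) d(2) in auto)
    then show ?thesis by (simp add: k add.commute add.left_commute flip: wpow_add)
  qed
  have steps: "\<phi> (wpow x (k + t * d)) = \<phi> (wpow x k)" if "i \<le> k" for k t
    using that
  proof (induction t)
    case (Suc t)
    have "\<phi> (wpow x (k + Suc t * d)) = \<phi> (wpow x ((k + t * d) + d))" by (simp add: add_ac)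
    then show ?case using step[of "k + t * d"] Suc by simp
  qed simp
  \<comment> \<open>At least the preperiod \<open>i\<close> and a multiple of the period
    \<open>d\<close>, so that doubling the exponent does not change the class.\<close>
  let ?n = "Suc i * d"
  have "i \<le> Suc i * d" using d(1) by (cases d) auto
  then have "\<phi> (wpow x (?n + ?n)) = \<phi> (wpow x ?n)" by (rule steps)
  then show ?thesis using that[of ?n] d(1) by (simp only: wpow_add) simp
qed

text \<open>The set is recognized by \<open>\<phi>\<close>, as far as ultimately periodic words are
  concerned.\<close>

definition respected :: "'a word set \<Rightarrow> bool" where
  "respected U \<longleftrightarrow> (\<forall>u\<in>lists \<Sigma>. \<forall>u'\<in>lists \<Sigma>. \<forall>v\<in>lists \<Sigma>. \<forall>v'\<in>lists \<Sigma>. v \<noteq> [] \<and> v' \<noteq> [] \<and>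
     \<phi> u = \<phi> u' \<and> \<phi> v = \<phi> v' \<longrightarrow> (u \<frown> v\<^sup>\<omega> \<in> U \<longleftrightarrow> u' \<frown> v'\<^sup>\<omega> \<in> U))"

lemma respectedD:
  assumes "respected U" "\<phi> u = \<phi> u'" "\<phi> v = \<phi> v'" "u \<in> lists \<Sigma>" "u' \<in> lists \<Sigma>" "v \<in> lists \<Sigma>"
    "v' \<in> lists \<Sigma>" "v \<noteq> []" "v' \<noteq> []"
  shows "u \<frown> v\<^sup>\<omega> \<in> U \<longleftrightarrow> u' \<frown> v'\<^sup>\<omega> \<in> U"
  using assms unfolding respected_def by blast

text \<open>The linked pairs of the theory of omega-semigroups, represented by words instead of
  semigroup elements.\<close>

definition linked :: "'a list \<Rightarrow> 'a list \<Rightarrow> bool" where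
  "linked u v \<longleftrightarrow> u \<in> lists \<Sigma> \<and> v \<in> lists \<Sigma> \<and> v \<noteq> [] \<and> \<phi> (u @ v) = \<phi> u \<and> \<phi> (v @ v) = \<phi> v"

text \<open>The period is replaced by an idempotent power of itself; one copy of this power is moved
  into the prefix, which then absorbs further copies.\<close>

lemma linked_exists:
  assumes "u \<in> lists \<Sigma>" "v \<in> lists \<Sigma>" "v \<noteq> []"
  obtains u' v' where "linked u' v'" "u \<frown> v\<^sup>\<omega> = u' \<frown> v'\<^sup>\<omega>"
proof -
  obtain n where n: "0 < n" "\<phi> (wpow v n @ wpow v n) = \<phi> (wpow v n)"
    using idempotent_power[OF assms(2)] .
  have "\<phi> ((u @ wpow v n) @ wpow v n) = \<phi> (u @ wpow v n)"
    unfolding append_assoc by (rule cong) (use n assms in auto)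
  then have "linked (u @ wpow v n) (wpow v n)"
    using n assms by (simp add: linked_def)
  moreover have "u \<frown> v\<^sup>\<omega> = (u @ wpow v n) \<frown> (wpow v n)\<^sup>\<omega>"
    using conc_iter_wpow[OF assms(3)] iter_wpow[OF assms(3) n(1)] by simp
  ultimately show ?thesis using that by blast
qed

text \<open>A prefix \<open>x\<close> of an infinite word witnesses \<open>(u, v)\<close> if it ends with a factor of the class of
  \<open>v\<close>, minimal among the factors starting at the same position, that is preceded by a word of the
  class of \<open>u\<close>. By minimality, infinitely many witnesses have infinitely many starting positions.\<close>

definition witness :: "'a list \<Rightarrow> 'a list \<Rightarrow> 'a list \<Rightarrow> bool" where
  "witness u v x \<longleftrightarrow> (\<exists>a b. x = a @ b \<and> b \<noteq> [] \<and> \<phi> a = \<phi> u \<and> \<phi> b = \<phi> v \<and>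
     (\<forall>i. 0 < i \<and> i < length b \<longrightarrow> \<phi> (take i b) \<noteq> \<phi> v))"

text \<open>Each prefix \<open>u @ wpow v (Suc n)\<close> stays in the class of \<open>u\<close>.
  After it, the shortest nonempty prefix of \<open>v\<^sup>\<omega>\<close> in the class of
  \<open>v\<close> is a minimal factor as required.\<close>

lemma witnesses_infinite:
  assumes "linked u v"
  shows "\<exists>\<^sub>\<infinity>n. witness u v (prefix n (u \<frown> v\<^sup>\<omega>))"
  unfolding INFM_nat
proof
  fix n
  have uv: "u \<in> lists \<Sigma>" "v \<in> lists \<Sigma>" "v \<noteq> []" "\<phi> (u @ v) = \<phi> u" using assms by (auto simp: linked_def)
  define a where "a = u @ wpow v (Suc n)"
  have a_lists: "a \<in> lists \<Sigma>" using uv by (simp add: a_def)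
  have "\<phi> (u @ wpow v k) = \<phi> u" for k
  proof (induction k)
    case (Suc k)
    have "\<phi> ((u @ v) @ wpow v k) = \<phi> (u @ wpow v k)" by (rule cong) (use uv in auto)
    then show ?case using Suc by simp
  qed simp
  then have a: "\<phi> a = \<phi> u" unfolding a_def .
  have word: "u \<frown> v\<^sup>\<omega> = a \<frown> v\<^sup>\<omega>" unfolding a_def by (rule conc_iter_wpow[OF uv(3), symmetric])
  let ?P = "\<lambda>i. 0 < i \<and> \<phi> (prefix i (v\<^sup>\<omega>)) = \<phi> v"
  have "?P (length v)" using uv by (simp add: prefix_iter)
  then have least: "?P (Least ?P)" by (rule LeastI)
  have minimal: "\<not> ?P i" if "i < Least ?P" for i using that by (rule not_less_Least)
  let ?b = "prefix (Least ?P) (v\<^sup>\<omega>)"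
  have "prefix (length a + Least ?P) (u \<frown> v\<^sup>\<omega>) = a @ ?b" unfolding word by simp
  moreover have "witness u v (a @ ?b)"
    unfolding witness_def
    by (intro exI[of _ a] exI[of _ ?b]) (use least minimal a in \<open>auto simp: min_def\<close>)
  moreover have "n < length a + Least ?P"
  proof -
    have "Suc n * 1 \<le> Suc n * length v" using uv(3) by (intro mult_left_mono) (auto simp: Suc_le_eq)
    then show ?thesis by (simp add: a_def del: replicate.simps)
  qed
  ultimately show "\<exists>k>n. witness u v (prefix k (u \<frown> v\<^sup>\<omega>))"
    by (intro exI[of _ "length a + Least ?P"]) simp
qed

text \<open>Two starts \<open>p1 < p2\<close> of witnessing factors at the same offset within copies
  of \<open>v'\<close> bound a segment \<open>z\<close> that is a period of the word. It begins with
  a factor of the class of \<open>v\<close> and fixes the class of \<open>u\<close>;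
  \<open>f\<close> is an idempotent power of \<open>z\<close>. In terms of Green's preorders,
  \<open>f\<close> lies in the right ideal of \<open>v\<close>, and \<open>v'\<close> in the
  two-sided ideal of \<open>f\<close>.\<close>

lemma witnesses_factor:
  assumes "linked u v" "linked u' v'" "\<exists>\<^sub>\<infinity>n. witness u v (prefix n (u' \<frown> v'\<^sup>\<omega>))"
  obtains f x y a where "f \<in> lists \<Sigma>" "x \<in> lists \<Sigma>" "y \<in> lists \<Sigma>" "a \<in> lists \<Sigma>" "f \<noteq> []"
    "\<phi> (f @ f) = \<phi> f" "\<phi> (v @ f) = \<phi> f" "\<phi> (u @ f) = \<phi> u" "\<phi> v' = \<phi> (x @ f @ y)"
    "u' \<frown> v'\<^sup>\<omega> = a \<frown> f\<^sup>\<omega>" "\<phi> a = \<phi> u"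
proof -
  let ?w = "u' \<frown> v'\<^sup>\<omega>" and ?l = "length u'" and ?d = "length v'"
  have uv: "u \<in> lists \<Sigma>" "v \<in> lists \<Sigma>" "v \<noteq> []" "\<phi> (u @ v) = \<phi> u" "\<phi> (v @ v) = \<phi> v"
    using assms(1) by (auto simp: linked_def)
  have uv': "u' \<in> lists \<Sigma>" "v' \<in> lists \<Sigma>" "v' \<noteq> []" "\<phi> (v' @ v') = \<phi> v'"
    using assms(2) by (auto simp: linked_def)
  have range: "range ?w \<subseteq> \<Sigma>" using range_conc_iter[OF uv'(3), of u' \<Sigma>] uv' by blast
  have seg: "?w [i \<rightarrow> j] \<in> lists \<Sigma>" for i j using segment_in_lists[OF range] .
  define start where "start p i \<longleftrightarrow> p < i \<and> \<phi> (prefix p ?w) = \<phi> u \<and> \<phi> (?w [p \<rightarrow> i]) = \<phi> v \<and>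
    (\<forall>j. p < j \<and> j < i \<longrightarrow> \<phi> (?w [p \<rightarrow> j]) \<noteq> \<phi> v)" for p i
  have start: "\<exists>p. start p i" if w: "witness u v (prefix i ?w)" for i
  proof -
    obtain a b where ab: "prefix i ?w = a @ b" "b \<noteq> []" "\<phi> a = \<phi> u" "\<phi> b = \<phi> v"
      "\<And>j. 0 < j \<Longrightarrow> j < length b \<Longrightarrow> \<phi> (take j b) \<noteq> \<phi> v"
      using w by (auto simp: witness_def)
    have i: "i = length a + length b" using arg_cong[OF ab(1), of length] by simp
    have "a = prefix (length a) ?w"
      using arg_cong[OF ab(1), of "take (length a)"] i by (simp add: min_def)
    moreover have b: "b = ?w [length a \<rightarrow> i]"
      using arg_cong[OF ab(1), of "drop (length a)"] by simp
    moreover have "\<phi> (?w [length a \<rightarrow> j]) \<noteq> \<phi> v" if "length a < j" "j < i" for j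
    proof -
      have "take (j - length a) b = ?w [length a \<rightarrow> j]" using that by (subst b) (simp add: min_def)
      then show ?thesis using ab(5)[of "j - length a"] that i by simp
    qed
    ultimately have "start (length a) i"
      using ab(2-4) i unfolding start_def by (metis length_greater_0_conv less_add_same_cancel1)
    then show ?thesis by blast
  qed
  define P where "P = {p. \<exists>i. start p i}"
  \<comment> \<open>By minimality, two witnesses with the same start have the same end, so
    infinitely many ends need infinitely many starts.\<close>
  have "infinite P"
  proof
    assume fin: "finite P"
    let ?I = "{i. witness u v (prefix i ?w)}"
    obtain p where p: "\<And>i. i \<in> ?I \<Longrightarrow> start (p i) i" using start by (metis mem_Collect_eq)
    have "inj_on p ?I"
    proof (rule inj_onI)
      fix i j assume "i \<in> ?I" "j \<in> ?I" "p i = p j"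
      then have "start (p i) i" "start (p i) j" using p by metis+
      then show "i = j" unfolding start_def by (metis linorder_neqE_nat)
    qed
    moreover have "p ` ?I \<subseteq> P" using p by (auto simp: P_def)
    ultimately have "finite ?I" using fin by (meson finite_imageD finite_subset)
    then show False using assms(3) by (simp add: Inf_many_def)
  qed
  then have inf: "infinite (P - {..<?l})" by simp
  have "(\<lambda>p. p mod ?d) ` (P - {..<?l}) \<subseteq> {..<?d}" using uv'(3) by auto
  then have "finite ((\<lambda>p. p mod ?d) ` (P - {..<?l}))" using finite_subset by blast
  then obtain p0 where p0: "infinite {p \<in> P - {..<?l}. p mod ?d = p0 mod ?d}"
    using pigeonhole_infinite[OF inf] by blast
  then obtain p1 where p1: "p1 \<in> P" "?l \<le> p1" "p1 mod ?d = p0 mod ?d"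
    using not_finite_existsD by force
  then obtain i1 where i1: "start p1 i1" by (auto simp: P_def)
  \<comment> \<open>Beyond \<open>i1\<close>, so that the whole factor witnessed at
    \<open>p1\<close> fits into the segment between \<open>p1\<close> and \<open>p2\<close>.\<close>
  have "\<exists>p2. i1 \<le> p2 \<and> p2 \<in> {p \<in> P - {..<?l}. p mod ?d = p0 mod ?d}"
    using p0 by (meson infinite_nat_iff_unbounded_le)
  then obtain p2 where p2: "i1 \<le> p2" "p2 \<in> P" "p2 mod ?d = p0 mod ?d" by blast
  have p12: "p1 < p2" using i1 p2(1) by (simp add: start_def)
  define z a where "z = ?w [p1 \<rightarrow> p2]" and "a = prefix p1 ?w"
  have period: "?w (n + t * ?d) = ?w n" if "?l \<le> n" for n t
    using that uv'(3) by (simp add: iter_nth) (metis add.commute diff_add_assoc mod_mult_self2 mult.commute)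
  obtain t where t: "p2 - p1 = t * ?d"
    using p1(3) p2(3) p12 by (metis dvd_def less_imp_le_nat mod_eq_dvd_iff_nat mult.commute)
  have "suffix p1 ?w = (?w [p1 \<rightarrow> p1 + (p2 - p1)])\<^sup>\<omega>"
  proof (rule periodic_suffix)
    show "?w (n + (p2 - p1)) = ?w n" if "p1 \<le> n" for n
      using period[of n t] p1(2) that t by simp
  qed (use p12 in simp)
  then have suffix: "suffix p1 ?w = z\<^sup>\<omega>" using p12 by (simp add: z_def)
  then have word: "?w = a \<frown> z\<^sup>\<omega>" unfolding a_def by (metis prefix_suffix)
  have z: "z \<in> lists \<Sigma>" "z \<noteq> []" "a \<in> lists \<Sigma>" using seg p12 by (auto simp: z_def a_def)
  have phi_a: "\<phi> a = \<phi> u" using i1 by (simp add: start_def a_def)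
  have "prefix p2 ?w = a @ z"
    using subsequence_append[of ?w p1 "p2 - p1"] p12 by (simp add: a_def z_def)
  then have phi_az: "\<phi> (a @ z) = \<phi> u" using p2(2) by (auto simp: P_def start_def)
  have phi_vz: "\<phi> (v @ z) = \<phi> z"
  proof -
    let ?b = "?w [p1 \<rightarrow> i1]" and ?g = "?w [i1 \<rightarrow> p2]"
    have split: "z = ?b @ ?g"
      unfolding z_def by (rule segment_split) (use i1 p2(1) in \<open>simp_all add: start_def\<close>)
    have b: "\<phi> ?b = \<phi> v" using i1 by (simp add: start_def)
    have vg: "\<phi> z = \<phi> (v @ ?g)" unfolding split by (rule cong) (use b seg uv in auto)
    have "\<phi> (v @ z) = \<phi> (v @ v @ ?g)" by (rule cong) (use vg seg uv z in auto)
    also have "\<dots> = \<phi> ((v @ v) @ ?g)" by simp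
    also have "\<dots> = \<phi> (v @ ?g)" by (rule cong) (use seg uv in auto)
    finally show ?thesis using vg by simp
  qed
  obtain N where N: "0 < N" "\<phi> (wpow z N @ wpow z N) = \<phi> (wpow z N)" using idempotent_power[OF z(1)] .
  define f where "f = wpow z N"
  have f: "f \<in> lists \<Sigma>" "f \<noteq> []" using z N by (auto simp: f_def)
  obtain N' where N': "N = Suc N'" using N(1) gr0_implies_Suc by blast
  have "\<phi> ((v @ z) @ wpow z N') = \<phi> (z @ wpow z N')" by (rule cong) (use phi_vz z uv in auto)
  then have phi_vf: "\<phi> (v @ f) = \<phi> f" by (simp add: f_def N')
  have phi_au: "\<phi> (u @ z) = \<phi> u"
  proof -
    have "\<phi> (u @ z) = \<phi> (a @ z)" by (rule cong) (use phi_a z uv in auto)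
    then show ?thesis using phi_az by simp
  qed
  have phi_uf: "\<phi> (u @ f) = \<phi> u"
  proof -
    have "\<phi> (u @ wpow z k) = \<phi> u" for k
    proof (induction k)
      case (Suc k)
      have "\<phi> ((u @ z) @ wpow z k) = \<phi> (u @ wpow z k)" by (rule cong) (use phi_au uv z in auto)
      then show ?case using Suc by simp
    qed simp
    then show ?thesis unfolding f_def .
  qed
  \<comment> \<open>\<open>f\<close> is a factor of a long power of \<open>v'\<close>, and all
    positive powers of \<open>v'\<close> have the class of \<open>v'\<close>.\<close>
  have "\<exists>x\<in>lists \<Sigma>. \<exists>y\<in>lists \<Sigma>. \<phi> v' = \<phi> (x @ f @ y)"
  proof -
    let ?e = "p1 + N * length z"
    define k where "k = Suc ?e"
    have k: "?e \<le> ?l + k * ?d"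
    proof -
      have "Suc ?e * 1 \<le> Suc ?e * ?d" using uv'(3) by (intro mult_left_mono) (auto simp: Suc_le_eq)
      then show ?thesis by (simp add: k_def)
    qed
    have "prefix (?l + k * ?d) ?w = u' @ wpow v' k" using uv'(3) by (simp add: prefix_iter)
    then have "?w [?l \<rightarrow> ?l + k * ?d] = wpow v' k"
      using subsequence_append[of ?w ?l "k * ?d"] by simp
    moreover have "?w [?l \<rightarrow> ?l + k * ?d] = ?w [?l \<rightarrow> p1] @ ?w [p1 \<rightarrow> ?e] @ ?w [?e \<rightarrow> ?l + k * ?d]"
      using segment_split[of ?l p1 "?l + k * ?d" ?w] segment_split[of p1 ?e "?l + k * ?d" ?w] p1(2) k by simp
    moreover have "?w [p1 \<rightarrow> ?e] = f"
    proof -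
      have "?w [p1 \<rightarrow> ?e] = prefix (N * length z) (suffix p1 ?w)" by simp
      also have "\<dots> = f" unfolding suffix using z(2) by (simp add: prefix_iter f_def)
      finally show ?thesis .
    qed
    moreover have "\<phi> (wpow v' (Suc n)) = \<phi> v'" for n
    proof (induction n)
      case (Suc n)
      have "\<phi> (v' @ wpow v' (Suc n)) = \<phi> (v' @ v')" by (rule cong) (use Suc uv' in auto)
      then show ?case using uv'(4) by simp
    qed simp
    then have "\<phi> (wpow v' k) = \<phi> v'" unfolding k_def by blast
    ultimately show ?thesis using seg by metis
  qed
  then show ?thesis
    using that[of f _ _ a] f z N(2) phi_vf phi_uf phi_a word iter_wpow[OF z(2) N(1)] by (auto simp: f_def)
qed

text \<open>\<open>f\<close> is in the right ideal of \<open>v\<close> and, by way of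
  \<open>f'\<close>, \<open>v\<close> is in the two-sided ideal of \<open>f\<close>. In a finite
  semigroup this makes them R-equivalent: \<open>f @ v\<close> has the class of \<open>v\<close>,
  and \<open>v @ f\<close> that of \<open>f\<close>. Rotating \<open>f @ v\<close> into
  \<open>v @ f\<close> then leads from \<open>u \<frown> v\<^sup>\<omega>\<close> to
  \<open>a \<frown> f\<^sup>\<omega>\<close>, which is the other word.\<close>

lemma membership_transfer:
  assumes "respected U" "linked u v" "linked u' v'"
    "\<exists>\<^sub>\<infinity>n. witness u v (prefix n (u' \<frown> v'\<^sup>\<omega>))" "\<exists>\<^sub>\<infinity>n. witness u' v' (prefix n (u \<frown> v\<^sup>\<omega>))"
  shows "u \<frown> v\<^sup>\<omega> \<in> U \<longleftrightarrow> u' \<frown> v'\<^sup>\<omega> \<in> U"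
proof -
  obtain f x y a where f: "f \<in> lists \<Sigma>" "x \<in> lists \<Sigma>" "y \<in> lists \<Sigma>" "a \<in> lists \<Sigma>" "f \<noteq> []"
    "\<phi> (f @ f) = \<phi> f" "\<phi> (v @ f) = \<phi> f" "\<phi> (u @ f) = \<phi> u" "\<phi> v' = \<phi> (x @ f @ y)"
    "u' \<frown> v'\<^sup>\<omega> = a \<frown> f\<^sup>\<omega>" "\<phi> a = \<phi> u"
    using witnesses_factor[OF assms(2-4)] .
  obtain f' x' y' where f': "f' \<in> lists \<Sigma>" "x' \<in> lists \<Sigma>" "y' \<in> lists \<Sigma>"
    "\<phi> (v' @ f') = \<phi> f'" "\<phi> v = \<phi> (x' @ f' @ y')"
    using witnesses_factor[OF assms(3,2,5)] .
  have uv: "u \<in> lists \<Sigma>" "v \<in> lists \<Sigma>" "v \<noteq> []" "v' \<in> lists \<Sigma>" using assms(2,3) by (auto simp: linked_def)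
  \<comment> \<open>Replacing \<open>f'\<close> by \<open>v' @ f'\<close> and then \<open>v'\<close>
    by \<open>x @ f @ y\<close> factors the class of \<open>v\<close> as
    \<open>\<alpha> @ g\<close>. Since \<open>g\<close> starts with \<open>f\<close>, it absorbs
    \<open>v\<close> on the left.\<close>
  define \<alpha> g where "\<alpha> = x' @ x" and "g = f @ y @ f' @ y'"
  have lists: "\<alpha> \<in> lists \<Sigma>" "g \<in> lists \<Sigma>" using f f' by (auto simp: \<alpha>_def g_def)
  have "\<phi> (v' @ f') = \<phi> ((x @ f @ y) @ f')" by (rule cong) (use f f' uv in auto)
  then have "\<phi> f' = \<phi> ((x @ f @ y) @ f')" using f'(4) by simp
  then have "\<phi> (f' @ y') = \<phi> (((x @ f @ y) @ f') @ y')"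
    by (rule cong) (use f f' in auto)
  then have "\<phi> (x' @ (f' @ y')) = \<phi> (x' @ (((x @ f @ y) @ f') @ y'))"
    by (rule cong[OF refl]) (use f f' in auto)
  then have v1: "\<phi> v = \<phi> (\<alpha> @ g)" using f'(5) by (simp add: \<alpha>_def g_def)
  have "\<phi> ((v @ f) @ y @ f' @ y') = \<phi> (f @ y @ f' @ y')"
    by (rule cong) (use f f' uv in auto)
  then have vg: "\<phi> (v @ g) = \<phi> g" by (simp add: g_def)
  have v2: "\<phi> (\<alpha> @ v @ g) = \<phi> v"
    unfolding v1 by (rule cong) (use vg lists uv in auto)
  \<comment> \<open>Pumping on both sides writes \<open>v\<close> with a power of \<open>g\<close>
    at its end. If that power is idempotent, \<open>v\<close> absorbs it on the right; since the
    power starts with \<open>f\<close>, this puts \<open>v\<close> into the right ideal of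
    \<open>f\<close>.\<close>
  have v3: "\<phi> (wpow \<alpha> k @ v @ wpow g k) = \<phi> v" for k
  proof (induction k)
    case (Suc k)
    have "\<phi> (wpow \<alpha> (Suc k) @ v @ wpow g (Suc k)) = \<phi> (\<alpha> @ ((wpow \<alpha> k @ v @ wpow g k) @ g))"
      by (simp only: wpow_Suc2[of _ g]) simp
    also have "\<dots> = \<phi> (\<alpha> @ (v @ g))"
      by (intro cong refl) (use Suc lists uv in auto)
    finally show ?case using v2 by simp
  qed simp
  obtain n where n: "0 < n" "\<phi> (wpow g n @ wpow g n) = \<phi> (wpow g n)" using idempotent_power[OF lists(2)] .
  have "\<phi> (v @ wpow g n) = \<phi> ((wpow \<alpha> n @ v @ wpow g n) @ wpow g n)"
    by (rule cong) (use v3[of n] lists uv in auto)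
  also have "\<dots> = \<phi> ((wpow \<alpha> n @ v) @ (wpow g n @ wpow g n))" by simp
  also have "\<dots> = \<phi> ((wpow \<alpha> n @ v) @ wpow g n)"
    by (rule cong) (use n lists uv in auto)
  finally have vG: "\<phi> (v @ wpow g n) = \<phi> v" using v3[of n] by simp
  obtain n' where n': "n = Suc n'" using n(1) gr0_implies_Suc by blast
  define h where "h = (y @ f' @ y') @ wpow g n'"
  have h: "h \<in> lists \<Sigma>" using f f' lists by (auto simp: h_def)
  have "\<phi> ((v @ f) @ h) = \<phi> (f @ h)" by (rule cong) (use f h uv in auto)
  moreover have "wpow g n = f @ h" by (simp add: n' h_def g_def)
  ultimately have vfh: "\<phi> v = \<phi> (f @ h)" using vG by simp
  have "\<phi> (f @ v) = \<phi> (f @ f @ h)" by (rule cong) (use vfh f h uv in auto)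
  also have "\<dots> = \<phi> ((f @ f) @ h)" by simp
  also have "\<dots> = \<phi> (f @ h)" by (rule cong) (use f h in auto)
  finally have fv: "\<phi> (f @ v) = \<phi> v" using vfh by simp
  have "u \<frown> v\<^sup>\<omega> \<in> U \<longleftrightarrow> u \<frown> (f @ v)\<^sup>\<omega> \<in> U"
    by (rule respectedD[OF assms(1)]) (use fv f uv in auto)
  also have "u \<frown> (f @ v)\<^sup>\<omega> = (u @ f) \<frown> (v @ f)\<^sup>\<omega>" using uv(3) by (intro conc_iter_rotate) auto
  also have "\<dots> \<in> U \<longleftrightarrow> a \<frown> f\<^sup>\<omega> \<in> U"
    by (rule respectedD[OF assms(1)]) (use f uv in auto)
  finally show ?thesis using f(10) by simp
qed

text \<open>The state of a deterministic automaton that watches for witnesses. For every split of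
  the word, the classes of the proper prefixes of \<open>b\<close> are recorded because they decide
  minimality, and such triples can be updated letter by letter.\<close>

definition profile :: "'a list \<Rightarrow> 'c \<times> ('c \<times> 'c \<times> 'c set) set" where
  "profile x = (\<phi> x, {(\<phi> a, \<phi> b, (\<lambda>i. \<phi> (take i b)) ` {0<..<length b}) | a b. x = a @ b \<and> b \<noteq> []})"

text \<open>A split of \<open>x @ [c]\<close> is either the new one with \<open>b = [c]\<close>, or
  an old one with \<open>c\<close> appended to \<open>b\<close>; in the latter case the old
  \<open>b\<close> becomes a proper prefix, so its class joins the recorded set.\<close>

lemma profile_snoc:
  assumes "x \<in> lists \<Sigma>" "c \<in> \<Sigma>"
  shows "snd (profile (x @ [c])) = insert (\<phi> x, \<phi> [c], {})
    ((\<lambda>(s, t, H). (s, mult t (\<phi> [c]), insert t H)) ` snd (profile x))" (is "?l = ?r")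
proof
  show "?l \<subseteq> ?r"
  proof
    fix p assume "p \<in> ?l"
    then obtain a b where ab: "x @ [c] = a @ b" "b \<noteq> []" "p = (\<phi> a, \<phi> b, (\<lambda>i. \<phi> (take i b)) ` {0<..<length b})"
      by (auto simp: profile_def)
    obtain b' where b': "b = b' @ [c]" "x = a @ b'"
      using ab(1,2) by (metis append_butlast_last_id butlast_append butlast_snoc last_appendR last_snoc)
    show "p \<in> ?r"
    proof (cases "b' = []")
      case False
      have "{0<..<length b} = insert (length b') {0<..<length b'}" using b' False by auto
      then have "(\<lambda>i. \<phi> (take i b)) ` {0<..<length b} = insert (\<phi> b') ((\<lambda>i. \<phi> (take i b')) ` {0<..<length b'})"
        by (auto simp: b'(1) image_iff)
      moreover have "\<phi> b = mult (\<phi> b') (\<phi> [c])" using b' assms hom[of b' "[c]"] by simp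
      moreover have "(\<phi> a, \<phi> b', (\<lambda>i. \<phi> (take i b')) ` {0<..<length b'}) \<in> snd (profile x)"
        using b' False by (auto simp: profile_def)
      ultimately show ?thesis using ab(3) by (auto simp: image_iff intro!: bexI[rotated])
    qed (use ab b' in auto)
  qed
  show "?r \<subseteq> ?l"
  proof
    fix p assume "p \<in> ?r"
    then consider "p = (\<phi> x, \<phi> [c], {})"
      | a b where "x = a @ b" "b \<noteq> []"
        "p = (\<phi> a, mult (\<phi> b) (\<phi> [c]), insert (\<phi> b) ((\<lambda>i. \<phi> (take i b)) ` {0<..<length b}))"
      by (auto simp: profile_def)
    then show "p \<in> ?l"
    proof cases
      case 1
      then show ?thesis unfolding profile_def snd_conv
        by (intro CollectI exI[of _ x] exI[of _ "[c]"]) auto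
    next
      case 2
      have "{0<..<length (b @ [c])} = insert (length b) {0<..<length b}" using 2 by auto
      then have "(\<lambda>i. \<phi> (take i (b @ [c]))) ` {0<..<length (b @ [c])} = insert (\<phi> b) ((\<lambda>i. \<phi> (take i b)) ` {0<..<length b})"
        by (auto simp: image_iff)
      moreover have "\<phi> (b @ [c]) = mult (\<phi> b) (\<phi> [c])" using 2 assms hom[of b "[c]"] by simp
      ultimately show ?thesis unfolding profile_def snd_conv
        by (intro CollectI exI[of _ a] exI[of _ "b @ [c]"]) (use 2 in simp)
    qed
  qed
qed

lemma profile_snoc_cong:
  assumes "x \<in> lists \<Sigma>" "y \<in> lists \<Sigma>" "c \<in> \<Sigma>" "profile x = profile y"
  shows "profile (x @ [c]) = profile (y @ [c])"
proof (rule prod_eqI)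
  have "\<phi> x = \<phi> y" using assms(4) by (simp add: profile_def)
  then show "snd (profile (x @ [c])) = snd (profile (y @ [c]))"
    using assms by (simp add: profile_snoc)
  show "fst (profile (x @ [c])) = fst (profile (y @ [c]))"
    using \<open>\<phi> x = \<phi> y\<close> assms by (simp add: profile_def hom)
qed

lemma finite_profiles: "finite (profile ` lists \<Sigma>)"
proof (rule finite_subset)
  let ?F = "\<phi> ` lists \<Sigma>"
  show "profile ` lists \<Sigma> \<subseteq> ?F \<times> Pow (?F \<times> ?F \<times> Pow ?F)"
    by (auto simp: profile_def intro!: imageI dest: in_set_takeD)
  show "finite (?F \<times> Pow (?F \<times> ?F \<times> Pow ?F))" using finite_image by simp
qed

lemma witness_iff_profile: "witness u v x \<longleftrightarrow> (\<exists>H. (\<phi> u, \<phi> v, H) \<in> snd (profile x) \<and> \<phi> v \<notin> H)"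
proof
  assume "witness u v x"
  then obtain a b where ab: "x = a @ b" "b \<noteq> []" "\<phi> a = \<phi> u" "\<phi> b = \<phi> v"
    "\<forall>i. 0 < i \<and> i < length b \<longrightarrow> \<phi> (take i b) \<noteq> \<phi> v" unfolding witness_def by blast
  let ?H = "(\<lambda>i. \<phi> (take i b)) ` {0<..<length b}"
  have "(\<phi> u, \<phi> v, ?H) \<in> snd (profile x)"
    unfolding profile_def snd_conv by (intro CollectI exI[of _ a] exI[of _ b]) (use ab in simp)
  moreover have "\<phi> v \<notin> ?H" using ab(5) by (auto simp: image_iff)
  ultimately show "\<exists>H. (\<phi> u, \<phi> v, H) \<in> snd (profile x) \<and> \<phi> v \<notin> H" by blast
next
  assume "\<exists>H. (\<phi> u, \<phi> v, H) \<in> snd (profile x) \<and> \<phi> v \<notin> H"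
  then obtain a b where ab: "x = a @ b" "b \<noteq> []" "\<phi> a = \<phi> u" "\<phi> b = \<phi> v"
    "\<phi> v \<notin> (\<lambda>i. \<phi> (take i b)) ` {0<..<length b}" unfolding profile_def by auto
  have "\<phi> (take i b) \<noteq> \<phi> v" if "0 < i" "i < length b" for i
  proof -
    have "\<phi> (take i b) \<in> (\<lambda>i. \<phi> (take i b)) ` {0<..<length b}" by (rule imageI) (use that in simp)
    then show ?thesis using ab(5) by auto
  qed
  then show "witness u v x"
    unfolding witness_def by (rule_tac exI[of _ a], rule_tac exI[of _ b]) (simp add: ab)
qed

end

text \<open>The Myhill-Nerode construction, with states coded as natural numbers and transitions
  through chosen representatives. The table stays empty until the limits that have to accept are
  known.\<close>

lemma aut_of_right_congruence:
  fixes T :: "'a list \<Rightarrow> 'c"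
  assumes "finite (T ` lists \<Sigma>)"
    and "\<And>x y c. x \<in> lists \<Sigma> \<Longrightarrow> y \<in> lists \<Sigma> \<Longrightarrow> c \<in> \<Sigma> \<Longrightarrow> T x = T y \<Longrightarrow> T (x @ [c]) = T (y @ [c])"
  obtains A :: "(nat, 'a) dma" and code :: "'c \<Rightarrow> nat"
    where "complete_aut \<Sigma> A" "inj_on code (T ` lists \<Sigma>)" "\<And>x. x \<in> lists \<Sigma> \<Longrightarrow> reach A x = code (T x)"
proof -
  obtain code :: "'c \<Rightarrow> nat" where code: "inj_on code (T ` lists \<Sigma>)"
    using assms(1) finite_imp_inj_to_nat_seg by metis
  define rep where "rep q = (SOME x. x \<in> lists \<Sigma> \<and> code (T x) = q)" for q
  define A :: "(nat, 'a) dma" where "A = \<lparr>states = code ` T ` lists \<Sigma>, init = code (T []),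
    trans = (\<lambda>q c. code (T (rep q @ [c]))), table = {}\<rparr>"
  have rep: "rep (code (T x)) \<in> lists \<Sigma>" "T (rep (code (T x))) = T x" if "x \<in> lists \<Sigma>" for x
  proof -
    have *: "rep (code (T x)) \<in> lists \<Sigma> \<and> code (T (rep (code (T x)))) = code (T x)"
      unfolding rep_def by (rule someI[of _ x]) (use that in simp)
    then show "rep (code (T x)) \<in> lists \<Sigma>" by blast
    show "T (rep (code (T x))) = T x" using * code that by (meson imageI inj_onD)
  qed
  have "complete_aut \<Sigma> A"
    using assms(1) rep by (auto simp: complete_aut_def A_def)
  moreover have "reach A x = code (T x)" if "x \<in> lists \<Sigma>" for x
    using that
  proof (induction x rule: rev_induct)
    case (snoc c x)
    then have "reach A (x @ [c]) = code (T (rep (code (T x)) @ [c]))"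
      by (simp add: reach_append) (simp add: A_def)
    also have "T (rep (code (T x)) @ [c]) = T (x @ [c])"
      by (rule assms(2)) (use snoc rep[of x] in auto)
    finally show ?case .
  qed (simp add: reach_def A_def)
  ultimately show ?thesis using that code by blast
qed

text \<open>The existence half of the description \<open>fdfa_lang\<close>. Two words with the same
  limit in the profile automaton have the same pairs witnessed infinitely often, so
  \<open>membership_transfer\<close> gives them the same verdict.\<close>

lemma (in finite_morphism) dma_exists:
  assumes "respected U" "\<And>w. w \<in> U \<Longrightarrow> \<exists>u v. decomposition \<Sigma> w u v"
  obtains M :: "(nat, 'a) dma" where "complete_dma \<Sigma> M"
    "{w \<in> dma_lang \<Sigma> M. \<exists>u v. decomposition \<Sigma> w u v} = U"
proof -
  obtain A :: "(nat, 'a) dma" and code where A: "complete_aut \<Sigma> A" "inj_on code (profile ` lists \<Sigma>)"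
    "\<And>x. x \<in> lists \<Sigma> \<Longrightarrow> reach A x = code (profile x)"
    using aut_of_right_congruence[of profile \<Sigma>] finite_profiles profile_snoc_cong by metis
  \<comment> \<open>If infinitely many prefixes of \<open>w\<close> are witnesses, one witnessing
    profile recurs by finiteness; it is in the common limit, so it recurs on \<open>w'\<close>,
    too.\<close>
  have witnesses: "\<exists>\<^sub>\<infinity>n. witness u v (prefix n w')"
    if w: "range w \<subseteq> \<Sigma>" "range w' \<subseteq> \<Sigma>" "limit (run A w) = limit (run A w')"
      and inf: "\<exists>\<^sub>\<infinity>n. witness u v (prefix n w)" for u v w w'
  proof -
    let ?G = "{q. \<exists>x\<in>lists \<Sigma>. q = code (profile x) \<and> witness u v x}"
    have "prefix n w \<in> lists \<Sigma>" for n using segment_in_lists[OF w(1)] .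
    then have "\<exists>\<^sub>\<infinity>n. run A w n \<in> ?G"
      using inf by (rule_tac INFM_mono[OF inf]) (auto simp: run_def A(3))
    then have "\<exists>q. q \<in> limit (run A w) \<inter> ?G"
      by (rule INF_limit_inter) (use finite_range_run[OF A(1) w(1)] in simp)
    then obtain x where x: "x \<in> lists \<Sigma>" "witness u v x" "code (profile x) \<in> limit (run A w')"
      using w(3) by blast
    then have "\<exists>\<^sub>\<infinity>n. run A w' n = code (profile x)" by (simp add: limit_iff_frequent)
    then show ?thesis
    proof (rule INFM_mono)
      fix n assume "run A w' n = code (profile x)"
      moreover have "prefix n w' \<in> lists \<Sigma>" using segment_in_lists[OF w(2)] .
      ultimately have "profile (prefix n w') = profile x"
        using A(2,3) x(1) by (metis image_eqI inj_onD run_def)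
      then show "witness u v (prefix n w')" using x(2) by (simp add: witness_iff_profile)
    qed
  qed
  have same: "w \<in> U \<longleftrightarrow> w' \<in> U"
    if d: "decomposition \<Sigma> w u v" and d': "decomposition \<Sigma> w' u' v'"
      and lim: "limit (run A w) = limit (run A w')" for w w' u v u' v'
  proof -
    obtain u1 v1 where 1: "linked u1 v1" "w = u1 \<frown> v1\<^sup>\<omega>"
      using linked_exists[of u v] d unfolding decomposition_def by blast
    obtain u2 v2 where 2: "linked u2 v2" "w' = u2 \<frown> v2\<^sup>\<omega>"
      using linked_exists[of u' v'] d' unfolding decomposition_def by blast
    have range: "range w \<subseteq> \<Sigma>" "range w' \<subseteq> \<Sigma>"
      using range_conc_iter[of v1 u1 \<Sigma>] range_conc_iter[of v2 u2 \<Sigma>] 1 2 unfolding linked_def by blast+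
    show ?thesis
      unfolding 1(2) 2(2)
    proof (rule membership_transfer[OF assms(1) 1(1) 2(1)])
      show "\<exists>\<^sub>\<infinity>n. witness u1 v1 (prefix n (u2 \<frown> v2\<^sup>\<omega>))"
        using witnesses[OF range lim] witnesses_infinite[OF 1(1)] 1(2) 2(2) by blast
      show "\<exists>\<^sub>\<infinity>n. witness u2 v2 (prefix n (u1 \<frown> v1\<^sup>\<omega>))"
        using witnesses[OF range(2,1) lim[symmetric]] witnesses_infinite[OF 2(1)] 1(2) 2(2) by blast
    qed
  qed
  \<comment> \<open>Declaring the limits of the words of \<open>U\<close> accepting adds no other
    ultimately periodic word, because words with equal limits agree by \<open>same\<close>.\<close>
  define M where "M = A\<lparr>table := {limit (run A w) | w. w \<in> U}\<rparr>"
  have reach_M: "reach M = reach A" by (simp add: M_def reach_def fun_eq_iff)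
  then have run_M: "run M = run A" by (simp add: run_def fun_eq_iff)
  have range: "range w \<subseteq> \<Sigma>" if "decomposition \<Sigma> w u v" for w u v
    using that range_conc_iter[of v u \<Sigma>] unfolding decomposition_def by blast
  have "limit (run A w) \<subseteq> states A" if "w \<in> U" for w
  proof -
    have "range w \<subseteq> \<Sigma>" using assms(2)[OF that] range by blast
    then have "run A w n \<in> states A" for n
      unfolding run_def by (intro reach_in_states[OF A(1)] segment_in_lists)
    then show ?thesis using limit_in_range by fastforce
  qed
  then have "complete_dma \<Sigma> M"
    using A(1) by (auto simp: complete_dma_def complete_aut_def M_def)
  moreover have "{w \<in> dma_lang \<Sigma> M. \<exists>u v. decomposition \<Sigma> w u v} = U"
  proof (intro equalityI subsetI)
    fix w assume "w \<in> {w \<in> dma_lang \<Sigma> M. \<exists>u v. decomposition \<Sigma> w u v}"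
    then obtain u v w' where "decomposition \<Sigma> w u v" "w' \<in> U" "limit (run A w) = limit (run A w')"
      by (auto simp: dma_lang_def run_M) (auto simp: M_def)
    then show "w \<in> U" using same assms(2) by blast
  next
    fix w assume w: "w \<in> U"
    then obtain u v where "decomposition \<Sigma> w u v" using assms(2) by blast
    then show "w \<in> {w \<in> dma_lang \<Sigma> M. \<exists>u v. decomposition \<Sigma> w u v}"
      using w range by (auto simp: dma_lang_def run_M) (auto simp: M_def)
  qed
  ultimately show ?thesis using that by blast
qed

section \<open>Alternating chains of an FDFA\<close>

text \<open>The action of a word as a relation: confined to \<open>states A\<close> there are
  finitely many of them, and concatenation becomes relational composition.\<close>

definition graph :: "('q, 'a, 'm) aut_scheme \<Rightarrow> 'a list \<Rightarrow> 'q rel" where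
  "graph A x = {(q, foldl (trans A) q x) | q. q \<in> states A}"

lemma graph_append: "complete_aut \<Sigma> A \<Longrightarrow> x \<in> lists \<Sigma> \<Longrightarrow> graph A (x @ y) = graph A x O graph A y"
  unfolding graph_def using foldl_in_states by fastforce

lemma graph_subset: "complete_aut \<Sigma> A \<Longrightarrow> x \<in> lists \<Sigma> \<Longrightarrow> graph A x \<subseteq> states A \<times> states A"
  by (auto simp: graph_def intro: foldl_in_states)

lemma graph_eqD: "graph A x = graph A y \<Longrightarrow> q \<in> states A \<Longrightarrow> foldl (trans A) q x = foldl (trans A) q y"
  unfolding graph_def by blast

section \<open>The language of a saturated FDFA\<close>

locale saturated_fdfa =
  fixes \<Sigma> :: "'a set" and F :: "('q, 'p, 'a) fdfa"
  assumes complete: "complete_fdfa \<Sigma> F" and saturated: "saturated \<Sigma> F"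
begin

abbreviation "Q \<equiv> leading F"
abbreviation "P q \<equiv> progress F q"

lemma complete_Q: "complete_aut \<Sigma> Q" and complete_P: "q \<in> states Q \<Longrightarrow> complete_aut \<Sigma> (P q)"
  using complete by (auto simp: complete_fdfa_def complete_dfa_def)

definition acc :: "'q \<Rightarrow> 'a list \<Rightarrow> bool" where
  "acc q v \<longleftrightarrow> reach (P q) v \<in> final (P q)"

definition up_lang :: "'a word set" where
  "up_lang = {u \<frown> v\<^sup>\<omega> | u v. (u, v) \<in> fdfa_pairs \<Sigma> F}"

text \<open>Acceptance asks for some normalized decomposition; by saturation any one that is at hand
  can be consulted instead.\<close>

lemma normalized_in_up_lang:
  assumes "u \<in> lists \<Sigma>" "v \<in> lists \<Sigma>" "v \<noteq> []" "reach Q (u @ v) = reach Q u"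
  shows "u \<frown> v\<^sup>\<omega> \<in> up_lang \<longleftrightarrow> acc (reach Q u) v"
proof -
  have n: "normalized_decomposition \<Sigma> F (u \<frown> v\<^sup>\<omega>) u v"
    using assms by (simp add: normalized_decomposition_def decomposition_def)
  have a: "v \<in> dfa_lang \<Sigma> (progress_dfa F u) \<longleftrightarrow> acc (reach Q u) v"
    using assms(2) by (simp add: dfa_lang_def progress_dfa_def acc_def)
  show ?thesis
  proof
    assume "u \<frown> v\<^sup>\<omega> \<in> up_lang"
    then obtain u' v' where "u \<frown> v\<^sup>\<omega> = u' \<frown> v'\<^sup>\<omega>" "(u', v') \<in> fdfa_pairs \<Sigma> F" by (auto simp: up_lang_def)
    then obtain x y where "normalized_decomposition \<Sigma> F (u \<frown> v\<^sup>\<omega>) x y" "y \<in> dfa_lang \<Sigma> (progress_dfa F x)"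
      by (auto simp: fdfa_pairs_def)
    then show "acc (reach Q u) v" using saturated n a unfolding saturated_def by blast
  next
    assume "acc (reach Q u) v"
    then have "(u, v) \<in> fdfa_pairs \<Sigma> F" using n a assms by (auto simp: fdfa_pairs_def)
    then show "u \<frown> v\<^sup>\<omega> \<in> up_lang" by (auto simp: up_lang_def)
  qed
qed

text \<open>The actions on all progress DFAs at once, on their disjoint union: a state is tagged
  with the leading state that selects its DFA.\<close>

definition progress_graph :: "'a list \<Rightarrow> ('q \<times> 'p) rel" where
  "progress_graph x = {((q, p), (q, foldl (trans (P q)) p x)) | q p. q \<in> states Q \<and> p \<in> states (P q)}"

text \<open>An automaton \<open>M\<close> is carried along so that one idempotent power of a word
  serves the leading automaton, the progress DFAs and \<open>M\<close> simultaneously. This ties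
  cycles of a Muller automaton to progress states.\<close>

definition class_of :: "('m, 'a) dma \<Rightarrow> 'a list \<Rightarrow> 'q rel \<times> ('q \<times> 'p) rel \<times> 'm rel" where
  "class_of M x = (graph Q x, progress_graph x, graph M x)"

lemma morphism_class_of:
  assumes "complete_aut \<Sigma> M"
  shows "finite_morphism \<Sigma> (class_of M) (\<lambda>(a, b, c) (a', b', c'). (a O a', b O b', c O c'))"
proof
  let ?S = "Sigma (states Q) (\<lambda>q. states (P q))"
  have sub: "class_of M ` lists \<Sigma> \<subseteq> Pow (states Q \<times> states Q) \<times> Pow (?S \<times> ?S) \<times> Pow (states M \<times> states M)"
  proof
    fix c assume "c \<in> class_of M ` lists \<Sigma>"
    then obtain x where x: "x \<in> lists \<Sigma>" "c = class_of M x" by blast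
    have "progress_graph x \<subseteq> ?S \<times> ?S"
      using foldl_in_states[OF complete_P x(1)] by (auto simp: progress_graph_def)
    then show "c \<in> Pow (states Q \<times> states Q) \<times> Pow (?S \<times> ?S) \<times> Pow (states M \<times> states M)"
      using graph_subset[OF complete_Q x(1)] graph_subset[OF assms x(1)] x(2) by (simp add: class_of_def)
  qed
  have "finite (states Q)" "finite (states M)" "finite ?S"
    using complete_Q complete_P assms by (auto simp: complete_aut_def)
  then have "finite (Pow (states Q \<times> states Q) \<times> Pow (?S \<times> ?S) \<times> Pow (states M \<times> states M))" by simp
  then show "finite (class_of M ` lists \<Sigma>)" using sub finite_subset by blast
  fix x y assume x: "x \<in> lists \<Sigma>"
  have "progress_graph (x @ y) = progress_graph x O progress_graph y"
    unfolding progress_graph_def using foldl_in_states[OF complete_P x] by fastforce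
  then show "class_of M (x @ y) = (case class_of M x of (a, b, c) \<Rightarrow> \<lambda>(a', b', c'). (a O a', b O b', c O c')) (class_of M y)"
    using graph_append[OF complete_Q x] graph_append[OF assms x] by (simp add: class_of_def)
qed

lemma class_of_eqD:
  assumes "class_of M x = class_of M y"
  shows "q \<in> states Q \<Longrightarrow> foldl (trans Q) q x = foldl (trans Q) q y"
    and "q \<in> states Q \<Longrightarrow> p \<in> states (P q) \<Longrightarrow> foldl (trans (P q)) p x = foldl (trans (P q)) p y"
    and "s \<in> states M \<Longrightarrow> foldl (trans M) s x = foldl (trans M) s y"
proof -
  show "q \<in> states Q \<Longrightarrow> foldl (trans Q) q x = foldl (trans Q) q y"
    and "s \<in> states M \<Longrightarrow> foldl (trans M) s x = foldl (trans M) s y"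
    using assms by (auto simp: class_of_def dest: graph_eqD)
  assume q: "q \<in> states Q" "p \<in> states (P q)"
  have "progress_graph x = progress_graph y" using assms by (simp add: class_of_def)
  moreover have "((q, p), (q, foldl (trans (P q)) p x)) \<in> progress_graph x" using q by (auto simp: progress_graph_def)
  ultimately have "((q, p), (q, foldl (trans (P q)) p x)) \<in> progress_graph y" by simp
  then show "foldl (trans (P q)) p x = foldl (trans (P q)) p y" by (auto simp: progress_graph_def)
qed

lemma class_of_eq_reach:
  assumes "class_of M x = class_of M y"
  shows "reach Q x = reach Q y" "q \<in> states Q \<Longrightarrow> reach (P q) x = reach (P q) y"
  using class_of_eqD(1)[OF assms, of "init Q"] class_of_eqD(2)[OF assms, of q "init (P q)"] complete_Q complete_P
  by (auto simp: reach_def complete_aut_def)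

text \<open>A common idempotent power of \<open>v\<close> and \<open>v'\<close> makes both
  decompositions normalized, at the same leading state. Words of equal class then lead to the same
  state of the progress DFA consulted there.\<close>

lemma up_lang_respected:
  assumes "complete_aut \<Sigma> M"
  shows "finite_morphism.respected \<Sigma> (class_of M) up_lang"
proof -
  interpret finite_morphism \<Sigma> "class_of M" "\<lambda>(a, b, c) (a', b', c'). (a O a', b O b', c O c')"
    using morphism_class_of[OF assms] .
  show ?thesis
    unfolding respected_def
  proof (intro ballI impI)
    fix u u' v v' assume lists: "u \<in> lists \<Sigma>" "u' \<in> lists \<Sigma>" "v \<in> lists \<Sigma>" "v' \<in> lists \<Sigma>"
      and eq: "v \<noteq> [] \<and> v' \<noteq> [] \<and> class_of M u = class_of M u' \<and> class_of M v = class_of M v'"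
    obtain n where n: "0 < n" "class_of M (wpow v n @ wpow v n) = class_of M (wpow v n)"
      using idempotent_power[OF lists(3)] .
    have eq_n: "class_of M (wpow v n) = class_of M (wpow v' n)" using wpow_cong eq lists by blast
    have eq_un: "class_of M (u @ wpow v n) = class_of M (u' @ wpow v' n)"
      by (rule cong) (use eq eq_n lists in auto)
    have "class_of M ((u @ wpow v n) @ wpow v n) = class_of M (u @ wpow v n)"
      unfolding append_assoc by (rule cong) (use n lists in auto)
    then have l: "reach Q ((u @ wpow v n) @ wpow v n) = reach Q (u @ wpow v n)" by (rule class_of_eq_reach)
    have "class_of M ((u' @ wpow v' n) @ wpow v' n) = class_of M ((u @ wpow v n) @ wpow v n)"
      by (rule cong) (use eq_un eq_n lists in auto)
    then have l': "reach Q ((u' @ wpow v' n) @ wpow v' n) = reach Q (u' @ wpow v' n)"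
      using class_of_eq_reach(1) l eq_un by metis
    let ?q = "reach Q (u @ wpow v n)"
    have q: "?q \<in> states Q" by (rule reach_in_states[OF complete_Q]) (use lists in simp)
    have "u \<frown> v\<^sup>\<omega> \<in> up_lang \<longleftrightarrow> (u @ wpow v n) \<frown> (wpow v n)\<^sup>\<omega> \<in> up_lang"
      using conc_iter_wpow iter_wpow eq n(1) by metis
    also have "\<dots> \<longleftrightarrow> acc ?q (wpow v n)"
      by (rule normalized_in_up_lang) (use lists eq n l in auto)
    also have "\<dots> \<longleftrightarrow> acc ?q (wpow v' n)"
      unfolding acc_def using class_of_eq_reach(2)[OF eq_n q] by simp
    also have "?q = reach Q (u' @ wpow v' n)" using class_of_eq_reach(1)[OF eq_un] .
    also have "acc \<dots> (wpow v' n) \<longleftrightarrow> (u' @ wpow v' n) \<frown> (wpow v' n)\<^sup>\<omega> \<in> up_lang"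
      by (rule normalized_in_up_lang[symmetric]) (use lists eq n l' in auto)
    also have "\<dots> \<longleftrightarrow> u' \<frown> v'\<^sup>\<omega> \<in> up_lang"
      using conc_iter_wpow iter_wpow eq n(1) by metis
    finally show "u \<frown> v\<^sup>\<omega> \<in> up_lang \<longleftrightarrow> u' \<frown> v'\<^sup>\<omega> \<in> up_lang" .
  qed
qed

text \<open>Existence by \<open>dma_exists\<close> and uniqueness by
  \<open>omega_regular_eqI\<close> unlock the definite description.\<close>

lemma fdfa_lang_properties:
  "omega_regular \<Sigma> (fdfa_lang \<Sigma> F)"
  "{w \<in> fdfa_lang \<Sigma> F. \<exists>u v. decomposition \<Sigma> w u v} = up_lang"
proof -
  let ?P = "\<lambda>L. omega_regular \<Sigma> L \<and> {w \<in> L. \<exists>u v. decomposition \<Sigma> w u v} = {u \<frown> v\<^sup>\<omega> | u v. (u, v) \<in> fdfa_pairs \<Sigma> F}"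
  \<comment> \<open>\<open>class_of\<close> expects some automaton as third component; the leading
    automaton with an empty table is at hand.\<close>
  define A :: "('q, 'a) dma" where "A = \<lparr>states = states Q, init = init Q, trans = trans Q, table = {}\<rparr>"
  have A: "complete_aut \<Sigma> A" using complete_Q by (simp add: A_def complete_aut_def)
  interpret finite_morphism \<Sigma> "class_of A" "\<lambda>(a, b, c) (a', b', c'). (a O a', b O b', c O c')"
    using morphism_class_of[OF A] .
  have "\<exists>u v. decomposition \<Sigma> w u v" if "w \<in> up_lang" for w
    using that by (auto simp: up_lang_def fdfa_pairs_def decomposition_def)
  then obtain M :: "(nat, 'a) dma" where "complete_dma \<Sigma> M" "{w \<in> dma_lang \<Sigma> M. \<exists>u v. decomposition \<Sigma> w u v} = up_lang"
    using dma_exists[OF up_lang_respected[OF A]] by blast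
  then have M: "?P (dma_lang \<Sigma> M)" by (auto simp: omega_regular_def up_lang_def)
  have "?P (THE L. ?P L)"
  proof (rule theI)
    show "?P (dma_lang \<Sigma> M)" by (rule M)
    fix L assume L: "?P L"
    show "L = dma_lang \<Sigma> M"
      by (rule omega_regular_eqI[OF L[THEN conjunct1] M[THEN conjunct1]])
        (simp only: L[THEN conjunct2] M[THEN conjunct2])
  qed
  then show "omega_regular \<Sigma> (fdfa_lang \<Sigma> F)"
    "{w \<in> fdfa_lang \<Sigma> F. \<exists>u v. decomposition \<Sigma> w u v} = up_lang"
    unfolding fdfa_lang_def up_lang_def by auto
qed

lemma in_fdfa_lang_iff:
  assumes "u \<in> lists \<Sigma>" "v \<in> lists \<Sigma>" "v \<noteq> []"
  shows "u \<frown> v\<^sup>\<omega> \<in> fdfa_lang \<Sigma> F \<longleftrightarrow> u \<frown> v\<^sup>\<omega> \<in> up_lang"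
  using fdfa_lang_properties(2) assms unfolding decomposition_def by blast

subsection \<open>Chains of idempotent progress states\<close>

text \<open>The progress state to which a loop \<open>v\<close> and all its positive powers
  lead.\<close>

definition idem :: "'q \<Rightarrow> 'p \<Rightarrow> bool" where
  "idem q s \<longleftrightarrow> (\<exists>v\<in>lists \<Sigma>. v \<noteq> [] \<and> foldl (trans Q) q v = q \<and> reach (P q) v = s \<and> foldl (trans (P q)) s v = s)"

definition above :: "'q \<Rightarrow> 'p \<Rightarrow> 'p \<Rightarrow> bool" where
  "above q s s' \<longleftrightarrow> (\<exists>z\<in>lists \<Sigma>. foldl (trans Q) q z = q \<and> foldl (trans (P q)) s z = s')"

definition chain_at :: "'q \<Rightarrow> bool \<Rightarrow> 'p list \<Rightarrow> bool" where
  "chain_at q b ss \<longleftrightarrow> ss \<noteq> [] \<and> (\<forall>s\<in>set ss. idem q s) \<and> (hd ss \<in> final (P q) \<longleftrightarrow> b) \<and>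
     (\<forall>i. Suc i < length ss \<longrightarrow> above q (ss ! i) (ss ! Suc i) \<and>
        (ss ! i \<in> final (P q)) \<noteq> (ss ! Suc i \<in> final (P q)))"

text \<open>Length 0 always counts, in agreement with the empty chain in
  \<open>alternating_chain\<close>.\<close>

definition fchain :: "bool \<Rightarrow> nat \<Rightarrow> bool" where
  "fchain b k \<longleftrightarrow> k = 0 \<or> (\<exists>q\<in>reach Q ` lists \<Sigma>. \<exists>ss. length ss = k \<and> chain_at q b ss)"

text \<open>The words that loop on \<open>q\<close> form a monoid on which acceptance is invariant under conjugation,
  by saturation. So equality of progress states, a right congruence, is two-sided up to acceptance.\<close>

definition loops :: "'q \<Rightarrow> 'a list set" where
  "loops q = {x \<in> lists \<Sigma>. foldl (trans Q) q x = q}"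

lemma loops_append: "x \<in> loops q \<Longrightarrow> y \<in> loops q \<Longrightarrow> x @ y \<in> loops q"
  by (simp add: loops_def)

lemma loops_wpow: "x \<in> loops q \<Longrightarrow> wpow x n \<in> loops q"
  by (simp add: loops_def foldl_wpow)

text \<open>A syntactic right congruence relative to the loops on \<open>q\<close>;
  \<open>acc_commute\<close> makes up for the missing left contexts.\<close>

definition similar :: "'q \<Rightarrow> 'a list \<Rightarrow> 'a list \<Rightarrow> bool" where
  "similar q x y \<longleftrightarrow> (\<forall>z\<in>loops q. acc q (x @ z) \<longleftrightarrow> acc q (y @ z))"

lemma similarD: "similar q x y \<Longrightarrow> z \<in> loops q \<Longrightarrow> acc q (x @ z) \<longleftrightarrow> acc q (y @ z)"
  by (simp add: similar_def)

lemma similar_if_reach_eq: "reach (P q) x = reach (P q) y \<Longrightarrow> similar q x y"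
  by (simp add: similar_def acc_def reach_append)

text \<open>Rotation turns \<open>u \<frown> (x @ y)\<^sup>\<omega>\<close> into
  \<open>(u @ x) \<frown> (y @ x)\<^sup>\<omega>\<close>. Both decompositions are normalized at
  \<open>q\<close>, so saturation equates their verdicts.\<close>

lemma acc_commute:
  assumes "q \<in> reach Q ` lists \<Sigma>" "x \<in> loops q" "y \<in> loops q" "x \<noteq> []"
  shows "acc q (x @ y) \<longleftrightarrow> acc q (y @ x)"
proof -
  obtain u where u: "u \<in> lists \<Sigma>" "q = reach Q u" using assms(1) by blast
  have xy: "x \<in> lists \<Sigma>" "y \<in> lists \<Sigma>" "foldl (trans Q) q x = q" "foldl (trans Q) q y = q"
    using assms(2,3) by (auto simp: loops_def)
  have ux: "reach Q (u @ x) = q" using u xy by (simp add: reach_append)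
  have "acc q (x @ y) \<longleftrightarrow> u \<frown> (x @ y)\<^sup>\<omega> \<in> up_lang"
    unfolding u(2) by (rule normalized_in_up_lang[symmetric]) (use u xy assms(4) in \<open>auto simp: reach_append\<close>)
  also have "u \<frown> (x @ y)\<^sup>\<omega> = (u @ x) \<frown> (y @ x)\<^sup>\<omega>" using assms(4) by (intro conc_iter_rotate) simp
  also have "\<dots> \<in> up_lang \<longleftrightarrow> acc (reach Q (u @ x)) (y @ x)"
    by (rule normalized_in_up_lang) (use u xy assms(4) ux in \<open>auto simp: reach_append\<close>)
  finally show ?thesis using ux by simp
qed

text \<open>A factor can be exchanged for a similar one only at the front. Commuting brings the
  other copies of \<open>y\<close> to the front one after the other; the copies of \<open>v\<close>
  that replace them collapse because \<open>v @ v\<close> and \<open>v\<close> reach the same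
  state.\<close>

lemma similar_power:
  assumes "q \<in> reach Q ` lists \<Sigma>" "y \<in> loops q" "v \<in> loops q" "y \<noteq> []" "v \<noteq> []"
    and "similar q y v" "reach (P q) (v @ v) = reach (P q) v"
  shows "similar q (wpow y (Suc n)) v"
proof (induction n)
  case 0
  then show ?case using assms(6) by simp
next
  case (Suc n)
  show ?case
    unfolding similar_def
  proof
    fix z assume z: "z \<in> loops q"
    let ?w = "wpow y (Suc n)"
    have w: "?w \<in> loops q" using loops_wpow[OF assms(2)] .
    note l = assms(2,3) z w loops_append
    have "acc q (wpow y (Suc (Suc n)) @ z) \<longleftrightarrow> acc q (y @ (?w @ z))" by simp
    also have "\<dots> \<longleftrightarrow> acc q (v @ (?w @ z))" by (rule similarD[OF assms(6)]) (intro l)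
    also have "\<dots> \<longleftrightarrow> acc q ((?w @ z) @ v)" by (rule acc_commute[OF assms(1)]) (intro l | rule assms(5))+
    also have "\<dots> \<longleftrightarrow> acc q (?w @ (z @ v))" by simp
    also have "\<dots> \<longleftrightarrow> acc q (v @ (z @ v))" by (rule similarD[OF Suc]) (intro l)
    also have "\<dots> \<longleftrightarrow> acc q ((v @ z) @ v)" by simp
    also have "\<dots> \<longleftrightarrow> acc q (v @ (v @ z))"
      by (rule acc_commute[OF assms(1)]) (use assms(5) in \<open>auto intro: l\<close>)
    also have "\<dots> \<longleftrightarrow> acc q ((v @ v) @ z)" by simp
    also have "\<dots> \<longleftrightarrow> acc q (v @ z)" by (rule similarD[OF similar_if_reach_eq[OF assms(7)] z])
    finally show "acc q (wpow y (Suc (Suc n)) @ z) \<longleftrightarrow> acc q (v @ z)" .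
  qed
qed

lemma above_trans: "above q s s' \<Longrightarrow> above q s' s'' \<Longrightarrow> above q s s''"
  unfolding above_def by (metis append_in_lists_conv foldl_append)

text \<open>With \<open>v\<close> and \<open>v'\<close> idempotent loops for \<open>s\<close> and
  \<open>s'\<close>, each verdict equals that of the product, \<open>v @ v'\<close> or
  \<open>v' @ v\<close>, and these agree by commuting. Hence alternation cannot take place within a
  strongly connected part.\<close>

lemma above_antisym_acc:
  assumes "q \<in> reach Q ` lists \<Sigma>" "idem q s" "idem q s'" "above q s s'" "above q s' s"
  shows "s \<in> final (P q) \<longleftrightarrow> s' \<in> final (P q)"
proof -
  obtain v where v: "v \<in> loops q" "v \<noteq> []" "reach (P q) v = s" "foldl (trans (P q)) s v = s"
    using assms(2) by (auto simp: idem_def loops_def)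
  obtain v' where v': "v' \<in> loops q" "v' \<noteq> []" "reach (P q) v' = s'" "foldl (trans (P q)) s' v' = s'"
    using assms(3) by (auto simp: idem_def loops_def)
  obtain z where z: "z \<in> loops q" "foldl (trans (P q)) s z = s'" using assms(4) by (auto simp: above_def loops_def)
  obtain z' where z': "z' \<in> loops q" "foldl (trans (P q)) s' z' = s" using assms(5) by (auto simp: above_def loops_def)
  note l = v(1) v'(1) z(1) z'(1) loops_append
  have nil: "[] \<in> loops q" by (simp add: loops_def)
  have *: "acc q (a @ b) \<longleftrightarrow> acc q b"
    if a: "a \<in> loops q" "a \<noteq> []" "reach (P q) (a @ a) = reach (P q) a" and b: "b \<in> loops q" "b \<noteq> []"
      and c: "c \<in> loops q" "reach (P q) (a @ c) = reach (P q) b" for a b c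
  proof -
    have sim: "similar q (a @ c) b" using similar_if_reach_eq[OF c(2)] .
    have "acc q (a @ b) \<longleftrightarrow> acc q (b @ a)" by (rule acc_commute[OF assms(1)]) (use a b in auto)
    also have "\<dots> \<longleftrightarrow> acc q ((a @ c) @ a)" using similarD[OF sim a(1)] by simp
    also have "\<dots> \<longleftrightarrow> acc q (a @ (a @ c))"
      using acc_commute[OF assms(1) _ a(1), of "a @ c"] a c loops_append by auto
    also have "\<dots> \<longleftrightarrow> acc q ((a @ a) @ c)" by simp
    also have "\<dots> \<longleftrightarrow> acc q (a @ c)" by (rule similarD[OF similar_if_reach_eq[OF a(3)] c(1)])
    also have "\<dots> \<longleftrightarrow> acc q b" using similarD[OF sim nil] by simp
    finally show ?thesis .
  qed
  have "acc q v' \<longleftrightarrow> acc q (v @ v')"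
    by (rule *[symmetric, of v v' z]) (use v v' z in \<open>simp_all add: reach_append\<close>)
  also have "\<dots> \<longleftrightarrow> acc q (v' @ v)" by (rule acc_commute[OF assms(1)]) (use v v' in auto)
  also have "\<dots> \<longleftrightarrow> acc q v"
    by (rule *[of v' v z']) (use v v' z' in \<open>simp_all add: reach_append\<close>)
  finally show ?thesis using v(3) v'(3) by (simp add: acc_def)
qed

lemma chain_at_above: "chain_at q b ss \<Longrightarrow> i < j \<Longrightarrow> j < length ss \<Longrightarrow> above q (ss ! i) (ss ! j)"
proof (induction j)
  case (Suc j)
  then have "above q (ss ! j) (ss ! Suc j)" by (auto simp: chain_at_def)
  then show ?case using Suc above_trans by (cases "i = j") auto
qed simp

text \<open>A repeated state would put two neighbours of opposite acceptance above each
  other.\<close>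

lemma chain_at_distinct:
  assumes "q \<in> reach Q ` lists \<Sigma>" "chain_at q b ss"
  shows "distinct ss"
  unfolding distinct_conv_nth
proof (intro allI impI)
  have *: "ss ! i \<noteq> ss ! j" if "i < j" "j < length ss" for i j
  proof
    assume eq: "ss ! i = ss ! j"
    have i: "Suc i < length ss" using that by simp
    have id: "idem q (ss ! i)" "idem q (ss ! Suc i)" using assms(2) i that by (auto simp: chain_at_def)
    have ne: "(ss ! i \<in> final (P q)) \<noteq> (ss ! Suc i \<in> final (P q))" "above q (ss ! i) (ss ! Suc i)"
      using assms(2) i by (auto simp: chain_at_def)
    show False
    proof (cases "Suc i = j")
      case True
      then show ?thesis using ne eq by simp
    next
      case False
      then have "above q (ss ! Suc i) (ss ! j)" using chain_at_above[OF assms(2), of "Suc i" j] that by simp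
      then show ?thesis using above_antisym_acc[OF assms(1) id ne(2)] ne(1) eq by simp
    qed
  qed
  fix i j assume "i < length ss" "j < length ss" "i \<noteq> j"
  then show "ss ! i \<noteq> ss ! j" using *[of i j] *[of j i] by (cases "i < j") auto
qed

text \<open>Distinctness bounds chains by the number of progress states. Later this keeps chain
  lengths within the input length, and thus within a register.\<close>

lemma fchain_bound:
  assumes "fchain b k" "0 < k"
  shows "\<exists>q\<in>states Q. k \<le> card (states (P q))"
proof -
  obtain q ss where q: "q \<in> reach Q ` lists \<Sigma>" "length ss = k" "chain_at q b ss"
    using assms by (auto simp: fchain_def)
  have q_states: "q \<in> states Q" using q(1) reach_in_states[OF complete_Q] by auto
  have "s \<in> states (P q)" if "idem q s" for s
    using that reach_in_states[OF complete_P[OF q_states]] by (auto simp: idem_def)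
  then have "set ss \<subseteq> states (P q)" using q(3) by (auto simp: chain_at_def)
  moreover have "card (set ss) = k" using chain_at_distinct[OF q(1,3)] q(2) by (simp add: distinct_card)
  moreover have "finite (states (P q))" using complete_P[OF q_states] by (simp add: complete_aut_def)
  ultimately show ?thesis using q_states card_mono by blast
qed

end

section \<open>Chains of a Muller automaton\<close>

lemma visited_single [simp]: "visited A p [c] = {trans A p c}"
  by (simp add: visited_def)

lemma visited_scc:
  assumes "u \<in> lists \<Sigma>" "x \<in> lists \<Sigma>" "x \<noteq> []" "foldl (trans A) (reach A u) x = reach A u"
  shows "reachable_scc \<Sigma> A (visited A (reach A u) x)"
proof -
  let ?p = "reach A u" and ?n = "length x"
  define f where "f i = foldl (trans A) ?p (take i x)" for i
  let ?S = "visited A ?p x" and ?E = "edges_within \<Sigma> A (visited A ?p x)"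
  have S: "?S = f ` {1..?n}" by (simp add: visited_def f_def)
  have ends: "f 0 = f ?n" using assms(4) by (simp add: f_def)
  have f_S: "f i \<in> ?S" if "i \<le> ?n" for i
  proof (cases "i = 0")
    case True
    have "?n \<in> {1..?n}" using assms(3) by (simp add: Suc_le_eq)
    then show ?thesis unfolding S True ends by (rule imageI)
  qed (use that in \<open>simp add: S\<close>)
  have edge: "(f i, f (Suc i)) \<in> ?E" if "i < ?n" for i
  proof -
    have "f (Suc i) = trans A (f i) (x ! i)" using that by (simp add: f_def take_Suc_conv_app_nth)
    moreover have "x ! i \<in> \<Sigma>" using assms(2) that by (auto simp: in_lists_conv_set)
    ultimately show ?thesis using f_S[of i] f_S[of "Suc i"] that by (auto simp: edges_within_def)
  qed
  have path: "(f i, f j) \<in> ?E\<^sup>*" if "i \<le> j" "j \<le> ?n" for i j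
    using that
  proof (induction j)
    case (Suc j)
    then show ?case using edge[of j] by (cases "i = Suc j") (auto intro: rtrancl.rtrancl_into_rtrancl)
  qed simp
  have "(f i, f j) \<in> ?E\<^sup>+" if i: "i \<in> {1..?n}" and j: "j \<in> {1..?n}" for i j
  proof -
    obtain j' where j': "j = Suc j'" using j by (cases j) auto
    have "(f i, f ?n) \<in> ?E\<^sup>*" "(f ?n, f j') \<in> ?E\<^sup>*" using i j j' path[of i ?n] path[of 0 j'] ends by auto
    moreover have "(f j', f j) \<in> ?E" using edge[of j'] j j' by simp
    ultimately show ?thesis by (meson rtrancl_into_trancl1 rtrancl_trans)
  qed
  then have "\<forall>p\<in>?S. \<forall>q\<in>?S. (p, q) \<in> ?E\<^sup>+" unfolding S by blast
  moreover have "?S \<subseteq> reach A ` lists \<Sigma>"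
  proof
    fix q assume "q \<in> ?S"
    then obtain i where "q = reach A (u @ take i x)" by (auto simp: S f_def reach_append)
    moreover have "u @ take i x \<in> lists \<Sigma>" using assms(1,2) by (auto dest: in_set_takeD)
    ultimately show "q \<in> reach A ` lists \<Sigma>" by blast
  qed
  moreover have "?S \<noteq> {}" using f_S[of 0] by blast
  ultimately show ?thesis by (simp add: reachable_scc_def)
qed

lemma scc_path:
  assumes "(p, q) \<in> (edges_within \<Sigma> A S)\<^sup>+"
  shows "\<exists>x\<in>lists \<Sigma>. x \<noteq> [] \<and> foldl (trans A) p x = q \<and> visited A p x \<subseteq> S"
  using assms
proof (induction rule: trancl_induct)
  case (base q)
  then obtain c where "c \<in> \<Sigma>" "trans A p c = q" "q \<in> S" by (auto simp: edges_within_def)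
  then show ?case by (intro bexI[of _ "[c]"]) auto
next
  case (step q r)
  then obtain x where x: "x \<in> lists \<Sigma>" "foldl (trans A) p x = q" "visited A p x \<subseteq> S" by blast
  obtain c where "c \<in> \<Sigma>" "trans A q c = r" "r \<in> S" using step.hyps(2) by (auto simp: edges_within_def)
  then show ?case using x
    by (intro bexI[of _ "x @ [c]"]) (auto simp: visited_append)
qed

text \<open>Loops at \<open>p\<close> are joined one after the other, a state not yet covered being
  visited by a detour that returns to \<open>p\<close> within \<open>S\<close>.\<close>

lemma scc_loop:
  assumes "reachable_scc \<Sigma> A S" "p \<in> S" "finite S"
  shows "\<exists>x\<in>lists \<Sigma>. x \<noteq> [] \<and> foldl (trans A) p x = p \<and> visited A p x = S"
proof -
  have conn: "\<exists>x\<in>lists \<Sigma>. x \<noteq> [] \<and> foldl (trans A) a x = b \<and> visited A a x \<subseteq> S" if "a \<in> S" "b \<in> S" for a b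
    by (rule scc_path) (use assms(1) that in \<open>auto simp: reachable_scc_def\<close>)
  have "\<exists>x\<in>lists \<Sigma>. x \<noteq> [] \<and> foldl (trans A) p x = p \<and> visited A p x \<subseteq> S \<and> T \<subseteq> visited A p x"
    if "finite T" "T \<subseteq> S" for T
    using that
  proof (induction T)
    case empty
    then show ?case using conn[OF assms(2) assms(2)] by auto
  next
    case (insert t T)
    then obtain x where x: "x \<in> lists \<Sigma>" "x \<noteq> []" "foldl (trans A) p x = p" "visited A p x \<subseteq> S" "T \<subseteq> visited A p x" by auto
    obtain y where y: "y \<in> lists \<Sigma>" "y \<noteq> []" "foldl (trans A) p y = t" "visited A p y \<subseteq> S"
      using conn[OF assms(2), of t] insert.prems by auto
    obtain z where z: "z \<in> lists \<Sigma>" "z \<noteq> []" "foldl (trans A) t z = p" "visited A t z \<subseteq> S"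
      using conn[OF _ assms(2), of t] insert.prems by auto
    have "t \<in> visited A p y" using end_in_visited[OF y(2), of A p] y(3) by simp
    then show ?case
      by (intro bexI[of _ "x @ y @ z"]) (use x y z in \<open>auto simp: visited_append\<close>)
  qed
  from this[OF assms(3) order_refl] show ?thesis by blast
qed

lemma scc_finite: "complete_aut \<Sigma> A \<Longrightarrow> reachable_scc \<Sigma> A S \<Longrightarrow> finite S \<and> S \<subseteq> states A"
proof -
  assume c: "complete_aut \<Sigma> A" and s: "reachable_scc \<Sigma> A S"
  have "S \<subseteq> states A" using s reach_in_states[OF c] unfolding reachable_scc_def by blast
  then show ?thesis using c finite_subset by (auto simp: complete_aut_def)
qed

lemma alternating_chain_nth_iff:
  assumes "alternating_chain \<Sigma> M b Ss"
  shows "i < length Ss \<Longrightarrow> Ss ! i \<in> table M \<longleftrightarrow> (b \<longleftrightarrow> even i)"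
proof (induction i)
  case 0
  then show ?case using assms by (cases Ss) (auto simp: alternating_chain_def)
next
  case (Suc i)
  then show ?case using assms by (auto simp: alternating_chain_def)
qed

lemma alternating_chain_snoc:
  assumes "alternating_chain \<Sigma> M b Ss" "Ss \<noteq> []" "reachable_scc \<Sigma> M S" "last Ss \<subset> S"
    "(last Ss \<in> table M) \<noteq> (S \<in> table M)"
  shows "alternating_chain \<Sigma> M b (Ss @ [S])"
proof -
  have "T \<subset> S" if "T \<in> set Ss" for T
  proof -
    have sorted: "sorted_wrt (\<subset>) (butlast Ss @ [last Ss])"
      using assms(1,2) by (simp add: alternating_chain_def)
    have "T \<in> set (butlast Ss) \<or> T = last Ss"
      using that assms(2) by (metis Un_iff append_butlast_last_id empty_iff insert_iff list.set set_append)
    then show ?thesis using sorted assms(4) by (auto simp: sorted_wrt_append)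
  qed
  then show ?thesis using assms unfolding alternating_chain_def
    by (auto simp: sorted_wrt_append nth_append last_conv_nth less_Suc_eq) (metis One_nat_def Suc_eq_plus1 add_diff_cancel_right')+
qed

lemma alternating_chain_take:
  "alternating_chain \<Sigma> M b Ss \<Longrightarrow> alternating_chain \<Sigma> M b (take n Ss)"
  by (cases "n = 0") (auto simp: alternating_chain_def sorted_wrt_take hd_take dest: in_set_takeD)

lemma strict_chain_length:
  assumes "finite (S :: 'b set)" "sorted_wrt (\<subset>) Ss" "\<forall>T\<in>set Ss. T \<subseteq> S"
  shows "length Ss \<le> Suc (card S)"
proof -
  have "i < length Ss \<Longrightarrow> i \<le> card (Ss ! i)" for i
  proof (induction i)
    case (Suc i)
    then have "Ss ! i \<subset> Ss ! Suc i" using assms(2) by (auto simp: sorted_wrt_iff_nth_less)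
    moreover have "finite (Ss ! Suc i)" using Suc.prems assms(1,3) by (meson finite_subset nth_mem)
    ultimately have "card (Ss ! i) < card (Ss ! Suc i)" by (rule psubset_card_mono[rotated])
    with Suc show ?case by simp
  qed simp
  from this[of "length Ss - 1"] show ?thesis
    using assms by (cases "Ss = []") (auto dest!: card_mono[of S "Ss ! (length Ss - 1)"])
qed

text \<open>Initial parts of chains are chains, so every length up to the maximum occurs; the
  maximum exists since strict inclusion bounds the lengths.\<close>

lemma chain_measure_ge_iff:
  assumes "complete_aut \<Sigma> M"
  shows "k \<le> chain_measure \<Sigma> M b \<longleftrightarrow> (\<exists>Ss. length Ss = k \<and> alternating_chain \<Sigma> M b Ss)"
proof -
  let ?L = "{length Ss | Ss. alternating_chain \<Sigma> M b Ss}"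
  have "length Ss \<le> Suc (card (states M))" if "alternating_chain \<Sigma> M b Ss" for Ss
    by (rule strict_chain_length)
      (use that assms scc_finite[OF assms] in \<open>auto simp: alternating_chain_def complete_aut_def\<close>)
  then have "?L \<subseteq> {..Suc (card (states M))}" by auto
  then have fin: "finite ?L" using finite_subset by blast
  have "alternating_chain \<Sigma> M b []" by (simp add: alternating_chain_def)
  then have ne: "?L \<noteq> {}" by blast
  show ?thesis
  proof
    assume "k \<le> chain_measure \<Sigma> M b"
    moreover have "Max ?L \<in> ?L" by (rule Max_in[OF fin ne])
    ultimately obtain Ss where "alternating_chain \<Sigma> M b Ss" "k \<le> length Ss" by (auto simp: chain_measure_def)
    then show "\<exists>Ss. length Ss = k \<and> alternating_chain \<Sigma> M b Ss"
      by (intro exI[of _ "take k Ss"]) (simp add: alternating_chain_take)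
  next
    assume "\<exists>Ss. length Ss = k \<and> alternating_chain \<Sigma> M b Ss"
    then have "k \<in> ?L" by blast
    then show "k \<le> chain_measure \<Sigma> M b" unfolding chain_measure_def by (rule Max_ge[OF fin])
  qed
qed

text \<open>Given loops \<open>ws\<close> of one automaton, some state of another one has loops \<open>ys\<close> such that
  \<open>ys ! i\<close> is composed of \<open>ws ! 0, \<dots>, ws ! i\<close> and contains \<open>ws ! i\<close>. Such a state is found in a
  terminal component for \<open>ws\<close>, then in a terminal one for all but the last of them, and so on.\<close>

definition generated :: "'a list list \<Rightarrow> 'a list set" where
  "generated ws = {concat xs | xs. set xs \<subseteq> set ws}"

lemma generated_append: "x \<in> generated ws \<Longrightarrow> y \<in> generated ws \<Longrightarrow> x @ y \<in> generated ws"
  unfolding generated_def by clarify (metis concat_append set_append Un_least)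

lemma generated_Nil: "[] \<in> generated ws"
  unfolding generated_def by (auto intro: exI[of _ "[]"])

lemma generated_member: "w \<in> set ws \<Longrightarrow> w \<in> generated ws"
  unfolding generated_def by (auto intro: exI[of _ "[w]"])

lemma generated_mono: "set ws \<subseteq> set ws' \<Longrightarrow> generated ws \<subseteq> generated ws'"
  unfolding generated_def by blast

lemma generated_in_lists: "set ws \<subseteq> lists \<Sigma> \<Longrightarrow> x \<in> generated ws \<Longrightarrow> x \<in> lists \<Sigma>"
proof -
  assume ws: "set ws \<subseteq> lists \<Sigma>" and "x \<in> generated ws"
  then obtain xs where "x = concat xs" "set xs \<subseteq> set ws" by (auto simp: generated_def)
  then show ?thesis using ws by (induction xs arbitrary: x) auto
qed

lemma terminal_state:
  assumes "complete_aut \<Sigma> A" "q0 \<in> states A" "set ws \<subseteq> lists \<Sigma>"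
  obtains r where "r \<in> generated ws"
    "\<And>x. x \<in> generated ws \<Longrightarrow> \<exists>y\<in>generated ws. foldl (trans A) q0 (r @ x @ y) = foldl (trans A) q0 r"
proof -
  define R where "R q = (\<lambda>x. foldl (trans A) q x) ` generated ws" for q
  \<comment> \<open>A word after which the fewest states remain reachable. No continuation can
    shrink this set further, so the state reached by \<open>r\<close> remains reachable.\<close>
  obtain r where r: "r \<in> generated ws"
    "\<And>x. x \<in> generated ws \<Longrightarrow> card (R (foldl (trans A) q0 r)) \<le> card (R (foldl (trans A) q0 x))"
    using exists_least_iff[of "\<lambda>n. \<exists>x\<in>generated ws. card (R (foldl (trans A) q0 x)) = n"] generated_Nil
    by (metis not_le)
  let ?q = "foldl (trans A) q0 r"
  have "?q \<in> states A" using foldl_in_states[OF assms(1) _ assms(2)] generated_in_lists[OF assms(3) r(1)] by blast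
  then have "R ?q \<subseteq> states A"
    using foldl_in_states[OF assms(1)] generated_in_lists[OF assms(3)] by (auto simp: R_def)
  then have fin: "finite (R ?q)" using assms(1) finite_subset by (auto simp: complete_aut_def)
  have "\<exists>y\<in>generated ws. foldl (trans A) q0 (r @ x @ y) = ?q" if x: "x \<in> generated ws" for x
  proof -
    have "R (foldl (trans A) ?q x) \<subseteq> R ?q"
    proof
      fix s assume "s \<in> R (foldl (trans A) ?q x)"
      then obtain y where "y \<in> generated ws" "s = foldl (trans A) ?q (x @ y)" by (auto simp: R_def)
      then show "s \<in> R ?q"
        unfolding R_def using generated_append[OF x] by (intro image_eqI[of _ _ "x @ y"]) auto
    qed
    moreover have "card (R ?q) \<le> card (R (foldl (trans A) ?q x))"
      using r(2)[of "r @ x"] generated_append[OF r(1) x] by simp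
    ultimately have "R (foldl (trans A) ?q x) = R ?q" using fin by (simp add: card_seteq)
    moreover have "?q \<in> R ?q" unfolding R_def using generated_Nil by (metis foldl_Nil imageI)
    ultimately have "?q \<in> R (foldl (trans A) ?q x)" by simp
    then obtain y where "y \<in> generated ws" "?q = foldl (trans A) (foldl (trans A) ?q x) y" by (auto simp: R_def)
    then show ?thesis by (intro bexI[of _ y]) auto
  qed
  then show ?thesis using that r(1) by blast
qed

lemma common_loop_state:
  assumes "complete_aut \<Sigma> A" "set ws \<subseteq> lists \<Sigma>" "q0 \<in> states A"
  shows "\<exists>r\<in>generated ws. \<exists>ys. length ys = length ws \<and> (\<forall>i<length ws. \<exists>t\<in>generated (take (Suc i) ws).
    ys ! i = ws ! i @ t \<and> foldl (trans A) (foldl (trans A) q0 r) (ys ! i) = foldl (trans A) q0 r)"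
  using assms(2,3)
proof (induction ws arbitrary: q0 rule: rev_induct)
  case Nil
  then show ?case using generated_Nil by auto
next
  case (snoc w ws)
  let ?\<delta> = "foldl (trans A)"
  obtain r1 where r1: "r1 \<in> generated (ws @ [w])"
    "\<And>x. x \<in> generated (ws @ [w]) \<Longrightarrow> \<exists>y\<in>generated (ws @ [w]). ?\<delta> q0 (r1 @ x @ y) = ?\<delta> q0 r1"
    using terminal_state[OF assms(1) snoc.prems(2,1)] by blast
  have "?\<delta> q0 r1 \<in> states A"
    using foldl_in_states[OF assms(1) _ snoc.prems(2)] generated_in_lists[OF snoc.prems(1) r1(1)] by blast
  then obtain r2 ys where r2: "r2 \<in> generated ws" "length ys = length ws"
    and ys: "\<And>i. i < length ws \<Longrightarrow> \<exists>t\<in>generated (take (Suc i) ws).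
      ys ! i = ws ! i @ t \<and> ?\<delta> (?\<delta> (?\<delta> q0 r1) r2) (ys ! i) = ?\<delta> (?\<delta> q0 r1) r2"
    using snoc.IH[of "?\<delta> q0 r1"] snoc.prems(1) by auto
  have r2': "r2 \<in> generated (ws @ [w])" using r2(1) generated_mono[of ws "ws @ [w]"] by auto
  have "r2 @ w \<in> generated (ws @ [w])" by (rule generated_append[OF r2' generated_member]) simp
  then obtain y where y: "y \<in> generated (ws @ [w])" "?\<delta> q0 (r1 @ (r2 @ w) @ y) = ?\<delta> q0 r1" using r1(2) by blast
  \<comment> \<open>After \<open>r1 @ r2 @ w\<close>, terminality provides \<open>y\<close> that
    leads back to the state of \<open>r1\<close>, and \<open>r2\<close> leads on to the common state
    again.\<close>
  define y' where "y' = w @ y @ r2"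
  have "?\<delta> (?\<delta> q0 (r1 @ r2)) y' = ?\<delta> q0 (r1 @ r2)" using y(2) by (simp add: y'_def)
  moreover have "y @ r2 \<in> generated (ws @ [w])" by (rule generated_append[OF y(1) r2'])
  ultimately have "\<exists>t\<in>generated (take (Suc i) (ws @ [w])). (ys @ [y']) ! i = (ws @ [w]) ! i @ t \<and>
      ?\<delta> (?\<delta> q0 (r1 @ r2)) ((ys @ [y']) ! i) = ?\<delta> q0 (r1 @ r2)" if "i < length (ws @ [w])" for i
  proof (cases "i = length ws")
    case False
    then have i: "i < length ws" using that by simp
    then have "(ys @ [y']) ! i = ys ! i" "(ws @ [w]) ! i = ws ! i" "take (Suc i) (ws @ [w]) = take (Suc i) ws"
      using r2(2) by (simp_all add: nth_append)
    then show ?thesis using ys[OF i] by simp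
  qed (use r2(2) in \<open>auto simp: nth_append y'_def\<close>)
  moreover have "r1 @ r2 \<in> generated (ws @ [w])" by (rule generated_append[OF r1(1) r2'])
  ultimately show ?case using r2(2) by (intro bexI[of _ "r1 @ r2"] exI[of _ "ys @ [y']"]) auto
qed

lemma generated_loop:
  assumes "\<And>w. w \<in> set ws \<Longrightarrow> foldl (trans A) p w = p \<and> visited A p w \<subseteq> S" "x \<in> generated ws"
  shows "foldl (trans A) p x = p \<and> visited A p x \<subseteq> S"
proof -
  obtain xs where "x = concat xs" "set xs \<subseteq> set ws" using assms(2) by (auto simp: generated_def)
  then show ?thesis using assms(1) by (induction xs arbitrary: x) (auto simp: visited_append)
qed

context saturated_fdfa
begin

lemma dma_visited_iff:
  assumes "dma_lang \<Sigma> M = fdfa_lang \<Sigma> F"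
    and "u \<in> lists \<Sigma>" "v \<in> lists \<Sigma>" "v \<noteq> []" "foldl (trans M) (reach M u) v = reach M u" "reach Q (u @ v) = reach Q u"
  shows "visited M (reach M u) v \<in> table M \<longleftrightarrow> acc (reach Q u) v"
  using conc_iter_in_dma_lang[OF assms(4,5,2,3)] in_fdfa_lang_iff[OF assms(2-4)]
    normalized_in_up_lang[OF assms(2-4,6)] assms(1) by simp

text \<open>Loops around one state \<open>p\<close> that traverse the SCCs exactly are rearranged by
  \<open>common_loop_state\<close> into loops on a leading state \<open>q\<close>. The blocks added
  on the way belong to SCCs lower in the chain or to the same one, so \<open>ys ! i\<close> still
  traverses exactly \<open>Ss ! i\<close>.\<close>

lemma fchain_if_alternating_chain:
  assumes M: "complete_dma \<Sigma> M" "dma_lang \<Sigma> M = fdfa_lang \<Sigma> F"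
    and chain: "alternating_chain \<Sigma> M b Ss"
  shows "fchain b (length Ss)"
proof (cases "Ss = []")
  case False
  have cM: "complete_aut \<Sigma> M" using M(1) by (simp add: complete_dma_def)
  interpret finite_morphism \<Sigma> "class_of M" "\<lambda>(a, b, c) (a', b', c'). (a O a', b O b', c O c')"
    using morphism_class_of[OF cM] .
  let ?k = "length Ss"
  have scc: "\<And>S. S \<in> set Ss \<Longrightarrow> reachable_scc \<Sigma> M S" and sorted: "sorted_wrt (\<subset>) Ss"
    using chain by (auto simp: alternating_chain_def)
  have mono: "Ss ! i \<subseteq> Ss ! j" if "i \<le> j" "j < ?k" for i j
    using that sorted by (cases "i = j") (auto simp: sorted_wrt_iff_nth_less le_less)
  \<comment> \<open>Taken from the smallest SCC, \<open>p\<close> lies in all of them, so that loops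
    around it can be composed.\<close>
  obtain p where p: "p \<in> Ss ! 0" using scc[of "Ss ! 0"] False by (auto simp: reachable_scc_def)
  then obtain u where u: "u \<in> lists \<Sigma>" "reach M u = p"
    using scc[of "Ss ! 0"] False by (auto simp: reachable_scc_def)
  have p_in: "p \<in> Ss ! i" if "i < ?k" for i using mono[of 0 i] p that by auto
  have "\<exists>x\<in>lists \<Sigma>. x \<noteq> [] \<and> foldl (trans M) p x = p \<and> visited M p x = Ss ! i" if "i < ?k" for i
    by (rule scc_loop) (use scc p_in that scc_finite[OF cM] in auto)
  then obtain wf where wf: "\<And>i. i < ?k \<Longrightarrow> wf i \<in> lists \<Sigma> \<and> wf i \<noteq> [] \<and> foldl (trans M) p (wf i) = p \<and> visited M p (wf i) = Ss ! i"
    by metis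
  define ws where "ws = map wf [0..<?k]"
  have ws: "length ws = ?k" "\<And>i. i < ?k \<Longrightarrow> ws ! i = wf i" "set ws \<subseteq> lists \<Sigma>"
    using wf by (simp_all add: ws_def image_subset_iff)
  have "reach Q u \<in> states Q" using reach_in_states[OF complete_Q u(1)] .
  from common_loop_state[OF complete_Q ws(3) this] obtain r ys where r: "r \<in> generated ws"
    and ys: "\<And>i. i < ?k \<Longrightarrow> \<exists>t\<in>generated (take (Suc i) ws). ys ! i = ws ! i @ t \<and>
      foldl (trans Q) (foldl (trans Q) (reach Q u) r) (ys ! i) = foldl (trans Q) (reach Q u) r"
    unfolding ws(1) by blast
  have gen: "foldl (trans M) p t = p \<and> visited M p t \<subseteq> Ss ! i" if t: "t \<in> generated (take (Suc i) ws)" and i: "i < ?k" for t i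
  proof (rule generated_loop[OF _ t])
    fix w assume "w \<in> set (take (Suc i) ws)"
    then obtain j where "j \<le> i" "w = ws ! j" using i ws(1) by (auto simp: in_set_conv_nth less_Suc_eq_le)
    then show "foldl (trans M) p w = p \<and> visited M p w \<subseteq> Ss ! i" using wf[of j] ws(2)[of j] mono[of j i] i by auto
  qed
  define u' q where "u' = u @ r" and "q = reach Q u'"
  have u': "u' \<in> lists \<Sigma>" using u(1) generated_in_lists[OF ws(3) r] by (simp add: u'_def)
  have q_states: "q \<in> states Q" unfolding q_def by (rule reach_in_states[OF complete_Q u'])
  have "take (Suc (?k - 1)) ws = ws" using ws(1) False by simp
  then have "foldl (trans M) p r = p" using gen[of r "?k - 1"] r False by simp
  then have pM: "reach M u' = p" using u(2) by (simp add: u'_def reach_append)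
  have ys': "ys ! i \<in> lists \<Sigma>" "ys ! i \<noteq> []" "foldl (trans M) p (ys ! i) = p" "visited M p (ys ! i) = Ss ! i"
    "foldl (trans Q) q (ys ! i) = q" if i: "i < ?k" for i
  proof -
    obtain t where t: "t \<in> generated (take (Suc i) ws)" "ys ! i = ws ! i @ t"
      "foldl (trans Q) q (ys ! i) = q"
      using ys[OF i] by (auto simp: q_def u'_def reach_append)
    have "t \<in> lists \<Sigma>" using generated_in_lists[OF _ t(1)] ws(3) by (meson in_set_takeD subset_iff)
    then show "ys ! i \<in> lists \<Sigma>" "ys ! i \<noteq> []" "foldl (trans M) p (ys ! i) = p" "visited M p (ys ! i) = Ss ! i"
      "foldl (trans Q) q (ys ! i) = q"
      using t wf[OF i] ws(2)[OF i] gen[OF t(1) i] by (auto simp: visited_append)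
  qed
  have "\<exists>n>0. class_of M (wpow x n @ wpow x n) = class_of M (wpow x n)" if "x \<in> lists \<Sigma>" for x
    using idempotent_power[OF that] by metis
  then obtain N where N: "\<And>x. x \<in> lists \<Sigma> \<Longrightarrow> 0 < N x \<and> class_of M (wpow x (N x) @ wpow x (N x)) = class_of M (wpow x (N x))"
    by metis
  \<comment> \<open>Nested idempotent powers: each \<open>x (Suc i)\<close> starts with
    \<open>x i\<close>, which relates the progress states by \<open>above\<close>, and acts
    idempotently, which makes them \<open>idem\<close>.\<close>
  define x where "x = rec_nat (wpow (ys ! 0) (N (ys ! 0))) (\<lambda>i y. wpow (y @ ys ! Suc i) (N (y @ ys ! Suc i)))"
  have x_Suc: "x (Suc i) = wpow (x i @ ys ! Suc i) (N (x i @ ys ! Suc i))" for i by (simp add: x_def)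
  have x: "x i \<in> lists \<Sigma> \<and> x i \<noteq> [] \<and> foldl (trans M) p (x i) = p \<and> visited M p (x i) = Ss ! i \<and>
    foldl (trans Q) q (x i) = q \<and> class_of M (x i @ x i) = class_of M (x i)" if "i < ?k" for i
    using that
  proof (induction i)
    case 0
    then show ?case using ys'[of 0] N[of "ys ! 0"] by (simp add: x_def foldl_wpow visited_wpow)
  next
    case (Suc i)
    let ?y = "x i @ ys ! Suc i"
    have "?y \<in> lists \<Sigma>" "?y \<noteq> []" "foldl (trans M) p ?y = p" "foldl (trans Q) q ?y = q"
      using Suc ys'[OF Suc.prems] by auto
    moreover have "visited M p ?y = Ss ! Suc i"
      using Suc ys'[OF Suc.prems] mono[of i "Suc i"] by (auto simp: visited_append)
    ultimately show ?case using N[of ?y] unfolding x_Suc by (simp add: foldl_wpow visited_wpow)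
  qed
  define ss where "ss = map (\<lambda>i. reach (P q) (x i)) [0..<?k]"
  have ss: "length ss = ?k" "\<And>i. i < ?k \<Longrightarrow> ss ! i = reach (P q) (x i)" by (auto simp: ss_def)
  have idem: "idem q (ss ! i)" if i: "i < ?k" for i
  proof -
    have "reach (P q) (x i @ x i) = reach (P q) (x i)" using x[OF i] class_of_eq_reach(2)[OF _ q_states] by blast
    then show ?thesis unfolding idem_def using x[OF i] ss(2)[OF i]
      by (intro bexI[of _ "x i"]) (auto simp: reach_append)
  qed
  have above: "above q (ss ! i) (ss ! Suc i)" if i: "Suc i < ?k" for i
  proof -
    let ?y = "x i @ ys ! Suc i"
    have y: "?y \<in> lists \<Sigma>" "foldl (trans Q) q ?y = q" using x[of i] ys'[OF i] i by auto
    then obtain n where n: "N ?y = Suc n" using N[of ?y] gr0_implies_Suc by blast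
    let ?z = "ys ! Suc i @ wpow ?y n"
    have "x (Suc i) = x i @ ?z" unfolding x_Suc n by simp
    moreover have "?z \<in> lists \<Sigma>" "foldl (trans Q) q ?z = q"
      using y ys'[OF i] wpow_in_lists[of ?y \<Sigma> n] foldl_wpow[of "trans Q" q ?y n] by auto
    ultimately show ?thesis
      unfolding above_def using ss(2)[of i] ss(2)[OF i] i by (intro bexI[of _ ?z]) (auto simp: reach_append)
  qed
  have final: "ss ! i \<in> final (P q) \<longleftrightarrow> Ss ! i \<in> table M" if i: "i < ?k" for i
  proof -
    have "visited M (reach M u') (x i) \<in> table M \<longleftrightarrow> acc (reach Q u') (x i)"
      by (rule dma_visited_iff[OF M(2) u']) (use x[OF i] pM in \<open>auto simp: reach_append q_def\<close>)
    then show ?thesis using x[OF i] ss(2)[OF i] by (simp add: pM q_def acc_def)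
  qed
  have "chain_at q b ss"
    unfolding chain_at_def
  proof (intro conjI allI impI ballI)
    show "ss \<noteq> []" using ss(1) False by auto
    show "idem q s" if "s \<in> set ss" for s using that idem ss(1) by (auto simp: in_set_conv_nth)
    show "hd ss \<in> final (P q) \<longleftrightarrow> b"
      using final[of 0] alternating_chain_nth_iff[OF chain, of 0] False ss(1) by (simp add: hd_conv_nth flip: length_greater_0_conv)
    fix i assume i: "Suc i < length ss"
    show "above q (ss ! i) (ss ! Suc i)" using above i ss(1) by simp
    show "(ss ! i \<in> final (P q)) \<noteq> (ss ! Suc i \<in> final (P q))"
      using final[of i] final[of "Suc i"] i ss(1) alternating_chain_nth_iff[OF chain, of i]
        alternating_chain_nth_iff[OF chain, of "Suc i"] by simp
  qed
  then show ?thesis using ss(1) u' by (auto simp: fchain_def q_def)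
qed (simp add: fchain_def)

text \<open>The converse, again by nested loops. A constructed loop \<open>y\<close> need not lead
  to the progress state of \<open>v i\<close>, but it is \<open>similar\<close> to
  \<open>v i\<close>; by \<open>similar_power\<close> so are its powers, which decides the
  acceptance of the cycles they run through in \<open>M\<close>.\<close>

lemma alternating_chain_if_chain_at:
  assumes M: "complete_dma \<Sigma> M" "dma_lang \<Sigma> M = fdfa_lang \<Sigma> F"
    and q: "q \<in> reach Q ` lists \<Sigma>" and chain: "chain_at q b ss"
  shows "\<exists>Ss. length Ss = length ss \<and> alternating_chain \<Sigma> M b Ss"
proof -
  have cM: "complete_aut \<Sigma> M" using M(1) by (simp add: complete_dma_def)
  interpret finite_morphism \<Sigma> "class_of M" "\<lambda>(a, b, c) (a', b', c'). (a O a', b O b', c O c')"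
    using morphism_class_of[OF cM] .
  let ?D = "foldl (trans M)"
  have nil: "[] \<in> loops q" by (simp add: loops_def)
  have "\<exists>v. v \<in> loops q \<and> v \<noteq> [] \<and> reach (P q) v = ss ! i \<and> reach (P q) (v @ v) = ss ! i" if "i < length ss" for i
  proof -
    have "idem q (ss ! i)" using chain that by (auto simp: chain_at_def)
    then show ?thesis by (auto simp: idem_def loops_def reach_append)
  qed
  then obtain v where v: "\<And>i. i < length ss \<Longrightarrow> v i \<in> loops q \<and> v i \<noteq> [] \<and> reach (P q) (v i) = ss ! i \<and> reach (P q) (v i @ v i) = ss ! i"
    by metis
  have final: "visited M (reach M u) (wpow y n) \<in> table M \<longleftrightarrow> ss ! i \<in> final (P q)"
    if i: "i < length ss" and y: "y \<in> loops q" "y \<noteq> []" "similar q y (v i)" "0 < n"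
      and u: "u \<in> lists \<Sigma>" "reach Q u = q" "?D (reach M u) (wpow y n) = reach M u" for i y n u
  proof -
    have wy: "wpow y n \<in> loops q" using loops_wpow[OF y(1)] .
    have "visited M (reach M u) (wpow y n) \<in> table M \<longleftrightarrow> acc (reach Q u) (wpow y n)"
      by (rule dma_visited_iff[OF M(2) u(1)]) (use wy u y in \<open>auto simp: loops_def reach_append\<close>)
    also have "acc (reach Q u) (wpow y n) \<longleftrightarrow> acc q (wpow y n @ [])" using u(2) by simp
    also have "\<dots> \<longleftrightarrow> acc q (v i @ [])"
    proof (rule similarD[OF _ nil])
      obtain m where "n = Suc m" using y(4) gr0_implies_Suc by blast
      then show "similar q (wpow y n) (v i)"
        using similar_power[OF q y(1) _ y(2) _ y(3)] v[OF i] by simp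
    qed
    also have "\<dots> \<longleftrightarrow> ss ! i \<in> final (P q)" using v[OF i] by (simp add: acc_def)
    finally show ?thesis .
  qed
  have scc: "reachable_scc \<Sigma> M (visited M (reach M u) (wpow y n))"
    if "y \<in> loops q" "y \<noteq> []" "0 < n" "u \<in> lists \<Sigma>" "?D (reach M u) (wpow y n) = reach M u" for u y n
    by (rule visited_scc) (use that loops_wpow[OF that(1)] in \<open>auto simp: loops_def\<close>)
  \<comment> \<open>The prefix \<open>u\<close> is left open because the next round runs the loops
    of this one after a prefix that is fixed only then. As \<open>n\<close> makes the action on
    \<open>M\<close> idempotent, \<open>M\<close> is on a cycle after one copy of
    \<open>wpow y n\<close>.\<close>
  have "\<exists>y n. y \<in> loops q \<and> y \<noteq> [] \<and> similar q y (v i) \<and> 0 < n \<and>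
      class_of M (wpow y n @ wpow y n) = class_of M (wpow y n) \<and>
      (\<forall>u\<in>lists \<Sigma>. reach Q u = q \<longrightarrow> (\<exists>Ss. length Ss = Suc i \<and> alternating_chain \<Sigma> M b Ss \<and>
        last Ss = visited M (reach M (u @ wpow y n)) (wpow y n)))" if "i < length ss" for i
    using that
  proof (induction i)
    case 0
    let ?y = "v 0"
    have y: "?y \<in> loops q" "?y \<noteq> []" "similar q ?y (v 0)" using v[of 0] 0 by (auto simp: similar_def)
    then obtain n where n: "0 < n" "class_of M (wpow ?y n @ wpow ?y n) = class_of M (wpow ?y n)"
      using idempotent_power[of ?y] by (auto simp: loops_def)
    have "\<exists>Ss. length Ss = Suc 0 \<and> alternating_chain \<Sigma> M b Ss \<and> last Ss = visited M (reach M (u @ wpow ?y n)) (wpow ?y n)"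
      if u: "u \<in> lists \<Sigma>" "reach Q u = q" for u
    proof -
      let ?u = "u @ wpow ?y n"
      have lp: "?D (reach M ?u) (wpow ?y n) = reach M ?u"
        using class_of_eqD(3)[OF n(2), of "reach M u"] reach_in_states[OF cM u(1)] by (simp add: reach_append)
      have u': "?u \<in> lists \<Sigma>" "reach Q ?u = q"
        using u y(1) loops_wpow[OF y(1), of n] by (auto simp: loops_def reach_append)
      let ?S = "visited M (reach M ?u) (wpow ?y n)"
      have "?S \<in> table M \<longleftrightarrow> ss ! 0 \<in> final (P q)" by (rule final[OF 0 y n(1) u' lp])
      moreover have "ss ! 0 \<in> final (P q) \<longleftrightarrow> b" using chain 0 by (auto simp: chain_at_def hd_conv_nth)
      ultimately have "alternating_chain \<Sigma> M b [?S]"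
        using scc[OF y(1,2) n(1) u'(1) lp] by (simp add: alternating_chain_def)
      then show ?thesis by (intro exI[of _ "[?S]"]) simp
    qed
    then show ?case using y n by blast
  next
    case (Suc i)
    then obtain y n where y: "y \<in> loops q" "y \<noteq> []" "similar q y (v i)" "0 < n"
      "class_of M (wpow y n @ wpow y n) = class_of M (wpow y n)"
      and IH: "\<And>u. u \<in> lists \<Sigma> \<Longrightarrow> reach Q u = q \<Longrightarrow> \<exists>Ss. length Ss = Suc i \<and> alternating_chain \<Sigma> M b Ss \<and>
        last Ss = visited M (reach M (u @ wpow y n)) (wpow y n)"
      by auto
    have i: "i < length ss" using Suc.prems by simp
    obtain z where z: "z \<in> loops q" "foldl (trans (P q)) (ss ! i) z = ss ! Suc i"
    proof -
      have "above q (ss ! i) (ss ! Suc i)" using chain Suc.prems by (simp add: chain_at_def)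
      then show ?thesis using that by (auto simp: above_def loops_def)
    qed
    \<comment> \<open>The first copy of \<open>wpow y n\<close> brings \<open>M\<close> onto the
      previous cycle and the second runs through it, so the states of that cycle are among those
      visited by \<open>y'\<close>. Then \<open>z\<close> moves the progress state on along the
      chain.\<close>
    define y' where "y' = (wpow y n @ wpow y n) @ z"
    have wyy: "wpow y n @ wpow y n = wpow y (n + n)" by (simp add: wpow_add)
    have y'_loop: "y' \<in> loops q" "y' \<noteq> []" using loops_wpow[OF y(1)] loops_append z(1) y(2,4) by (auto simp: y'_def)
    have sim: "similar q y' (v (Suc i))"
      unfolding similar_def
    proof
      fix z' assume z': "z' \<in> loops q"
      obtain m where m: "n + n = Suc m" using y(4) by (cases "n + n") auto
      have "similar q (wpow y (n + n)) (v i)"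
        unfolding m using similar_power[OF q y(1) _ y(2) _ y(3)] v[OF i] by simp
      from similarD[OF this loops_append[OF z(1) z']] have "acc q (y' @ z') \<longleftrightarrow> acc q ((v i @ z) @ z')"
        by (simp add: y'_def wyy)
      also have "\<dots> \<longleftrightarrow> acc q (v (Suc i) @ z')"
        by (rule similarD[OF similar_if_reach_eq z']) (use v[OF i] v[OF Suc.prems] z(2) in \<open>simp add: reach_append\<close>)
      finally show "acc q (y' @ z') \<longleftrightarrow> acc q (v (Suc i) @ z')" .
    qed
    obtain n' where n': "0 < n'" "class_of M (wpow y' n' @ wpow y' n') = class_of M (wpow y' n')"
      using idempotent_power[of y'] y'_loop by (auto simp: loops_def)
    have "\<exists>Ss. length Ss = Suc (Suc i) \<and> alternating_chain \<Sigma> M b Ss \<and> last Ss = visited M (reach M (u @ wpow y' n')) (wpow y' n')"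
      if u: "u \<in> lists \<Sigma>" "reach Q u = q" for u
    proof -
      let ?u = "u @ wpow y' n'"
      let ?S = "visited M (reach M ?u) (wpow y' n')"
      have lp: "?D (reach M ?u) (wpow y' n') = reach M ?u"
        using class_of_eqD(3)[OF n'(2), of "reach M u"] reach_in_states[OF cM u(1)] by (simp add: reach_append)
      have u': "?u \<in> lists \<Sigma>" "reach Q ?u = q"
        using u loops_wpow[OF y'_loop(1), of n'] by (auto simp: loops_def reach_append)
      obtain Ss where Ss: "length Ss = Suc i" "alternating_chain \<Sigma> M b Ss"
        "last Ss = visited M (reach M (?u @ wpow y n)) (wpow y n)" using IH[OF u'] by blast
      obtain m where m: "n' = Suc m" using n'(1) gr0_implies_Suc by blast
      have "last Ss \<subseteq> visited M (reach M ?u) y'"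
        unfolding Ss(3) y'_def by (auto simp: visited_append reach_append)
      also have "\<dots> \<subseteq> ?S" unfolding m by (simp add: visited_append)
      finally have sub: "last Ss \<subseteq> ?S" .
      have S_final: "?S \<in> table M \<longleftrightarrow> ss ! Suc i \<in> final (P q)"
        by (rule final[OF Suc.prems y'_loop sim n'(1) u' lp])
      have last: "last Ss \<in> table M \<longleftrightarrow> ss ! i \<in> final (P q)"
        unfolding Ss(3)
      proof (rule final[OF i y(1-4)])
        show "?u @ wpow y n \<in> lists \<Sigma>" "reach Q (?u @ wpow y n) = q"
          using u' loops_wpow[OF y(1), of n] by (auto simp: loops_def reach_append)
        show "?D (reach M (?u @ wpow y n)) (wpow y n) = reach M (?u @ wpow y n)"
          using class_of_eqD(3)[OF y(5), of "reach M ?u"] reach_in_states[OF cM u'(1)] by (simp add: reach_append)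
      qed
      have ne: "(last Ss \<in> table M) \<noteq> (?S \<in> table M)"
        using S_final last chain Suc.prems by (auto simp: chain_at_def)
      then have "last Ss \<subset> ?S" using sub by auto
      then have "alternating_chain \<Sigma> M b (Ss @ [?S])"
        using Ss(1) by (intro alternating_chain_snoc[OF Ss(2)] scc y'_loop n'(1) u'(1) lp ne) auto
      then show ?thesis using Ss(1) by (intro exI[of _ "Ss @ [?S]"]) simp
    qed
    then show ?case using y'_loop sim n' by blast
  qed
  moreover have "length ss - 1 < length ss" using chain by (auto simp: chain_at_def)
  moreover obtain u where "u \<in> lists \<Sigma>" "reach Q u = q" using q by blast
  ultimately obtain Ss where "length Ss = Suc (length ss - 1)" "alternating_chain \<Sigma> M b Ss" by metis
  then show ?thesis using chain by (auto simp: chain_at_def)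
qed

theorem chain_measure_iff_fchain:
  assumes "complete_dma \<Sigma> M" "dma_lang \<Sigma> M = fdfa_lang \<Sigma> F"
  shows "k \<le> chain_measure \<Sigma> M b \<longleftrightarrow> fchain b k"
proof -
  have cM: "complete_aut \<Sigma> M" using assms(1) by (simp add: complete_dma_def)
  have "alternating_chain \<Sigma> M b []" by (simp add: alternating_chain_def)
  then show ?thesis
    unfolding chain_measure_ge_iff[OF cM] fchain_def
    using fchain_if_alternating_chain[OF assms, of b] alternating_chain_if_chain_at[OF assms, of _ b]
    unfolding fchain_def by (metis list.size(3))
qed

end

subsection \<open>The position in the Wagner hierarchy\<close>

text \<open>\<open>within_measures\<close>, with each measure replaced by the predicate that a chain
  of the given length exists.\<close>

fun bounded_by :: "(bool \<Rightarrow> nat \<Rightarrow> bool) \<Rightarrow> nat \<Rightarrow> wagner_sign \<Rightarrow> bool" where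
  "bounded_by c k Plus \<longleftrightarrow> \<not> c True (Suc k) \<and> \<not> c False k"
| "bounded_by c k Minus \<longleftrightarrow> \<not> c True k \<and> \<not> c False (Suc k)"
| "bounded_by c k PlusMinus \<longleftrightarrow> \<not> c True (Suc k) \<and> \<not> c False (Suc k)"

text \<open>The matching lower bounds, which make the class minimal. For \<open>Plus\<close> and
  \<open>Minus\<close> the other measure then follows by \<open>fchain_tail\<close>.\<close>

fun attained_by :: "(bool \<Rightarrow> nat \<Rightarrow> bool) \<Rightarrow> nat \<Rightarrow> wagner_sign \<Rightarrow> bool" where
  "attained_by c k Plus \<longleftrightarrow> c True k"
| "attained_by c k Minus \<longleftrightarrow> c False k"
| "attained_by c k PlusMinus \<longleftrightarrow> c True k \<and> c False k"

lemma bounded_by_iff: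
  assumes "\<And>k b. c b k \<longleftrightarrow> k \<le> m b"
  shows "bounded_by c k sg \<longleftrightarrow> within_measures k sg (m True) (m False)"
  by (cases sg) (auto simp: assms)

context saturated_fdfa
begin

lemma dma_for_lang:
  obtains M :: "(nat, 'a) dma" where "complete_dma \<Sigma> M" "dma_lang \<Sigma> M = fdfa_lang \<Sigma> F"
  using fdfa_lang_properties(1) unfolding omega_regular_def by blast

text \<open>All Muller automata of the language have the same measures, so the existential over
  automata in the definition of a class can be tested on any of them.\<close>

lemma in_wagner_class_iff: "fdfa_lang \<Sigma> F \<in> wagner_class \<Sigma> k sg \<longleftrightarrow> bounded_by fchain k sg"
proof -
  have *: "bounded_by fchain k sg \<longleftrightarrow> within_measures k sg (chain_measure \<Sigma> M True) (chain_measure \<Sigma> M False)"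
    if "complete_dma \<Sigma> M" "dma_lang \<Sigma> M = fdfa_lang \<Sigma> F" for M :: "(nat, 'a) dma"
    by (rule bounded_by_iff) (simp add: chain_measure_iff_fchain[OF that])
  obtain M :: "(nat, 'a) dma" where "complete_dma \<Sigma> M" "dma_lang \<Sigma> M = fdfa_lang \<Sigma> F"
    using dma_for_lang .
  then show ?thesis using * unfolding wagner_class_def by blast
qed

text \<open>Dropping the first state flips the sign. Hence the two measures differ by at most
  one.\<close>

lemma fchain_tail:
  assumes "fchain b (Suc k)"
  shows "fchain (\<not> b) k"
proof (cases "k = 0")
  case False
  obtain q ss where q: "q \<in> reach Q ` lists \<Sigma>" "length ss = Suc k" "chain_at q b ss"
    using assms by (auto simp: fchain_def)
  obtain s ss' where ss: "ss = s # ss'" "length ss' = k" using q(2) by (cases ss) auto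
  have "(ss ! 0 \<in> final (P q)) \<noteq> (ss ! 1 \<in> final (P q))"
    using q False by (auto simp: chain_at_def)
  then have "(hd ss' \<in> final (P q)) \<longleftrightarrow> \<not> b"
    using q(3) ss False by (cases ss') (auto simp: chain_at_def)
  moreover have "above q (ss' ! i) (ss' ! Suc i) \<and> (ss' ! i \<in> final (P q)) \<noteq> (ss' ! Suc i \<in> final (P q))"
    if "Suc i < length ss'" for i
  proof -
    have "Suc (Suc i) < length ss" using that ss by simp
    then have "above q (ss ! Suc i) (ss ! Suc (Suc i)) \<and>
      (ss ! Suc i \<in> final (P q)) \<noteq> (ss ! Suc (Suc i) \<in> final (P q))"
      using q(3) unfolding chain_at_def by blast
    then show ?thesis using ss(1) by simp
  qed
  moreover have "ss' \<noteq> []" "\<forall>s\<in>set ss'. idem q s" using q(3) ss False by (auto simp: chain_at_def)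
  ultimately have "chain_at q (\<not> b) ss'" unfolding chain_at_def by blast
  then show ?thesis using q(1) ss(2) unfolding fchain_def by blast
qed (simp add: fchain_def)

text \<open>An idempotent power of a letter, used both as prefix and as loop, gives a leading state
  with an \<open>idem\<close> progress state. So the two measures are not both 0, and the index of
  the position is at least 1.\<close>

lemma fchain_one:
  assumes "\<Sigma> \<noteq> {}"
  shows "\<exists>b. fchain b 1"
proof -
  obtain a where a: "[a] \<in> lists \<Sigma>" using assms by auto
  obtain M :: "(nat, 'a) dma" where "complete_dma \<Sigma> M" using dma_for_lang .
  then have cM: "complete_aut \<Sigma> M" by (simp add: complete_dma_def)
  interpret finite_morphism \<Sigma> "class_of M" "\<lambda>(a, b, c) (a', b', c'). (a O a', b O b', c O c')"
    using morphism_class_of[OF cM] .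
  obtain n where n: "0 < n" "class_of M (wpow [a] n @ wpow [a] n) = class_of M (wpow [a] n)"
    using idempotent_power[OF a] .
  define v q where "v = wpow [a] n" and "q = reach Q (wpow [a] n)"
  have v: "v \<in> lists \<Sigma>" "v \<noteq> []" using wpow_in_lists[OF a, of n] n(1) by (auto simp: v_def)
  have q: "q \<in> states Q" unfolding q_def using reach_in_states[OF complete_Q wpow_in_lists[OF a]] .
  have "foldl (trans Q) q v = q" using class_of_eq_reach(1)[OF n(2)] by (simp add: v_def q_def reach_append)
  moreover have "foldl (trans (P q)) (reach (P q) v) v = reach (P q) v"
    using class_of_eq_reach(2)[OF n(2) q] by (simp add: v_def reach_append)
  ultimately have "idem q (reach (P q) v)" unfolding idem_def using v by blast
  then have "chain_at q (reach (P q) v \<in> final (P q)) [reach (P q) v]" by (simp add: chain_at_def)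
  moreover have "q \<in> reach Q ` lists \<Sigma>" using v(1) by (auto simp: q_def v_def)
  ultimately have "fchain (reach (P q) v \<in> final (P q)) 1"
    unfolding fchain_def by (metis One_nat_def length_Cons list.size(3))
  then show ?thesis by blast
qed

text \<open>By attainment, every automaton within the bounds of this class has measures at most
  those of the language (\<open>bound\<close>), so it also satisfies the bounds of any class that
  contains the language.\<close>

lemma is_wagner_position_if_attained:
  assumes "1 \<le> k" "bounded_by fchain k sg" "attained_by fchain k sg"
  shows "is_wagner_position \<Sigma> (fdfa_lang \<Sigma> F) k sg"
proof -
  obtain M :: "(nat, 'a) dma" where M: "complete_dma \<Sigma> M" "dma_lang \<Sigma> M = fdfa_lang \<Sigma> F"
    using dma_for_lang .
  let ?p = "chain_measure \<Sigma> M True" and ?n = "chain_measure \<Sigma> M False"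
  have m: "fchain b j \<longleftrightarrow> j \<le> chain_measure \<Sigma> M b" for b j using chain_measure_iff_fchain[OF M] by simp
  obtain k' where k': "k = Suc k'" using assms(1) by (cases k) auto
  have bound: "a \<le> ?p \<and> b \<le> ?n" if "within_measures k sg a b" for a b
    using that assms(3) fchain_tail[of True k'] fchain_tail[of False k'] by (cases sg) (auto simp: m k')
  have "wagner_class \<Sigma> k sg \<subseteq> wagner_class \<Sigma> j sj" if "fdfa_lang \<Sigma> F \<in> wagner_class \<Sigma> j sj" for j sj
  proof -
    have j: "within_measures j sj ?p ?n"
      using that unfolding in_wagner_class_iff by (subst (asm) bounded_by_iff[OF m])
    have "within_measures j sj a b" if "within_measures k sg a b" for a b
      using bound[OF that] j by (cases sj) auto
    then show ?thesis unfolding wagner_class_def by blast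
  qed
  then show ?thesis using assms(1,2) by (simp add: is_wagner_position_def in_wagner_class_iff)
qed

lemma position_exists:
  assumes "\<Sigma> \<noteq> {}"
  shows "\<exists>k sg. 1 \<le> k \<and> bounded_by fchain k sg \<and> attained_by fchain k sg"
proof -
  obtain M :: "(nat, 'a) dma" where M: "complete_dma \<Sigma> M" "dma_lang \<Sigma> M = fdfa_lang \<Sigma> F"
    using dma_for_lang .
  have m: "fchain b j \<longleftrightarrow> j \<le> chain_measure \<Sigma> M b" for b j using chain_measure_iff_fchain[OF M] by simp
  obtain b where b: "1 \<le> chain_measure \<Sigma> M b" using fchain_one[OF assms] by (auto simp: m)
  let ?p = "chain_measure \<Sigma> M True" and ?n = "chain_measure \<Sigma> M False"
  consider "?p > ?n" | "?p < ?n" | "?p = ?n" by linarith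
  then show ?thesis
  proof cases
    case 1
    then show ?thesis by (intro exI[of _ ?p] exI[of _ Plus]) (simp add: m)
  next
    case 2
    then show ?thesis by (intro exI[of _ ?n] exI[of _ Minus]) (simp add: m)
  next
    case 3
    then show ?thesis using b by (cases b; intro exI[of _ ?p] exI[of _ PlusMinus]) (simp_all add: m)
  qed
qed

end

section \<open>Nondeterministic programs over bounded registers\<close>

instance cell :: (countable) countable by countable_datatype
instance sym :: countable by countable_datatype

text \<open>Registers are changed only by guessing a whole value and inspected only by one addition
  test with carries. Either takes a single sweep over the digits; assignments and comparisons are
  derived from guess and check.\<close>

datatype 'o atom = MoveL | MoveR | CellIs "sym cell" | Guess nat | AddTest bool bool nat nat nat | Out 'o

datatype 'o prog = Atom "'o atom" | Seq "'o prog" "'o prog" | Choice "'o prog" "'o prog" | Star "'o prog"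

instance atom :: (countable) countable by countable_datatype
instance prog :: (countable) countable by countable_datatype

type_synonym 'o pstate = "nat \<times> (nat \<Rightarrow> nat) \<times> 'o list"

text \<open>Eight bits in a tape cell turn a logarithmic number of cells into numbers up to the
  eighth power of the input length.\<close>

definition radix :: nat where "radix = 2 ^ 8"

text \<open>The number of binary digits of \<open>length w + 1\<close>, which is exactly the number
  of cells used by a counter that runs over the input up to the right end marker.\<close>

definition width :: "sym list \<Rightarrow> nat" where "width w = floorlog 2 (length w + 1)"

text \<open>Registers hold numbers below \<open>cap w\<close>, which exceeds the eighth power of the input length:
  this is what makes room for tuples of input positions in a single register.\<close>

definition cap :: "sym list \<Rightarrow> nat" where "cap w = radix ^ width w"

lemma radix_gt_1: "1 < radix"
  by (simp add: radix_def)

lemma length_less_width: "length w + 2 \<le> 2 ^ width w"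
  using floorlog_bounds[of "length w + 1" 2] by (simp add: width_def)

lemma cap_ge: "(length w + 2) ^ 8 \<le> cap w"
proof -
  have "(length w + 2) ^ 8 \<le> (2 ^ width w) ^ 8"
    using length_less_width by (rule power_mono) simp
  also have "\<dots> = cap w"
    by (simp only: cap_def radix_def power_mult[symmetric] mult.commute)
  finally show ?thesis .
qed

fun exec_atom :: "sym list \<Rightarrow> 'o atom \<Rightarrow> 'o pstate \<Rightarrow> 'o pstate \<Rightarrow> bool" where
  "exec_atom w MoveL (h, r, ys) s \<longleftrightarrow> s = (h - 1, r, ys)"
| "exec_atom w MoveR (h, r, ys) s \<longleftrightarrow> s = (min (h + 1) (length w + 1), r, ys)"
| "exec_atom w (CellIs c) (h, r, ys) s \<longleftrightarrow> s = (h, r, ys) \<and> input_cell w h = c"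
| "exec_atom w (Guess j) (h, r, ys) s \<longleftrightarrow> (\<exists>v<cap w. s = (h, r(j := v), ys))"
| "exec_atom w (AddTest ci co i j k) (h, r, ys) s \<longleftrightarrow>
     s = (h, r, ys) \<and> r i + r j + of_bool ci = r k + of_bool co * cap w"
| "exec_atom w (Out y) (h, r, ys) s \<longleftrightarrow> s = (h, r, ys @ [y])"

fun sem :: "sym list \<Rightarrow> 'o prog \<Rightarrow> 'o pstate rel" where
  "sem w (Atom a) = {(s, t). exec_atom w a s t}"
| "sem w (Seq p q) = sem w p O sem w q"
| "sem w (Choice p q) = sem w p \<union> sem w q"
| "sem w (Star p) = (sem w p)\<^sup>*"

definition valid_regs :: "sym list \<Rightarrow> (nat \<Rightarrow> nat) \<Rightarrow> bool" where
  "valid_regs w r \<longleftrightarrow> (\<forall>j. r j < cap w)"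

definition valid :: "sym list \<Rightarrow> 'o pstate \<Rightarrow> bool" where
  "valid w s \<longleftrightarrow> fst s \<le> length w + 1 \<and> valid_regs w (fst (snd s))"

lemma valid_simp [simp]: "valid w (h, r, ys) \<longleftrightarrow> h \<le> length w + 1 \<and> valid_regs w r"
  by (simp add: valid_def)

lemma valid_regs_upd: "valid_regs w r \<Longrightarrow> v < cap w \<Longrightarrow> valid_regs w (r(j := v))"
  by (simp add: valid_regs_def)

lemma exec_atom_valid: "exec_atom w a s t \<Longrightarrow> valid w s \<Longrightarrow> valid w t"
  by (cases s; cases a) (auto simp: valid_regs_upd)

lemma sem_valid: "(s, t) \<in> sem w p \<Longrightarrow> valid w s \<Longrightarrow> valid w t"
proof (induction p arbitrary: s t)
  case (Star p)
  from Star.prems(1) have "(s, t) \<in> (sem w p)\<^sup>*" by simp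
  then show ?case using Star.prems(2)
    by (induction rule: rtrancl_induct) (auto intro: Star.IH)
qed (auto intro: exec_atom_valid)

subsection \<open>Stacks of pending programs as control states\<close>

fun moves :: "'o prog \<Rightarrow> 'o prog list set" where
  "moves (Atom a) = {[]}"
| "moves (Seq p q) = {[p, q]}"
| "moves (Choice p q) = {[p], [q]}"
| "moves (Star p) = {[], [p, Star p]}"

inductive_set sstep :: "sym list \<Rightarrow> ('o prog list \<times> 'o pstate) rel" for w where
  atom: "exec_atom w a s t \<Longrightarrow> ((Atom a # K, s), (K, t)) \<in> sstep w"
| control: "m \<in> moves p \<Longrightarrow> \<nexists>a. p = Atom a \<Longrightarrow> ((p # K, s), (m @ K, s)) \<in> sstep w"

fun sem_stack :: "sym list \<Rightarrow> 'o prog list \<Rightarrow> 'o pstate rel" where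
  "sem_stack w [] = Id"
| "sem_stack w (p # K) = sem w p O sem_stack w K"

lemma sem_stack_append: "sem_stack w (K @ K') = sem_stack w K O sem_stack w K'"
  by (induction K) auto

lemma sstep_complete: "(s, t) \<in> sem w p \<Longrightarrow> ((p # K, s), (K, t)) \<in> (sstep w)\<^sup>*"
proof (induction p arbitrary: s t K)
  case (Atom a)
  then show ?case by (auto intro: sstep.atom)
next
  case (Seq p q)
  then obtain u where "(s, u) \<in> sem w p" "(u, t) \<in> sem w q" by auto
  then have "((p # q # K, s), (K, t)) \<in> (sstep w)\<^sup>*"
    using Seq.IH by (meson rtrancl_trans)
  moreover have "((Seq p q # K, s), ([p, q] @ K, s)) \<in> sstep w"
    by (rule sstep.control) auto
  ultimately show ?case by (simp add: converse_rtrancl_into_rtrancl)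
next
  case (Choice p q)
  have "((Choice p q # K, s), ([p] @ K, s)) \<in> sstep w" "((Choice p q # K, s), ([q] @ K, s)) \<in> sstep w"
    by (rule sstep.control; auto)+
  then have "((Choice p q # K, s), (p # K, s)) \<in> sstep w" "((Choice p q # K, s), (q # K, s)) \<in> sstep w"
    by simp_all
  moreover have "((p # K, s), (K, t)) \<in> (sstep w)\<^sup>* \<or> ((q # K, s), (K, t)) \<in> (sstep w)\<^sup>*"
    using Choice.IH Choice.prems by (metis UnE sem.simps(3))
  ultimately show ?case by (meson converse_rtrancl_into_rtrancl)
next
  case (Star p)
  have 1: "((Star p # K, s), ([] @ K, s)) \<in> sstep w" for s
    by (rule sstep.control) auto
  have 2: "((Star p # K, s), ([p, Star p] @ K, s)) \<in> sstep w" for s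
    by (rule sstep.control) auto
  from Star.prems have "(s, t) \<in> (sem w p)\<^sup>*" by simp
  then show ?case
  proof (induction rule: converse_rtrancl_induct)
    case base
    then show ?case using 1[of t] by auto
  next
    case (step s u)
    have "((p # Star p # K, s), (Star p # K, u)) \<in> (sstep w)\<^sup>*"
      using Star.IH step.hyps(1) by blast
    with 2[of s] step.IH show ?case
      by (simp add: converse_rtrancl_into_rtrancl rtrancl_trans)
  qed
qed

lemma sstep_sound:
  assumes "((K, s), (K', t)) \<in> sstep w" "(t, u) \<in> sem_stack w K'"
  shows "(s, u) \<in> sem_stack w K"
  using assms
proof cases
  case (atom a)
  then show ?thesis using assms(2) by auto
next
  case (control m p K'')
  have "(t, u) \<in> sem_stack w m O sem_stack w K''"
    using assms(2) control sem_stack_append by metis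
  moreover have "sem_stack w m \<subseteq> sem w p"
    using control(4,5) by (cases p) (auto intro: converse_rtrancl_into_rtrancl)
  ultimately show ?thesis using control by auto
qed

lemma sstep_iff_sem: "(([p], s), ([], t)) \<in> (sstep w)\<^sup>* \<longleftrightarrow> (s, t) \<in> sem w p"
proof
  have "((K, s), ([], t)) \<in> (sstep w)\<^sup>* \<Longrightarrow> (s, t) \<in> sem_stack w K" for K s
    by (induction rule: converse_rtrancl_induct2) (auto intro: sstep_sound)
  from this[of "[p]"] show "(([p], s), ([], t)) \<in> (sstep w)\<^sup>* \<Longrightarrow> (s, t) \<in> sem w p"
    by simp
qed (rule sstep_complete)

text \<open>A finite superset of the stacks that occur, comparable to the partial derivatives of a
  regular expression. A \<open>Star\<close> puts itself back only below its own body, so stacks do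
  not grow with the iterations and can be control states.\<close>

fun stacks :: "'o prog \<Rightarrow> 'o prog list set" where
  "stacks (Atom a) = {[Atom a], []}"
| "stacks (Seq p q) = insert [Seq p q] ((\<lambda>k. k @ [q]) ` stacks p \<union> stacks q)"
| "stacks (Choice p q) = insert [Choice p q] (stacks p \<union> stacks q)"
| "stacks (Star p) = insert [Star p] (insert [] ((\<lambda>k. k @ [Star p]) ` stacks p))"

lemma finite_stacks: "finite (stacks p)"
  by (induction p) auto

lemma self_in_stacks: "[p] \<in> stacks p"
  by (cases p) auto

lemma stacks_closed: "x # K \<in> stacks p \<Longrightarrow> m \<in> moves x \<Longrightarrow> m @ K \<in> stacks p"
proof (induction p arbitrary: x K m)
  case (Seq p q)
  consider "x = Seq p q" "K = []" | k where "k \<in> stacks p" "x # K = k @ [q]" | "x # K \<in> stacks q"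
    using Seq.prems(1) by auto
  then show ?case
  proof cases
    case 1
    then show ?thesis using Seq.prems self_in_stacks[of p] by (auto intro: image_eqI[of _ _ "[p]"])
  next
    case 2
    show ?thesis
    proof (cases k)
      case Nil
      then show ?thesis using 2 Seq.IH(2)[of x K m] Seq.prems self_in_stacks[of q] by auto
    next
      case (Cons y k')
      then have "m @ k' \<in> stacks p" using 2 Seq.IH(1) Seq.prems by auto
      then show ?thesis using 2 Cons by auto
    qed
  next
    case 3
    then show ?thesis using Seq by auto
  qed
next
  case (Choice p q)
  then show ?case using self_in_stacks[of p] self_in_stacks[of q] by auto
next
  case (Star p)
  have star: "m @ [] \<in> stacks (Star p)" if "m \<in> moves (Star p)" for m
    using that self_in_stacks[of p] by (auto intro: image_eqI[of _ _ "[p]"])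
  from Star.prems(1) consider "x = Star p" "K = []" | k where "k \<in> stacks p" "x # K = k @ [Star p]"
    by auto
  then show ?case
  proof cases
    case 1
    then show ?thesis using star Star.prems by auto
  next
    case 2
    show ?thesis
    proof (cases k)
      case Nil
      then show ?thesis using 2 star Star.prems by auto
    next
      case (Cons y k')
      then have "m @ k' \<in> stacks p" using 2 Star.IH Star.prems by auto
      then show ?thesis using 2 Cons by auto
    qed
  qed
qed auto

lemma sstep_stacks:
  assumes "((K, s), (K', t)) \<in> sstep w" "K \<in> stacks p"
  shows "K' \<in> stacks p"
  using assms by cases (use stacks_closed[of _ _ p] in fastforce)+

fun atom_regs :: "'o atom \<Rightarrow> nat set" where
  "atom_regs (Guess j) = {j}"
| "atom_regs (AddTest ci co i j k) = {i, j, k}"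
| "atom_regs _ = {}"

fun regs :: "'o prog \<Rightarrow> nat set" where
  "regs (Atom a) = atom_regs a"
| "regs (Seq p q) = regs p \<union> regs q"
| "regs (Choice p q) = regs p \<union> regs q"
| "regs (Star p) = regs p"

fun outs :: "'o prog \<Rightarrow> 'o set" where
  "outs (Atom (Out y)) = {y}"
| "outs (Atom _) = {}"
| "outs (Seq p q) = outs p \<union> outs q"
| "outs (Choice p q) = outs p \<union> outs q"
| "outs (Star p) = outs p"

lemma finite_regs: "finite (regs p)"
proof (induction p)
  case (Atom a)
  then show ?case by (cases a) auto
qed auto

lemma finite_outs: "finite (outs p)"
proof (induction p)
  case (Atom a)
  then show ?case by (cases a) auto
qed auto

lemma stacks_regs_outs: "K \<in> stacks p \<Longrightarrow> q \<in> set K \<Longrightarrow> regs q \<subseteq> regs p \<and> outs q \<subseteq> outs p"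
proof (induction p arbitrary: K)
  case (Seq p1 p2)
  then show ?case by (auto; blast)
next
  case (Choice p1 p2)
  then show ?case by (auto; blast)
next
  case (Star p)
  then show ?case by (auto; blast)
qed auto

subsection \<open>Digits\<close>

definition digit :: "nat \<Rightarrow> nat \<Rightarrow> nat" where
  "digit v x = v div radix ^ x mod radix"

lemma digit_less: "digit v x < radix"
  using radix_gt_1 by (simp add: digit_def)

lemma digits_exist:
  assumes "\<And>x. g x < radix"
  shows "\<exists>v < radix ^ L. \<forall>x<L. digit v x = g x"
proof (induction L)
  case (Suc L)
  then obtain v where v: "v < radix ^ L" "\<forall>x<L. digit v x = g x" by auto
  let ?v = "v + g L * radix ^ L"
  have "?v < radix ^ L + g L * radix ^ L" using v by simp
  also have "\<dots> = (1 + g L) * radix ^ L" by (simp add: algebra_simps)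
  also have "\<dots> \<le> radix * radix ^ L" using assms[of L] by (intro mult_right_mono) auto
  finally have "?v < radix ^ Suc L" by simp
  moreover have "digit ?v x = g x" if "x < Suc L" for x
  proof (cases "x = L")
    case True
    then show ?thesis using v(1) assms[of L] radix_gt_1 by (simp add: digit_def)
  next
    case False
    then have "x < L" using that by simp
    then obtain k where k: "L = Suc x + k" using less_imp_Suc_add by auto
    have "digit ?v x = (v + radix ^ x * (g L * radix ^ k * radix)) div radix ^ x mod radix"
      by (simp add: digit_def k power_add algebra_simps)
    also have "\<dots> = (g L * radix ^ k * radix + v div radix ^ x) mod radix"
      using radix_gt_1 by (subst div_mult_self2) auto
    also have "\<dots> = digit v x" by (simp add: digit_def)
    finally show ?thesis using v(2) \<open>x < L\<close> by simp
  qed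
  ultimately show ?case by blast
qed simp

lemma mod_radix_power_Suc: "v mod radix ^ Suc x = v mod radix ^ x + radix ^ x * digit v x"
  by (simp only: digit_def power_Suc2 mod_mult2_eq add.commute)

lemma carry_step:
  assumes "a mod radix ^ x + b mod radix ^ x + C = c mod radix ^ x + of_bool t * radix ^ x"
    and "digit a x + digit b x + of_bool t = digit c x + of_bool t' * radix"
  shows "a mod radix ^ Suc x + b mod radix ^ Suc x + C = c mod radix ^ Suc x + of_bool t' * radix ^ Suc x"
proof -
  have "a mod radix ^ Suc x + b mod radix ^ Suc x + C
      = (a mod radix ^ x + b mod radix ^ x + C) + radix ^ x * (digit a x + digit b x)"
    by (simp add: mod_radix_power_Suc algebra_simps del: power_Suc)
  also have "\<dots> = c mod radix ^ x + radix ^ x * (digit a x + digit b x + of_bool t)"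
    by (simp only: assms(1)) (simp add: algebra_simps)
  also have "\<dots> = c mod radix ^ Suc x + of_bool t' * radix ^ Suc x"
    by (simp only: assms(2) mod_radix_power_Suc) (simp add: algebra_simps)
  finally show ?thesis .
qed

text \<open>The carry into position \<open>x\<close> is the overflow of the parts below
  \<open>x\<close>; both sides agree modulo \<open>radix ^ x\<close>, and at most one overflow is
  possible.\<close>

lemma carries_exist:
  assumes "a + b + of_bool ci = c + of_bool co * radix ^ L" "a < radix ^ L" "b < radix ^ L" "c < radix ^ L"
  shows "\<exists>t. t 0 = ci \<and> t L = co \<and>
    (\<forall>x<L. digit a x + digit b x + of_bool (t x) = digit c x + of_bool (t (Suc x)) * radix)"
proof -
  define t where "t x \<longleftrightarrow> a mod radix ^ x + b mod radix ^ x + of_bool ci \<ge> radix ^ x" for x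
  have inv: "a mod radix ^ x + b mod radix ^ x + of_bool ci = c mod radix ^ x + of_bool (t x) * radix ^ x"
    if "x \<le> L" for x
  proof -
    have p: "0 < radix ^ x" using radix_gt_1 by simp
    define k where "k = L - x"
    then have k: "L = x + k" using that by simp
    have "(a mod radix ^ x + b mod radix ^ x + of_bool ci) mod radix ^ x = (a + b + of_bool ci) mod radix ^ x"
      by (metis mod_add_eq mod_add_left_eq)
    also have "\<dots> = c mod radix ^ x"
      by (simp only: assms(1) k power_add) (simp add: mult.left_commute)
    finally have m: "(a mod radix ^ x + b mod radix ^ x + of_bool ci) mod radix ^ x = c mod radix ^ x" .
    have "a mod radix ^ x < radix ^ x" "b mod radix ^ x < radix ^ x" using p by auto
    then have less: "a mod radix ^ x + b mod radix ^ x + of_bool ci - radix ^ x < radix ^ x"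
      by (cases ci) auto
    show ?thesis
    proof (cases "t x")
      case True
      then show ?thesis
        using m less le_mod_geq[of "radix ^ x" "a mod radix ^ x + b mod radix ^ x + of_bool ci"]
        by (simp add: t_def)
    next
      case False
      then show ?thesis using m by (simp add: t_def)
    qed
  qed
  have "t 0 = ci" by (auto simp: t_def)
  moreover have "t L = co"
    using assms by (auto simp: t_def)
  moreover have "digit a x + digit b x + of_bool (t x) = digit c x + of_bool (t (Suc x)) * radix"
    if "x < L" for x
  proof -
    have p: "0 < radix ^ x" using radix_gt_1 by simp
    have "(a mod radix ^ x + b mod radix ^ x + of_bool ci) + radix ^ x * (digit a x + digit b x)
      = c mod radix ^ x + radix ^ x * digit c x + of_bool (t (Suc x)) * (radix ^ x * radix)"
      using inv[of "Suc x"] that unfolding mod_radix_power_Suc by (simp add: algebra_simps del: of_bool_eq_iff)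
    then have "radix ^ x * (digit a x + digit b x + of_bool (t x)) = radix ^ x * (digit c x + of_bool (t (Suc x)) * radix)"
      using inv[of x] that by (simp add: algebra_simps)
    then show ?thesis using p by (metis nat_mult_eq_cancel1)
  qed
  ultimately show ?thesis by blast
qed

subsection \<open>Compilation to Turing machines\<close>

datatype 'o tm_state = Begin | Count | Carry bool | CountBack | Loc "'o prog list"
  | Sweep "'o atom" bool "'o prog list" | Back "'o prog list"

instance tm_state :: (countable) countable by countable_datatype

text \<open>The offset keeps 0 for the blank and 1 for the marker in cell 0 that stops the head on
  its way back.\<close>

definition cell_code :: "nat list \<Rightarrow> nat" where "cell_code ds = 2 + to_nat ds"

lemma cell_code_inject [simp]: "cell_code ds = cell_code ds' \<longleftrightarrow> ds = ds'"
  by (simp add: cell_code_def)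

lemma cell_code_neq [simp]: "cell_code ds \<noteq> 0" "cell_code ds \<noteq> 1" "cell_code ds \<noteq> Suc 0"
  "0 \<noteq> cell_code ds" "1 \<noteq> cell_code ds" "Suc 0 \<noteq> cell_code ds"
  by (auto simp: cell_code_def)

text \<open>One step of a sweep over the digits of the registers, from the least significant ones on;
  the flag is the carry.\<close>

fun digit_step :: "'o atom \<Rightarrow> bool \<Rightarrow> nat list \<Rightarrow> bool \<Rightarrow> nat list \<Rightarrow> bool" where
  "digit_step (Guess j) t ds t' ds' \<longleftrightarrow> \<not> t' \<and> (\<exists>v<radix. ds' = ds[j := v])"
| "digit_step (AddTest ci co i j k) t ds t' ds' \<longleftrightarrow>
     ds' = ds \<and> ds ! i + ds ! j + of_bool t = ds ! k + of_bool t' * radix"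
| "digit_step _ t ds t' ds' \<longleftrightarrow> False"

fun carry_in :: "'o atom \<Rightarrow> bool" where
  "carry_in (AddTest ci co i j k) = ci"
| "carry_in _ = False"

fun carry_out :: "'o atom \<Rightarrow> bool" where
  "carry_out (AddTest ci co i j k) = co"
| "carry_out _ = False"

fun is_sweep :: "'o atom \<Rightarrow> bool" where
  "is_sweep (Guess j) = True"
| "is_sweep (AddTest ci co i j k) = True"
| "is_sweep _ = False"

fun atom_dir :: "'o atom \<Rightarrow> dir" where
  "atom_dir MoveL = MoveLeft"
| "atom_dir MoveR = MoveRight"
| "atom_dir _ = Stay"

fun atom_out :: "'o atom \<Rightarrow> 'o list" where
  "atom_out (Out y) = [y]"
| "atom_out _ = []"

definition cells :: "nat \<Rightarrow> nat list set" where
  "cells d = {ds. set ds \<subseteq> {..<radix} \<and> length ds = d}"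

lemma finite_cells: "finite (cells d)"
  unfolding cells_def by (rule finite_lists_length_eq) simp

text \<open>A bit of the counter is stored as the same digit of every register, so that the tape
  left by the counter is already a legal register tape.\<close>

definition bit_cell :: "nat \<Rightarrow> bool \<Rightarrow> nat list" where
  "bit_cell d b = replicate d (of_bool b)"

lemma bit_cell_in_cells: "bit_cell d b \<in> cells d"
  using radix_gt_1 by (auto simp: bit_cell_def cells_def)

text \<open>The phase before \<^term>\<open>Loc [p]\<close> counts the input length in binary, in order to mark
  \<^term>\<open>width w\<close> cells of the work tape.\<close>

inductive tm_trans :: "nat \<Rightarrow> 'o prog \<Rightarrow> 'o tm_state \<Rightarrow> sym cell \<Rightarrow> nat \<Rightarrow>
    'o tm_state \<Rightarrow> dir \<Rightarrow> nat \<Rightarrow> dir \<Rightarrow> 'o list \<Rightarrow> bool" for d p where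
  launch: "tm_trans d p Begin c 0 Count Stay 1 Stay []"
| count: "c \<noteq> RightEnd \<Longrightarrow> tm_trans d p Count c 1 (Carry True) MoveRight 1 MoveRight []"
| counted: "tm_trans d p Count RightEnd 1 (Loc [p]) Stay 1 Stay []"
| carry: "tm_trans d p (Carry b) c (cell_code (bit_cell d b')) (Carry (b \<and> b'))
    Stay (cell_code (bit_cell d (b \<noteq> b'))) MoveRight []"
| carry_end: "tm_trans d p (Carry b) c 0 CountBack Stay (if b then cell_code (bit_cell d True) else 0) MoveLeft []"
| count_back: "ds \<in> cells d \<Longrightarrow> tm_trans d p CountBack c (cell_code ds) CountBack Stay (cell_code ds) MoveLeft []"
| count_ready: "tm_trans d p CountBack c 1 Count Stay 1 Stay []"
| control: "x # K \<in> stacks p \<Longrightarrow> \<nexists>a. x = Atom a \<Longrightarrow> m \<in> moves x \<Longrightarrow>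
    tm_trans d p (Loc (x # K)) c 1 (Loc (m @ K)) Stay 1 Stay []"
| atom: "Atom a # K \<in> stacks p \<Longrightarrow> \<not> is_sweep a \<Longrightarrow> (\<And>c'. a = CellIs c' \<Longrightarrow> c = c') \<Longrightarrow>
    tm_trans d p (Loc (Atom a # K)) c 1 (Loc K) (atom_dir a) 1 Stay (atom_out a)"
| sweep: "Atom a # K \<in> stacks p \<Longrightarrow> is_sweep a \<Longrightarrow>
    tm_trans d p (Loc (Atom a # K)) c 1 (Sweep a (carry_in a) K) Stay 1 MoveRight []"
| sweep_digit: "Atom a # K \<in> stacks p \<Longrightarrow> digit_step a t ds t' ds' \<Longrightarrow> ds \<in> cells d \<Longrightarrow> ds' \<in> cells d \<Longrightarrow>
    tm_trans d p (Sweep a t K) c (cell_code ds) (Sweep a t' K) Stay (cell_code ds') MoveRight []"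
| sweep_end: "Atom a # K \<in> stacks p \<Longrightarrow> t = carry_out a \<Longrightarrow>
    tm_trans d p (Sweep a t K) c 0 (Back K) Stay 0 MoveLeft []"
| sweep_back: "K \<in> stacks p \<Longrightarrow> ds \<in> cells d \<Longrightarrow>
    tm_trans d p (Back K) c (cell_code ds) (Back K) Stay (cell_code ds) MoveLeft []"
| ready: "K \<in> stacks p \<Longrightarrow> tm_trans d p (Back K) c 1 (Loc K) Stay 1 Stay []"

definition compile :: "nat \<Rightarrow> 'o::countable prog \<Rightarrow> (sym, 'o) ntm" where
  "compile d p = \<lparr>work_tapes = 1, start_state = to_nat (Begin :: 'o tm_state),
     accept_state = to_nat (Loc [] :: 'o tm_state),
     delta = {((to_nat q, c, [x]), (to_nat q', e, [(x', e')], ys)) | q c x q' e x' e' ys.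
       tm_trans d p q c x q' e x' e' ys}\<rparr>"

definition tm_states :: "'o prog \<Rightarrow> 'o tm_state set" where
  "tm_states p = {Begin, Count, CountBack} \<union> range Carry \<union> Loc ` stacks p \<union> Back ` stacks p \<union>
     (\<lambda>(K, t). case K of Atom a # K' \<Rightarrow> Sweep a t K' | _ \<Rightarrow> Begin) ` (stacks p \<times> UNIV)"

lemma Sweep_in_tm_states: "Atom a # K \<in> stacks p \<Longrightarrow> Sweep a t K \<in> tm_states p"
  unfolding tm_states_def by (auto intro!: rev_image_eqI[of "(Atom a # K, t)"])

lemma in_tm_states:
  "Begin \<in> tm_states p" "Count \<in> tm_states p" "CountBack \<in> tm_states p" "Carry t \<in> tm_states p"
  "K \<in> stacks p \<Longrightarrow> Loc K \<in> tm_states p" "K \<in> stacks p \<Longrightarrow> Back K \<in> tm_states p"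
  by (auto simp: tm_states_def)

lemma finite_tm_states: "finite (tm_states p)"
  unfolding tm_states_def by (intro finite_UnI finite_imageI finite_cartesian_product finite_stacks) auto

lemma tm_trans_finite:
  assumes "tm_trans d p q c x q' e x' e' ys"
  shows "q \<in> tm_states p \<and> x \<in> insert 0 (insert 1 (cell_code ` cells d)) \<and> q' \<in> tm_states p \<and>
    x' \<in> insert 0 (insert 1 (cell_code ` cells d)) \<and> ys \<in> insert [] ((\<lambda>y. [y]) ` outs p)"
  using assms
proof cases
  case (control y K m)
  then show ?thesis using stacks_closed[of y K p m] by (auto simp: in_tm_states)
next
  case (atom a K)
  have st: "Atom a # K \<in> stacks p" using atom by blast
  have "K \<in> stacks p" using stacks_closed[OF st, of "[]"] by simp
  moreover have "outs (Atom a) \<subseteq> outs p" using stacks_regs_outs[OF st] by auto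
  then have "ys \<in> insert [] ((\<lambda>y. [y]) ` outs p)" using atom by (cases a) auto
  ultimately show ?thesis using atom by (auto simp: in_tm_states)
next
  case (sweep_end a K)
  have st: "Atom a # K \<in> stacks p" using sweep_end by blast
  have "K \<in> stacks p" using stacks_closed[OF st, of "[]"] by simp
  then show ?thesis using sweep_end Sweep_in_tm_states[OF st] by (auto simp: in_tm_states)
qed (auto simp: Sweep_in_tm_states bit_cell_in_cells in_tm_states self_in_stacks)

lemma finite_cell: "finite (UNIV :: sym cell set)"
proof -
  have "(UNIV :: sym cell set) = {LeftEnd, RightEnd, Symbol Sep, Symbol (Bit True), Symbol (Bit False)}"
  proof (intro equalityI subsetI)
    fix c :: "sym cell"
    show "c \<in> {LeftEnd, RightEnd, Symbol Sep, Symbol (Bit True), Symbol (Bit False)}"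
    proof (cases c)
      case (Symbol s)
      then show ?thesis by (cases s) auto
    qed auto
  qed auto
  then show ?thesis by (metis finite.emptyI finite_insert)
qed

lemma finite_dir: "finite (UNIV :: dir set)"
proof -
  have "(UNIV :: dir set) = {MoveLeft, Stay, MoveRight}"
    using dir.exhaust by auto
  then show ?thesis by (metis finite.emptyI finite_insert)
qed

lemma ntm_compile: "ntm (compile d p)"
proof -
  let ?X = "insert 0 (insert 1 (cell_code ` cells d))"
  let ?A = "tm_states p \<times> (UNIV :: sym cell set) \<times> ?X \<times> tm_states p \<times> (UNIV :: dir set) \<times> ?X \<times>
    (UNIV :: dir set) \<times> insert [] ((\<lambda>y. [y]) ` outs p)"
  let ?f = "\<lambda>(q, c, x, q', e, x', e', ys). ((to_nat q, c, [x]), (to_nat q', e, [(x', e')], ys))"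
  have "delta (compile d p) \<subseteq> ?f ` ?A"
    unfolding compile_def using tm_trans_finite[of d p] by (fastforce simp: image_iff)
  moreover have "finite (?f ` ?A)"
    by (intro finite_imageI finite_cartesian_product finite_tm_states finite_cell finite_dir
        finite.insertI finite_cells finite_outs)
  ultimately have "finite (delta (compile d p))" by (rule finite_subset)
  moreover have "\<not> tm_trans d p (Loc []) c x q' e x' e' ys" for c x q' e x' e' ys
    by (auto elim: tm_trans.cases)
  ultimately show ?thesis
    unfolding ntm_def by (auto simp: compile_def)
qed

subsection \<open>Correctness of the compilation\<close>

definition cfg :: "'o::countable tm_state \<Rightarrow> nat \<Rightarrow> (nat \<Rightarrow> nat) \<Rightarrow> nat \<Rightarrow> 'o list \<Rightarrow> 'o config" where
  "cfg q i t h ys = (to_nat q, i, [(t, h)], ys)"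

lemma cfg_inject [simp]: "cfg q i t h ys = cfg q' i' t' h' ys' \<longleftrightarrow> q = q' \<and> i = i' \<and> t = t' \<and> h = h' \<and> ys = ys'"
  by (simp add: cfg_def)

lemma step_iff:
  "ntm_step (compile d p) w (cfg q i t h ys) c \<longleftrightarrow> (\<exists>q' e x' e' zs.
     tm_trans d p q (input_cell w i) (t h) q' e x' e' zs \<and>
     c = cfg q' (min (move e i) (length w + 1)) (t(h := x')) (move e' h) (ys @ zs))"
  (is "?l \<longleftrightarrow> ?r")
proof
  assume ?l
  then have "ntm_step (compile d p) w (to_nat q, i, [(t, h)], ys) c" by (simp add: cfg_def)
  then show ?r
  proof cases
    case (1 q' e acts zs)
    then obtain q'' x' e' where "q' = to_nat q''" "acts = [(x', e')]"
      "tm_trans d p q (input_cell w i) (t h) q'' e x' e' zs"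
      by (auto simp: compile_def)
    with 1 show ?thesis by (auto simp: cfg_def intro!: exI)
  qed
next
  assume ?r
  then obtain q' e x' e' zs where tr: "tm_trans d p q (input_cell w i) (t h) q' e x' e' zs"
    and c: "c = cfg q' (min (move e i) (length w + 1)) (t(h := x')) (move e' h) (ys @ zs)" by blast
  have "((to_nat q, input_cell w i, map (\<lambda>(t, h). t h) [(t, h)]), (to_nat q', e, [(x', e')], zs)) \<in> delta (compile d p)"
    using tr by (auto simp: compile_def)
  from ntm_step.intros[OF this, of ys] show ?l by (simp add: c cfg_def)
qed

lemma stepI:
  assumes "tm_trans d p q c x q' e x' e' zs" "input_cell w i = c" "t h = x"
    and "i' = min (move e i) (length w + 1)" "t' = t(h := x')" "h' = move e' h" "ys' = ys @ zs"
  shows "ntm_step (compile d p) w (cfg q i t h ys) (cfg q' i' t' h' ys')"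
  using assms step_iff by blast

definition tape :: "nat \<Rightarrow> (nat \<Rightarrow> nat list) \<Rightarrow> nat \<Rightarrow> nat" where
  "tape L g = (\<lambda>x. if x = 0 then 1 else if x \<le> L then cell_code (g (x - 1)) else 0)"

lemma tape_simps [simp]:
  "tape L g 0 = 1" "x < L \<Longrightarrow> tape L g (Suc x) = cell_code (g x)" "L \<le> x \<Longrightarrow> tape L g (Suc x) = 0"
  by (auto simp: tape_def)

lemma tape_upd [simp]:
  "(tape L g)(0 := Suc 0) = tape L g" "(tape L g)(0 := 1) = tape L g"
  "L \<le> x \<Longrightarrow> (tape L g)(Suc x := 0) = tape L g"
  "x < L \<Longrightarrow> (tape L g)(Suc x := cell_code ds) = tape L (g(x := ds))"
  "(tape L g)(Suc L := cell_code ds) = tape (Suc L) (g(L := ds))"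
  by (auto simp: tape_def fun_eq_iff)

lemma tape_cong: "(\<And>x. x < L \<Longrightarrow> g x = g' x) \<Longrightarrow> tape L g = tape L g'"
  by (auto simp: tape_def fun_eq_iff)

definition reg_cell :: "nat \<Rightarrow> (nat \<Rightarrow> nat) \<Rightarrow> nat \<Rightarrow> nat list" where
  "reg_cell d r x = map (\<lambda>j. digit (r j) x) [0..<d]"

lemma reg_cell_in_cells: "reg_cell d r x \<in> cells d"
  using digit_less by (auto simp: reg_cell_def cells_def)

lemma reg_cell_nth [simp]: "j < d \<Longrightarrow> reg_cell d r x ! j = digit (r j) x"
  by (simp add: reg_cell_def)

definition reg_tape :: "nat \<Rightarrow> sym list \<Rightarrow> (nat \<Rightarrow> nat) \<Rightarrow> nat \<Rightarrow> nat" where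
  "reg_tape d w r = tape (width w) (reg_cell d r)"

text \<open>The tape in the middle of an increment: positions below \<open>x\<close> already show
  \<open>Suc i\<close>, the others still \<open>i\<close>.\<close>

definition carry_tape :: "nat \<Rightarrow> nat \<Rightarrow> nat \<Rightarrow> nat \<Rightarrow> nat" where
  "carry_tape d i x = tape (floorlog 2 i) (\<lambda>y. bit_cell d (odd ((if y < x then Suc i else i) div 2 ^ y)))"

lemma carry_tape_simps [simp]:
  "carry_tape d i x 0 = 1" "carry_tape d i x (Suc (floorlog 2 i)) = 0"
  "y < floorlog 2 i \<Longrightarrow>
    carry_tape d i x (Suc y) = cell_code (bit_cell d (odd ((if y < x then Suc i else i) div 2 ^ y)))"
  by (simp_all add: carry_tape_def)

abbreviation count_tape :: "nat \<Rightarrow> nat \<Rightarrow> nat \<Rightarrow> nat" where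
  "count_tape d i \<equiv> carry_tape d i 0"

lemma count_tape_eq: "count_tape d i = tape (floorlog 2 i) (\<lambda>y. bit_cell d (odd (i div 2 ^ y)))"
  by (simp add: carry_tape_def)

lemma count_tape_0: "(\<lambda>_. 0)(0 := 1) = count_tape d 0"
  by (auto simp: count_tape_eq tape_def fun_eq_iff floorlog_def)

lemma Suc_div_power: "Suc i div 2 ^ x = (if 2 ^ x dvd Suc i then Suc (i div 2 ^ x) else i div 2 ^ x)"
  by (simp add: div_Suc mod_eq_0_iff_dvd)

text \<open>That \<open>2 ^ x\<close> divides \<open>Suc i\<close> is the arithmetic form of a carry
  arriving at position \<open>x\<close>; it passes on exactly through bits that are 1.\<close>

lemma carry_Suc: "2 ^ Suc x dvd Suc i \<longleftrightarrow> 2 ^ x dvd Suc i \<and> odd (i div 2 ^ x)"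
proof -
  have "2 ^ Suc x dvd Suc i \<longleftrightarrow> 2 ^ x dvd Suc i \<and> even (Suc i div 2 ^ x)"
      by auto
  then show ?thesis by (simp add: Suc_div_power)
qed

lemma carry_bit: "odd (Suc i div 2 ^ x) \<longleftrightarrow> (2 ^ x dvd Suc i) \<noteq> odd (i div 2 ^ x)"
  by (simp add: Suc_div_power)

lemma carry_tape_step:
  assumes "x < floorlog 2 i"
  shows "(carry_tape d i x)(Suc x := cell_code (bit_cell d ((2 ^ x dvd Suc i) \<noteq> odd (i div 2 ^ x))))
    = carry_tape d i (Suc x)"
  unfolding carry_bit[symmetric] carry_tape_def using assms by (auto intro!: tape_cong)

text \<open>The carry leaves the top position only if \<open>Suc i\<close> is a power of two, and
  just then the counter needs a new cell.\<close>

lemma carry_tape_end: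
  "(carry_tape d i (floorlog 2 i))(Suc (floorlog 2 i) :=
      if 2 ^ floorlog 2 i dvd Suc i then cell_code (bit_cell d True) else 0) = count_tape d (Suc i)"
proof -
  let ?L = "floorlog 2 i"
  have less: "i < 2 ^ ?L" by (rule floorlog_leD) simp_all
  show ?thesis
  proof (cases "2 ^ ?L dvd Suc i")
    case True
    with less have eq: "Suc i = 2 ^ ?L" by (metis Suc_leI dvd_imp_le le_antisym zero_less_Suc)
    have "floorlog 2 (Suc i) = Suc ?L"
      using floorlog_power[of 1 2 ?L] by (simp add: eq floorlog_def)
    moreover have "odd (Suc i div 2 ^ ?L)" using eq by simp
    ultimately show ?thesis using True
      by (auto simp: carry_tape_def less_Suc_eq intro!: tape_cong)
  next
    case False
    have "Suc i < 2 ^ ?L" using less False by (metis Suc_leI dvd_refl le_neq_implies_less)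
    then have "floorlog 2 (Suc i) \<le> ?L" by (intro floorlog_leI) simp_all
    moreover have "?L \<le> floorlog 2 (Suc i)" by (rule floorlog_mono) simp
    ultimately show ?thesis using False
      by (auto simp: carry_tape_def intro!: tape_cong)
  qed
qed

text \<open>What the counter leaves behind is read as some valid initial content of the registers;
  programs have to cope with any such content.\<close>

lemma count_tape_final: "\<exists>r. valid_regs w r \<and> count_tape d (length w + 1) = reg_tape d w r"
proof -
  have "of_bool (odd ((length w + 1) div 2 ^ x)) < radix" for x
    using radix_gt_1 by auto
  from digits_exist[OF this] obtain v where v: "v < cap w"
    "\<And>x. x < width w \<Longrightarrow> digit v x = of_bool (odd ((length w + 1) div 2 ^ x))"
    unfolding cap_def by meson
  have "count_tape d (length w + 1) = reg_tape d w (\<lambda>_. v)"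
    using v(2) by (auto simp: count_tape_eq reg_tape_def width_def reg_cell_def bit_cell_def map_replicate_const
        intro!: tape_cong)
  then show ?thesis using v(1) by (auto simp: valid_regs_def)
qed

subsubsection \<open>Completeness\<close>

abbreviation tm_steps :: "nat \<Rightarrow> 'o::countable prog \<Rightarrow> sym list \<Rightarrow> 'o config \<Rightarrow> 'o config \<Rightarrow> bool" where
  "tm_steps d p w \<equiv> (ntm_step (compile d p) w)\<^sup>*\<^sup>*"

lemma back_steps:
  assumes "K \<in> stacks p" "\<And>x. x < L \<Longrightarrow> g x \<in> cells d" "h \<le> L" "i \<le> length w + 1"
  shows "tm_steps d p w (cfg (Back K) i (tape L g) h ys) (cfg (Loc K) i (tape L g) 0 ys)"
  using assms(3)
proof (induction h)
  case 0
  have "ntm_step (compile d p) w (cfg (Back K) i (tape L g) 0 ys) (cfg (Loc K) i (tape L g) 0 ys)"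
    by (rule stepI, rule tm_trans.ready[OF assms(1)]) (use assms in auto)
  then show ?case by auto
next
  case (Suc h)
  have "ntm_step (compile d p) w (cfg (Back K) i (tape L g) (Suc h) ys) (cfg (Back K) i (tape L g) h ys)"
    by (rule stepI, rule tm_trans.sweep_back[OF assms(1)]) (use assms Suc in \<open>auto\<close>)
  with Suc show ?case by (simp add: converse_rtranclp_into_rtranclp)
qed

lemma sweep_steps:
  assumes "Atom a # K \<in> stacks p" "is_sweep a" "i \<le> length w + 1"
    and "\<And>x. x < L \<Longrightarrow> digit_step a (c x) (g x) (c (Suc x)) (g' x)"
    and "c 0 = carry_in a" "c L = carry_out a"
    and "\<And>x. x < L \<Longrightarrow> g x \<in> cells d" "\<And>x. x < L \<Longrightarrow> g' x \<in> cells d"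
  shows "tm_steps d p w (cfg (Loc (Atom a # K)) i (tape L g) 0 ys) (cfg (Loc K) i (tape L g') 0 ys)"
proof -
  let ?g = "\<lambda>x y. if y < x then g' y else g y"
  have K: "K \<in> stacks p" using stacks_closed[OF assms(1), of "[]"] by simp
  have *: "tm_steps d p w (cfg (Sweep a (c x) K) i (tape L (?g x)) (Suc x) ys) (cfg (Loc K) i (tape L g') 0 ys)"
    if "x \<le> L" for x
    using that
  proof (induction "L - x" arbitrary: x)
    case 0
    then have x: "x = L" by simp
    have "ntm_step (compile d p) w (cfg (Sweep a (c x) K) i (tape L (?g x)) (Suc x) ys) (cfg (Back K) i (tape L (?g x)) x ys)"
      by (rule stepI, rule tm_trans.sweep_end[OF assms(1)]) (use assms x in auto)
    also have "tape L (?g x) = tape L g'" using x by (auto intro: tape_cong)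
    also have "tm_steps d p w (cfg (Back K) i (tape L g') x ys) (cfg (Loc K) i (tape L g') 0 ys)"
      using assms K x by (intro back_steps) auto
    finally (converse_rtranclp_into_rtranclp) show ?case using x \<open>tape L (?g x) = tape L g'\<close> by simp
  next
    case (Suc k)
    then have x: "x < L" by simp
    have "ntm_step (compile d p) w (cfg (Sweep a (c x) K) i (tape L (?g x)) (Suc x) ys)
        (cfg (Sweep a (c (Suc x)) K) i (tape L (?g (Suc x))) (Suc (Suc x)) ys)"
      by (rule stepI, rule tm_trans.sweep_digit[OF assms(1), of _ _ _ "g' x"])
        (use assms x in \<open>auto intro!: tape_cong\<close>)
    moreover have "tm_steps d p w (cfg (Sweep a (c (Suc x)) K) i (tape L (?g (Suc x))) (Suc (Suc x)) ys)
        (cfg (Loc K) i (tape L g') 0 ys)"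
      using Suc by (intro Suc.hyps(1)) auto
    ultimately show ?case by (rule converse_rtranclp_into_rtranclp)
  qed
  have "ntm_step (compile d p) w (cfg (Loc (Atom a # K)) i (tape L g) 0 ys) (cfg (Sweep a (c 0) K) i (tape L (?g 0)) (Suc 0) ys)"
    unfolding assms(5)
    by (rule stepI, rule tm_trans.sweep[OF assms(1,2)]) (use assms in auto)
  with *[of 0] show ?thesis by (simp add: converse_rtranclp_into_rtranclp)
qed

lemma sstep_steps:
  assumes "((K, (i, r, ys)), (K', (i', r', ys'))) \<in> sstep w" "K \<in> stacks p"
    and "valid w (i, r, ys)" "regs p \<subseteq> {..<d}"
  shows "tm_steps d p w (cfg (Loc K) i (reg_tape d w r) 0 ys) (cfg (Loc K') i' (reg_tape d w r') 0 ys')"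
  using assms(1)
proof cases
  case (atom a)
  note K = assms(2)[unfolded atom(1)]
  have regs: "atom_regs a \<subseteq> {..<d}"
    using stacks_regs_outs[OF assms(2), of "Atom a"] assms(4) atom by auto
  show ?thesis
  proof (cases "is_sweep a")
    case False
    have "ntm_step (compile d p) w (cfg (Loc K) i (reg_tape d w r) 0 ys) (cfg (Loc K') i' (reg_tape d w r') 0 ys')"
      unfolding atom(1) reg_tape_def
      by (rule stepI, rule tm_trans.atom[OF K False])
        (use assms(3) atom False in \<open>cases a; auto\<close>)+
    then show ?thesis by auto
  next
    case True
    then show ?thesis
    proof (cases a)
      case (Guess j)
      then obtain v where v: "v < cap w" "r' = r(j := v)" "i' = i" "ys' = ys" using atom by auto
      show ?thesis unfolding atom(1) reg_tape_def v(3,4)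
      proof (rule sweep_steps[OF K True])
        fix x
        show "digit_step a False (reg_cell d r x) False (reg_cell d r' x)"
          using Guess v regs digit_less[of v x] by (auto simp: reg_cell_def nth_list_update intro!: exI[of _ "digit v x"] nth_equalityI)
      qed (use Guess assms(3) in \<open>auto simp: reg_cell_in_cells\<close>)
    next
      case (AddTest ci co j k l)
      then have e: "r' = r" "i' = i" "ys' = ys" "r j + r k + of_bool ci = r l + of_bool co * radix ^ width w"
        using atom by (auto simp: cap_def)
      have "r m < radix ^ width w" for m using assms(3) by (auto simp: valid_regs_def cap_def)
      from carries_exist[OF e(4) this this this] obtain t where t: "t 0 = ci" "t (width w) = co"
        "\<And>x. x < width w \<Longrightarrow> digit (r j) x + digit (r k) x + of_bool (t x) = digit (r l) x + of_bool (t (Suc x)) * radix"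
        by auto
      show ?thesis unfolding atom(1) reg_tape_def e(1-3)
        by (rule sweep_steps[OF K True, where c = t])
          (use AddTest t regs assms(3) in \<open>auto simp: reg_cell_in_cells\<close>)
    qed auto
  qed
next
  case (control m p' K'')
  have "ntm_step (compile d p) w (cfg (Loc K) i (reg_tape d w r) 0 ys) (cfg (Loc K') i' (reg_tape d w r') 0 ys')"
    unfolding control(1,2) reg_tape_def
    by (rule stepI, rule tm_trans.control) (use control assms in auto)
  then show ?thesis by auto
qed

lemma count_back_steps:
  assumes "h \<le> L" "i \<le> length w + 1" "\<And>x. x < L \<Longrightarrow> g x \<in> cells d"
  shows "tm_steps d p w (cfg CountBack i (tape L g) h ys) (cfg Count i (tape L g) 0 ys)"
  using assms(1)
proof (induction h)
  case 0
  have "ntm_step (compile d p) w (cfg CountBack i (tape L g) 0 ys) (cfg Count i (tape L g) 0 ys)"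
    by (rule stepI, rule tm_trans.count_ready) (use assms in auto)
  then show ?case by auto
next
  case (Suc h)
  have "ntm_step (compile d p) w (cfg CountBack i (tape L g) (Suc h) ys) (cfg CountBack i (tape L g) h ys)"
    by (rule stepI, rule tm_trans.count_back) (use assms Suc in \<open>auto\<close>)
  with Suc show ?case by (simp add: converse_rtranclp_into_rtranclp)
qed

lemma count_step:
  assumes "i \<le> length w"
  shows "tm_steps d p w (cfg Count i (count_tape d i) 0 ys) (cfg Count (Suc i) (count_tape d (Suc i)) 0 ys)"
proof -
  let ?L = "floorlog 2 i"
  have *: "tm_steps d p w (cfg (Carry (2 ^ x dvd Suc i)) (Suc i) (carry_tape d i x) (Suc x) ys)
      (cfg Count (Suc i) (count_tape d (Suc i)) 0 ys)" if "x \<le> ?L" for x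
    using that
  proof (induction "?L - x" arbitrary: x)
    case 0
    then have x: "x = ?L" by simp
    have "ntm_step (compile d p) w (cfg (Carry (2 ^ x dvd Suc i)) (Suc i) (carry_tape d i x) (Suc x) ys)
        (cfg CountBack (Suc i) (count_tape d (Suc i)) x ys)"
      by (rule stepI, rule tm_trans.carry_end)
        (use assms x carry_tape_end[of d i] in auto)
    moreover have "tm_steps d p w (cfg CountBack (Suc i) (count_tape d (Suc i)) x ys)
        (cfg Count (Suc i) (count_tape d (Suc i)) 0 ys)"
      unfolding count_tape_eq using x assms
      by (intro count_back_steps) (auto simp: floorlog_mono bit_cell_in_cells)
    ultimately show ?case by (rule converse_rtranclp_into_rtranclp)
  next
    case (Suc k)
    then have x: "x < ?L" by simp
    have "ntm_step (compile d p) w (cfg (Carry (2 ^ x dvd Suc i)) (Suc i) (carry_tape d i x) (Suc x) ys)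
        (cfg (Carry (2 ^ Suc x dvd Suc i)) (Suc i) (carry_tape d i (Suc x)) (Suc (Suc x)) ys)"
      unfolding carry_Suc
      by (rule stepI, rule tm_trans.carry)
        (use assms x carry_tape_step[OF x, of d] in auto)
    moreover have "tm_steps d p w (cfg (Carry (2 ^ Suc x dvd Suc i)) (Suc i) (carry_tape d i (Suc x)) (Suc (Suc x)) ys)
        (cfg Count (Suc i) (count_tape d (Suc i)) 0 ys)"
      using Suc by (intro Suc.hyps(1)) auto
    ultimately show ?case by (rule converse_rtranclp_into_rtranclp)
  qed
  have "ntm_step (compile d p) w (cfg Count i (count_tape d i) 0 ys)
      (cfg (Carry True) (Suc i) (carry_tape d i 0) (Suc 0) ys)"
    by (rule stepI, rule tm_trans.count)
      (use assms in \<open>auto simp: input_cell_def carry_tape_def\<close>)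
  with *[of 0] show ?thesis by (simp add: converse_rtranclp_into_rtranclp)
qed

lemma count_steps:
  "\<exists>r. valid_regs w r \<and> tm_steps d p w (cfg Begin 0 (\<lambda>_. 0) 0 []) (cfg (Loc [p]) (length w + 1) (reg_tape d w r) 0 [])"
proof -
  have "tm_steps d p w (cfg Count 0 (count_tape d 0) 0 []) (cfg Count i (count_tape d i) 0 [])"
    if "i \<le> length w + 1" for i
    using that
  proof (induction i)
    case (Suc i)
    then show ?case using count_step[of i w d p "[]"] by (simp add: rtranclp_trans)
  qed simp
  moreover have "ntm_step (compile d p) w (cfg Begin 0 (\<lambda>_. 0) 0 []) (cfg Count 0 (count_tape d 0) 0 [])"
    unfolding count_tape_0[symmetric] by (rule stepI, rule tm_trans.launch) auto
  moreover have "ntm_step (compile d p) w (cfg Count (length w + 1) (count_tape d (length w + 1)) 0 [])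
      (cfg (Loc [p]) (length w + 1) (count_tape d (length w + 1)) 0 [])"
    by (rule stepI, rule tm_trans.counted) (auto simp: input_cell_def)
  ultimately have "tm_steps d p w (cfg Begin 0 (\<lambda>_. 0) 0 [])
      (cfg (Loc [p]) (length w + 1) (count_tape d (length w + 1)) 0 [])"
    by (meson converse_rtranclp_into_rtranclp order_refl rtranclp.rtrancl_into_rtrancl)
  then show ?thesis using count_tape_final[of w d] by auto
qed

subsubsection \<open>Soundness and space\<close>

definition reaches :: "'o prog \<Rightarrow> sym list \<Rightarrow> 'o prog list \<Rightarrow> 'o pstate \<Rightarrow> bool" where
  "reaches p w K s \<longleftrightarrow> K \<in> stacks p \<and> valid w s \<and>
     (\<exists>r. valid_regs w r \<and> (([p], (length w + 1, r, [])), (K, s)) \<in> (sstep w)\<^sup>*)"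

lemma reaches_step:
  assumes "reaches p w K s" "((K, s), (K', t)) \<in> sstep w"
  shows "reaches p w K' t"
proof -
  have "valid w t" using assms(2,1) by cases (auto simp: reaches_def intro: exec_atom_valid)
  then show ?thesis
    using assms sstep_stacks[OF assms(2)] unfolding reaches_def by (meson rtrancl.rtrancl_into_rtrancl)
qed

text \<open>What a sweep has established after \<open>x\<close> digits: for an addition test, the
  equation between the lower parts with the current carry; for a guess, only that the tape holds the
  old registers with another value in the guessed one.\<close>

fun swept :: "sym list \<Rightarrow> 'o atom \<Rightarrow> (nat \<Rightarrow> nat) \<Rightarrow> nat \<Rightarrow> bool \<Rightarrow> (nat \<Rightarrow> nat) \<Rightarrow> bool" where
  "swept w (Guess j) r x t r' \<longleftrightarrow> (\<exists>v<cap w. r' = r(j := v))"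
| "swept w (AddTest ci co i j k) r x t r' \<longleftrightarrow> r' = r \<and>
     r i mod radix ^ x + r j mod radix ^ x + of_bool ci = r k mod radix ^ x + of_bool t * radix ^ x"
| "swept w _ r x t r' \<longleftrightarrow> False"

text \<open>One invariant serves two purposes: an accepting configuration is backed by a run of the
  program, and the head stays within \<open>width w + 1\<close> on every branch.\<close>

fun tm_inv :: "nat \<Rightarrow> 'o prog \<Rightarrow> sym list \<Rightarrow> 'o tm_state \<Rightarrow> nat \<Rightarrow> (nat \<Rightarrow> nat) \<Rightarrow> nat \<Rightarrow> 'o list \<Rightarrow> bool" where
  "tm_inv d p w Begin i t h ys \<longleftrightarrow> i = 0 \<and> t = (\<lambda>_. 0) \<and> h = 0 \<and> ys = []"
| "tm_inv d p w Count i t h ys \<longleftrightarrow> i \<le> length w + 1 \<and> t = count_tape d i \<and> h = 0 \<and> ys = []"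
| "tm_inv d p w (Carry b) i t h ys \<longleftrightarrow> (\<exists>i' x. i = Suc i' \<and> h = Suc x \<and> x \<le> floorlog 2 i' \<and> i' \<le> length w \<and>
     t = carry_tape d i' x \<and> (b \<longleftrightarrow> 2 ^ x dvd Suc i') \<and> ys = [])"
| "tm_inv d p w CountBack i t h ys \<longleftrightarrow> i \<le> length w + 1 \<and> t = count_tape d i \<and> h \<le> floorlog 2 i \<and> ys = []"
| "tm_inv d p w (Loc K) i t h ys \<longleftrightarrow> (\<exists>r. reaches p w K (i, r, ys) \<and> t = reg_tape d w r \<and> h = 0)"
| "tm_inv d p w (Sweep a b K) i t h ys \<longleftrightarrow> (\<exists>r x r'. reaches p w (Atom a # K) (i, r, ys) \<and> t = reg_tape d w r' \<and>
     h = Suc x \<and> x \<le> width w \<and> swept w a r x b r')"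
| "tm_inv d p w (Back K) i t h ys \<longleftrightarrow> (\<exists>r. reaches p w K (i, r, ys) \<and> t = reg_tape d w r \<and> h \<le> width w)"

lemma reg_tape_simps [simp]:
  "reg_tape d w r 0 = 1" "x < width w \<Longrightarrow> reg_tape d w r (Suc x) = cell_code (reg_cell d r x)"
  "width w \<le> x \<Longrightarrow> reg_tape d w r (Suc x) = 0"
  "(reg_tape d w r)(0 := Suc 0) = reg_tape d w r"
  by (simp_all add: reg_tape_def)

lemma digit_change:
  assumes "v < cap w" "\<delta> < radix"
  shows "\<exists>v'<cap w. \<forall>y<width w. digit v' y = (if y = x then \<delta> else digit v y)"
  unfolding cap_def by (rule digits_exist) (use assms digit_less in auto)

lemma bit_cell_inject: "0 < d \<Longrightarrow> bit_cell d b = bit_cell d b' \<longleftrightarrow> b = b'"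
  by (cases d) (auto simp: bit_cell_def)

lemma fun_upd_same: "t h = x \<Longrightarrow> t(h := x) = t"
  by auto

lemma tm_inv_step:
  assumes "tm_trans d p q (input_cell w i) (t h) q' e x' e' zs" "tm_inv d p w q i t h ys" "regs p \<subseteq> {..<d}" "0 < d"
  shows "tm_inv d p w q' (min (move e i) (length w + 1)) (t(h := x')) (move e' h) (ys @ zs)"
  using assms(1)
proof cases
  case launch
  then show ?thesis using assms(2) by (auto simp: count_tape_0[simplified])
next
  case count
  then have "i \<le> length w" using assms(2) by (auto simp: input_cell_def not_le split: if_splits)
  then show ?thesis using count assms(2) by auto
next
  case counted
  then have "i = length w + 1" using assms(2) by (auto simp: input_cell_def split: if_splits)
  with count_tape_final[of w d] show ?thesis
    using counted assms(2) by (auto simp: reaches_def self_in_stacks)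
next
  case (carry b b')
  then obtain i' x where I: "i = Suc i'" "h = Suc x" "x \<le> floorlog 2 i'" "i' \<le> length w"
     "t = carry_tape d i' x" "b \<longleftrightarrow> 2 ^ x dvd Suc i'" "ys = []" using assms(2) by auto
  have x: "x < floorlog 2 i'"
  proof (rule ccontr)
    assume "\<not> ?thesis"
    then show False using I carry by (auto simp: le_less)
  qed
  have b': "b' \<longleftrightarrow> odd (i' div 2 ^ x)" using I x carry assms(4) by (simp add: bit_cell_inject)
  have "tm_inv d p w (Carry (b \<and> b')) (Suc i') (carry_tape d i' (Suc x)) (Suc (Suc x)) []"
    unfolding tm_inv.simps
    by (rule exI[of _ i'], rule exI[of _ "Suc x"]) (use I x b' carry_Suc[of x i'] in simp)
  moreover have "carry_tape d i' (Suc x) = t(h := x')"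
    using carry I carry_tape_step[OF x, of d] b' by simp
  ultimately show ?thesis using carry I by simp
next
  case (carry_end b)
  then obtain i' x where I: "i = Suc i'" "h = Suc x" "x \<le> floorlog 2 i'" "i' \<le> length w"
     "t = carry_tape d i' x" "b \<longleftrightarrow> 2 ^ x dvd Suc i'" "ys = []" using assms(2) by auto
  have x: "x = floorlog 2 i'" using I carry_end by (cases "x < floorlog 2 i'") auto
  show ?thesis
    using carry_end I x carry_tape_end[of d i'] floorlog_mono[of i' "Suc i'" 2] by auto
next
  case (count_back ds)
  then show ?thesis using assms(2) fun_upd_same[of t h] by (cases h) auto
next
  case count_ready
  then have "h = 0" using assms(2) by (cases h) (auto simp: count_tape_eq tape_def split: if_splits)
  then show ?thesis using count_ready assms(2) fun_upd_same[of t h] by auto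
next
  case (control y K m)
  then obtain r where r: "reaches p w (y # K) (i, r, ys)" "t = reg_tape d w r" "h = 0"
    using assms(2) by auto
  have "((y # K, (i, r, ys)), (m @ K, (i, r, ys))) \<in> sstep w"
    by (rule sstep.control) (use control in auto)
  from reaches_step[OF r(1) this] show ?thesis
    using control r by (auto simp: reaches_def)
next
  case (atom a K)
  then obtain r where r: "reaches p w (Atom a # K) (i, r, ys)" "t = reg_tape d w r" "h = 0"
    using assms(2) by auto
  have i: "i \<le> length w + 1" using r(1) by (simp add: reaches_def)
  have "exec_atom w a (i, r, ys) (min (move e i) (length w + 1), r, ys @ zs)"
    using atom i by (cases a) auto
  then have "((Atom a # K, (i, r, ys)), (K, (min (move e i) (length w + 1), r, ys @ zs))) \<in> sstep w"
    by (rule sstep.atom)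
  from reaches_step[OF r(1) this] show ?thesis using atom r by auto
next
  case (sweep a K)
  then obtain r where r: "reaches p w (Atom a # K) (i, r, ys)" "t = reg_tape d w r" "h = 0"
    using assms(2) by auto
  have i: "i \<le> length w + 1" "valid_regs w r" using r(1) by (simp_all add: reaches_def)
  \<comment> \<open>Before a guess has overwritten any digit, the guessed value is the present
    content of the register.\<close>
  then have "\<exists>v<cap w. r = r(j := v)" for j
    by (intro exI[of _ "r j"]) (auto simp: valid_regs_def)
  then have "swept w a r 0 (carry_in a) r" using sweep by (cases a) auto
  then show ?thesis using sweep r i by auto
next
  case (sweep_digit a K b ds b' ds')
  then obtain r x r' where r: "reaches p w (Atom a # K) (i, r, ys)" "t = reg_tape d w r'" "h = Suc x"
    "x \<le> width w" "swept w a r x b r'" using assms(2) by auto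
  have i: "i \<le> length w + 1" "valid_regs w r" using r(1) by (simp_all add: reaches_def)
  have x: "x < width w" using r sweep_digit by (cases "x < width w") auto
  then have ds: "ds = reg_cell d r' x" using r sweep_digit by auto
  have regs: "atom_regs a \<subseteq> {..<d}"
    using stacks_regs_outs[of "Atom a # K" p "Atom a"] assms(3) sweep_digit by auto
  have "\<exists>r''. t(h := x') = reg_tape d w r'' \<and> swept w a r (Suc x) b' r''"
  proof (cases a)
    case (Guess j)
    then obtain \<delta> where \<delta>: "\<delta> < radix" "ds' = ds[j := \<delta>]" using sweep_digit by auto
    obtain v where v: "v < cap w" "r' = r(j := v)" using r(5) Guess by auto
    obtain v' where v': "v' < cap w" "\<And>y. y < width w \<Longrightarrow> digit v' y = (if y = x then \<delta> else digit v y)"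
      using digit_change[OF v(1) \<delta>(1)] by blast
    have "t(h := x') = reg_tape d w (r(j := v'))"
    proof -
      have "x' = cell_code ds'" using sweep_digit by simp
      then have "t(h := x') = tape (width w) ((reg_cell d r')(x := ds'))"
        using r(2,3) x by (simp add: reg_tape_def)
      also have "\<dots> = reg_tape d w (r(j := v'))"
        unfolding reg_tape_def \<delta>(2) ds
        by (auto simp: v' v(2) reg_cell_def nth_list_update intro!: tape_cong nth_equalityI)
      finally show ?thesis .
    qed
    then show ?thesis using Guess v' by auto
  next
    case (AddTest ci co k l m)
    then have "t(h := x') = reg_tape d w r"
      using r(2,3,5) x sweep_digit ds by (auto simp: fun_upd_same)
    moreover have "swept w a r (Suc x) b' r"
      using carry_step[of "r k" x "r l" "of_bool ci" "r m" b b'] r(5) sweep_digit ds regs AddTest by simp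
    ultimately show ?thesis by blast
  qed (use sweep_digit in auto)
  then show ?thesis using sweep_digit r x i by auto
next
  case (sweep_end a K b)
  then obtain r x r' where r: "reaches p w (Atom a # K) (i, r, ys)" "t = reg_tape d w r'" "h = Suc x"
    "x \<le> width w" "swept w a r x b r'" using assms(2) by auto
  have i: "i \<le> length w + 1" "valid_regs w r" using r(1) by (simp_all add: reaches_def)
  then have mod: "r j mod radix ^ width w = r j" for j by (auto simp: valid_regs_def cap_def)
  have x: "x = width w" using r sweep_end by (cases "x < width w") auto
  have "exec_atom w a (i, r, ys) (i, r', ys)"
    using r(5) sweep_end by (cases a) (auto simp: x mod cap_def)
  then have "((Atom a # K, (i, r, ys)), (K, (i, r', ys))) \<in> sstep w"
    by (rule sstep.atom)
  from reaches_step[OF r(1) this] show ?thesis using sweep_end r i x by (auto simp: fun_upd_same)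
next
  case (sweep_back K ds)
  then show ?thesis using assms(2) fun_upd_same[of t h] by (cases h) (auto simp: reaches_def)
next
  case (ready K)
  then have "h = 0" using assms(2) by (cases h) (auto simp: reg_tape_def tape_def split: if_splits)
  then show ?thesis using ready assms(2) fun_upd_same[of t h] by (auto simp: reaches_def)
qed

lemma tm_inv_reaches:
  assumes "ntm_reaches (compile d p) w c" "regs p \<subseteq> {..<d}" "0 < d"
  shows "\<exists>q i t h ys. c = cfg q i t h ys \<and> tm_inv d p w q i t h ys"
  using assms(1) unfolding ntm_reaches_def
proof (induction rule: rtranclp_induct)
  case base
  have "start_config (compile d p) = cfg Begin 0 (\<lambda>_. 0) 0 []"
    by (simp add: start_config_def compile_def cfg_def)
  then show ?case by auto
next
  case (step c c')
  then obtain q i t h ys where c: "c = cfg q i t h ys" "tm_inv d p w q i t h ys" by blast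
  from step.hyps(2)[unfolded c(1) step_iff] show ?case
    using tm_inv_step[OF _ c(2) assms(2,3)] by blast
qed

lemma tm_inv_space: "tm_inv d p w q i t h ys \<Longrightarrow> h \<le> width w + 1"
proof (cases q)
  case (Carry b)
  assume "tm_inv d p w q i t h ys"
  then obtain i' x where "h = Suc x" "x \<le> floorlog 2 i'" "i' \<le> length w" using Carry by auto
  then show ?thesis using floorlog_mono[of i' "length w + 1" 2] by (simp add: width_def)
next
  case CountBack
  assume "tm_inv d p w q i t h ys"
  then have "h \<le> floorlog 2 i" "i \<le> length w + 1" using CountBack by auto
  then show ?thesis using floorlog_mono[of i "length w + 1" 2] by (simp add: width_def)
qed auto

lemma log_space_compile:
  assumes "regs p \<subseteq> {..<d}" "0 < d"
  shows "log_space (compile d p)"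
proof -
  \<comment> \<open>The head stays within \<open>width w + 1\<close>, which is at most the logarithm
    plus 2; as the logarithm of \<open>length w + 2\<close> is at least 1, the summand 2 is covered
    by tripling.\<close>
  have "real h \<le> 3 * log 2 (real (length w) + 2)" if reach: "ntm_reaches (compile d p) w (q, i, ts, ys)" and th: "(t, h) \<in> set ts"
    for w q i ts ys t h
  proof -
    obtain q' i' t' h' ys' where "(q, i, ts, ys) = cfg q' i' t' h' ys'" "tm_inv d p w q' i' t' h' ys'"
      using tm_inv_reaches[OF reach assms] by blast
    then have "h \<le> width w + 1" using th tm_inv_space by (auto simp: cfg_def)
    then have "real h \<le> real (width w) + 1" by linarith
    also have "real (width w) \<le> log 2 (real (length w + 1)) + 1"
    proof -
      have "(2::nat) ^ (width w - 1) \<le> length w + 1"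
        using floorlog_bounds[of "length w + 1" 2] by (simp add: width_def)
      then have "(2::real) ^ (width w - 1) \<le> real (length w + 1)"
        by (metis of_nat_le_iff of_nat_numeral of_nat_power)
      then have "real (width w - 1) \<le> log 2 (real (length w + 1))"
        by (simp add: le_log_iff powr_realpow)
      then show ?thesis by linarith
    qed
    also have "log 2 (real (length w + 1)) \<le> log 2 (real (length w) + 2)" by simp
    finally have "real h \<le> log 2 (real (length w) + 2) + 2" by simp
    moreover have "1 \<le> log 2 (real (length w) + 2)" by simp
    ultimately show ?thesis by linarith
  qed
  then show ?thesis unfolding log_space_def by (intro exI[of _ 3]) blast
qed

theorem compile_outputs:
  assumes "regs p \<subseteq> {..<d}" "0 < d"
  shows "ntm_outputs (compile d p) w ys \<Longrightarrow>
      \<exists>r h' r'. valid_regs w r \<and> ((length w + 1, r, []), (h', r', ys)) \<in> sem w p"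
    and "\<exists>r. valid_regs w r \<and> (\<forall>h' r' ys. ((length w + 1, r, []), (h', r', ys)) \<in> sem w p \<longrightarrow>
      ntm_outputs (compile d p) w ys)"
proof -
  assume "ntm_outputs (compile d p) w ys"
  then obtain i ts where "ntm_reaches (compile d p) w (accept_state (compile d p), i, ts, ys)"
    by (auto simp: ntm_outputs_def)
  from tm_inv_reaches[OF this assms] obtain t h where "tm_inv d p w (Loc []) i t h ys"
    by (auto simp: cfg_def compile_def)
  then show "\<exists>r h' r'. valid_regs w r \<and> ((length w + 1, r, []), (h', r', ys)) \<in> sem w p"
    by (auto simp: reaches_def sstep_iff_sem)
next
  from count_steps[of w d p] obtain r where r: "valid_regs w r"
    "tm_steps d p w (cfg Begin 0 (\<lambda>_. 0) 0 []) (cfg (Loc [p]) (length w + 1) (reg_tape d w r) 0 [])" by blast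
  have "ntm_outputs (compile d p) w ys" if "((length w + 1, r, []), (h', r', ys)) \<in> sem w p" for h' r' ys
  proof -
    from that have "(([p], (length w + 1, r, [])), ([], (h', r', ys))) \<in> (sstep w)\<^sup>*"
      by (simp add: sstep_iff_sem)
    moreover have "K \<in> stacks p \<and> valid w (i, r', ys) \<and> tm_steps d p w (cfg (Loc [p]) (length w + 1) (reg_tape d w r) 0 [])
        (cfg (Loc K) i (reg_tape d w r') 0 ys)"
      if "(([p], (length w + 1, r, [])), (K, (i, r', ys))) \<in> (sstep w)\<^sup>*" for K i r' ys
      using that
    proof (induction K "(i, r', ys)" arbitrary: i r' ys rule: rtrancl_induct2)
      case refl
      then show ?case using r(1) self_in_stacks by auto
    next
      case (step K s K')
      obtain i0 r0 ys0 where s: "s = (i0, r0, ys0)" by (cases s)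
      note IH = step.hyps(3)[OF s]
      have "valid w (i, r', ys)"
        using step.hyps(2) IH unfolding s by cases (auto intro: exec_atom_valid simp del: valid_simp)
      then show ?case
        using sstep_stacks step.hyps(2) IH sstep_steps[OF step.hyps(2)[unfolded s], of p d] assms s
        by (meson rtranclp_trans)
    qed
    ultimately have "tm_steps d p w (cfg Begin 0 (\<lambda>_. 0) 0 []) (cfg (Loc []) h' (reg_tape d w r') 0 ys)"
      using r(2) by (meson rtranclp_trans)
    moreover have "start_config (compile d p) = cfg Begin 0 (\<lambda>_. 0) 0 []"
      by (simp add: start_config_def compile_def cfg_def)
    ultimately show ?thesis
      by (auto simp: ntm_outputs_def ntm_reaches_def cfg_def compile_def)
  qed
  then show "\<exists>r. valid_regs w r \<and> (\<forall>h' r' ys. ((length w + 1, r, []), (h', r', ys)) \<in> sem w p \<longrightarrow>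
      ntm_outputs (compile d p) w ys)" using r(1) by blast
qed

section \<open>Nondeterministic logarithmic space as a logic\<close>

text \<open>A failing test is a program without runs. The head may start and end anywhere, so that
  tests can be put one after another; only the protected registers and the output carry
  over.\<close>

definition tests :: "nat \<Rightarrow> sym prog \<Rightarrow> (sym list \<Rightarrow> (nat \<Rightarrow> nat) \<Rightarrow> bool) \<Rightarrow> bool" where
  "tests m p Q \<longleftrightarrow> (\<forall>w h r ys. valid w (h, r, ys) \<longrightarrow>
     (\<forall>h' r' ys'. ((h, r, ys), (h', r', ys')) \<in> sem w p \<longrightarrow> ys' = ys \<and> (\<forall>j<m. r' j = r j) \<and> Q w r) \<and>
     (Q w r \<longrightarrow> (\<exists>h' r'. ((h, r, ys), (h', r', ys)) \<in> sem w p)))"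

text \<open>A query has its arguments in the registers \<open>f 0, f 1, \<dots>\<close>; its program must preserve the
  registers below \<open>m\<close> and may use the others as scratch space.\<close>

definition NL :: "(sym list \<Rightarrow> (nat \<Rightarrow> nat) \<Rightarrow> bool) \<Rightarrow> bool" where
  "NL Q \<longleftrightarrow> (\<forall>f m. (\<forall>i. f i < m) \<longrightarrow> (\<exists>p. tests m p (\<lambda>w r. Q w (\<lambda>i. r (f i)))))"

lemma testsI:
  assumes "\<And>w h r ys h' r' ys'. valid w (h, r, ys) \<Longrightarrow> ((h, r, ys), (h', r', ys')) \<in> sem w p \<Longrightarrow>
      ys' = ys \<and> (\<forall>j<m. r' j = r j) \<and> Q w r"
    and "\<And>w h r ys. valid w (h, r, ys) \<Longrightarrow> Q w r \<Longrightarrow> \<exists>h' r'. ((h, r, ys), (h', r', ys)) \<in> sem w p"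
  shows "tests m p Q"
  using assms unfolding tests_def by blast

lemma tests_sound:
  assumes "tests m p Q" "((h, r, ys), (h', r', ys')) \<in> sem w p" "valid w (h, r, ys)"
  shows "ys' = ys" "\<And>j. j < m \<Longrightarrow> r' j = r j" "Q w r" "valid w (h', r', ys')"
  using assms sem_valid[OF assms(2,3)] unfolding tests_def by blast+

lemma tests_complete:
  assumes "tests m p Q" "valid w (h, r, ys)" "Q w r"
  obtains h' r' where "((h, r, ys), (h', r', ys)) \<in> sem w p" "\<And>j. j < m \<Longrightarrow> r' j = r j" "valid w (h', r', ys)"
  using assms sem_valid[of "(h, r, ys)"] unfolding tests_def by meson

lemma NL_obtain:
  assumes "NL Q" "\<forall>i. f i < m"
  obtains p where "tests m p (\<lambda>w r. Q w (\<lambda>i. r (f i)))"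
  using assms unfolding NL_def by blast

lemma NL_I:
  assumes "\<And>f m. \<forall>i. f i < m \<Longrightarrow> \<exists>p. tests m p (\<lambda>w r. Q w (\<lambda>i. r (f i)))"
  shows "NL Q"
  using assms unfolding NL_def by blast

lemma NL_cong:
  assumes "\<And>w e. (\<And>i. e i < cap w) \<Longrightarrow> Q w e \<longleftrightarrow> Q' w e"
  shows "NL Q \<longleftrightarrow> NL Q'"
proof -
  have "tests m p (\<lambda>w r. Q w (\<lambda>i. r (f i))) \<longleftrightarrow> tests m p (\<lambda>w r. Q' w (\<lambda>i. r (f i)))" for m p f
    unfolding tests_def using assms by (auto simp: valid_regs_def)
  then show ?thesis unfolding NL_def by simp
qed

lemma NL_subst: "NL Q \<Longrightarrow> NL (\<lambda>w e. Q w (\<lambda>i. e (g i)))"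
proof (rule NL_I)
  fix f :: "nat \<Rightarrow> nat" and m
  assume "NL Q" "\<forall>i. f i < m"
  then show "\<exists>p. tests m p (\<lambda>w r. Q w (\<lambda>i. r (f (g i))))"
    using NL_obtain[of Q "\<lambda>i. f (g i)" m] by blast
qed

lemma NL_conj:
  assumes "NL Q" "NL Q'"
  shows "NL (\<lambda>w e. Q w e \<and> Q' w e)"
proof (rule NL_I)
  fix f :: "nat \<Rightarrow> nat" and m
  assume f: "\<forall>i. f i < m"
  obtain p where p: "tests m p (\<lambda>w r. Q w (\<lambda>i. r (f i)))" using NL_obtain[OF assms(1) f] by blast
  obtain p' where p': "tests m p' (\<lambda>w r. Q' w (\<lambda>i. r (f i)))" using NL_obtain[OF assms(2) f] by blast
  have "tests m (Seq p p') (\<lambda>w r. Q w (\<lambda>i. r (f i)) \<and> Q' w (\<lambda>i. r (f i)))"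
  proof (rule testsI)
    fix w h r h' r' and ys ys' :: "sym list"
    assume v: "valid w (h, r, ys)" and "((h, r, ys), (h', r', ys')) \<in> sem w (Seq p p')"
    then obtain h1 r1 ys1 where 1: "((h, r, ys), (h1, r1, ys1)) \<in> sem w p"
      and 2: "((h1, r1, ys1), (h', r', ys')) \<in> sem w p'" by auto
    note s1 = tests_sound[OF p 1 v] and s2 = tests_sound[OF p' 2 tests_sound(4)[OF p 1 v]]
    have "(\<lambda>i. r1 (f i)) = (\<lambda>i. r (f i))" using s1(2) f by auto
    then show "ys' = ys \<and> (\<forall>j<m. r' j = r j) \<and> Q w (\<lambda>i. r (f i)) \<and> Q' w (\<lambda>i. r (f i))"
      using s1 s2 by auto
  next
    fix w h r and ys :: "sym list"
    assume v: "valid w (h, r, ys)" and q: "Q w (\<lambda>i. r (f i)) \<and> Q' w (\<lambda>i. r (f i))"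
    obtain h1 r1 where 1: "((h, r, ys), (h1, r1, ys)) \<in> sem w p" "\<And>j. j < m \<Longrightarrow> r1 j = r j" "valid w (h1, r1, ys)"
      using tests_complete[OF p v] q by blast
    have "(\<lambda>i. r1 (f i)) = (\<lambda>i. r (f i))" using 1 f by auto
    then have "Q' w (\<lambda>i. r1 (f i))" using q by simp
    from tests_complete[OF p' 1(3) this] obtain h2 r2 where "((h1, r1, ys), (h2, r2, ys)) \<in> sem w p'" by blast
    with 1 show "\<exists>h' r'. ((h, r, ys), (h', r', ys)) \<in> sem w (Seq p p')" by auto
  qed
  then show "\<exists>p. tests m p (\<lambda>w r. Q w (\<lambda>i. r (f i)) \<and> Q' w (\<lambda>i. r (f i)))" by blast
qed

lemma NL_disj:
  assumes "NL Q" "NL Q'"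
  shows "NL (\<lambda>w e. Q w e \<or> Q' w e)"
proof (rule NL_I)
  fix f :: "nat \<Rightarrow> nat" and m
  assume f: "\<forall>i. f i < m"
  obtain p where p: "tests m p (\<lambda>w r. Q w (\<lambda>i. r (f i)))" using NL_obtain[OF assms(1) f] by blast
  obtain p' where p': "tests m p' (\<lambda>w r. Q' w (\<lambda>i. r (f i)))" using NL_obtain[OF assms(2) f] by blast
  have "tests m (Choice p p') (\<lambda>w r. Q w (\<lambda>i. r (f i)) \<or> Q' w (\<lambda>i. r (f i)))"
    using p p' unfolding tests_def sem.simps by blast
  then show "\<exists>p. tests m p (\<lambda>w r. Q w (\<lambda>i. r (f i)) \<or> Q' w (\<lambda>i. r (f i)))" by blast
qed

lemma sem_Guess:
  "((h, r, ys), t) \<in> sem w (Seq (Atom (Guess j)) p) \<longleftrightarrow> (\<exists>v<cap w. ((h, r(j := v), ys), t) \<in> sem w p)"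
  by (auto simp: relcomp_unfold)

lemma NL_ex:
  assumes "NL (\<lambda>w e. Q w (\<lambda>i. e (Suc i)) (e 0))"
  shows "NL (\<lambda>w e. \<exists>v<cap w. Q w e v)"
proof (rule NL_I)
  fix f :: "nat \<Rightarrow> nat" and m
  assume f: "\<forall>i. f i < m"
  \<comment> \<open>Register \<open>m\<close>, the first one outside the protected range, takes the
    witness and becomes argument 0; inside the body it is protected, too.\<close>
  then have "\<forall>i. case_nat m f i < Suc m" by (auto simp: less_Suc_eq split: nat.split)
  from NL_obtain[OF assms this] have "\<exists>p. tests (Suc m) p (\<lambda>w r. Q w (\<lambda>i. r (case_nat m f (Suc i))) (r (case_nat m f 0)))"
    by blast
  then obtain p where p: "tests (Suc m) p (\<lambda>w r. Q w (\<lambda>i. r (f i)) (r m))" by auto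
  have upd: "(\<lambda>i. (r(m := v)) (f i)) = (\<lambda>i. r (f i))" for r :: "nat \<Rightarrow> nat" and v
    using f by (auto simp: fun_eq_iff less_imp_neq)
  have "tests m (Seq (Atom (Guess m)) p) (\<lambda>w r. \<exists>v<cap w. Q w (\<lambda>i. r (f i)) v)"
  proof (rule testsI)
    fix w h r h' r' and ys ys' :: "sym list"
    assume v: "valid w (h, r, ys)" and "((h, r, ys), (h', r', ys')) \<in> sem w (Seq (Atom (Guess m)) p)"
    then obtain u where u: "u < cap w" "((h, r(m := u), ys), (h', r', ys')) \<in> sem w p" by auto
    have "valid w (h, r(m := u), ys)" using v u by (simp add: valid_regs_upd)
    from tests_sound[OF p u(2) this] show "ys' = ys \<and> (\<forall>j<m. r' j = r j) \<and> (\<exists>v<cap w. Q w (\<lambda>i. r (f i)) v)"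
      using u(1) unfolding upd by auto
  next
    fix w h r and ys :: "sym list"
    assume v: "valid w (h, r, ys)" and q: "\<exists>v<cap w. Q w (\<lambda>i. r (f i)) v"
    then obtain u where u: "u < cap w" "Q w (\<lambda>i. r (f i)) u" by blast
    have "valid w (h, r(m := u), ys)" using v u by (simp add: valid_regs_upd)
    moreover have "Q w (\<lambda>i. (r(m := u)) (f i)) ((r(m := u)) m)" using u(2) unfolding upd by simp
    ultimately obtain h' r' where "((h, r(m := u), ys), (h', r', ys)) \<in> sem w p"
      using tests_complete[OF p] by blast
    then show "\<exists>h' r'. ((h, r, ys), (h', r', ys)) \<in> sem w (Seq (Atom (Guess m)) p)"
      using u(1) unfolding sem_Guess by blast
  qed
  then show "\<exists>p. tests m p (\<lambda>w r. \<exists>v<cap w. Q w (\<lambda>i. r (f i)) v)" by blast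
qed

lemma NL_add_carry: "NL (\<lambda>w e. e i + e j + of_bool ci = e k + of_bool co * cap w)"
proof (rule NL_I)
  fix f :: "nat \<Rightarrow> nat" and m
  have "tests m (Atom (AddTest ci co (f i) (f j) (f k)))
      (\<lambda>w r. r (f i) + r (f j) + of_bool ci = r (f k) + of_bool co * cap w)"
    unfolding tests_def by auto
  then show "\<exists>p. tests m p (\<lambda>w r. r (f i) + r (f j) + of_bool ci = r (f k) + of_bool co * cap w)" by blast
qed

lemma cap_pos: "0 < cap w" and cap_gt_1: "1 < cap w"
proof -
  have "2 ^ 8 \<le> (length w + 2) ^ 8" by (rule power_mono) simp_all
  then have "2 ^ 8 \<le> cap w" using cap_ge[of w] by linarith
  then show "0 < cap w" "1 < cap w" by auto
qed

text \<open>Assignments by guess and check: \<open>z + z = z\<close> without carries forces 0, and a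
  register \<open>z\<close> that holds 0 makes addition tests compare or increment.\<close>

definition Zero :: "nat \<Rightarrow> 'o prog" where
  "Zero z = Seq (Atom (Guess z)) (Atom (AddTest False False z z z))"

definition Copy :: "nat \<Rightarrow> nat \<Rightarrow> nat \<Rightarrow> 'o prog" where
  "Copy z x y = Seq (Atom (Guess x)) (Atom (AddTest False False y z x))"

definition Increment :: "nat \<Rightarrow> nat \<Rightarrow> nat \<Rightarrow> 'o prog" where
  "Increment z x y = Seq (Atom (Guess x)) (Atom (AddTest True False y z x))"

lemma sem_Zero: "((h, r, ys), s) \<in> sem w (Zero z) \<longleftrightarrow> s = (h, r(z := 0), ys)"
  unfolding Zero_def sem_Guess using cap_pos[of w] by auto

lemma sem_Copy:
  assumes "r z = 0" "x \<noteq> y" "x \<noteq> z" "valid_regs w r"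
  shows "((h, r, ys), s) \<in> sem w (Copy z x y) \<longleftrightarrow> s = (h, r(x := r y), ys)"
  unfolding Copy_def sem_Guess using assms by (auto simp: valid_regs_def)

lemma sem_Increment:
  assumes "r z = 0" "x \<noteq> y" "x \<noteq> z"
  shows "((h, r, ys), s) \<in> sem w (Increment z x y) \<longleftrightarrow> Suc (r y) < cap w \<and> s = (h, r(x := Suc (r y)), ys)"
  unfolding Increment_def sem_Guess using assms by auto

text \<open>The range of a quantified variable is a register, so all its values can be run through
  in a loop that performs the nondeterministic test at each of them.\<close>

lemma NL_all:
  assumes "NL (\<lambda>w e. Q w (\<lambda>i. e (Suc i)) (e 0))"
  shows "NL (\<lambda>w e. \<forall>v<cap w. Q w e v)"
proof (rule NL_I)
  fix f :: "nat \<Rightarrow> nat" and m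
  assume f: "\<forall>i. f i < m"
  define v t z where vtz: "v = m" "t = m + 1" "z = m + 2"
  have "\<forall>i. case_nat m f i < m + 3" using f by (auto simp: trans_less_add1 split: nat.split)
  from NL_obtain[OF assms this] have "\<exists>p. tests (m + 3) p (\<lambda>w r. Q w (\<lambda>i. r (case_nat m f (Suc i))) (r (case_nat m f 0)))"
    by blast
  then obtain p where p: "tests (m + 3) p (\<lambda>w r. Q w (\<lambda>i. r (f i)) (r v))"
    by (auto simp: vtz)
  define body where "body = Seq p (Seq (Increment z t v) (Copy z v t))"
  define J where "J w r ys u s \<longleftrightarrow> valid w s \<and> snd (snd s) = ys \<and> (\<forall>j<m. fst (snd s) j = r j) \<and>
    fst (snd s) v = u \<and> fst (snd s) z = 0" for w and r :: "nat \<Rightarrow> nat" and ys :: "sym list" and u s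
  have J_arg: "(\<lambda>i. fst (snd s) (f i)) = (\<lambda>i. r (f i))" if "J w r ys u s" for w r ys u s
    using that f by (auto simp: J_def)
  have test_J: "J w r ys u s' \<and> Q w (\<lambda>i. r (f i)) u" if "J w r ys u s" "(s, s') \<in> sem w p" for w r ys u s s'
  proof -
    obtain h1 r1 ys1 where s: "s = (h1, r1, ys1)" by (cases s)
    obtain h2 r2 ys2 where s': "s' = (h2, r2, ys2)" by (cases s')
    have "valid w (h1, r1, ys1)" using that s by (simp add: J_def)
    from tests_sound[OF p that(2)[unfolded s s'] this] show ?thesis
      using that(1) J_arg[OF that(1)] by (auto simp: J_def s s' vtz)
  qed
  have body_sound: "J w r ys (Suc u) s' \<and> Q w (\<lambda>i. r (f i)) u" if J: "J w r ys u s" and sem: "(s, s') \<in> sem w body" for w r ys u s s'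
  proof -
    obtain s1 where s1: "(s, s1) \<in> sem w p" "(s1, s') \<in> sem w (Seq (Increment z t v) (Copy z v t))"
      using sem by (auto simp: body_def)
    note j = test_J[OF J s1(1)]
    obtain h1 r1 ys1 where s1': "s1 = (h1, r1, ys1)" by (cases s1)
    from s1(2) j show ?thesis
      by (auto simp: s1' J_def sem_Increment sem_Copy vtz valid_regs_upd)
  qed
  have body_complete: "\<exists>s'. (s, s') \<in> sem w body"
    if "J w r ys u s" "Q w (\<lambda>i. r (f i)) u" "Suc u < cap w" for w r ys u s
  proof -
    obtain h1 r1 ys1 where s: "s = (h1, r1, ys1)" by (cases s)
    have "valid w (h1, r1, ys1)" "Q w (\<lambda>i. r1 (f i)) (r1 v)"
      using that J_arg[OF that(1)] by (auto simp: J_def s)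
    then obtain h2 r2 where s2: "(s, (h2, r2, ys1)) \<in> sem w p"
      unfolding s using tests_complete[OF p, of w h1 r1 ys1] by blast
    then have "J w r ys u (h2, r2, ys1)" using test_J that by blast
    then have "((h2, r2, ys1), (h2, r2(t := Suc u, v := Suc u), ys1)) \<in> sem w (Seq (Increment z t v) (Copy z v t))"
      using that(3) by (auto simp: J_def sem_Increment sem_Copy vtz valid_regs_upd intro!: relcompI)
    then show ?thesis using s2 unfolding body_def sem.simps(2)[of w p] by blast
  qed
  \<comment> \<open>With \<open>z\<close> being 0, the final test with both carries set says
    \<open>Suc v = cap w\<close>: the loop must not stop before the last value.\<close>
  define P where "P = Seq (Zero z) (Seq (Zero v) (Seq (Star body) (Seq p (Atom (AddTest True True v z z)))))"
  have init: "J w r ys 0 (h, r(z := 0, v := 0), ys)" if "valid w (h, r, ys)" for w h r ys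
    using that cap_pos[of w] by (auto simp: J_def vtz valid_regs_upd)
  have last: "((h, r, ys), s) \<in> sem w (Atom (AddTest True True v z z)) \<longleftrightarrow> s = (h, r, ys) \<and> Suc (r v) = cap w"
    for h r w s and ys :: "sym list"
    by auto
  have "tests m P (\<lambda>w r. \<forall>v<cap w. Q w (\<lambda>i. r (f i)) v)"
  proof (rule testsI)
    fix w h r h' r' and ys ys' :: "sym list"
    assume val: "valid w (h, r, ys)" and "((h, r, ys), (h', r', ys')) \<in> sem w P"
    then obtain s s' where st: "((h, r(z := 0, v := 0), ys), s) \<in> (sem w body)\<^sup>*" "(s, s') \<in> sem w p"
      "(s', (h', r', ys')) \<in> sem w (Atom (AddTest True True v z z))"
      by (auto simp: P_def sem_Zero simp del: sem.simps(1))
    from st(1) have "\<exists>u. J w r ys u s \<and> (\<forall>u'<u. Q w (\<lambda>i. r (f i)) u')"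
    proof (induction rule: rtrancl_induct)
      case base
      then show ?case using init[OF val] by blast
    next
      case (step y y')
      then show ?case using body_sound by (metis less_Suc_eq)
    qed
    then obtain u where u: "J w r ys u s" "\<And>u'. u' < u \<Longrightarrow> Q w (\<lambda>i. r (f i)) u'" by blast
    note j = test_J[OF u(1) st(2)]
    have "s' = (h', r', ys')" "Suc u = cap w"
      using st(3) j by (cases s'; auto simp: J_def)+
    with j u(2) show "ys' = ys \<and> (\<forall>j<m. r' j = r j) \<and> (\<forall>v<cap w. Q w (\<lambda>i. r (f i)) v)"
      by (auto simp: J_def) (metis less_Suc_eq)
  next
    fix w h r and ys :: "sym list"
    assume val: "valid w (h, r, ys)" and q: "\<forall>v<cap w. Q w (\<lambda>i. r (f i)) v"
    have "\<exists>s. ((h, r(z := 0, v := 0), ys), s) \<in> (sem w body)\<^sup>* \<and> J w r ys u s" if "u < cap w" for u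
      using that
    proof (induction u)
      case 0
      then show ?case using init[OF val] by blast
    next
      case (Suc u)
      have "u < cap w" using Suc.prems by simp
      then obtain s where s: "((h, r(z := 0, v := 0), ys), s) \<in> (sem w body)\<^sup>*" "J w r ys u s"
        using Suc.IH by blast
      obtain s' where "(s, s') \<in> sem w body" using body_complete[OF s(2)] q Suc.prems by auto
      then show ?case using s body_sound by (meson rtrancl.rtrancl_into_rtrancl)
    qed
    from this[of "cap w - 1"] obtain s where s: "((h, r(z := 0, v := 0), ys), s) \<in> (sem w body)\<^sup>*" "J w r ys (cap w - 1) s"
      using cap_pos[of w] by auto
    obtain h1 r1 ys1 where s1: "s = (h1, r1, ys1)" by (cases s)
    have "valid w (h1, r1, ys1)" "Q w (\<lambda>i. r1 (f i)) (r1 v)"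
      using s(2) J_arg[OF s(2)] q cap_pos[of w] by (auto simp: J_def s1)
    then obtain h2 r2 where s2: "(s, (h2, r2, ys1)) \<in> sem w p"
      unfolding s1 using tests_complete[OF p, of w h1 r1 ys1] by blast
    have j: "J w r ys (cap w - 1) (h2, r2, ys1)" using test_J[OF s(2) s2] by blast
    then have "((h2, r2, ys1), (h2, r2, ys)) \<in> sem w (Atom (AddTest True True v z z))"
      using cap_pos[of w] by (auto simp: J_def)
    with s2 s(1) have "((h, r, ys), (h2, r2, ys)) \<in> sem w P"
      by (auto simp: P_def sem_Zero intro!: relcompI simp del: sem.simps(1))
    then show "\<exists>h' r'. ((h, r, ys), (h', r', ys)) \<in> sem w P" by blast
  qed
  then show "\<exists>p. tests m p (\<lambda>w r. \<forall>v<cap w. Q w (\<lambda>i. r (f i)) v)" by blast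
qed

definition tc2 :: "sym list \<Rightarrow> (nat \<Rightarrow> nat \<Rightarrow> nat \<Rightarrow> nat \<Rightarrow> bool) \<Rightarrow> (nat \<times> nat) rel" where
  "tc2 w R = {((a, b), (c, d)). a < cap w \<and> b < cap w \<and> c < cap w \<and> d < cap w \<and> R a b c d}\<^sup>*"

text \<open>A path is guessed node by node, with only the current node and its successor in
  registers.\<close>

lemma NL_tc2:
  assumes "NL (\<lambda>w e. R w (\<lambda>i. e (i + 4)) (e 0) (e 1) (e 2) (e 3))"
  shows "NL (\<lambda>w e. ((e i, e j), (e k, e l)) \<in> tc2 w (R w e))"
proof (rule NL_I)
  fix f :: "nat \<Rightarrow> nat" and m
  assume f: "\<forall>i. f i < m"
  have fn: "f i \<noteq> m + c" "f i \<noteq> m" "m \<noteq> f i" "f i \<noteq> Suc m" "Suc m \<noteq> f i" "f i \<noteq> Suc (Suc m)" for i c using spec[OF f, of i] by auto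
  define x y x' y' z where reg: "x = m" "y = m + 1" "x' = m + 2" "y' = m + 3" "z = m + 4"
  let ?f = "\<lambda>i. if i < 4 then m + i else f (i - 4)"
  have "\<forall>i. ?f i < m + 5" using f by (auto simp: trans_less_add1)
  from NL_obtain[OF assms this] have "\<exists>p. tests (m + 5) p (\<lambda>w r. R w (\<lambda>i. r (?f (i + 4))) (r (?f 0)) (r (?f 1)) (r (?f 2)) (r (?f 3)))"
    by blast
  then obtain p where
    p: "tests (m + 5) p (\<lambda>w r. R w (\<lambda>i. r (f i)) (r x) (r y) (r x') (r y'))"
    by (auto simp: reg)
  define body where "body = Seq (Atom (Guess x')) (Seq (Atom (Guess y')) (Seq p (Seq (Copy z x x') (Copy z y y'))))"
  define J where "J w r ys a b s \<longleftrightarrow> valid w s \<and> snd (snd s) = ys \<and> (\<forall>j<m. fst (snd s) j = r j) \<and>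
    fst (snd s) x = a \<and> fst (snd s) y = b \<and> fst (snd s) z = 0" for w and r :: "nat \<Rightarrow> nat" and ys :: "sym list" and a b s
  let ?R = "\<lambda>w r. {((a, b), (c, d)). a < cap w \<and> b < cap w \<and> c < cap w \<and> d < cap w \<and> R w (\<lambda>i. r (f i)) a b c d}"
  have J_arg: "(\<lambda>i. fst (snd s) (f i)) = (\<lambda>i. r (f i))" if "J w r ys a b s" for w r ys a b s
    using that f by (auto simp: J_def)
  have body_sound: "\<exists>c d. J w r ys c d s' \<and> ((a, b), (c, d)) \<in> ?R w r"
    if J: "J w r ys a b s" and sem: "(s, s') \<in> sem w body" for w r ys a b s s'
  proof -
    obtain h1 r1 ys1 where s: "s = (h1, r1, ys1)" by (cases s)
    obtain c d s2 where cd: "c < cap w" "d < cap w" "((h1, r1(x' := c, y' := d), ys1), s2) \<in> sem w p"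
      "(s2, s') \<in> sem w (Seq (Copy z x x') (Copy z y y'))"
      using sem unfolding body_def s sem_Guess sem.simps(2)[of w p] by blast
    obtain h2 r2 ys2 where s2: "s2 = (h2, r2, ys2)" by (cases s2)
    have "valid w (h1, r1(x' := c, y' := d), ys1)" using J cd by (simp add: J_def s valid_regs_upd)
    note * = tests_sound[OF p cd(3)[unfolded s2] this]
    have "(\<lambda>i. (r1(x' := c, y' := d)) (f i)) = (\<lambda>i. r (f i))"
      using J_arg[OF J] by (auto simp: s fun_eq_iff reg fn)
    then have "R w (\<lambda>i. r (f i)) a b c d"
      using *(3) J by (auto simp: J_def s reg)
    moreover have "r1 x < cap w" "r1 y < cap w" using J by (auto simp: J_def s valid_regs_def)
    moreover have "J w r ys c d s'"
      using cd J *(1,4) *(2)[of x] *(2)[of x'] *(2)[of y] *(2)[of y'] *(2)[of z] *(2)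
      by (auto simp: J_def s s2 sem_Copy reg valid_regs_upd)
    ultimately show ?thesis using J cd by (auto simp: J_def s)
  qed
  have body_complete: "\<exists>s'. (s, s') \<in> sem w body \<and> J w r ys c d s'"
    if J: "J w r ys a b s" and step: "((a, b), (c, d)) \<in> ?R w r" for w r ys a b c d s
  proof -
    obtain h1 r1 ys1 where s: "s = (h1, r1, ys1)" by (cases s)
    have val: "valid w (h1, r1(x' := c, y' := d), ys1)" using J step by (simp add: J_def s valid_regs_upd)
    have "(\<lambda>i. (r1(x' := c, y' := d)) (f i)) = (\<lambda>i. r (f i))"
      using J_arg[OF J] by (auto simp: s fun_eq_iff reg fn)
    then have "R w (\<lambda>i. (r1(x' := c, y' := d)) (f i)) ((r1(x' := c, y' := d)) x) ((r1(x' := c, y' := d)) y)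
      ((r1(x' := c, y' := d)) x') ((r1(x' := c, y' := d)) y')"
      using J step by (auto simp: J_def s reg)
    then obtain h2 r2 where
      2: "((h1, r1(x' := c, y' := d), ys1), (h2, r2, ys1)) \<in> sem w p" "\<And>j. j < m + 5 \<Longrightarrow> r2 j = (r1(x' := c, y' := d)) j"
         "valid w (h2, r2, ys1)" using tests_complete[OF p val] by blast
    have "((h2, r2, ys1), (h2, r2(x := c, y := d), ys1)) \<in> sem w (Seq (Copy z x x') (Copy z y y'))"
      using J 2(2,3) step by (auto simp: J_def s sem_Copy reg valid_regs_upd intro!: relcompI)
    moreover have "J w r ys c d (h2, r2(x := c, y := d), ys1)"
      using J 2(2,3) step by (auto simp: J_def s reg valid_regs_upd)
    moreover have "(s, (h2, r2(x := c, y := d), ys1)) \<in> sem w body"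
      using 2(1) calculation(1) step unfolding body_def s sem_Guess sem.simps(2)[of w p] by blast
    ultimately show ?thesis by blast
  qed
  define P where "P = Seq (Zero z) (Seq (Copy z x (f i)) (Seq (Copy z y (f j)) (Seq (Star body)
    (Seq (Atom (AddTest False False x z (f k))) (Atom (AddTest False False y z (f l)))))))"
  have init: "((h, r, ys), s) \<in> sem w (Seq (Zero z) (Seq (Copy z x (f i)) (Seq (Copy z y (f j)) q))) \<longleftrightarrow>
      ((h, r(z := 0, x := r (f i), y := r (f j)), ys), s) \<in> sem w q"
    if "valid w (h, r, ys)" for w h r ys s and q :: "sym prog"
    using that cap_pos[of w] by (auto simp: sem_Zero sem_Copy valid_regs_def reg fn relcomp_unfold)
  have init_J: "J w r ys (r (f i)) (r (f j)) (h, r(z := 0, x := r (f i), y := r (f j)), ys)"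
    if "valid w (h, r, ys)" for w h r ys
    using that cap_pos[of w] by (auto simp: J_def reg valid_regs_def)
  have "tests m P (\<lambda>w r. ((r (f i), r (f j)), (r (f k), r (f l))) \<in> tc2 w (R w (\<lambda>i. r (f i))))"
    unfolding tc2_def
  proof (rule testsI)
    fix w h r h' r' and ys ys' :: "sym list"
    assume val: "valid w (h, r, ys)" and "((h, r, ys), (h', r', ys')) \<in> sem w P"
    then obtain s where st: "((h, r(z := 0, x := r (f i), y := r (f j)), ys), s) \<in> (sem w body)\<^sup>*"
      "(s, (h', r', ys')) \<in> sem w (Seq (Atom (AddTest False False x z (f k))) (Atom (AddTest False False y z (f l))))"
      unfolding P_def init[OF val] by (auto simp del: fun_upd_apply)
    from st(1) have "\<exists>a b. J w r ys a b s \<and> ((r (f i), r (f j)), (a, b)) \<in> (?R w r)\<^sup>*"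
    proof (induction rule: rtrancl_induct)
      case base
      then show ?case using init_J[OF val] by blast
    next
      case (step s s')
      then show ?case using body_sound by (meson rtrancl.rtrancl_into_rtrancl)
    qed
    then obtain a b where "J w r ys a b s" "((r (f i), r (f j)), (a, b)) \<in> (?R w r)\<^sup>*" by blast
    moreover have "s = (h', r', ys')" using st(2) by (cases s) auto
    ultimately show "ys' = ys \<and> (\<forall>j<m. r' j = r j) \<and> ((r (f i), r (f j)), (r (f k), r (f l))) \<in> (?R w r)\<^sup>*"
      using st(2) f by (auto simp: J_def)
  next
    fix w h r and ys :: "sym list"
    assume val: "valid w (h, r, ys)" and q: "((r (f i), r (f j)), (r (f k), r (f l))) \<in> (?R w r)\<^sup>*"
    have "\<exists>s. ((h, r(z := 0, x := r (f i), y := r (f j)), ys), s) \<in> (sem w body)\<^sup>* \<and> J w r ys a b s"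
      if "((r (f i), r (f j)), (a, b)) \<in> (?R w r)\<^sup>*" for a b
      using that
    proof (induction rule: rtrancl_induct2)
      case refl
      then show ?case using init_J[OF val] by blast
    next
      case (step a b c d)
      then show ?case using body_complete by (meson rtrancl.rtrancl_into_rtrancl)
    qed
    from this[OF q] obtain s where s: "((h, r(z := 0, x := r (f i), y := r (f j)), ys), s) \<in> (sem w body)\<^sup>*"
      "J w r ys (r (f k)) (r (f l)) s" by blast
    obtain h1 r1 ys1 where s1: "s = (h1, r1, ys1)" by (cases s)
    have "(s, (h1, r1, ys)) \<in> sem w (Seq (Atom (AddTest False False x z (f k))) (Atom (AddTest False False y z (f l))))"
      using s(2) f by (auto simp: J_def s1)
    with s(1) have "((h, r, ys), (h1, r1, ys)) \<in> sem w P"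
      unfolding P_def init[OF val] by (auto simp del: fun_upd_apply)
    then show "\<exists>h' r'. ((h, r, ys), (h', r', ys)) \<in> sem w P" by blast
  qed
  then show "\<exists>p. tests m p (\<lambda>w r. ((r (f i), r (f j)), (r (f k), r (f l))) \<in> tc2 w (R w (\<lambda>i. r (f i))))"
    by blast
qed

text \<open>The head is first sent to the left end and then moved right together with a counter, so
  that its position is known when the counter equals the argument.\<close>

lemma NL_cell: "NL (\<lambda>w e. e i \<le> length w + 1 \<and> input_cell w (e i) = c)"
proof (rule NL_I)
  fix f :: "nat \<Rightarrow> nat" and m
  assume f: "\<forall>i. f i < m"
  define x t z where reg: "x = m" "t = m + 1" "z = m + 2"
  \<comment> \<open>A right move is cut off at the end marker. Excluding that cell before each move
    keeps the counter equal to the head position.\<close>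
  define inside :: "sym prog" where "inside = Choice (Atom (CellIs LeftEnd)) (Choice (Atom (CellIs (Symbol Sep)))
    (Choice (Atom (CellIs (Symbol (Bit True)))) (Atom (CellIs (Symbol (Bit False))))))"
  have inside: "((h, r, ys), s) \<in> sem w inside \<longleftrightarrow> s = (h, r, ys) \<and> h \<le> length w" for h r ys s w
  proof -
    have "c \<noteq> RightEnd \<longleftrightarrow> c = LeftEnd \<or> c = Symbol Sep \<or> c = Symbol (Bit True) \<or> c = Symbol (Bit False)" for c :: "sym cell"
      by (metis cell.distinct cell.exhaust sym.exhaust)
    from this[of "input_cell w h"] have "((h, r, ys), s) \<in> sem w inside \<longleftrightarrow> s = (h, r, ys) \<and> input_cell w h \<noteq> RightEnd"
      by (auto simp: inside_def)
    then show ?thesis by (auto simp: input_cell_def)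
  qed
  define body where "body = Seq inside (Seq (Atom MoveR) (Seq (Increment z t x) (Copy z x t)))"
  have body: "((h, r, ys), s) \<in> sem w body \<longleftrightarrow> h \<le> length w \<and> s = (Suc h, r(t := Suc (r x), x := Suc (r x)), ys)"
    if "r z = 0" "r x = h" "valid_regs w r" for w h r ys s
  proof -
    have "length w + 2 \<le> (length w + 2) ^ 8" by (rule self_le_power) auto
    then have "h \<le> length w \<Longrightarrow> Suc h < cap w" using cap_ge[of w] by linarith
    then show ?thesis
      using that by (auto simp: body_def inside sem_Increment sem_Copy reg relcomp_unfold valid_regs_upd)
  qed
  define J where "J w r ys h s \<longleftrightarrow> valid w s \<and> snd (snd s) = ys \<and> (\<forall>j<m. fst (snd s) j = r j) \<and>
    fst s = h \<and> fst (snd s) x = h \<and> fst (snd s) z = 0" for w and r :: "nat \<Rightarrow> nat" and ys :: "sym list" and h s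
  have body_J: "J w r ys (Suc h) s'" if J: "J w r ys h s" and sem: "(s, s') \<in> sem w body" for w r ys h s s'
  proof -
    obtain h1 r1 ys1 where s: "s = (h1, r1, ys1)" by (cases s)
    have *: "h \<le> length w" "s' = (Suc h1, r1(t := Suc (r1 x), x := Suc (r1 x)), ys1)"
      using J sem body[of r1 h1 w ys1 s'] by (auto simp: J_def s)
    moreover have "length w + 2 \<le> (length w + 2) ^ 8" by (rule self_le_power) auto
    then have "Suc h < cap w" using cap_ge[of w] * by linarith
    ultimately show ?thesis using J by (auto simp: J_def s reg valid_regs_upd)
  qed
  define L :: "sym prog" where "L = Seq (Star (Atom MoveL)) (Atom (CellIs LeftEnd))"
  have left: "((h, r, ys), s) \<in> sem w L \<longleftrightarrow> s = (0, r, ys)" for h r ys s w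
    unfolding L_def sem.simps(2,4)
  proof
    have "t = (fst t, r, ys)" if "((h, r, ys), t) \<in> (sem w (Atom MoveL))\<^sup>*" for t
      using that by (induction rule: rtrancl_induct) auto
    then show "((h, r, ys), s) \<in> (sem w (Atom MoveL))\<^sup>* O sem w (Atom (CellIs LeftEnd)) \<Longrightarrow> s = (0, r, ys)"
      by (fastforce simp: input_cell_def split: if_splits)
  next
    have "((h, r, ys), (0, r, ys)) \<in> (sem w (Atom MoveL))\<^sup>*"
      by (induction h) (auto intro: converse_rtrancl_into_rtrancl)
    then show "s = (0, r, ys) \<Longrightarrow> ((h, r, ys), s) \<in> (sem w (Atom MoveL))\<^sup>* O sem w (Atom (CellIs LeftEnd))"
      by (auto simp: input_cell_def)
  qed
  define P where "P = Seq L (Seq (Zero z) (Seq (Zero x)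
    (Seq (Star body) (Seq (Atom (AddTest False False x z (f i))) (Atom (CellIs c))))))"
  have P: "((h, r, ys), s) \<in> sem w P \<longleftrightarrow> ((0, r(z := 0, x := 0), ys), s) \<in>
      (sem w body)\<^sup>* O sem w (Seq (Atom (AddTest False False x z (f i))) (Atom (CellIs c)))" for w h r ys s
    by (auto simp: P_def left sem_Zero relcomp_unfold)
  have init_J: "J w r ys 0 (0, r(z := 0, x := 0), ys)" if "valid w (h, r, ys)" for w r h ys
    using that cap_pos[of w] by (auto simp: J_def reg valid_regs_upd)
  have "tests m P (\<lambda>w r. r (f i) \<le> length w + 1 \<and> input_cell w (r (f i)) = c)"
  proof (rule testsI)
    fix w h r h' r' and ys ys' :: "sym list"
    assume val: "valid w (h, r, ys)" and "((h, r, ys), (h', r', ys')) \<in> sem w P"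
    then obtain s where st: "((0, r(z := 0, x := 0), ys), s) \<in> (sem w body)\<^sup>*"
      "(s, (h', r', ys')) \<in> sem w (Seq (Atom (AddTest False False x z (f i))) (Atom (CellIs c)))"
      unfolding P by (auto simp del: fun_upd_apply)
    from st(1) have "\<exists>h. J w r ys h s"
    proof (induction rule: rtrancl_induct)
      case base
      then show ?case using init_J[OF val] by blast
    next
      case (step s s')
      then show ?case using body_J by blast
    qed
    then show "ys' = ys \<and> (\<forall>j<m. r' j = r j) \<and> r (f i) \<le> length w + 1 \<and> input_cell w (r (f i)) = c"
      using st(2) f by (cases s) (auto simp: J_def)
  next
    fix w h r and ys :: "sym list"
    assume val: "valid w (h, r, ys)" and q: "r (f i) \<le> length w + 1 \<and> input_cell w (r (f i)) = c"
    have "\<exists>s. ((0, r(z := 0, x := 0), ys), s) \<in> (sem w body)\<^sup>* \<and> J w r ys h s" if "h \<le> length w + 1" for h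
      using that
    proof (induction h)
      case 0
      then show ?case using init_J[OF val] by blast
    next
      case (Suc h)
      have "h \<le> length w + 1" using Suc.prems by simp
      then obtain s where s: "((0, r(z := 0, x := 0), ys), s) \<in> (sem w body)\<^sup>*" "J w r ys h s"
        using Suc.IH by blast
      obtain h1 r1 ys1 where s1: "s = (h1, r1, ys1)" by (cases s)
      have "\<exists>s'. (s, s') \<in> sem w body"
        using body[of r1 h1 w ys1] s(2) Suc.prems by (auto simp: J_def s1)
      then show ?case using s body_J by (meson rtrancl.rtrancl_into_rtrancl)
    qed
    then obtain s where s: "((0, r(z := 0, x := 0), ys), s) \<in> (sem w body)\<^sup>*" "J w r ys (r (f i)) s" using q by blast
    obtain h1 r1 ys1 where s1: "s = (h1, r1, ys1)" by (cases s)
    have "(s, (h1, r1, ys)) \<in> sem w (Seq (Atom (AddTest False False x z (f i))) (Atom (CellIs c)))"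
      using s(2) f q by (auto simp: J_def s1)
    with s(1) show "\<exists>h' r'. ((h, r, ys), (h', r', ys)) \<in> sem w P"
      unfolding P by blast
  qed
  then show "\<exists>p. tests m p (\<lambda>w r. r (f i) \<le> length w + 1 \<and> input_cell w (r (f i)) = c)" by blast
qed

lemma NL_const: "NL (\<lambda>w e. c)"
proof (rule NL_I)
  fix f :: "nat \<Rightarrow> nat" and m
  define p :: "sym prog" where
    \<comment> \<open>A star always has a run; a cell cannot be both end markers, so the other
      program has none.\<close>
    "p = (if c then Star (Atom MoveL) else Seq (Atom (CellIs LeftEnd)) (Atom (CellIs RightEnd)))"
  have "(s, t) \<in> (sem w (Atom MoveL))\<^sup>* \<Longrightarrow> snd t = snd s" for s t w
    by (induction rule: rtrancl_induct) auto
  then have "tests m p (\<lambda>w r. c)"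
    unfolding tests_def p_def by (cases c) force+
  then show "\<exists>p. tests m p (\<lambda>w r. c)" by blast
qed

section \<open>Arithmetic predicates\<close>

lemma NL_add: "NL (\<lambda>w e. e i + e j = e k)"
  using NL_add_carry[of i j False k False] by simp

lemma NL_add_Suc: "NL (\<lambda>w e. Suc (e i + e j) = e k)"
  using NL_add_carry[of i j True k False] by simp

lemma NL_add_over: "NL (\<lambda>w e. e i + e j = e k + cap w)"
  using NL_add_carry[of i j False k True] by simp

lemma NL_add_Suc_over: "NL (\<lambda>w e. Suc (e i + e j) = e k + cap w)"
  using NL_add_carry[of i j True k True] by simp

lemma NL_zero: "NL (\<lambda>w e. e i = 0)"
  using NL_add[of i i i] by simp

lemma NL_eq: "NL (\<lambda>w e. e i = e j)"
proof -
  have "NL (\<lambda>w e. \<exists>z<cap w. z = 0 \<and> e i + z = e j)"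
    by (intro NL_ex NL_conj NL_zero NL_add)
  then show ?thesis by (simp add: cap_pos)
qed

lemma NL_Suc: "NL (\<lambda>w e. Suc (e i) = e j)"
proof -
  have "NL (\<lambda>w e. \<exists>z<cap w. z = 0 \<and> Suc (e i + z) = e j)"
    by (intro NL_ex NL_conj NL_zero NL_add_Suc)
  then show ?thesis by (simp add: cap_pos)
qed

lemma NL_max: "NL (\<lambda>w e. Suc (e i) = cap w)"
proof -
  have "NL (\<lambda>w e. \<exists>z<cap w. z = 0 \<and> Suc (e i + z) = z + cap w)"
    by (intro NL_ex NL_conj NL_zero NL_add_Suc_over)
  then show ?thesis by (simp add: cap_pos)
qed

lemma NL_less: "NL (\<lambda>w e. e i < e j)"
proof -
  have "NL (\<lambda>w e. \<exists>z<cap w. Suc (e i + z) = e j)"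
    by (intro NL_ex NL_add_Suc)
  moreover have "(\<exists>z<cap w. Suc (e i + z) = e j) \<longleftrightarrow> e i < e j" if "\<And>i. e i < cap w" for w :: "sym list" and e
  proof
    assume "e i < e j"
    then show "\<exists>z<cap w. Suc (e i + z) = e j"
      using that[of j] by (intro exI[of _ "e j - Suc (e i)"]) auto
  qed auto
  ultimately show ?thesis by (subst NL_cong) auto
qed

lemma NL_neq: "NL (\<lambda>w e. e i \<noteq> e j)"
proof -
  have "NL (\<lambda>w e. e i < e j \<or> e j < e i)"
    by (intro NL_disj NL_less)
  then show ?thesis by (simp add: neq_iff)
qed

text \<open>Exactly one addition test with carry out is passed by the actual sum, below
  \<open>cap w\<close> or reduced by it; guessing this sum refutes the claimed one.\<close>

lemma NL_not_add: "NL (\<lambda>w e. e i + e j \<noteq> e k)"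
proof -
  have "NL (\<lambda>w e. \<exists>z<cap w. (e i + e j = z \<and> z \<noteq> e k) \<or> e i + e j = z + cap w)"
    by (intro NL_ex NL_conj NL_disj NL_add NL_neq NL_add_over)
  moreover have "(\<exists>z<cap w. (e i + e j = z \<and> z \<noteq> e k) \<or> e i + e j = z + cap w) \<longleftrightarrow> e i + e j \<noteq> e k"
    if "\<And>i. e i < cap w" for w :: "sym list" and e
  proof
    assume "e i + e j \<noteq> e k"
    then show "\<exists>z<cap w. (e i + e j = z \<and> z \<noteq> e k) \<or> e i + e j = z + cap w"
      using that[of i] that[of j]
      by (intro exI[of _ "if e i + e j < cap w then e i + e j else e i + e j - cap w"]) auto
  next
    assume "\<exists>z<cap w. (e i + e j = z \<and> z \<noteq> e k) \<or> e i + e j = z + cap w"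
    then show "e i + e j \<noteq> e k" using that[of k] by auto
  qed
  ultimately show ?thesis by (subst NL_cong) auto
qed

subsection \<open>Closure under complement\<close>

text \<open>The Immerman--Szelepcsenyi argument. All registers are bounded by \<open>cap w\<close>, so the number of
  nodes at distance at most \<open>d\<close> from \<open>s\<close> is counted without the node \<open>s\<close> itself.\<close>

definition tc1 :: "sym list \<Rightarrow> (nat \<Rightarrow> nat \<Rightarrow> bool) \<Rightarrow> nat rel" where
  "tc1 w S = {(a, b). a < cap w \<and> b < cap w \<and> S a b}\<^sup>*"

definition contributes :: "(nat \<Rightarrow> bool) \<Rightarrow> (nat \<Rightarrow> bool) \<Rightarrow> nat \<Rightarrow> nat \<Rightarrow> nat \<Rightarrow> bool" where
  "contributes Y N u a b \<longleftrightarrow> (Y u \<and> Suc a = b) \<or> (N u \<and> a = b)"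

text \<open>A pass over all nodes with a running count: every node needs a certificate
  \<open>Y\<close>, and is counted, or \<open>N\<close>, and is not. If the certificates exclude
  each other, the count is forced.\<close>

definition scan :: "sym list \<Rightarrow> (nat \<Rightarrow> bool) \<Rightarrow> (nat \<Rightarrow> bool) \<Rightarrow> nat \<Rightarrow> bool" where
  "scan w Y N c \<longleftrightarrow> (\<exists>z<cap w. z = 0 \<and> (\<exists>m<cap w. Suc m = cap w \<and> (\<exists>a<cap w. contributes Y N z z a \<and>
     ((z, a), (m, c)) \<in> tc2 w (\<lambda>u a u' b. Suc u = u' \<and> contributes Y N u' a b))))"

lemma scan_iff:
  assumes "c < cap w"
  shows "scan w Y N c \<longleftrightarrow> (\<exists>S\<subseteq>{..<cap w}. (\<forall>u\<in>S. Y u) \<and> (\<forall>u\<in>{..<cap w} - S. N u) \<and> card S = c)"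
proof -
  let ?R = "tc2 w (\<lambda>u a u' b. Suc u = u' \<and> contributes Y N u' a b)"
  have sound: "\<exists>S\<subseteq>{..u}. (\<forall>u\<in>S. Y u) \<and> (\<forall>u\<in>{..u} - S. N u) \<and> card S = c"
    if "((0, a), (u, c)) \<in> ?R" "contributes Y N 0 0 a" for a u c
    using that(1) unfolding tc2_def
  proof (induction rule: rtrancl_induct2)
    case refl
    from that(2) show ?case unfolding contributes_def
    proof
      assume "Y 0 \<and> Suc 0 = a"
      then show ?thesis by (intro exI[of _ "{0}"]) auto
    next
      assume "N 0 \<and> 0 = a"
      then show ?thesis by (intro exI[of _ "{}"]) auto
    qed
  next
    case (step u c u' c')
    then obtain S where S: "S \<subseteq> {..u}" "\<forall>u\<in>S. Y u" "\<forall>u\<in>{..u} - S. N u" "card S = c" by blast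
    have u': "u' = Suc u" "(Y u' \<and> c' = Suc c) \<or> (N u' \<and> c' = c)"
      using step.hyps by (auto simp: contributes_def)
    have fin: "finite S" using S(1) finite_subset by blast
    from u'(2) show ?case
    proof
      assume "Y u' \<and> c' = Suc c"
      then show ?thesis using S u'(1) fin
        by (intro exI[of _ "insert u' S"]) (auto simp: le_Suc_eq card_insert_if)
    next
      assume "N u' \<and> c' = c"
      then show ?thesis using S u'(1)
        by (intro exI[of _ S]) (auto simp: le_Suc_eq)
    qed
  qed
  have complete: "\<exists>a<cap w. contributes Y N 0 0 a \<and> ((0, a), (u, card S)) \<in> ?R"
    if "u < cap w" "S \<subseteq> {..u}" "\<forall>u\<in>S. Y u" "\<forall>u\<in>{..u} - S. N u" "card S < cap w" for u S
    using that
  proof (induction u arbitrary: S)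
    case 0
    then have "S = {} \<or> S = {0}" by auto
    then show ?case using 0 cap_pos[of w] cap_gt_1[of w] by (auto simp: contributes_def tc2_def)
  next
    case (Suc u)
    let ?S = "S - {Suc u}"
    have fin: "finite S" using Suc.prems(2) finite_subset by blast
    have card: "card S = (if Suc u \<in> S then Suc (card ?S) else card ?S)"
      using card.remove[OF fin, of "Suc u"] by (cases "Suc u \<in> S") auto
    have "?S \<subseteq> {..u}" "\<forall>u\<in>?S. Y u" "\<forall>u\<in>{..u} - ?S. N u"
      using Suc.prems(2-4) by (auto simp: le_Suc_eq)
    moreover have "u < cap w" "card ?S < cap w" using Suc.prems(1,5) card by (auto split: if_splits)
    ultimately obtain a where a: "a < cap w" "contributes Y N 0 0 a" "((0, a), (u, card ?S)) \<in> ?R"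
      using Suc.IH by blast
    have le: "card ?S \<le> card S" using fin by (intro card_mono) auto
    have "contributes Y N (Suc u) (card ?S) (card S)"
      unfolding contributes_def using Suc.prems(3,4) card by (cases "Suc u \<in> S") auto
    then have "((u, card ?S), (Suc u, card S)) \<in> {((a, b), c, d). a < cap w \<and> b < cap w \<and> c < cap w \<and>
        d < cap w \<and> Suc a = c \<and> contributes Y N c b d}"
      using Suc.prems(1,5) le by simp
    then show ?case using a unfolding tc2_def by (meson rtrancl.rtrancl_into_rtrancl)
  qed
  obtain n where n: "cap w = Suc n" using cap_pos[of w] gr0_conv_Suc by blast
  have B: "{..<cap w} = {..n}" using n by auto
  have "scan w Y N c \<longleftrightarrow> (\<exists>a<cap w. contributes Y N 0 0 a \<and> ((0, a), (n, c)) \<in> ?R)"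
    by (auto simp: scan_def n)
  also have "\<dots> \<longleftrightarrow> (\<exists>S\<subseteq>{..<cap w}. (\<forall>u\<in>S. Y u) \<and> (\<forall>u\<in>{..<cap w} - S. N u) \<and> card S = c)"
    unfolding B
  proof
    assume "\<exists>a<cap w. contributes Y N 0 0 a \<and> ((0, a), (n, c)) \<in> ?R"
    then show "\<exists>S\<subseteq>{..n}. (\<forall>u\<in>S. Y u) \<and> (\<forall>u\<in>{..n} - S. N u) \<and> card S = c"
      using sound by blast
  next
    assume "\<exists>S\<subseteq>{..n}. (\<forall>u\<in>S. Y u) \<and> (\<forall>u\<in>{..n} - S. N u) \<and> card S = c"
    then obtain S where "S \<subseteq> {..n}" "\<forall>u\<in>S. Y u" "\<forall>u\<in>{..n} - S. N u" "card S = c" by blast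
    then show "\<exists>a<cap w. contributes Y N 0 0 a \<and> ((0, a), (n, c)) \<in> ?R"
      using complete[of n S] n assms by simp
  qed
  finally show ?thesis .
qed

lemma NL_scan:
  assumes Y: "NL (\<lambda>w e. Y w (\<lambda>i. e (Suc i)) (e 0))" and N: "NL (\<lambda>w e. N w (\<lambda>i. e (Suc i)) (e 0))"
  shows "NL (\<lambda>w e. scan w (Y w e) (N w e) (e i))"
proof -
  have Y': "NL (\<lambda>w e. Y w (\<lambda>i. e (g i)) (e j))" for g j
    using NL_subst[OF Y, of "case_nat j g"] by simp
  have N': "NL (\<lambda>w e. N w (\<lambda>i. e (g i)) (e j))" for g j
    using NL_subst[OF N, of "case_nat j g"] by simp
  show ?thesis
    unfolding scan_def contributes_def
    by (intro NL_ex NL_conj NL_disj NL_zero NL_max NL_Suc NL_eq NL_tc2 Y' N')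
qed

primrec layer :: "sym list \<Rightarrow> (nat \<Rightarrow> nat \<Rightarrow> bool) \<Rightarrow> nat \<Rightarrow> nat \<Rightarrow> nat set" where
  "layer w S s 0 = {s}"
| "layer w S s (Suc d) = layer w S s d \<union> {v. v < cap w \<and> (\<exists>u\<in>layer w S s d. S u v)}"

text \<open>Idle steps \<open>a = b\<close> pad a shorter path to exactly \<open>d\<close>
  steps.\<close>

definition in_layer :: "sym list \<Rightarrow> (nat \<Rightarrow> nat \<Rightarrow> bool) \<Rightarrow> nat \<Rightarrow> nat \<Rightarrow> nat \<Rightarrow> bool" where
  "in_layer w S s d v \<longleftrightarrow> (\<exists>z<cap w. z = 0 \<and>
     ((s, z), (v, d)) \<in> tc2 w (\<lambda>a i b j. Suc i = j \<and> (a = b \<or> S a b)))"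

text \<open>The certificate that \<open>v\<close> is not within \<open>d + 1\<close> steps:
  \<open>c\<close> nodes of layer \<open>d\<close> are exhibited, none of which is \<open>v\<close>
  or has an edge to it. If \<open>c\<close> is the true count these are all nodes but
  \<open>s\<close>, which is checked apart; the rest may be skipped, hence the constant
  \<open>True\<close>.\<close>

definition avoids :: "sym list \<Rightarrow> (nat \<Rightarrow> nat \<Rightarrow> bool) \<Rightarrow> nat \<Rightarrow> nat \<Rightarrow> nat \<Rightarrow> nat \<Rightarrow> bool" where
  "avoids w S s d c v \<longleftrightarrow> v \<noteq> s \<and> \<not> S s v \<and>
     scan w (\<lambda>u. u \<noteq> s \<and> in_layer w S s d u \<and> u \<noteq> v \<and> \<not> S u v) (\<lambda>_. True) c"

text \<open>The inductive step of the counting: the count \<open>c\<close> of one layer certifies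
  nonmembership in the next, so that the pass over all nodes yields the next count
  \<open>c'\<close>.\<close>

definition count_step :: "sym list \<Rightarrow> (nat \<Rightarrow> nat \<Rightarrow> bool) \<Rightarrow> nat \<Rightarrow> nat \<Rightarrow> nat \<Rightarrow> nat \<Rightarrow> nat \<Rightarrow> bool" where
  "count_step w S s d d' c c' \<longleftrightarrow>
     scan w (\<lambda>v. v \<noteq> s \<and> in_layer w S s d' v) (\<lambda>v. v = s \<or> avoids w S s d c v) c'"

definition layer_count :: "sym list \<Rightarrow> (nat \<Rightarrow> nat \<Rightarrow> bool) \<Rightarrow> nat \<Rightarrow> nat \<Rightarrow> nat \<Rightarrow> bool" where
  "layer_count w S s d c \<longleftrightarrow> (\<exists>z<cap w. z = 0 \<and>
     ((z, z), (d, c)) \<in> tc2 w (\<lambda>d c d' c'. Suc d = d' \<and> count_step w S s d d' c c'))"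

text \<open>Two consecutive layers with the same count are equal, so nothing new is ever reached
  after them; avoiding the second one then suffices.\<close>

definition unreachable :: "sym list \<Rightarrow> (nat \<Rightarrow> nat \<Rightarrow> bool) \<Rightarrow> nat \<Rightarrow> nat \<Rightarrow> bool" where
  "unreachable w S s t \<longleftrightarrow> (\<exists>d<cap w. \<exists>d'<cap w. \<exists>c<cap w. Suc d = d' \<and>
     layer_count w S s d c \<and> layer_count w S s d' c \<and> avoids w S s d c t)"

lemma layer_bound: "s < cap w \<Longrightarrow> layer w S s d \<subseteq> {..<cap w}"
  by (induction d) auto

lemma finite_layer: "s < cap w \<Longrightarrow> finite (layer w S s d)"
  by (rule finite_subset[OF layer_bound]) simp_all

lemma source_in_layer: "s \<in> layer w S s d"
  by (induction d) auto

lemma layer_mono: "layer w S s d \<subseteq> layer w S s (d + k)"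
  by (induction k) auto

lemma card_layer_less: "s < cap w \<Longrightarrow> card (layer w S s d - {s}) < cap w"
proof -
  assume s: "s < cap w"
  have "card (layer w S s d - {s}) < card (layer w S s d)"
    using finite_layer[OF s] source_in_layer by (intro psubset_card_mono) auto
  also have "\<dots> \<le> cap w" using card_mono[OF _ layer_bound[OF s]] by simp
  finally show ?thesis .
qed

lemma in_layer_iff:
  assumes "s < cap w" "d < cap w"
  shows "in_layer w S s d v \<longleftrightarrow> v \<in> layer w S s d"
proof -
  let ?R = "{((a, b), c, d). a < cap w \<and> b < cap w \<and> c < cap w \<and> d < cap w \<and> Suc b = d \<and> (a = c \<or> S a c)}"
  have "((s, 0), (v, d)) \<in> ?R\<^sup>* \<Longrightarrow> v \<in> layer w S s d" for v d
  proof (induction rule: rtrancl_induct2)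
    case (step a i b j)
    then show ?case by auto
  qed simp
  moreover have "v \<in> layer w S s d \<Longrightarrow> d < cap w \<Longrightarrow> ((s, 0), (v, d)) \<in> ?R\<^sup>*" for v d
  proof (induction d arbitrary: v)
    case (Suc d)
    then obtain u where u: "u \<in> layer w S s d" "u = v \<or> S u v" "v < cap w"
      using layer_bound[OF assms(1), of S "Suc d"] by auto
    then have "((s, 0), (u, d)) \<in> ?R\<^sup>*" using Suc by simp
    moreover have "((u, d), (v, Suc d)) \<in> ?R"
      using u Suc.prems layer_bound[OF assms(1), of S d] by auto
    ultimately show ?case by (rule rtrancl.rtrancl_into_rtrancl)
  qed simp
  ultimately show ?thesis using assms cap_pos[of w] unfolding in_layer_def tc2_def by auto
qed

lemma avoids_iff:
  assumes "s < cap w" "d < cap w" "v < cap w" "c = card (layer w S s d - {s})"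
  shows "avoids w S s d c v \<longleftrightarrow> v \<notin> layer w S s (Suc d)"
proof -
  let ?L = "layer w S s d - {s}"
  have fin: "finite ?L" using finite_layer[OF assms(1)] by blast
  have "scan w (\<lambda>u. u \<noteq> s \<and> in_layer w S s d u \<and> u \<noteq> v \<and> \<not> S u v) (\<lambda>_. True) c \<longleftrightarrow>
      (\<exists>T\<subseteq>{..<cap w}. (\<forall>u\<in>T. u \<in> ?L \<and> u \<noteq> v \<and> \<not> S u v) \<and> card T = c)"
    using card_layer_less[OF assms(1), of S d] assms by (subst scan_iff) (auto simp: in_layer_iff)
  also have "\<dots> \<longleftrightarrow> (\<forall>u\<in>?L. u \<noteq> v \<and> \<not> S u v)"
  proof
    assume "\<exists>T\<subseteq>{..<cap w}. (\<forall>u\<in>T. u \<in> ?L \<and> u \<noteq> v \<and> \<not> S u v) \<and> card T = c"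
    then obtain T where T: "\<forall>u\<in>T. u \<in> ?L \<and> u \<noteq> v \<and> \<not> S u v" "card T = c" by blast
    then have "T \<subseteq> ?L" by blast
    then have "T = ?L" using card_subset_eq[OF fin] T assms(4) by blast
    then show "\<forall>u\<in>?L. u \<noteq> v \<and> \<not> S u v" using T by blast
  next
    assume "\<forall>u\<in>?L. u \<noteq> v \<and> \<not> S u v"
    then show "\<exists>T\<subseteq>{..<cap w}. (\<forall>u\<in>T. u \<in> ?L \<and> u \<noteq> v \<and> \<not> S u v) \<and> card T = c"
      using layer_bound[OF assms(1), of S d] assms(4) by (intro exI[of _ ?L]) auto
  qed
  finally show ?thesis
    using assms(3) source_in_layer[of s w S d] by (auto simp: avoids_def)
qed

lemma count_step_iff:
  assumes "s < cap w" "Suc d < cap w" "c = card (layer w S s d - {s})" "c' < cap w"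
  shows "count_step w S s d (Suc d) c c' \<longleftrightarrow> c' = card (layer w S s (Suc d) - {s})"
proof -
  let ?L = "layer w S s (Suc d) - {s}"
  have sub: "?L \<subseteq> {..<cap w}" using layer_bound[OF assms(1), of S "Suc d"] by blast
  have *: "d < cap w" using assms by simp
  have "count_step w S s d (Suc d) c c' \<longleftrightarrow>
      (\<exists>T\<subseteq>{..<cap w}. (\<forall>v\<in>T. v \<in> ?L) \<and> (\<forall>v\<in>{..<cap w} - T. v \<notin> ?L) \<and> card T = c')"
    unfolding count_step_def scan_iff[OF assms(4)]
    using in_layer_iff[OF assms(1,2)] avoids_iff[OF assms(1) * _ assms(3)]
    by (intro ex_cong conj_cong refl ball_cong) auto
  also have "\<dots> \<longleftrightarrow> c' = card ?L"
  proof
    assume "\<exists>T\<subseteq>{..<cap w}. (\<forall>v\<in>T. v \<in> ?L) \<and> (\<forall>v\<in>{..<cap w} - T. v \<notin> ?L) \<and> card T = c'"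
    then obtain T where "T \<subseteq> {..<cap w}" "\<forall>v\<in>T. v \<in> ?L" "\<forall>v\<in>{..<cap w} - T. v \<notin> ?L" "card T = c'"
      by blast
    moreover from this have "T = ?L" using sub by blast
    ultimately show "c' = card ?L" by blast
  qed (use sub in blast)
  finally show ?thesis .
qed

lemma layer_count_iff:
  assumes "s < cap w" "d < cap w" "c < cap w"
  shows "layer_count w S s d c \<longleftrightarrow> c = card (layer w S s d - {s})"
proof -
  let ?R = "{((d, c), d', c'). d < cap w \<and> c < cap w \<and> d' < cap w \<and> c' < cap w \<and> Suc d = d' \<and> count_step w S s d d' c c'}"
  have "((0, 0), (d, c)) \<in> ?R\<^sup>* \<Longrightarrow> c = card (layer w S s d - {s})" for d c
  proof (induction rule: rtrancl_induct2)
    case (step d c d' c')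
    then show ?case using count_step_iff[OF assms(1)] by blast
  qed simp
  moreover have "d < cap w \<Longrightarrow> ((0, 0), (d, card (layer w S s d - {s}))) \<in> ?R\<^sup>*" for d
  proof (induction d)
    case (Suc d)
    then have "((0, 0), (d, card (layer w S s d - {s}))) \<in> ?R\<^sup>*" by simp
    moreover have "((d, card (layer w S s d - {s})), (Suc d, card (layer w S s (Suc d) - {s}))) \<in> ?R"
      using Suc.prems card_layer_less[OF assms(1), of S] count_step_iff[OF assms(1) Suc.prems refl]
      by (auto simp del: layer.simps)
    ultimately show ?case by (rule rtrancl.rtrancl_into_rtrancl)
  qed simp
  ultimately show ?thesis using assms cap_pos[of w] unfolding layer_count_def tc2_def by auto
qed

lemma tc1_iff_layer:
  assumes "s < cap w"
  shows "(s, t) \<in> tc1 w S \<longleftrightarrow> (\<exists>d. t \<in> layer w S s d)"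
proof
  assume "(s, t) \<in> tc1 w S"
  then show "\<exists>d. t \<in> layer w S s d"
    unfolding tc1_def
  proof (induction rule: rtrancl_induct)
    case (step u v)
    then obtain d where "u \<in> layer w S s d" by blast
    then have "v \<in> layer w S s (Suc d)" using step.hyps by auto
    then show ?case by blast
  qed (auto intro: source_in_layer)
next
  assume "\<exists>d. t \<in> layer w S s d"
  then obtain d where "t \<in> layer w S s d" by blast
  then show "(s, t) \<in> tc1 w S"
  proof (induction d arbitrary: t)
    case (Suc d)
    then show ?case using layer_bound[OF assms, of S d]
      unfolding tc1_def by (auto intro: rtrancl.rtrancl_into_rtrancl)
  qed (simp add: tc1_def)
qed

lemma layer_stable:
  assumes "layer w S s (Suc d) = layer w S s d"
  shows "layer w S s (d + k) = layer w S s d"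
  using assms by (induction k) auto

lemma unreachable_iff:
  assumes "s < cap w" "t < cap w"
  shows "unreachable w S s t \<longleftrightarrow> (s, t) \<notin> tc1 w S"
proof
  assume "unreachable w S s t"
  then obtain d c where d: "Suc d < cap w" "c < cap w" "layer_count w S s d c" "layer_count w S s (Suc d) c"
    "avoids w S s d c t" unfolding unreachable_def by blast
  let ?L = "\<lambda>d. layer w S s d - {s}"
  have "d < cap w" using d by simp
  then have c: "c = card (?L d)" "c = card (?L (Suc d))" using d layer_count_iff[OF assms(1)] by blast+
  have "?L d = ?L (Suc d)"
    using c finite_layer[OF assms(1), of S "Suc d"] by (intro card_subset_eq) auto
  then have "layer w S s (Suc d) = layer w S s d"
    using source_in_layer[of s w S d] source_in_layer[of s w S "Suc d"] by blast
  note stable = layer_stable[OF this]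
  have t: "t \<notin> layer w S s (Suc d)"
    using d c avoids_iff[OF assms(1) \<open>d < cap w\<close> assms(2) c(1)] by blast
  have "t \<notin> layer w S s d'" for d'
  proof (cases "d' \<le> d")
    case True
    then show ?thesis using layer_mono[of w S s d' "d - d'"] t by auto
  next
    case False
    then show ?thesis using stable[of "d' - d"] t by simp
  qed
  then show "(s, t) \<notin> tc1 w S" using tc1_iff_layer[OF assms(1)] by blast
next
  assume "(s, t) \<notin> tc1 w S"
  then have t: "\<And>d. t \<notin> layer w S s d" using tc1_iff_layer[OF assms(1)] by blast
  \<comment> \<open>As long as layers grow, layer \<open>d\<close> has more than \<open>d\<close>
    nodes. Since \<open>t\<close> is in none, there are at most \<open>cap w - 1\<close> nodes to
    reach, so growth stops in time for \<open>Suc d\<close> to fit into a register.\<close>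
  have "\<exists>d. Suc d < cap w \<and> layer w S s (Suc d) = layer w S s d"
  proof (rule ccontr)
    assume neg: "\<nexists>d. Suc d < cap w \<and> layer w S s (Suc d) = layer w S s d"
    have "d < cap w \<Longrightarrow> d < card (layer w S s d)" for d
    proof (induction d)
      case (Suc d)
      then have "layer w S s d \<subset> layer w S s (Suc d)" using neg by auto
      then have "card (layer w S s d) < card (layer w S s (Suc d))"
        using finite_layer[OF assms(1)] by (intro psubset_card_mono)
      with Suc show ?case by simp
    qed simp
    from this[of "cap w - 1"] have "cap w \<le> card (layer w S s (cap w - 1))" using cap_pos[of w] by simp
    moreover have "layer w S s (cap w - 1) \<subseteq> {..<cap w} - {t}" using layer_bound[OF assms(1)] t by blast
    then have "card (layer w S s (cap w - 1)) \<le> card ({..<cap w} - {t})" by (intro card_mono) auto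
    ultimately show False using assms(2) by simp
  qed
  then obtain d where d: "Suc d < cap w" "layer w S s (Suc d) = layer w S s d" by blast
  let ?c = "card (layer w S s d - {s})"
  have "d < cap w" using d by simp
  moreover have "layer_count w S s d ?c"
    using layer_count_iff[OF assms(1) \<open>d < cap w\<close>] card_layer_less[OF assms(1)] by blast
  moreover have "layer_count w S s (Suc d) ?c"
    using layer_count_iff[OF assms(1) d(1)] card_layer_less[OF assms(1)] d(2) by metis
  moreover have "avoids w S s d ?c t"
    using avoids_iff[OF assms(1) \<open>d < cap w\<close> assms(2) refl] t by blast
  ultimately show "unreachable w S s t"
    unfolding unreachable_def using d(1) card_layer_less[OF assms(1)] by blast
qed

lemma NL_in_layer:
  assumes "NL (\<lambda>w e. S w (\<lambda>i. e (i + 2)) (e 0) (e 1))"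
  shows "NL (\<lambda>w e. in_layer w (S w e) (e i) (e j) (e k))"
proof -
  have S: "NL (\<lambda>w e. S w (\<lambda>i. e (g i)) (e j) (e k))" for g j k
    using NL_subst[OF assms, of "\<lambda>i. if i = 0 then j else if i = 1 then k else g (i - 2)"] by simp
  show ?thesis
    unfolding in_layer_def by (intro NL_ex NL_conj NL_disj NL_zero NL_Suc NL_eq NL_tc2 S)
qed

lemma NL_avoids:
  assumes S: "NL (\<lambda>w e. S w (\<lambda>i. e (i + 2)) (e 0) (e 1))"
    and not_S: "NL (\<lambda>w e. \<not> S w (\<lambda>i. e (i + 2)) (e 0) (e 1))"
  shows "NL (\<lambda>w e. avoids w (S w e) (e i) (e j) (e k) (e l))"
proof -
  have S': "NL (\<lambda>w e. S w (\<lambda>i. e (g i)) (e j) (e k))" for g j k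
    using NL_subst[OF S, of "\<lambda>i. if i = 0 then j else if i = 1 then k else g (i - 2)"] by simp
  have not_S': "NL (\<lambda>w e. \<not> S w (\<lambda>i. e (g i)) (e j) (e k))" for g j k
    using NL_subst[OF not_S, of "\<lambda>i. if i = 0 then j else if i = 1 then k else g (i - 2)"] by simp
  show ?thesis
    unfolding avoids_def by (intro NL_conj NL_neq NL_scan NL_const NL_in_layer not_S' S')
qed

lemma NL_layer_count:
  assumes S: "NL (\<lambda>w e. S w (\<lambda>i. e (i + 2)) (e 0) (e 1))"
    and not_S: "NL (\<lambda>w e. \<not> S w (\<lambda>i. e (i + 2)) (e 0) (e 1))"
  shows "NL (\<lambda>w e. layer_count w (S w e) (e i) (e j) (e k))"
proof -
  have S': "NL (\<lambda>w e. S w (\<lambda>i. e (g i)) (e j) (e k))" for g j k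
    using NL_subst[OF S, of "\<lambda>i. if i = 0 then j else if i = 1 then k else g (i - 2)"] by simp
  have not_S': "NL (\<lambda>w e. \<not> S w (\<lambda>i. e (g i)) (e j) (e k))" for g j k
    using NL_subst[OF not_S, of "\<lambda>i. if i = 0 then j else if i = 1 then k else g (i - 2)"] by simp
  show ?thesis
    unfolding layer_count_def count_step_def
    by (intro NL_ex NL_conj NL_disj NL_zero NL_Suc NL_eq NL_neq NL_tc2 NL_scan NL_in_layer NL_avoids S' not_S')
qed

lemma NL_not_tc1:
  assumes S: "NL (\<lambda>w e. S w (\<lambda>i. e (i + 2)) (e 0) (e 1))"
    and not_S: "NL (\<lambda>w e. \<not> S w (\<lambda>i. e (i + 2)) (e 0) (e 1))"
  shows "NL (\<lambda>w e. (e i, e j) \<notin> tc1 w (S w e))"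
proof -
  have S': "NL (\<lambda>w e. S w (\<lambda>i. e (g i)) (e j) (e k))" for g j k
    using NL_subst[OF S, of "\<lambda>i. if i = 0 then j else if i = 1 then k else g (i - 2)"] by simp
  have not_S': "NL (\<lambda>w e. \<not> S w (\<lambda>i. e (g i)) (e j) (e k))" for g j k
    using NL_subst[OF not_S, of "\<lambda>i. if i = 0 then j else if i = 1 then k else g (i - 2)"] by simp
  have "NL (\<lambda>w e. unreachable w (S w e) (e i) (e j))"
    unfolding unreachable_def
    by (intro NL_ex NL_conj NL_Suc NL_layer_count NL_avoids S' not_S')
  then show ?thesis by (subst NL_cong) (auto simp: unreachable_iff)
qed

lemma tc1_tc2: "(s, t) \<in> tc1 w S \<longleftrightarrow> ((s, z), (t, z)) \<in> tc2 w (\<lambda>a i b j. S a b \<and> i = j)" if "z < cap w"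
proof
  assume "(s, t) \<in> tc1 w S"
  then show "((s, z), (t, z)) \<in> tc2 w (\<lambda>a i b j. S a b \<and> i = j)"
    unfolding tc1_def tc2_def
    by (induction rule: rtrancl_induct) (use that in \<open>auto intro: rtrancl.rtrancl_into_rtrancl\<close>)
next
  have "((s, z), (t, z')) \<in> tc2 w (\<lambda>a i b j. S a b \<and> i = j) \<Longrightarrow> (s, t) \<in> tc1 w S" for z'
    unfolding tc1_def tc2_def
    by (induction rule: rtrancl_induct2) (auto intro: rtrancl.rtrancl_into_rtrancl)
  then show "((s, z), (t, z)) \<in> tc2 w (\<lambda>a i b j. S a b \<and> i = j) \<Longrightarrow> (s, t) \<in> tc1 w S" .
qed

lemma NL_tc1:
  assumes S: "NL (\<lambda>w e. S w (\<lambda>i. e (i + 2)) (e 0) (e 1))"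
  shows "NL (\<lambda>w e. (e i, e j) \<in> tc1 w (S w e))"
proof -
  have S': "NL (\<lambda>w e. S w (\<lambda>i. e (g i)) (e j) (e k))" for g j k
    using NL_subst[OF S, of "\<lambda>i. if i = 0 then j else if i = 1 then k else g (i - 2)"] by simp
  have "NL (\<lambda>w e. ((e i, e 0), (e j, e 0)) \<in> tc2 w (\<lambda>a i b j. S w e a b \<and> i = j))"
    by (intro NL_tc2 NL_conj S' NL_eq)
  moreover have "NL (\<lambda>w e. (e i, e j) \<in> tc1 w (S w e)) \<longleftrightarrow>
      NL (\<lambda>w e. ((e i, e 0), (e j, e 0)) \<in> tc2 w (\<lambda>a i b j. S w e a b \<and> i = j))"
    by (rule NL_cong, rule tc1_tc2)
  ultimately show ?thesis by blast
qed

subsection \<open>Decidable queries and definable terms\<close>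

definition dec :: "(sym list \<Rightarrow> (nat \<Rightarrow> nat) \<Rightarrow> bool) \<Rightarrow> bool" where
  "dec Q \<longleftrightarrow> NL Q \<and> NL (\<lambda>w e. \<not> Q w e)"

lemma decI: "NL Q \<Longrightarrow> NL (\<lambda>w e. \<not> Q w e) \<Longrightarrow> dec Q"
  by (simp add: dec_def)

lemma dec_NL: "dec Q \<Longrightarrow> NL Q" and dec_NL_not: "dec Q \<Longrightarrow> NL (\<lambda>w e. \<not> Q w e)"
  by (simp_all add: dec_def)

lemma dec_cong:
  assumes "\<And>w e. (\<And>i. e i < cap w) \<Longrightarrow> Q w e \<longleftrightarrow> Q' w e"
  shows "dec Q \<longleftrightarrow> dec Q'"
proof -
  have "NL Q \<longleftrightarrow> NL Q'" by (rule NL_cong) (rule assms)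
  moreover have "NL (\<lambda>w e. \<not> Q w e) \<longleftrightarrow> NL (\<lambda>w e. \<not> Q' w e)" by (rule NL_cong) (use assms in blast)
  ultimately show ?thesis by (simp add: dec_def)
qed

lemma dec_subst: "dec Q \<Longrightarrow> dec (\<lambda>w e. Q w (\<lambda>i. e (g i)))"
  using NL_subst[of Q g] NL_subst[of "\<lambda>w e. \<not> Q w e" g] by (simp add: dec_def)

lemma dec_const: "dec (\<lambda>w e. c)"
  by (simp add: dec_def NL_const)

lemma dec_not: "dec Q \<Longrightarrow> dec (\<lambda>w e. \<not> Q w e)"
  by (simp add: dec_def)

lemma dec_conj: "dec Q \<Longrightarrow> dec Q' \<Longrightarrow> dec (\<lambda>w e. Q w e \<and> Q' w e)"
  unfolding dec_def de_Morgan_conj by (intro conjI NL_conj NL_disj) auto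

lemma dec_disj: "dec Q \<Longrightarrow> dec Q' \<Longrightarrow> dec (\<lambda>w e. Q w e \<or> Q' w e)"
  unfolding dec_def de_Morgan_disj by (intro conjI NL_conj NL_disj) auto

lemma dec_imp: "dec Q \<Longrightarrow> dec Q' \<Longrightarrow> dec (\<lambda>w e. Q w e \<longrightarrow> Q' w e)"
  unfolding imp_conv_disj by (intro dec_disj dec_not)

lemma dec_iff: "dec Q \<Longrightarrow> dec Q' \<Longrightarrow> dec (\<lambda>w e. Q w e \<longleftrightarrow> Q' w e)"
  unfolding iff_conv_conj_imp by (intro dec_conj dec_imp)

lemma dec_ex:
  assumes "dec (\<lambda>w e. Q w (\<lambda>i. e (Suc i)) (e 0))"
  shows "dec (\<lambda>w e. \<exists>v<cap w. Q w e v)"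
proof (rule decI)
  show "NL (\<lambda>w e. \<exists>v<cap w. Q w e v)" using assms by (intro NL_ex dec_NL)
  have "NL (\<lambda>w e. \<forall>v<cap w. \<not> Q w e v)" using assms by (intro NL_all dec_NL_not)
  then show "NL (\<lambda>w e. \<not> (\<exists>v<cap w. Q w e v))" by simp
qed

lemma dec_eq: "dec (\<lambda>w e. e i = e j)"
  by (simp add: dec_def NL_eq NL_neq)

lemma dec_less: "dec (\<lambda>w e. e i < e j)"
proof (rule decI)
  have "NL (\<lambda>w e. e i = e j \<or> e j < e i)" by (intro NL_disj NL_eq NL_less)
  then show "NL (\<lambda>w e. \<not> e i < e j)" by (subst NL_cong) auto
qed (rule NL_less)

lemma dec_add: "dec (\<lambda>w e. e i + e j = e k)"
  by (simp add: dec_def NL_add NL_not_add)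

lemma dec_zero: "dec (\<lambda>w e. e i = 0)"
  using dec_add[of i i i] by simp

lemma dec_Suc: "dec (\<lambda>w e. Suc (e i) = e j)"
proof -
  have "dec (\<lambda>w e. e i < e j \<and> \<not> (\<exists>v<cap w. e i < v \<and> v < e j))"
    by (intro dec_conj dec_not dec_ex dec_less)
  moreover have "Suc (e i) = e j \<longleftrightarrow> e i < e j \<and> \<not> (\<exists>v<cap w. e i < v \<and> v < e j)"
    if "\<And>i. e i < cap w" for w :: "sym list" and e
  proof
    assume *: "e i < e j \<and> \<not> (\<exists>v<cap w. e i < v \<and> v < e j)"
    then have "Suc (e i) < cap w" using that[of j] by linarith
    then have "\<not> Suc (e i) < e j" using * by blast
    with * show "Suc (e i) = e j" by linarith
  qed auto
  ultimately show ?thesis by (subst dec_cong) auto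
qed

lemma dec_tc1:
  assumes "dec (\<lambda>w e. S w (\<lambda>i. e (i + 2)) (e 0) (e 1))"
  shows "dec (\<lambda>w e. (e i, e j) \<in> tc1 w (S w e))"
  by (rule decI) (rule NL_tc1 NL_not_tc1; rule dec_NL[OF assms] dec_NL_not[OF assms])+

text \<open>A term is given by its graph, and its value may exceed the registers: then it equals no
  argument, and the equation is decided as false.\<close>

definition dfun :: "(sym list \<Rightarrow> (nat \<Rightarrow> nat) \<Rightarrow> nat) \<Rightarrow> bool" where
  "dfun t \<longleftrightarrow> dec (\<lambda>w e. t w (\<lambda>i. e (Suc i)) = e 0)"

lemma dfun_inst: "dfun t \<Longrightarrow> dec (\<lambda>w e. t w (\<lambda>i. e (g i)) = e j)"
  using dec_subst[of "\<lambda>w e. t w (\<lambda>i. e (Suc i)) = e 0" "case_nat j g"] by (simp add: dfun_def)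

lemma dec_eq_var: "dfun t \<Longrightarrow> dec (\<lambda>w e. t w e = e j)"
  by (rule dfun_inst)

lemma dfun_var: "dfun (\<lambda>w e. e i)"
  by (simp add: dfun_def dec_eq)

lemma dfun_Suc: assumes "dfun t" shows "dfun (\<lambda>w e. Suc (t w e))"
proof -
  have "dec (\<lambda>w e. \<exists>v<cap w. t w (\<lambda>i. e (Suc i)) = v \<and> Suc v = e 0)"
    by (intro dec_ex dec_conj dfun_inst[OF assms] dec_Suc)
  moreover have "Suc (t w (\<lambda>i. e (Suc i))) = e 0 \<longleftrightarrow> (\<exists>v<cap w. t w (\<lambda>i. e (Suc i)) = v \<and> Suc v = e 0)"
    if "\<And>i. e i < cap w" for w e
    using that[of 0] by auto
  ultimately show ?thesis unfolding dfun_def by (subst dec_cong) auto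
qed

lemma dfun_const: "dfun (\<lambda>w e. c)"
proof (induction c)
  case 0
  then show ?case using dec_zero[of 0] by (simp add: dfun_def)
next
  case (Suc c)
  then show ?case by (rule dfun_Suc[of "\<lambda>_ _. c"])
qed

lemma dfun_add:
  assumes "dfun t" "dfun t'"
  shows "dfun (\<lambda>w e. t w e + t' w e)"
proof -
  have "dec (\<lambda>w e. \<exists>a<cap w. \<exists>b<cap w. t w (\<lambda>i. e (Suc i)) = a \<and> t' w (\<lambda>i. e (Suc i)) = b \<and> a + b = e 0)"
    by (intro dec_ex dec_conj dfun_inst[OF assms(1)] dfun_inst[OF assms(2)] dec_add)
  moreover have "t w (\<lambda>i. e (Suc i)) + t' w (\<lambda>i. e (Suc i)) = e 0 \<longleftrightarrow>
      (\<exists>a<cap w. \<exists>b<cap w. t w (\<lambda>i. e (Suc i)) = a \<and> t' w (\<lambda>i. e (Suc i)) = b \<and> a + b = e 0)"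
    if "\<And>i. e i < cap w" for w e
    using that[of 0] by auto
  ultimately show ?thesis unfolding dfun_def by (subst dec_cong) auto
qed

lemma multiplication_loop:
  assumes "x < cap w" "n < cap w" "v < cap w"
  shows "((0, 0), (n, v)) \<in> tc2 w (\<lambda>a b c d. Suc a = c \<and> b + x = d) \<longleftrightarrow> v = n * x"
proof
  assume "((0, 0), (n, v)) \<in> tc2 w (\<lambda>a b c d. Suc a = c \<and> b + x = d)"
  then show "v = n * x" unfolding tc2_def by (induction rule: rtrancl_induct2) auto
next
  have "n < cap w \<Longrightarrow> n * x < cap w \<Longrightarrow> ((0, 0), (n, n * x)) \<in> tc2 w (\<lambda>a b c d. Suc a = c \<and> b + x = d)"
    unfolding tc2_def
  proof (induction n)
    case (Suc n)
    then show ?case by (intro rtrancl.rtrancl_into_rtrancl[OF Suc.IH]) (auto simp: add.commute)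
  qed simp
  then show "v = n * x \<Longrightarrow> ((0, 0), (n, v)) \<in> tc2 w (\<lambda>a b c d. Suc a = c \<and> b + x = d)"
    using assms by simp
qed

lemma dec_mult: "dec (\<lambda>w e. e i * e j = e k)"
proof (rule decI)
  let ?R = "\<lambda>w x. tc2 w (\<lambda>a b c d. Suc a = c \<and> b + x = (d :: nat))"
  have "NL (\<lambda>w e. \<exists>z<cap w. z = 0 \<and> ((z, z), (e j, e k)) \<in> ?R w (e i))"
    by (intro NL_ex NL_conj NL_tc2 NL_zero NL_Suc NL_add)
  moreover have "e i * e j = e k \<longleftrightarrow> (\<exists>z<cap w. z = 0 \<and> ((z, z), (e j, e k)) \<in> ?R w (e i))"
    if "\<And>i. e i < cap w" for w e
    using that by (auto simp: multiplication_loop cap_pos mult.commute)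
  ultimately show "NL (\<lambda>w e. e i * e j = e k)" by (subst NL_cong) auto
  \<comment> \<open>The product differs from \<open>e k\<close> if repeated addition ends with
    another value, or if it leaves the register range before its last round.\<close>
  have "NL (\<lambda>w e. \<exists>z<cap w. z = 0 \<and> (\<exists>c<cap w. \<exists>b<cap w. ((z, z), (c, b)) \<in> ?R w (e i) \<and>
      ((c = e j \<and> b \<noteq> e k) \<or> (c < e j \<and> (\<exists>u<cap w. b + e i = u + cap w)))))"
    by (intro NL_ex NL_conj NL_disj NL_tc2 NL_zero NL_Suc NL_add NL_eq NL_neq NL_less NL_add_over)
  moreover have "e i * e j \<noteq> e k \<longleftrightarrow> (\<exists>z<cap w. z = 0 \<and> (\<exists>c<cap w. \<exists>b<cap w. ((z, z), (c, b)) \<in> ?R w (e i) \<and>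
      ((c = e j \<and> b \<noteq> e k) \<or> (c < e j \<and> (\<exists>u<cap w. b + e i = u + cap w)))))" (is "?l \<longleftrightarrow> ?r")
    if bound: "\<And>i. e i < cap w" for w e
  proof -
    have "?r \<longleftrightarrow> (\<exists>c<cap w. c * e i < cap w \<and>
      ((c = e j \<and> c * e i \<noteq> e k) \<or> (c < e j \<and> (\<exists>u<cap w. c * e i + e i = u + cap w))))"
    proof -
      have "?r \<longleftrightarrow> (\<exists>c<cap w. \<exists>b<cap w. b = c * e i \<and>
        ((c = e j \<and> b \<noteq> e k) \<or> (c < e j \<and> (\<exists>u<cap w. b + e i = u + cap w))))"
        using multiplication_loop[OF bound] cap_pos[of w] by (simp cong: conj_cong)
      then show ?thesis by auto
    qed
    also have "\<dots> \<longleftrightarrow> ?l"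
    proof
      assume "\<exists>c<cap w. c * e i < cap w \<and>
        ((c = e j \<and> c * e i \<noteq> e k) \<or> (c < e j \<and> (\<exists>u<cap w. c * e i + e i = u + cap w)))"
      then obtain c where "c < cap w" "c * e i < cap w"
        "(c = e j \<and> c * e i \<noteq> e k) \<or> (c < e j \<and> cap w \<le> c * e i + e i)" by auto
      then show ?l
      proof (elim disjE)
        assume c: "c < e j \<and> cap w \<le> c * e i + e i"
        then have "Suc c * e i \<le> e j * e i" by (intro mult_right_mono) auto
        then show ?l using c bound[of k] by (simp add: mult.commute)
      qed (auto simp: mult.commute)
    next
      assume l: ?l
      show "\<exists>c<cap w. c * e i < cap w \<and>
        ((c = e j \<and> c * e i \<noteq> e k) \<or> (c < e j \<and> (\<exists>u<cap w. c * e i + e i = u + cap w)))"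
      proof (cases "e j * e i < cap w")
        case True
        then show ?thesis using l bound[of j] by (auto simp: mult.commute)
      next
        case False
        then obtain n where n: "cap w \<le> n * e i" "\<And>m. m < n \<Longrightarrow> m * e i < cap w" "n \<le> e j"
          using exists_least_iff[of "\<lambda>n. cap w \<le> n * e i"] by (metis not_le)
        obtain c where c: "n = Suc c" using n(1) cap_pos[of w] by (cases n) auto
        have "c * e i < cap w" using n(2)[of c] c by simp
        moreover have "c < e j" "c < cap w" using c n(3) bound[of j] by simp_all
        moreover have "c * e i + e i = (c * e i + e i - cap w) + cap w" "c * e i + e i - cap w < cap w"
          using n(1) c calculation(1) bound[of i] by auto
        ultimately show ?thesis by blast
      qed
    qed
    finally show ?thesis by blast
  qed
  ultimately show "NL (\<lambda>w e. e i * e j \<noteq> e k)" by (subst NL_cong) auto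
qed

lemma dfun_mult:
  assumes "dfun t" "dfun t'"
  shows "dfun (\<lambda>w e. t w e * t' w e)"
proof -
  \<comment> \<open>If the product is 0, one factor may be too large for a register; otherwise both
    factors are bounded by the product. Hence the separate case of a zero factor.\<close>
  have "dec (\<lambda>w e. \<exists>z<cap w. z = 0 \<and> ((e 0 = z \<and> (t w (\<lambda>i. e (Suc i)) = z \<or> t' w (\<lambda>i. e (Suc i)) = z)) \<or>
      (\<exists>a<cap w. \<exists>b<cap w. t w (\<lambda>i. e (Suc i)) = a \<and> t' w (\<lambda>i. e (Suc i)) = b \<and> a * b = e 0)))"
    by (intro dec_ex dec_conj dec_disj dfun_inst[OF assms(1)] dfun_inst[OF assms(2)] dec_mult dec_zero dec_eq)
  moreover have "t w (\<lambda>i. e (Suc i)) * t' w (\<lambda>i. e (Suc i)) = e 0 \<longleftrightarrow> (\<exists>z<cap w. z = 0 \<and>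
      ((e 0 = z \<and> (t w (\<lambda>i. e (Suc i)) = z \<or> t' w (\<lambda>i. e (Suc i)) = z)) \<or>
      (\<exists>a<cap w. \<exists>b<cap w. t w (\<lambda>i. e (Suc i)) = a \<and> t' w (\<lambda>i. e (Suc i)) = b \<and> a * b = e 0)))"
    if "\<And>i. e i < cap w" for w e
  proof (cases "e 0 = 0")
    case False
    have "a \<le> a * b" "b \<le> a * b" if "a * b = e 0" for a b
      using that False by (cases a; cases b; simp)+
    then show ?thesis using that[of 0] False by (auto; metis le_less_trans)
  qed (auto simp: cap_pos)
  ultimately show ?thesis unfolding dfun_def by (subst dec_cong) auto
qed

text \<open>The bound puts \<open>c\<close> below every \<open>cap w\<close>, even for the empty
  input, so that a register can hold it.\<close>

lemma dec_eq_const: "dfun t \<Longrightarrow> c < 2 ^ 8 \<Longrightarrow> dec (\<lambda>w e. t w e = c)"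
proof -
  assume t: "dfun t" and c: "c < 2 ^ 8"
  have c_less: "c < cap w" for w
  proof -
    have "2 ^ 8 \<le> (length w + 2) ^ 8" by (rule power_mono) simp_all
    then show ?thesis using cap_ge[of w] c by linarith
  qed
  have "dec (\<lambda>w e. \<exists>v<cap w. c = v \<and> t w e = v)"
    by (intro dec_ex dec_conj dfun_inst[OF t] dec_eq_var dfun_const)
  then show ?thesis using c_less by simp
qed

text \<open>The negated form is chosen for terms beyond the register range: they have no value
  \<open>v\<close> to refute the inequality.\<close>

lemma dec_less_term: "dfun t \<Longrightarrow> dec (\<lambda>w e. e i < t w e)"
proof -
  assume t: "dfun t"
  have "dec (\<lambda>w e. \<not> (\<exists>v<cap w. t w e = v \<and> \<not> e i < v))"
    by (intro dec_ex dec_conj dec_not dec_less dfun_inst[OF t])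
  moreover have "e i < t w e \<longleftrightarrow> \<not> (\<exists>v<cap w. t w e = v \<and> \<not> e i < v)" if "\<And>i. e i < cap w" for w e
    using that[of i] by auto
  ultimately show ?thesis by (subst dec_cong) auto
qed

section \<open>The input length and the input cells\<close>

lemma small_less_cap: "length w + 1 < cap w" "(length w + 2) ^ 3 \<le> cap w"
proof -
  have "length w + 2 \<le> (length w + 2) ^ 8" by (rule self_le_power) auto
  then show "length w + 1 < cap w" using cap_ge[of w] by linarith
  have "(length w + 2) ^ 3 \<le> (length w + 2) ^ 8" by (rule power_increasing) auto
  then show "(length w + 2) ^ 3 \<le> cap w" using cap_ge[of w] by linarith
qed

lemma input_cell_end: "h \<le> length w + 1 \<and> input_cell w h = RightEnd \<longleftrightarrow> h = length w + 1"
  by (auto simp: input_cell_def)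

lemma NL_end: "NL (\<lambda>w e. e i = length w + 1)"
  using NL_cell[of i RightEnd] unfolding input_cell_end .

lemma dfun_length: "dfun (\<lambda>w e. length w + 1)"
  unfolding dfun_def
proof (rule decI)
  show "NL (\<lambda>w e. length w + 1 = e 0)" using NL_end[of 0] by (simp add: eq_commute)
  have "NL (\<lambda>w e. \<exists>u<cap w. u = length w + 1 \<and> u \<noteq> e 0)"
    by (intro NL_ex NL_conj NL_end NL_neq)
  then show "NL (\<lambda>w e. length w + 1 \<noteq> e 0)" using small_less_cap(1) by simp
qed

lemma dec_cell: "dec (\<lambda>w e. input_cell w (e i) = Symbol s)"
proof (rule decI)
  have "NL (\<lambda>w e. e i \<le> length w + 1 \<and> input_cell w (e i) = Symbol s)" by (rule NL_cell)
  moreover have "(e i \<le> length w + 1 \<and> input_cell w (e i) = Symbol s) \<longleftrightarrow> input_cell w (e i) = Symbol s"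
    for w and e :: "nat \<Rightarrow> nat"
    by (auto simp: input_cell_def)
  ultimately show "NL (\<lambda>w e. input_cell w (e i) = Symbol s)" by simp
  let ?P = "\<lambda>c w e. c \<noteq> Symbol s \<and> (e i \<le> length w + 1 \<and> input_cell w (e i) = c)"
  have "NL (\<lambda>w e. ((?P LeftEnd w e \<or> ?P RightEnd w e) \<or>
      (?P (Symbol Sep) w e \<or> (?P (Symbol (Bit True)) w e \<or> ?P (Symbol (Bit False)) w e))) \<or>
      (\<exists>u<cap w. u = length w + 1 \<and> u < e i))"
    by (intro NL_disj NL_conj NL_const NL_cell NL_ex NL_end NL_less)
  moreover have "((?P LeftEnd w e \<or> ?P RightEnd w e) \<or>
      (?P (Symbol Sep) w e \<or> (?P (Symbol (Bit True)) w e \<or> ?P (Symbol (Bit False)) w e))) \<or>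
      (\<exists>u<cap w. u = length w + 1 \<and> u < e i) \<longleftrightarrow> input_cell w (e i) \<noteq> Symbol s" (is "?l \<longleftrightarrow> ?r")
    for w and e :: "nat \<Rightarrow> nat"
  proof (cases "e i \<le> length w + 1")
    case True
    obtain c where c: "input_cell w (e i) = c" by blast
    have "c = LeftEnd \<or> c = RightEnd \<or> c = Symbol Sep \<or> c = Symbol (Bit True) \<or> c = Symbol (Bit False)"
      by (metis cell.exhaust sym.exhaust)
    then show ?thesis using True c by auto
  next
    case False
    then show ?thesis using small_less_cap(1)[of w] by (auto simp: input_cell_def)
  qed
  ultimately show "NL (\<lambda>w e. input_cell w (e i) \<noteq> Symbol s)" by simp
qed

subsection \<open>Transitive closure on tuples of input positions\<close>

lemma rtrancl_code:
  assumes "inj_on f D" "R \<subseteq> D \<times> D" "x \<in> D" "y \<in> D"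
  shows "(f x, f y) \<in> {(f a, f b) | a b. (a, b) \<in> R}\<^sup>* \<longleftrightarrow> (x, y) \<in> R\<^sup>*"
proof
  have "\<exists>b\<in>D. z = f b \<and> (x, b) \<in> R\<^sup>*" if "(f x, z) \<in> {(f a, f b) | a b. (a, b) \<in> R}\<^sup>*" for z
    using that
  proof (induction rule: rtrancl_induct)
    case (step y z)
    then obtain b a c where "b \<in> D" "y = f b" "(x, b) \<in> R\<^sup>*" "y = f a" "z = f c" "(a, c) \<in> R" by blast
    moreover from this have "a \<in> D" "c \<in> D" using assms(2) by auto
    ultimately show ?case using assms(1) by (metis inj_onD rtrancl.rtrancl_into_rtrancl)
  qed (use assms(3) in auto)
  moreover assume "(f x, f y) \<in> {(f a, f b) | a b. (a, b) \<in> R}\<^sup>*"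
  ultimately obtain b where "b \<in> D" "f y = f b" "(x, b) \<in> R\<^sup>*" by blast
  then show "(x, y) \<in> R\<^sup>*" using inj_onD[OF assms(1), of y b] assms(4) by simp
next
  assume "(x, y) \<in> R\<^sup>*"
  then show "(f x, f y) \<in> {(f a, f b) | a b. (a, b) \<in> R}\<^sup>*"
  proof (induction rule: rtrancl_induct)
    case (step y z)
    then have "(f y, f z) \<in> {(f a, f b) | a b. (a, b) \<in> R}" by blast
    with step.IH show ?case by (rule rtrancl.rtrancl_into_rtrancl)
  qed simp
qed

definition small_rel2 :: "sym list \<Rightarrow> (nat \<Rightarrow> nat \<Rightarrow> nat \<Rightarrow> nat \<Rightarrow> bool) \<Rightarrow> (nat \<times> nat) rel" where
  "small_rel2 w R = {((a, b), (c, d)). a < length w + 2 \<and> b < length w + 2 \<and> c < length w + 2 \<and> d < length w + 2 \<and>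
     R a b c d}"

definition small_rel3 :: "sym list \<Rightarrow> (nat \<Rightarrow> nat \<Rightarrow> nat \<Rightarrow> nat \<Rightarrow> nat \<Rightarrow> nat \<Rightarrow> bool) \<Rightarrow> (nat \<times> nat \<times> nat) rel" where
  "small_rel3 w R = {((a, b, c), (a', b', c')). a < length w + 2 \<and> b < length w + 2 \<and> c < length w + 2 \<and>
     a' < length w + 2 \<and> b' < length w + 2 \<and> c' < length w + 2 \<and> R a b c a' b' c'}"

definition code3 :: "sym list \<Rightarrow> nat \<Rightarrow> nat \<Rightarrow> nat \<Rightarrow> nat" where
  "code3 w a b c = (a * (length w + 2) + b) * (length w + 2) + c"

lemma code3_less:
  assumes "a < length w + 2" "b < length w + 2" "c < length w + 2"
  shows "code3 w a b c < cap w"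
proof -
  let ?C = "length w + 2"
  have "a * ?C + b < (a + 1) * ?C" using assms by simp
  also have "\<dots> \<le> ?C * ?C" using assms by (intro mult_right_mono) auto
  finally have "(a * ?C + b) + 1 \<le> ?C * ?C" by simp
  then have "((a * ?C + b) + 1) * ?C \<le> ?C * ?C * ?C" by (rule mult_right_mono) simp
  then have "(a * ?C + b) * ?C + c < ?C * ?C * ?C" using assms(3) by (simp add: algebra_simps)
  then show ?thesis using small_less_cap(2)[of w] by (simp add: code3_def power3_eq_cube)
qed

lemma code3_inject:
  assumes "b < length w + 2" "c < length w + 2" "b' < length w + 2" "c' < length w + 2"
  shows "code3 w a b c = code3 w a' b' c' \<longleftrightarrow> a = a' \<and> b = b' \<and> c = c'"
proof
  let ?C = "length w + 2"
  have div: "(x * C + y) div C = x" "(x * C + y) mod C = y" if "y < C" for x y C :: nat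
    using that by auto
  assume "code3 w a b c = code3 w a' b' c'"
  then have "a * ?C + b = a' * ?C + b'" "c = c'"
    unfolding code3_def using div assms(2,4) by metis+
  then show "a = a' \<and> b = b' \<and> c = c'" using div assms(1,3) by metis
qed auto

lemma dfun_code3: "dfun t \<Longrightarrow> dfun t' \<Longrightarrow> dfun t'' \<Longrightarrow> dfun (\<lambda>w e. code3 w (t w e) (t' w e) (t'' w e))"
proof -
  assume "dfun t" "dfun t'" "dfun t''"
  then have "dfun (\<lambda>w e. (t w e * Suc (length w + 1) + t' w e) * Suc (length w + 1) + t'' w e)"
    by (intro dfun_add dfun_mult dfun_Suc dfun_length)
  then show ?thesis by (simp add: code3_def)
qed

lemma dec_small: "dec (\<lambda>w e. e i < length w + 2)"
proof -
  have "dec (\<lambda>w e. e i < Suc (length w + 1))" by (intro dec_less_term dfun_Suc dfun_length)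
  then show ?thesis by simp
qed

lemma dec_small_rel3:
  assumes "dec (\<lambda>w e. R w (\<lambda>i. e (i + 6)) (e 0) (e 1) (e 2) (e 3) (e 4) (e 5))"
  shows "dec (\<lambda>w e. ((e i, e j, e k), (e i', e j', e k')) \<in> (small_rel3 w (R w e))\<^sup>*)"
proof -
  have R: "dec (\<lambda>w e. R w (\<lambda>i. e (g i)) (e a) (e b) (e c) (e d) (e f) (e h))" for g a b c d f h
    using dec_subst[OF assms, of "\<lambda>i. if i = 0 then a else if i = 1 then b else if i = 2 then c
      else if i = 3 then d else if i = 4 then f else if i = 5 then h else g (i - 6)"] by simp
  define S where "S w e X Y \<longleftrightarrow> (\<exists>a<cap w. \<exists>b<cap w. \<exists>c<cap w. \<exists>a'<cap w. \<exists>b'<cap w. \<exists>c'<cap w.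
      code3 w a b c = X \<and> code3 w a' b' c' = Y \<and> a < length w + 2 \<and> b < length w + 2 \<and> c < length w + 2 \<and>
      a' < length w + 2 \<and> b' < length w + 2 \<and> c' < length w + 2 \<and> R w e a b c a' b' c')" for w e X Y
  have S: "dec (\<lambda>w e. S w (\<lambda>i. e (g i)) (e X) (e Y))" for g X Y
    unfolding S_def by (intro dec_ex dec_conj dec_eq_var dfun_code3 dfun_var dec_small R)
  \<comment> \<open>The closure is reflexive also on triples outside the coded range, so equality is
    listed apart.\<close>
  have "dec (\<lambda>w e. (e i = e i' \<and> e j = e j' \<and> e k = e k') \<or>
      (e i < length w + 2 \<and> e j < length w + 2 \<and> e k < length w + 2 \<and>
       e i' < length w + 2 \<and> e j' < length w + 2 \<and> e k' < length w + 2 \<and>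
       (\<exists>X<cap w. \<exists>Y<cap w. code3 w (e i) (e j) (e k) = X \<and> code3 w (e i') (e j') (e k') = Y \<and>
         (X, Y) \<in> tc1 w (S w e))))"
    by (intro dec_disj dec_conj dec_eq dec_small dec_ex dec_eq_var dfun_code3 dfun_var dec_tc1 S)
  moreover have "(x = x' \<and> y = y' \<and> z = z') \<or> (x < length w + 2 \<and> y < length w + 2 \<and> z < length w + 2 \<and>
       x' < length w + 2 \<and> y' < length w + 2 \<and> z' < length w + 2 \<and>
       (\<exists>X<cap w. \<exists>Y<cap w. code3 w x y z = X \<and> code3 w x' y' z' = Y \<and> (X, Y) \<in> tc1 w (S w e))) \<longleftrightarrow>
      ((x, y, z), (x', y', z')) \<in> (small_rel3 w (R w e))\<^sup>*" (is "?l \<longleftrightarrow> ?r") for w e x y z x' y' z'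
  proof -
    let ?D = "{..<length w + 2} \<times> {..<length w + 2} \<times> {..<length w + 2}"
    let ?f = "\<lambda>(a, b, c). code3 w a b c"
    have inj: "inj_on ?f ?D" by (auto simp: inj_on_def code3_inject)
    have sub: "small_rel3 w (R w e) \<subseteq> ?D \<times> ?D" by (auto simp: small_rel3_def)
    have lt: "a < length w + 2 \<Longrightarrow> a < cap w" for a using small_less_cap(1)[of w] by linarith
    have S_iff: "S w e X Y \<longleftrightarrow> (\<exists>a b. (a, b) \<in> small_rel3 w (R w e) \<and> X = ?f a \<and> Y = ?f b)" for X Y
    proof
      assume "S w e X Y"
      then obtain a b c a' b' c' where *: "code3 w a b c = X" "code3 w a' b' c' = Y" "a < length w + 2"
        "b < length w + 2" "c < length w + 2" "a' < length w + 2" "b' < length w + 2" "c' < length w + 2"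
        "R w e a b c a' b' c'" unfolding S_def by blast
      then show "\<exists>a b. (a, b) \<in> small_rel3 w (R w e) \<and> X = ?f a \<and> Y = ?f b"
        by (intro exI[of _ "(a, b, c)"] exI[of _ "(a', b', c')"]) (simp add: small_rel3_def)
    next
      assume "\<exists>a b. (a, b) \<in> small_rel3 w (R w e) \<and> X = ?f a \<and> Y = ?f b"
      then obtain a b c a' b' c' where "((a, b, c), (a', b', c')) \<in> small_rel3 w (R w e)"
        "X = code3 w a b c" "Y = code3 w a' b' c'" by auto
      moreover from this have "a < length w + 2" "b < length w + 2" "c < length w + 2"
        "a' < length w + 2" "b' < length w + 2" "c' < length w + 2" "R w e a b c a' b' c'"
        by (simp_all add: small_rel3_def)
      moreover from this have "a < cap w" "b < cap w" "c < cap w" "a' < cap w" "b' < cap w" "c' < cap w"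
        using lt by blast+
      ultimately show "S w e X Y" unfolding S_def by blast
    qed
    have code_less: "?f a < cap w" "?f b < cap w" if "(a, b) \<in> small_rel3 w (R w e)" for a b
      using that by (auto simp: small_rel3_def intro!: code3_less)
    then have S_eq: "{(X, Y). X < cap w \<and> Y < cap w \<and> S w e X Y} = {(?f a, ?f b) | a b. (a, b) \<in> small_rel3 w (R w e)}"
      unfolding S_iff by blast
    have code: "(x, y, z) \<in> ?D \<Longrightarrow> (x', y', z') \<in> ?D \<Longrightarrow> (code3 w x y z, code3 w x' y' z') \<in> tc1 w (S w e) \<longleftrightarrow> ?r"
      using rtrancl_code[OF inj sub, of "(x, y, z)" "(x', y', z')"] unfolding tc1_def S_eq prod.case by blast
    have "?r \<Longrightarrow> (x, y, z) = (x', y', z') \<or> (x, y, z) \<in> ?D \<and> (x', y', z') \<in> ?D"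
    proof (cases "(x, y, z) = (x', y', z')")
      case False
      assume r: ?r
      obtain u where "((x, y, z), u) \<in> small_rel3 w (R w e)" using False r by (meson converse_rtranclE)
      moreover obtain u' where "(u', (x', y', z')) \<in> small_rel3 w (R w e)" using False r by (meson rtranclE)
      ultimately show ?thesis using sub by blast
    qed auto
    then show ?thesis using code code3_less by auto
  qed
  ultimately show ?thesis by simp
qed

lemma small_rel2_rel3:
  assumes "z < length w + 2"
  shows "((a, b), (c, d)) \<in> (small_rel2 w R)\<^sup>* \<longleftrightarrow>
    ((a, b, z), (c, d, z)) \<in> (small_rel3 w (\<lambda>a b y c d y'. R a b c d \<and> y = y'))\<^sup>*"
proof
  assume "((a, b), (c, d)) \<in> (small_rel2 w R)\<^sup>*"
  then show "((a, b, z), (c, d, z)) \<in> (small_rel3 w (\<lambda>a b y c d y'. R a b c d \<and> y = y'))\<^sup>*"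
    by (induction rule: rtrancl_induct2)
      (use assms in \<open>auto simp: small_rel2_def small_rel3_def intro: rtrancl.rtrancl_into_rtrancl\<close>)
next
  have "((a, b), (fst y, fst (snd y))) \<in> (small_rel2 w R)\<^sup>*"
    if "((a, b, z), y) \<in> (small_rel3 w (\<lambda>a b y c d y'. R a b c d \<and> y = y'))\<^sup>*" for y
    using that
    by (induction rule: rtrancl_induct)
      (auto simp: small_rel2_def small_rel3_def intro: rtrancl.rtrancl_into_rtrancl)
  from this[of "(c, d, z)"] show "((a, b, z), (c, d, z)) \<in> (small_rel3 w (\<lambda>a b y c d y'. R a b c d \<and> y = y'))\<^sup>* \<Longrightarrow>
    ((a, b), (c, d)) \<in> (small_rel2 w R)\<^sup>*" by simp
qed

lemma dec_small_rel2:
  assumes "dec (\<lambda>w e. R w (\<lambda>i. e (i + 4)) (e 0) (e 1) (e 2) (e 3))"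
  shows "dec (\<lambda>w e. ((e i, e j), (e k, e l)) \<in> (small_rel2 w (R w e))\<^sup>*)"
proof -
  have R: "dec (\<lambda>w e. R w (\<lambda>i. e (g i)) (e a) (e b) (e c) (e d))" for g a b c d
    using dec_subst[OF assms, of "\<lambda>i. if i = 0 then a else if i = 1 then b else if i = 2 then c
      else if i = 3 then d else g (i - 4)"] by simp
  have "dec (\<lambda>w e. \<exists>z<cap w. z = 0 \<and>
      ((e i, e j, z), (e k, e l, z)) \<in> (small_rel3 w (\<lambda>a b y c d y'. R w e a b c d \<and> y = y'))\<^sup>*)"
    by (intro dec_ex dec_conj dec_zero dec_small_rel3 R dec_eq)
  moreover have "(\<exists>z<cap w. z = 0 \<and>
      ((a, b, z), (c, d, z)) \<in> (small_rel3 w (\<lambda>a b y c d y'. R w e a b c d \<and> y = y'))\<^sup>*) \<longleftrightarrow>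
      ((a, b), (c, d)) \<in> (small_rel2 w (R w e))\<^sup>*" for w e a b c d
    using small_rel2_rel3[of 0 w a b c d "R w e"] cap_pos[of w] by auto
  ultimately show ?thesis by simp
qed

text \<open>A recursion over input positions with small values needs no stored table: its graph is
  the set of pairs on the path from \<open>(0, g w 0)\<close> that follows
  \<open>step\<close>.\<close>

lemma dec_recursion:
  assumes "\<And>w p. p < length w + 2 \<Longrightarrow> g w p < length w + 2"
    and "dfun (\<lambda>w e. g w 0)"
    and "dec (\<lambda>w e. step w (e 0) (e 1) (e 2))"
    and "\<And>w p x. Suc p < length w + 2 \<Longrightarrow> x < length w + 2 \<Longrightarrow> step w p (g w p) x \<longleftrightarrow> g w (Suc p) = x"
  shows "dec (\<lambda>w e. e i < length w + 2 \<and> g w (e i) = e j)"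
proof -
  have step: "dec (\<lambda>w e. step w (e a) (e b) (e c))" for a b c
    using dec_subst[OF assms(3), of "\<lambda>i. if i = 0 then a else if i = 1 then b else c"] by simp
  let ?R = "\<lambda>w. small_rel2 w (\<lambda>p a p' b. Suc p = p' \<and> step w p a b)"
  have *: "dec (\<lambda>w e. \<exists>z<cap w. z = 0 \<and> (\<exists>a<cap w. g w 0 = a \<and> e i < length w + 2 \<and> ((z, a), (e i, e j)) \<in> (?R w)\<^sup>*))"
    by (intro dec_ex dec_conj dec_zero dec_small dec_small_rel2 dec_Suc step dec_eq_var assms(2))
  have sound: "x = g w p" if "((0, g w 0), (p, x)) \<in> (?R w)\<^sup>*" for w p x
    using that by (induction rule: rtrancl_induct2) (auto simp: small_rel2_def assms(4))
  have complete: "((0, g w 0), (p, g w p)) \<in> (?R w)\<^sup>*" if "p < length w + 2" for w p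
    using that
  proof (induction p)
    case (Suc p)
    then have "((p, g w p), (Suc p, g w (Suc p))) \<in> ?R w"
      using assms(1)[of p w] assms(1)[of "Suc p" w] assms(4)[of p w "g w (Suc p)"] by (auto simp: small_rel2_def)
    with Suc show ?case by (simp add: rtrancl.rtrancl_into_rtrancl)
  qed simp
  have "g w 0 < cap w" for w using assms(1)[of 0 w] small_less_cap(1)[of w] by simp
  then have "(\<exists>z<cap w. z = 0 \<and> (\<exists>a<cap w. g w 0 = a \<and> p < length w + 2 \<and> ((z, a), (p, x)) \<in> (?R w)\<^sup>*)) \<longleftrightarrow>
      p < length w + 2 \<and> g w p = x" for w p x
    using sound[of w p x] complete[of p w] cap_pos[of w] by auto
  with * show ?thesis by simp
qed

section \<open>The decision procedure as a formula\<close>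

primrec seps :: "sym list \<Rightarrow> nat \<Rightarrow> nat" where
  "seps w 0 = 0"
| "seps w (Suc p) = seps w p + of_bool (input_cell w (Suc p) = Symbol Sep)"

text \<open>Numbers are truncated at \<open>length w + 1\<close>, which no number occurring in the encoding of an FDFA
  exceeds.\<close>

primrec number :: "sym list \<Rightarrow> nat \<Rightarrow> nat" where
  "number w 0 = 0"
| "number w (Suc p) =
    (if input_cell w (Suc p) = Symbol (Bit True) then min (length w + 1) (number w p + number w p + 1)
     else if input_cell w (Suc p) = Symbol (Bit False) then min (length w + 1) (number w p + number w p)
     else 0)"

lemma seps_le: "seps w p \<le> p"
  by (induction p) auto

lemma number_less: "number w p < length w + 2"
  by (cases p) auto

lemma dec_min_eq:
  assumes "dfun t"
  shows "dec (\<lambda>w e. min (length w + 1) (t w e) = e i)"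
proof -
  have "dfun (\<lambda>w e. t w (\<lambda>i. e (Suc i)))"
    using dec_subst[of "\<lambda>w e. t w (\<lambda>i. e (Suc i)) = e 0" "case_nat 0 (\<lambda>i. Suc (Suc i))"] assms
    by (simp add: dfun_def)
  then have "dec (\<lambda>w e. \<exists>m<cap w. length w + 1 = m \<and> ((m < t w e \<and> m = e i) \<or> (\<not> m < t w e \<and> t w e = e i)))"
    by (intro dec_ex dec_conj dec_disj dec_not dec_less_term dec_eq_var dfun_length dec_eq)
  moreover have "min (length w + 1) (t w e) = e i \<longleftrightarrow>
      (\<exists>m<cap w. length w + 1 = m \<and> ((m < t w e \<and> m = e i) \<or> (\<not> m < t w e \<and> t w e = e i)))" for w e
    using small_less_cap(1)[of w] by (auto simp: min_def)
  ultimately show ?thesis by simp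
qed

lemma dec_seps: "dec (\<lambda>w e. e i < length w + 2 \<and> seps w (e i) = e j)"
proof (rule dec_recursion)
  show "seps w p < length w + 2" if "p < length w + 2" for w p using seps_le[of w p] that by simp
  show "dfun (\<lambda>w e. seps w 0)" by (simp add: dfun_const)
  show "dec (\<lambda>w e. \<exists>q<cap w. Suc (e 0) = q \<and> ((input_cell w q = Symbol Sep \<and> Suc (e 1) = e 2) \<or>
      (input_cell w q \<noteq> Symbol Sep \<and> e 1 = e 2)))"
    by (intro dec_ex dec_conj dec_disj dec_not dec_Suc dec_cell dec_eq)
  show "(\<exists>q<cap w. Suc p = q \<and> ((input_cell w q = Symbol Sep \<and> Suc (seps w p) = x) \<or>
      (input_cell w q \<noteq> Symbol Sep \<and> seps w p = x))) \<longleftrightarrow> seps w (Suc p) = x"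
    if "Suc p < length w + 2" for w p x
    using that small_less_cap(1)[of w] by auto
qed

lemma dec_number: "dec (\<lambda>w e. e i < length w + 2 \<and> number w (e i) = e j)"
proof (rule dec_recursion)
  show "number w p < length w + 2" for w p by (rule number_less)
  show "dfun (\<lambda>w e. number w 0)" by (simp add: dfun_const)
  show "dec (\<lambda>w e. \<exists>q<cap w. Suc (e 0) = q \<and>
      ((input_cell w q = Symbol (Bit True) \<and> min (length w + 1) (e 1 + e 1 + 1) = e 2) \<or>
       (input_cell w q = Symbol (Bit False) \<and> min (length w + 1) (e 1 + e 1) = e 2) \<or>
       (input_cell w q \<noteq> Symbol (Bit True) \<and> input_cell w q \<noteq> Symbol (Bit False) \<and> e 2 = 0)))"
    by (intro dec_ex dec_conj dec_disj dec_not dec_Suc dec_cell dec_min_eq dfun_add dfun_var dfun_const dec_zero)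
  show "(\<exists>q<cap w. Suc p = q \<and>
      ((input_cell w q = Symbol (Bit True) \<and> min (length w + 1) (number w p + number w p + 1) = x) \<or>
       (input_cell w q = Symbol (Bit False) \<and> min (length w + 1) (number w p + number w p) = x) \<or>
       (input_cell w q \<noteq> Symbol (Bit True) \<and> input_cell w q \<noteq> Symbol (Bit False) \<and> x = 0))) \<longleftrightarrow>
      number w (Suc p) = x" if "Suc p < length w + 2" for w p x
    using that small_less_cap(1)[of w] by auto
qed

text \<open>An item is identified by its closing separator in cell \<open>Suc p\<close>:
  \<open>i\<close> separators come before it, and the number read up to \<open>p\<close> is the
  whole item, since every separator resets \<open>number\<close>.\<close>

definition item :: "sym list \<Rightarrow> nat \<Rightarrow> nat \<Rightarrow> bool" where
  "item w i v \<longleftrightarrow> (\<exists>p<cap w. \<exists>q<cap w. Suc p = q \<and> input_cell w q = Symbol Sep \<and>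
     (p < length w + 2 \<and> seps w p = i) \<and> (p < length w + 2 \<and> number w p = v))"

lemma dec_item: "dec (\<lambda>w e. item w (e i) (e j))"
  unfolding item_def by (intro dec_ex dec_conj dec_Suc dec_cell dec_seps dec_number)

text \<open>The input as a random access memory. The default 0 makes it a total term;
  \<open>LEAST\<close> turns the relation \<open>item\<close> into a function before its values are
  known to be unique.\<close>

definition mem :: "sym list \<Rightarrow> nat \<Rightarrow> nat" where
  "mem w i = (LEAST v. item w i v \<or> v = 0 \<and> \<not> (\<exists>u<cap w. item w i u))"

lemma mem_eq_iff: "mem w i = v \<longleftrightarrow> (item w i v \<or> v = 0 \<and> \<not> (\<exists>u<cap w. item w i u)) \<and>
    \<not> (\<exists>u<cap w. u < v \<and> (item w i u \<or> u = 0 \<and> \<not> (\<exists>u<cap w. item w i u)))" (is "_ \<longleftrightarrow> ?A v \<and> _")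
  if "v < cap w"
proof -
  have "\<exists>v. ?A v" by blast
  then have A: "?A (mem w i)" unfolding mem_def by (rule LeastI_ex)
  have least: "\<not> ?A u" if "u < mem w i" for u
    using that unfolding mem_def by (rule not_less_Least)
  show ?thesis
  proof
    assume "mem w i = v"
    then show "?A v \<and> \<not> (\<exists>u<cap w. u < v \<and> ?A u)" using A least by blast
  next
    assume v: "?A v \<and> \<not> (\<exists>u<cap w. u < v \<and> ?A u)"
    then have "\<not> v < mem w i" using least by blast
    moreover have "\<not> mem w i < v" using v A that by (meson less_trans)
    ultimately show "mem w i = v" by simp
  qed
qed

lemma item_less: "item w i v \<Longrightarrow> i < cap w"
  by (auto simp: item_def intro: le_less_trans[OF seps_le])

lemma dfun_mem:
  assumes "dfun t"
  shows "dfun (\<lambda>w e. mem w (t w e))"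
proof -
  have zero: "mem w i = 0" if "\<not> i < cap w" for w i
  proof -
    have "\<not> (\<exists>u. item w i u)" using item_less that by blast
    then show ?thesis using cap_pos[of w] by (subst mem_eq_iff) auto
  qed
  have "dec (\<lambda>w e. (\<exists>i<cap w. t w (\<lambda>i. e (Suc i)) = i \<and>
      ((item w i (e 0) \<or> e 0 = 0 \<and> \<not> (\<exists>u<cap w. item w i u)) \<and>
      \<not> (\<exists>u<cap w. u < e 0 \<and> (item w i u \<or> u = 0 \<and> \<not> (\<exists>u<cap w. item w i u))))) \<or>
      (\<not> (\<exists>i<cap w. t w (\<lambda>i. e (Suc i)) = i) \<and> e 0 = 0))"
    by (intro dec_ex dec_conj dec_disj dec_not dec_less dec_zero dec_item dfun_inst[OF assms])
  moreover have "mem w (t w (\<lambda>i. e (Suc i))) = e 0 \<longleftrightarrow> (\<exists>i<cap w. t w (\<lambda>i. e (Suc i)) = i \<and>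
      ((item w i (e 0) \<or> e 0 = 0 \<and> \<not> (\<exists>u<cap w. item w i u)) \<and>
      \<not> (\<exists>u<cap w. u < e 0 \<and> (item w i u \<or> u = 0 \<and> \<not> (\<exists>u<cap w. item w i u))))) \<or>
      (\<not> (\<exists>i<cap w. t w (\<lambda>i. e (Suc i)) = i) \<and> e 0 = 0)" if "\<And>i. e i < cap w" for w e
  proof (cases "t w (\<lambda>i. e (Suc i)) < cap w")
    case True
    then show ?thesis using mem_eq_iff[OF that[of 0], of "t w (\<lambda>i. e (Suc i))"] by auto
  qed (use zero in auto)
  ultimately show ?thesis unfolding dfun_def by (subst dec_cong) auto
qed

text \<open>The code of an FDFA starts at item \<open>d\<close> of the input; \<open>offset d w q\<close> is the index of the first
  item of the \<open>q\<close>-th progress DFA.\<close>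

primrec offset :: "nat \<Rightarrow> sym list \<Rightarrow> nat \<Rightarrow> nat" where
  "offset d w 0 = min (length w + 1) (d + 3 + mem w (d + 1) * mem w d)"
| "offset d w (Suc q) = min (length w + 1) (offset d w q +
     (2 + mem w (offset d w q) * mem w d + mem w (offset d w q)))"

lemma offset_less: "offset d w q < length w + 2"
  by (cases q) auto

lemma dec_offset: "dec (\<lambda>w e. e i < length w + 2 \<and> offset d w (e i) = e j)"
proof (rule dec_recursion)
  show "offset d w p < length w + 2" for w p by (rule offset_less)
  show "dfun (\<lambda>w e. offset d w 0)"
    unfolding dfun_def offset.simps
    by (intro dec_min_eq dfun_add dfun_mult dfun_mem dfun_const)
  show "dec (\<lambda>w e. min (length w + 1) (e 1 + (2 + mem w (e 1) * mem w d + mem w (e 1))) = e 2)"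
    by (intro dec_min_eq dfun_add dfun_mult dfun_mem dfun_const dfun_var)
qed simp

text \<open>\<open>offset\<close> is decided only for small arguments; the default makes it a total
  term.\<close>

definition off :: "nat \<Rightarrow> sym list \<Rightarrow> nat \<Rightarrow> nat" where
  "off d w q = (if q < length w + 2 then offset d w q else 0)"

lemma dfun_off: "dfun (\<lambda>w e. off d w (e i))"
proof -
  have "dec (\<lambda>w e. (e (Suc i) < length w + 2 \<and> offset d w (e (Suc i)) = e 0) \<or>
      (\<not> e (Suc i) < length w + 2 \<and> e 0 = 0))"
    by (intro dec_conj dec_disj dec_not dec_offset dec_small dec_zero)
  moreover have "(\<lambda>w e. (e (Suc i) < length w + 2 \<and> offset d w (e (Suc i)) = e 0) \<or>
      (\<not> e (Suc i) < length w + 2 \<and> e 0 = (0 :: nat))) = (\<lambda>w e. off d w (e (Suc i)) = e 0)"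
    by (auto simp: off_def fun_eq_iff)
  ultimately show ?thesis unfolding dfun_def by simp
qed

text \<open>Items \<open>d\<close>, \<open>d + 1\<close> and \<open>d + 2\<close> hold the alphabet
  size, the number of leading states and the initial state; the transition table follows row by row.
  A progress DFA has its size, initial state, table and final flags, in this order.\<close>

definition lead_trans :: "nat \<Rightarrow> sym list \<Rightarrow> nat \<Rightarrow> nat \<Rightarrow> nat" where
  "lead_trans d w q a = mem w (d + 3 + (q * mem w d + a))"

definition prog_trans :: "nat \<Rightarrow> sym list \<Rightarrow> nat \<Rightarrow> nat \<Rightarrow> nat \<Rightarrow> nat" where
  "prog_trans d w q s a = mem w (off d w q + (2 + (s * mem w d + a)))"

definition prog_init :: "nat \<Rightarrow> sym list \<Rightarrow> nat \<Rightarrow> nat" where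
  "prog_init d w q = mem w (off d w q + 1)"

definition is_final :: "nat \<Rightarrow> sym list \<Rightarrow> nat \<Rightarrow> nat \<Rightarrow> bool" where
  "is_final d w q s \<longleftrightarrow> mem w (off d w q + (2 + (mem w (off d w q) * mem w d + s))) = 1"

definition pair_step :: "nat \<Rightarrow> sym list \<Rightarrow> nat \<Rightarrow> nat \<Rightarrow> nat \<Rightarrow> nat \<Rightarrow> nat \<Rightarrow> bool" where
  "pair_step d w q s r s' r' \<longleftrightarrow> (\<exists>a<cap w. a < mem w d \<and> prog_trans d w q s a = s' \<and> lead_trans d w r a = r')"

text \<open>Two copies of the progress DFA and the leading automaton read the same letter: the three
  conditions of \<open>idem\<close> concern one word, which cannot be stored.\<close>

definition triple_step :: "nat \<Rightarrow> sym list \<Rightarrow> nat \<Rightarrow> nat \<Rightarrow> nat \<Rightarrow> nat \<Rightarrow> nat \<Rightarrow> nat \<Rightarrow> nat \<Rightarrow> bool" where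
  "triple_step d w q s t r s' t' r' \<longleftrightarrow> (\<exists>a<cap w. a < mem w d \<and> prog_trans d w q s a = s' \<and>
     prog_trans d w q t a = t' \<and> lead_trans d w r a = r')"

definition lead_reachable :: "nat \<Rightarrow> sym list \<Rightarrow> nat \<Rightarrow> bool" where
  "lead_reachable d w q \<longleftrightarrow> (\<exists>i<cap w. mem w (d + 2) = i \<and>
     (i, q) \<in> tc1 w (\<lambda>r r'. \<exists>a<cap w. a < mem w d \<and> lead_trans d w r a = r'))"

text \<open>The last letter is read by a separate step, which makes the loop nonempty. The bound on
  \<open>s\<close> confines the second copy to states of the progress DFA.\<close>

definition idem_query :: "nat \<Rightarrow> sym list \<Rightarrow> nat \<Rightarrow> nat \<Rightarrow> bool" where
  "idem_query d w q s \<longleftrightarrow> s < mem w (off d w q) \<and> (\<exists>i<cap w. prog_init d w q = i \<and> (\<exists>x<cap w. \<exists>y<cap w. \<exists>z<cap w.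
     ((i, s, q), (x, y, z)) \<in> (small_rel3 w (triple_step d w q))\<^sup>* \<and> triple_step d w q x y z s s q))"

definition above_query :: "nat \<Rightarrow> sym list \<Rightarrow> nat \<Rightarrow> nat \<Rightarrow> nat \<Rightarrow> bool" where
  "above_query d w q s s' \<longleftrightarrow> ((s, q), (s', q)) \<in> (small_rel2 w (pair_step d w q))\<^sup>*"

text \<open>Conditions on a chain concern neighbours only, so the current state and the length so
  far, starting at 1, are enough to guess it. The inner queries are closed under complement, as
  needed for steps of a closure that will itself be negated.\<close>

definition chain_query :: "nat \<Rightarrow> bool \<Rightarrow> sym list \<Rightarrow> nat \<Rightarrow> bool" where
  "chain_query d b w k \<longleftrightarrow> (\<exists>q<cap w. lead_reachable d w q \<and> (\<exists>s<cap w. idem_query d w q s \<and>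
     (is_final d w q s \<longleftrightarrow> b) \<and> (\<exists>i<cap w. i = 1 \<and> (\<exists>t<cap w. ((s, i), (t, k)) \<in>
       (small_rel2 w (\<lambda>s i s' i'. Suc i = i' \<and> above_query d w q s s' \<and> idem_query d w q s' \<and>
         \<not> (is_final d w q s \<longleftrightarrow> is_final d w q s')))\<^sup>*))))"

lemmas dfun_intros = dfun_add dfun_mult dfun_mem dfun_off dfun_const dfun_var

lemma dec_triple_step:
  "dec (\<lambda>w e. triple_step d w (e a) (e b) (e c) (e f) (e g) (e h) (e i))"
  unfolding triple_step_def prog_trans_def lead_trans_def
  by (intro dec_ex dec_conj dec_less_term dec_eq_var dfun_intros)

lemma dec_pair_step: "dec (\<lambda>w e. pair_step d w (e a) (e b) (e c) (e f) (e g))"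
  unfolding pair_step_def prog_trans_def lead_trans_def
  by (intro dec_ex dec_conj dec_less_term dec_eq_var dfun_intros)

lemma dec_lead_reachable: "dec (\<lambda>w e. lead_reachable d w (e i))"
  unfolding lead_reachable_def lead_trans_def
  by (intro dec_ex dec_conj dec_less_term dec_eq_var dfun_intros dec_tc1)

lemma dec_idem_query: "dec (\<lambda>w e. idem_query d w (e i) (e j))"
  unfolding idem_query_def prog_init_def
  by (intro dec_ex dec_conj dec_less_term dec_eq_var dfun_intros dec_small_rel3 dec_triple_step)

lemma dec_above_query: "dec (\<lambda>w e. above_query d w (e i) (e j) (e k))"
  unfolding above_query_def by (intro dec_small_rel2 dec_pair_step)

lemma dec_is_final: "dec (\<lambda>w e. is_final d w (e i) (e j))"
  unfolding is_final_def by (intro dec_eq_const dfun_intros) simp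

lemma dec_one: "dec (\<lambda>w e. e i = 1)"
  by (intro dec_eq_const dfun_var) simp

lemma dec_chain_query: "dec (\<lambda>w e. chain_query d b w (e i))"
  unfolding chain_query_def
  by (intro dec_ex dec_conj dec_iff dec_not dec_const dec_one dec_Suc dec_small_rel2 dec_lead_reachable
      dec_idem_query dec_is_final dec_above_query)

subsection \<open>Reading the encoding\<close>

lemma input_cell_append [simp]: "input_cell (xs @ c # ys) (Suc (length xs)) = Symbol c"
  by (simp add: input_cell_def)

lemma seps_prefix: "seps (xs @ ys) (length xs) = length (filter (\<lambda>c. c = Sep) xs)"
proof (induction xs arbitrary: ys rule: rev_induct)
  case (snoc c xs)
  then show ?case using snoc.IH[of "c # ys"] by simp
qed simp

text \<open>A preceding separator has reset the value, so the digits of \<open>n\<close> are read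
  from 0 by doubling; truncation commutes with each such step.\<close>

lemma number_binary:
  assumes "xs = [] \<or> last xs = Sep"
  shows "number (xs @ binary n @ ys) (length xs + length (binary n)) = min (length (xs @ binary n @ ys) + 1) n"
proof (induction n arbitrary: ys rule: less_induct)
  case (less n)
  show ?case
  proof (cases "n = 0")
    case True
    then have b: "binary n = []" by (subst binary.simps) simp
    show ?thesis
    proof (cases xs rule: rev_cases)
      case (snoc xs' c)
      then have "c = Sep" using assms by simp
      then show ?thesis using snoc True b by simp
    qed (use True b in simp)
  next
    case False
    then have b: "binary n = binary (n div 2) @ [Bit (odd n)]" by (subst binary.simps) simp
    let ?w = "xs @ binary n @ ys"
    let ?p = "length xs + length (binary (n div 2))"
    have w: "?w = xs @ binary (n div 2) @ Bit (odd n) # ys" unfolding b by simp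
    have IH: "number ?w ?p = min (length ?w + 1) (n div 2)"
      unfolding w by (rule less.IH) (use False in simp)
    have cell: "input_cell ?w (Suc ?p) = Symbol (Bit (odd n))"
      using input_cell_append[of "xs @ binary (n div 2)" "Bit (odd n)" ys] unfolding w by simp
    have "number ?w (Suc ?p) = min (length ?w + 1) n"
    proof (cases "odd n")
      case True
      then have "number ?w (Suc ?p) = min (length ?w + 1) (number ?w ?p + number ?w ?p + 1)"
        unfolding number.simps(2) cell by simp
      also have "\<dots> = min (length ?w + 1) (n div 2 + n div 2 + 1)" unfolding IH by linarith
      also have "n div 2 + n div 2 + 1 = n" using True by presburger
      finally show ?thesis .
    next
      case even: False
      then have "number ?w (Suc ?p) = min (length ?w + 1) (number ?w ?p + number ?w ?p)"
        unfolding number.simps(2) cell by simp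
      also have "\<dots> = min (length ?w + 1) (n div 2 + n div 2)" unfolding IH by linarith
      also have "n div 2 + n div 2 = n" using even by presburger
      finally show ?thesis .
    qed
    then show ?thesis using b by simp
  qed
qed

lemma Sep_not_in_binary: "Sep \<notin> set (binary n)"
proof (induction n rule: less_induct)
  case (less n)
  then show ?case by (cases "n = 0") (subst binary.simps, simp)+
qed

lemma encode_Cons: "encode (n # ns) = binary n @ Sep # encode ns"
  by (simp add: encode_def)

lemma encode_append: "encode (ns @ ms) = encode ns @ encode ms"
  by (simp add: encode_def)

lemma seps_encode: "length (filter (\<lambda>c. c = Sep) (encode ns)) = length ns"
  by (induction ns) (auto simp: encode_Cons Sep_not_in_binary filter_empty_conv encode_def intro!: filter_False)

lemma length_encode: "length ns \<le> length (encode ns)"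
  by (induction ns) (auto simp: encode_Cons)

lemma encode_split:
  assumes "j < length ns"
  shows "encode ns = encode (take j ns) @ binary (ns ! j) @ Sep # encode (drop (Suc j) ns)"
  using id_take_nth_drop[OF assms] by (metis encode_Cons encode_append)

lemma Sep_position:
  "p < length (encode ns) \<Longrightarrow> encode ns ! p = Sep \<Longrightarrow>
    \<exists>j<length ns. p = length (encode (take j ns)) + length (binary (ns ! j))"
proof (induction ns arbitrary: p)
  case Nil
  then show ?case by (simp add: encode_def)
next
  case (Cons n ns)
  consider "p < length (binary n)" | "p = length (binary n)" | "length (binary n) < p" by linarith
  then show ?case
  proof cases
    case 1
    then have "Sep \<in> set (binary n)" using Cons.prems(2) by (auto simp: encode_Cons nth_append in_set_conv_nth)
    then show ?thesis using Sep_not_in_binary by blast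
  next
    case 2
    then show ?thesis by (intro exI[of _ 0]) (simp add: encode_def)
  next
    case 3
    then obtain p' where p': "p = length (binary n) + Suc p'" using less_imp_Suc_add by auto
    then have "p' < length (encode ns)" "encode ns ! p' = Sep"
      using Cons.prems by (auto simp: encode_Cons nth_append)
    then obtain j where "j < length ns" "p' = length (encode (take j ns)) + length (binary (ns ! j))"
      using Cons.IH by blast
    then show ?thesis using p' by (intro exI[of _ "Suc j"]) (simp add: encode_Cons)
  qed
qed

lemma item_encode: "item (encode ns) i v \<longleftrightarrow> i < length ns \<and> v = min (length (encode ns) + 1) (ns ! i)"
proof -
  let ?w = "encode ns"
  define end_pos where "end_pos j = length (encode (take j ns)) + length (binary (ns ! j))" for j
  have at_end: "seps ?w (end_pos j) = j" "number ?w (end_pos j) = min (length ?w + 1) (ns ! j)"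
    "input_cell ?w (Suc (end_pos j)) = Symbol Sep" "end_pos j < length ?w" if j: "j < length ns" for j
  proof -
    let ?e = "encode (take j ns)"
    note split = encode_split[OF j]
    have "seps ((?e @ binary (ns ! j)) @ Sep # encode (drop (Suc j) ns)) (length (?e @ binary (ns ! j))) = j"
      unfolding seps_prefix using j by (simp add: seps_encode Sep_not_in_binary filter_empty_conv) (metis Sep_not_in_binary filter_False length_0_conv add_0_right min.absorb4)
    then show "seps ?w (end_pos j) = j" unfolding end_pos_def by (subst split) simp
    have "?e = [] \<or> last ?e = Sep"
      by (cases "take j ns" rule: rev_cases) (auto simp: encode_append encode_def)
    from number_binary[OF this, of "ns ! j" "Sep # encode (drop (Suc j) ns)"]
    show "number ?w (end_pos j) = min (length ?w + 1) (ns ! j)"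
      unfolding end_pos_def by (subst (1 2) split)
    show "input_cell ?w (Suc (end_pos j)) = Symbol Sep"
      unfolding end_pos_def by (subst split)
        (use input_cell_append[of "?e @ binary (ns ! j)" Sep "encode (drop (Suc j) ns)"] in simp)
    show "end_pos j < length ?w" unfolding end_pos_def by (subst split) simp
  qed
  show ?thesis
  proof
    assume "item ?w i v"
    then obtain p where p: "input_cell ?w (Suc p) = Symbol Sep" "seps ?w p = i" "number ?w p = v"
      unfolding item_def by blast
    then have "p < length ?w" "?w ! p = Sep" by (auto simp: input_cell_def split: if_splits)
    then obtain j where "j < length ns" "p = end_pos j" using Sep_position unfolding end_pos_def by blast
    then show "i < length ns \<and> v = min (length ?w + 1) (ns ! i)" using at_end[of j] p by simp
  next
    assume i: "i < length ns \<and> v = min (length ?w + 1) (ns ! i)"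
    then show "item ?w i v"
      unfolding item_def using at_end[of i] small_less_cap(1)[of ?w]
      by (intro exI[of _ "end_pos i"] exI[of _ "Suc (end_pos i)"] conjI) auto
  qed
qed

lemma mem_encode: "i < length ns \<Longrightarrow> mem (encode ns) i = min (length (encode ns) + 1) (ns ! i)"
  using small_less_cap(1)[of "encode ns"] by (subst mem_eq_iff) (auto simp: item_encode)

subsection \<open>Layout of the code of an FDFA\<close>

lemma length_table: "length (concat (map (\<lambda>q. map (f q) [0..<s]) [0..<c])) = c * s"
  by (induction c) auto

lemma nth_table:
  assumes "q < c" "a < s"
  shows "concat (map (\<lambda>q. map (f q) [0..<s]) [0..<c]) ! (q * s + a) = f q a"
  using assms
proof (induction c)
  case (Suc c)
  show ?case
  proof (cases "q = c")
    case True
    then show ?thesis using Suc.prems by (simp add: nth_append length_table)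
  next
    case False
    then have "q < c" using Suc.prems by simp
    then have "q * s + a < Suc q * s" "Suc q * s \<le> c * s" using Suc.prems by (auto intro: mult_right_mono simp del: mult_Suc) (auto)
    then have "q * s + a < c * s" by linarith
    then show ?thesis using Suc \<open>q < c\<close> by (simp add: nth_append length_table)
  qed
qed simp

lemma length_aut_code: "length (aut_code s A) = 2 + card (states A) * s"
  by (simp add: aut_code_def length_table)

lemma aut_code_nth:
  "aut_code s A ! 0 = card (states A)" "aut_code s A ! 1 = init A"
  "q < card (states A) \<Longrightarrow> a < s \<Longrightarrow> aut_code s A ! (2 + (q * s + a)) = trans A q a"
  using nth_table[of q "card (states A)" a s "trans A"] by (simp_all add: aut_code_def)

lemma length_dfa_code: "length (dfa_code s D) = 2 + card (states D) * s + card (states D)"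
  by (simp add: dfa_code_def length_aut_code)

lemma dfa_code_nth:
  "dfa_code s D ! 0 = card (states D)" "dfa_code s D ! 1 = init D"
  "q < card (states D) \<Longrightarrow> a < s \<Longrightarrow> dfa_code s D ! (2 + (q * s + a)) = trans D q a"
  "q < card (states D) \<Longrightarrow> dfa_code s D ! (2 + (card (states D) * s + q)) = (if q \<in> final D then 1 else 0)"
proof -
  have "q * s + a < card (states D) * s" if "q < card (states D)" "a < s"
  proof -
    have "q * s + a < Suc q * s" using that by simp
    also have "\<dots> \<le> card (states D) * s" using that by (intro mult_right_mono) auto
    finally show ?thesis .
  qed
  then show "q < card (states D) \<Longrightarrow> a < s \<Longrightarrow> dfa_code s D ! (2 + (q * s + a)) = trans D q a"
    using aut_code_nth(3)[of q D a s] by (simp add: dfa_code_def nth_append length_aut_code)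
qed (use aut_code_nth[of s D] in \<open>auto simp: dfa_code_def nth_append length_aut_code\<close>)

lemma nth_concat_blocks:
  "q < c \<Longrightarrow> j < length (g q) \<Longrightarrow> concat (map g [0..<c]) ! ((\<Sum>i<q. length (g i)) + j) = g q ! j"
proof (induction c)
  case (Suc c)
  have len: "length (concat (map g [0..<n])) = (\<Sum>i<n. length (g i))" for n
    by (induction n) auto
  show ?case
  proof (cases "q = c")
    case True
    then show ?thesis using len[of c] by (simp add: nth_append)
  next
    case False
    then have "q < c" using Suc.prems by simp
    have "(\<Sum>i<q. length (g i)) + j < (\<Sum>i<Suc q. length (g i))" using Suc.prems by simp
    also have "\<dots> \<le> (\<Sum>i<c. length (g i))" using \<open>q < c\<close> by (intro sum_mono2) auto
    finally show ?thesis using Suc \<open>q < c\<close> len[of c] by (simp add: nth_append)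
  qed
qed simp

subsection \<open>Correctness of the queries\<close>

lemma foldl_closed: "(\<And>x a. x \<in> D \<Longrightarrow> a \<in> A \<Longrightarrow> \<delta> x a \<in> D) \<Longrightarrow> x \<in> D \<Longrightarrow> z \<in> lists A \<Longrightarrow> foldl \<delta> x z \<in> D"
  by (induction z arbitrary: x) auto

lemma rtrancl_foldl:
  assumes R: "\<And>x y. x \<in> D \<Longrightarrow> (x, y) \<in> R \<longleftrightarrow> (\<exists>a\<in>A. y = \<delta> x a)"
    and closed: "\<And>x a. x \<in> D \<Longrightarrow> a \<in> A \<Longrightarrow> \<delta> x a \<in> D" and x: "x \<in> D"
  shows "(x, y) \<in> R\<^sup>* \<longleftrightarrow> (\<exists>z\<in>lists A. y = foldl \<delta> x z)"
proof
  assume "(x, y) \<in> R\<^sup>*"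
  then show "\<exists>z\<in>lists A. y = foldl \<delta> x z"
  proof induction
    case base
    then show ?case by (intro bexI[of _ "[]"]) auto
  next
    case (step y y')
    then obtain z where z: "z \<in> lists A" "y = foldl \<delta> x z" by blast
    then have "y \<in> D" using foldl_closed[of D A \<delta>] closed x by blast
    then obtain a where "a \<in> A" "y' = \<delta> y a" using R step(2) by blast
    then show ?case using z by (intro bexI[of _ "z @ [a]"]) auto
  qed
next
  assume "\<exists>z\<in>lists A. y = foldl \<delta> x z"
  then obtain z where "z \<in> lists A" "y = foldl \<delta> x z" by blast
  then have "(x, foldl \<delta> x z) \<in> R\<^sup>*" using x
  proof (induction z arbitrary: x y)
    case (Cons a z)
    then have "(x, \<delta> x a) \<in> R" "\<delta> x a \<in> D" using R closed by auto
    then show ?case using Cons by (auto intro: converse_rtrancl_into_rtrancl)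
  qed simp
  then show "(x, y) \<in> R\<^sup>*" using \<open>y = foldl \<delta> x z\<close> by simp
qed

lemma foldl_pair: "foldl (\<lambda>(x, y) a. (f x a, g y a)) (x, y) z = (foldl f x z, foldl g y z)"
  by (induction z arbitrary: x y) auto

lemma foldl_triple:
  "foldl (\<lambda>(x, y, u) a. (f x a, g y a, h u a)) (x, y, u) z = (foldl f x z, foldl g y z, foldl h u z)"
  by (induction z arbitrary: x y u) auto

lemma counted_path:
  assumes x: "x < length w + 2" and T: "\<And>x y. T x y \<Longrightarrow> y < length w + 2"
    and k: "0 < k" "k < length w + 2"
  shows "(\<exists>t<cap w. ((x, 1), (t, k)) \<in> (small_rel2 w (\<lambda>x i y j. Suc i = j \<and> T x y))\<^sup>*) \<longleftrightarrow>
    (\<exists>ss. length ss = k \<and> hd ss = x \<and> (\<forall>i. Suc i < length ss \<longrightarrow> T (ss ! i) (ss ! Suc i)))"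
    (is "(\<exists>t<_. (_, (t, k)) \<in> ?R\<^sup>*) \<longleftrightarrow> (\<exists>ss. ?path k ss)")
proof
  assume "\<exists>t<cap w. ((x, 1), (t, k)) \<in> ?R\<^sup>*"
  then obtain t where "((x, 1), (t, k)) \<in> ?R\<^sup>*" by blast
  then have "\<exists>ss. ss \<noteq> [] \<and> ?path k ss \<and> last ss = t"
  proof (induction rule: rtrancl_induct2)
    case refl
    then show ?case by (intro exI[of _ "[x]"]) auto
  next
    case (step t i t' i')
    then obtain ss where ss: "ss \<noteq> []" "?path i ss" "last ss = t" by blast
    have "Suc i = i'" "T t t'" using step(2) by (auto simp: small_rel2_def)
    moreover have "T ((ss @ [t']) ! j) ((ss @ [t']) ! Suc j)" if "Suc j < Suc (length ss)" for j
    proof (cases "Suc j < length ss")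
      case False
      then have "j = length ss - 1" "Suc j = length ss" using that by auto
      then show ?thesis using ss \<open>T t t'\<close> by (simp add: nth_append last_conv_nth)
    qed (use ss in \<open>simp add: nth_append\<close>)
    ultimately show ?case using ss by (intro exI[of _ "ss @ [t']"]) auto
  qed
  then show "\<exists>ss. ?path k ss" by blast
next
  assume "\<exists>ss. ?path k ss"
  then obtain ss where ss: "?path k ss" by blast
  have small: "ss ! j < length w + 2" if "j < k" for j
    using that x T ss k by (cases j) (auto simp: hd_conv_nth)
  have "((x, 1), (ss ! j, Suc j)) \<in> ?R\<^sup>*" if "j < k" for j
    using that
  proof (induction j)
    case 0
    then show ?case using ss by (auto simp: hd_conv_nth)
  next
    case (Suc j)
    have "((ss ! j, Suc j), (ss ! Suc j, Suc (Suc j))) \<in> ?R"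
      using Suc.prems ss k small[of j] small[of "Suc j"] by (simp add: small_rel2_def)
    then show ?case using Suc by (auto intro: rtrancl_into_rtrancl)
  qed
  from this[of "k - 1"] have "((x, 1), (ss ! (k - 1), k)) \<in> ?R\<^sup>*" using k by simp
  moreover have "ss ! (k - 1) < cap w" using small[of "k - 1"] k small_less_cap(1)[of w] by simp
  ultimately show "\<exists>t<cap w. ((x, 1), (t, k)) \<in> ?R\<^sup>*" by blast
qed

text \<open>The list \<open>pre\<close> is empty when the position is computed and holds
  \<open>k\<close> when membership in a class is decided; \<open>d\<close> shifts all item numbers
  accordingly.\<close>

locale encoded_fdfa =
  fixes s :: nat and F :: input_fdfa and pre :: "nat list" and w :: "sym list" and d :: nat
  assumes input: "(s, F) \<in> saturated_inputs"
    and w: "w = encode (pre @ fdfa_code (s, F))" and d: "d = length pre"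
begin

sublocale saturated_fdfa "{..<s}" F
  using input by unfold_locales (auto simp: saturated_inputs_def)

definition cq :: nat where "cq = card (states Q)"
definition cp :: "nat \<Rightarrow> nat" where "cp q = card (states (P q))"
definition start :: "nat \<Rightarrow> nat" where "start q = 3 + cq * s + (\<Sum>i<q. 2 + cp i * s + cp i)"

lemma s_pos: "0 < s"
  using input by (simp add: saturated_inputs_def)

lemma states_Q: "states Q = {..<cq}"
  using input by (simp add: saturated_inputs_def cq_def)

lemma states_P: "q < cq \<Longrightarrow> states (P q) = {..<cp q}"
  using input states_Q by (auto simp: saturated_inputs_def cp_def)

lemma init_Q: "init Q < cq" and trans_Q: "q < cq \<Longrightarrow> a < s \<Longrightarrow> trans Q q a < cq"
  using complete_Q states_Q by (auto simp: complete_aut_def)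

lemma init_P: "q < cq \<Longrightarrow> init (P q) < cp q"
  and trans_P: "q < cq \<Longrightarrow> p < cp q \<Longrightarrow> a < s \<Longrightarrow> trans (P q) p a < cp q"
  using complete_P[of q] states_P[of q] states_Q by (auto simp: complete_aut_def)

lemma length_code: "length (fdfa_code (s, F)) = start cq"
proof -
  have len: "length (concat (map g [0..<n])) = (\<Sum>i<n. length (g i))" for n and g :: "nat \<Rightarrow> nat list"
    by (induction n) auto
  show ?thesis
    unfolding fdfa_code_def by (simp add: length_aut_code start_def len length_dfa_code flip: cq_def cp_def)
qed

lemma start_mono: "q \<le> q' \<Longrightarrow> start q \<le> start q'"
  unfolding start_def by (intro add_left_mono sum_mono2) auto

lemma start_Suc: "start (Suc q) = start q + (2 + cp q * s + cp q)"
  by (simp add: start_def)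

lemma code_nth:
  "fdfa_code (s, F) ! 0 = s" "fdfa_code (s, F) ! 1 = cq" "fdfa_code (s, F) ! 2 = init Q"
  "q < cq \<Longrightarrow> a < s \<Longrightarrow> fdfa_code (s, F) ! (3 + (q * s + a)) = trans Q q a"
  "q < cq \<Longrightarrow> j < 2 + cp q * s + cp q \<Longrightarrow> fdfa_code (s, F) ! (start q + j) = dfa_code s (P q) ! j"
proof -
  let ?A = "aut_code s Q" and ?C = "concat (map (\<lambda>q. dfa_code s (P q)) [0..<cq])"
  have code: "fdfa_code (s, F) = s # ?A @ ?C" by (simp add: fdfa_code_def cq_def)
  have len: "length ?A = 2 + cq * s" by (simp add: length_aut_code cq_def)
  show "fdfa_code (s, F) ! 0 = s" by (simp add: code)
  show "fdfa_code (s, F) ! 1 = cq" using aut_code_nth(1)[of s Q] len by (simp add: code nth_append cq_def)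
  show "fdfa_code (s, F) ! 2 = init Q"
    using aut_code_nth(2)[of s Q] len by (simp add: code nth_append numeral_2_eq_2)
  show "fdfa_code (s, F) ! (3 + (q * s + a)) = trans Q q a" if "q < cq" "a < s"
  proof -
    have "q * s + a < Suc q * s" using that by simp
    also have "\<dots> \<le> cq * s" using that by (intro mult_right_mono) auto
    finally show ?thesis using aut_code_nth(3)[of q Q a s] that len
      by (simp add: code nth_append cq_def numeral_3_eq_3 numeral_2_eq_2)
  qed
  show "fdfa_code (s, F) ! (start q + j) = dfa_code s (P q) ! j" if "q < cq" "j < 2 + cp q * s + cp q"
  proof -
    have "start q + j = Suc (length ?A + ((\<Sum>i<q. length (dfa_code s (P i))) + j))"
      by (simp add: start_def len length_dfa_code cp_def)
    then have "fdfa_code (s, F) ! (start q + j) = ?C ! ((\<Sum>i<q. length (dfa_code s (P i))) + j)"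
      by (simp only: code nth_Cons_Suc nth_append_length_plus)
    also have "\<dots> = dfa_code s (P q) ! j"
      using that by (intro nth_concat_blocks) (simp_all add: length_dfa_code cp_def)
    finally show ?thesis .
  qed
qed

text \<open>Every item takes at least its separator. So the tables, and with them all state and
  letter counts, are bounded by the input length, and truncation does not affect the FDFA.\<close>

lemma length_w: "d + start cq \<le> length w"
  using length_encode[of "pre @ fdfa_code (s, F)"] by (simp add: w d length_code)

lemma start_0: "3 + cq * s \<le> start cq"
  using start_mono[of 0 cq] by (simp add: start_def)

lemma cq_bound: "cq \<le> length w"
proof -
  have "cq \<le> cq * s" using s_pos by (cases s) auto
  then show ?thesis using length_w start_0 by linarith
qed

lemma s_bound: "s \<le> length w"
proof -
  have "s \<le> cq * s" using init_Q by (cases cq) auto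
  then show ?thesis using length_w start_0 by linarith
qed

lemma cp_bound: "q < cq \<Longrightarrow> cp q \<le> length w"
  using length_w start_mono[of "Suc q" cq] by (simp add: start_Suc)

lemma mem_code:
  assumes "j < start cq" "fdfa_code (s, F) ! j \<le> length w"
  shows "mem w (d + j) = fdfa_code (s, F) ! j"
  using mem_encode[of "d + j" "pre @ fdfa_code (s, F)"] assms by (simp add: length_code d nth_append flip: w)

lemma mem_params: "mem w d = s" "mem w (d + 1) = cq" "mem w (d + 2) = init Q"
  using mem_code[of 0] mem_code[of 1] mem_code[of 2] start_0 s_bound cq_bound init_Q
  unfolding code_nth by simp_all

lemma lead_trans_eq: "q < cq \<Longrightarrow> a < s \<Longrightarrow> lead_trans d w q a = trans Q q a"
proof -
  assume q: "q < cq" and a: "a < s"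
  have "q * s + a < Suc q * s" using a by simp
  also have "\<dots> \<le> cq * s" using q by (intro mult_right_mono) auto
  finally have "3 + (q * s + a) < start cq" using start_0 by linarith
  moreover have "trans Q q a \<le> length w" using trans_Q[OF q a] cq_bound by linarith
  ultimately show ?thesis
    using mem_code[of "3 + (q * s + a)"] q a unfolding code_nth(4)[OF q a]
    by (simp add: lead_trans_def mem_params add.assoc)
qed

lemma mem_block:
  assumes "q < cq" "j < 2 + cp q * s + cp q" "dfa_code s (P q) ! j \<le> length w"
  shows "mem w (d + (start q + j)) = dfa_code s (P q) ! j"
proof -
  have "start q + j < start (Suc q)" using assms(2) by (simp add: start_Suc)
  also have "\<dots> \<le> start cq" using assms(1) by (intro start_mono) simp
  finally show ?thesis using mem_code[of "start q + j"] assms code_nth(5)[OF assms(1,2)] by simp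
qed

lemma offset_eq: "q \<le> cq \<Longrightarrow> offset d w q = d + start q"
proof (induction q)
  case 0
  have "d + start 0 \<le> length w" using start_mono[of 0 cq] length_w by simp
  moreover have "start 0 = 3 + cq * s" by (simp add: start_def)
  ultimately show ?case using mem_params(1,2) by (simp add: mult.commute)
next
  case (Suc q)
  then have q: "q < cq" by simp
  have "mem w (d + (start q + 0)) = cp q"
    using mem_block[OF q, of 0] cp_bound[OF q] dfa_code_nth(1)[of s "P q"] by (simp add: cp_def)
  moreover have "d + start (Suc q) \<le> length w" using start_mono[of "Suc q" cq] Suc.prems length_w by simp
  ultimately show ?case using Suc mem_params by (simp add: start_Suc)
qed

lemma off_eq: "q < cq \<Longrightarrow> off d w q = d + start q"
  using cq_bound by (simp add: off_def offset_eq)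

lemma mem_cp: "q < cq \<Longrightarrow> mem w (off d w q) = cp q"
  using mem_block[of q 0] cp_bound[of q] dfa_code_nth(1)[of s "P q"] by (simp add: off_eq cp_def)

lemma prog_init_eq: "q < cq \<Longrightarrow> prog_init d w q = init (P q)"
  using mem_block[of q 1] cp_bound[of q] init_P[of q] dfa_code_nth(2)[of s "P q"]
  by (simp add: off_eq prog_init_def add.assoc)

lemma prog_trans_eq:
  assumes "q < cq" "p < cp q" "a < s"
  shows "prog_trans d w q p a = trans (P q) p a"
proof -
  have "p * s + a < Suc p * s" using assms by simp
  also have "\<dots> \<le> cp q * s" using assms by (intro mult_right_mono) auto
  finally have "2 + (p * s + a) < 2 + cp q * s + cp q" by simp
  moreover have "dfa_code s (P q) ! (2 + (p * s + a)) = trans (P q) p a"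
    using dfa_code_nth(3) assms by (simp add: cp_def)
  moreover have "trans (P q) p a \<le> length w" using trans_P[OF assms] cp_bound[OF assms(1)] by linarith
  ultimately show ?thesis
    using mem_block[OF assms(1), of "2 + (p * s + a)"] assms(1)
    by (simp add: prog_trans_def off_eq mem_params add.assoc)
qed

lemma is_final_eq:
  assumes "q < cq" "p < cp q"
  shows "is_final d w q p \<longleftrightarrow> p \<in> final (P q)"
proof -
  have "dfa_code s (P q) ! (2 + (cp q * s + p)) = (if p \<in> final (P q) then 1 else 0)"
    using dfa_code_nth(4)[of p "P q" s] assms by (simp add: cp_def)
  moreover have "1 \<le> length w" using cq_bound init_Q by linarith
  ultimately have "mem w (d + (start q + (2 + (cp q * s + p)))) = (if p \<in> final (P q) then 1 else 0)"
    using mem_block[OF assms(1), of "2 + (cp q * s + p)"] assms by simp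
  then show ?thesis
    unfolding is_final_def mem_cp[OF assms(1)] unfolding off_eq[OF assms(1)] mem_params by (simp add: add.assoc)
qed

lemma length_w_less_cap: "length w + 1 < cap w"
  by (rule small_less_cap)

lemma letter_less_cap: "a < s \<Longrightarrow> a < cap w"
  using s_bound length_w_less_cap by linarith

lemma letter_ex: "(\<exists>a<cap w. a < s \<and> R a) \<longleftrightarrow> (\<exists>a<s. R a)"
  using letter_less_cap by blast

lemma q_less: "q < cq \<Longrightarrow> q < length w + 2"
  using cq_bound by linarith

lemma p_less: "q < cq \<Longrightarrow> p < cp q \<Longrightarrow> p < length w + 2"
  using cp_bound[of q] by linarith

lemma lead_reachable_iff: "lead_reachable d w q \<longleftrightarrow> q \<in> reach Q ` lists {..<s}"
proof -
  have i: "init Q < cap w" using q_less[OF init_Q] length_w_less_cap by linarith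
  have "(init Q, q) \<in> tc1 w (\<lambda>r r'. \<exists>a<cap w. a < mem w d \<and> lead_trans d w r a = r') \<longleftrightarrow>
      (\<exists>z\<in>lists {..<s}. q = foldl (trans Q) (init Q) z)"
    unfolding tc1_def
  proof (rule rtrancl_foldl[where D = "{..<cq}"])
    fix x y assume x: "x \<in> {..<cq}"
    have "trans Q x a < cap w" if "a < s" for a
      using q_less[OF trans_Q[of x a]] x that length_w_less_cap by simp
    then show "(x, y) \<in> {(r, r'). r < cap w \<and> r' < cap w \<and>
        (\<exists>a<cap w. a < mem w d \<and> lead_trans d w r a = r')} \<longleftrightarrow> (\<exists>a\<in>{..<s}. y = trans Q x a)"
      using x q_less[of x] length_w_less_cap by (auto simp: mem_params letter_ex lead_trans_eq cong: conj_cong)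
  qed (use trans_Q init_Q in auto)
  then show ?thesis using i unfolding lead_reachable_def mem_params reach_def image_iff by auto
qed

lemma above_query_iff:
  assumes q: "q < cq" and p: "p < cp q"
  shows "above_query d w q p p' \<longleftrightarrow> above q p p'"
proof -
  have "((p, q), (p', q)) \<in> (small_rel2 w (pair_step d w q))\<^sup>* \<longleftrightarrow>
      (\<exists>z\<in>lists {..<s}. (p', q) = foldl (\<lambda>(x, y) a. (trans (P q) x a, trans Q y a)) (p, q) z)"
  proof (rule rtrancl_foldl[where D = "{..<cp q} \<times> {..<cq}"])
    fix x y assume x: "x \<in> {..<cp q} \<times> {..<cq}"
    have small: "trans (P q) (fst x) a < length w + 2" "trans Q (snd x) a < length w + 2" if "a < s" for a
      using p_less[OF q trans_P[of q "fst x" a]] q_less[OF trans_Q[of "snd x" a]] x q that by auto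
    show "(x, y) \<in> small_rel2 w (pair_step d w q) \<longleftrightarrow>
        (\<exists>a\<in>{..<s}. y = (case x of (x, y) \<Rightarrow> \<lambda>a. (trans (P q) x a, trans Q y a)) a)"
      using x q small p_less[OF q, of "fst x"] q_less[of "snd x"]
      by (cases x; cases y)
        (auto simp: small_rel2_def pair_step_def mem_params letter_ex lead_trans_eq prog_trans_eq cong: conj_cong)
  qed (use trans_P trans_Q q p in auto)
  then show ?thesis unfolding above_query_def above_def foldl_pair by (simp del: in_lists_conv_set) metis
qed

lemma idem_query_iff:
  assumes q: "q < cq"
  shows "idem_query d w q p \<longleftrightarrow> idem q p"
proof -
  define f where "f = (\<lambda>(x, y, u) a. (trans (P q) x a, trans (P q) y a, trans Q u a))"
  let ?D = "{..<cp q} \<times> {..<cp q} \<times> {..<cq}"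
  have closed: "f x a \<in> ?D" if "x \<in> ?D" "a < s" for x a
    using that trans_P[OF q] trans_Q by (auto simp: f_def)
  have step: "triple_step d w q (fst x) (fst (snd x)) (snd (snd x)) x' y' u' \<longleftrightarrow> (\<exists>a<s. (x', y', u') = f x a)"
    if "x \<in> ?D" for x x' y' u'
    using that q
    by (cases x) (auto simp: f_def triple_step_def mem_params letter_ex lead_trans_eq prog_trans_eq cong: conj_cong)
  have reach: "((init (P q), p, q), x) \<in> (small_rel3 w (triple_step d w q))\<^sup>* \<longleftrightarrow>
      (\<exists>z\<in>lists {..<s}. x = foldl f (init (P q), p, q) z)" if p: "p < cp q" for x
  proof (rule rtrancl_foldl[where D = ?D])
    fix x y assume x: "x \<in> ?D"
    have small: "fst v < length w + 2 \<and> fst (snd v) < length w + 2 \<and> snd (snd v) < length w + 2" if "v \<in> ?D" for v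
      using that p_less[OF q] q_less by auto
    have y: "\<forall>a<s. f x a \<in> ?D" using closed[OF x] by blast
    have "(x, y) \<in> small_rel3 w (triple_step d w q) \<longleftrightarrow>
        (fst y < length w + 2 \<and> fst (snd y) < length w + 2 \<and> snd (snd y) < length w + 2) \<and> (\<exists>a<s. y = f x a)"
      using step[OF x, of "fst y" "fst (snd y)" "snd (snd y)"] small[OF x]
      by (cases x; cases y) (auto simp: small_rel3_def)
    then show "(x, y) \<in> small_rel3 w (triple_step d w q) \<longleftrightarrow> (\<exists>a\<in>{..<s}. y = f x a)"
      using y small by auto
  qed (use closed init_P q p in auto)
  have p_closed: "p < cp q" if p: "idem q p"
  proof -
    obtain v where v: "v \<in> lists {..<s}" "foldl (trans (P q)) (init (P q)) v = p"
      using p unfolding idem_def reach_def by blast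
    have "foldl (trans (P q)) (init (P q)) v \<in> {..<cp q}"
      by (rule foldl_closed[OF _ _ v(1)]) (use trans_P init_P q in auto)
    then show ?thesis using v by simp
  qed
  have "idem_query d w q p \<longleftrightarrow> idem q p" if p: "p < cp q"
  proof -
    have D0: "(init (P q), p, q) \<in> ?D" using init_P[OF q] p q by auto
    have D: "foldl f (init (P q), p, q) z \<in> ?D" if "z \<in> lists {..<s}" for z
      by (rule foldl_closed[OF closed D0 that]) auto
    have in_cap: "x < cap w" if "x < cp q \<or> x < cq" for x
      using that p_less[OF q, of x] q_less[of x] length_w_less_cap by linarith
    have "idem_query d w q p \<longleftrightarrow> (\<exists>x y u. x < cap w \<and> y < cap w \<and> u < cap w \<and>
        ((init (P q), p, q), (x, y, u)) \<in> (small_rel3 w (triple_step d w q))\<^sup>* \<and> triple_step d w q x y u p p q)"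
      unfolding idem_query_def mem_cp[OF q] prog_init_eq[OF q]
      using p in_cap[of "init (P q)"] init_P[OF q] by auto
    also have "\<dots> \<longleftrightarrow> (\<exists>x y u. x < cap w \<and> y < cap w \<and> u < cap w \<and>
        (\<exists>z\<in>lists {..<s}. (x, y, u) = foldl f (init (P q), p, q) z) \<and> triple_step d w q x y u p p q)"
      unfolding reach[OF p] ..
    also have "\<dots> \<longleftrightarrow> (\<exists>z\<in>lists {..<s}. \<exists>a<s. (p, p, q) = f (foldl f (init (P q), p, q) z) a)" (is "?l \<longleftrightarrow> ?r")
    proof
      assume ?l
      then obtain x y u z where z: "z \<in> lists {..<s}" "(x, y, u) = foldl f (init (P q), p, q) z"
        "triple_step d w q x y u p p q" by blast
      then have "\<exists>a<s. (p, p, q) = f (foldl f (init (P q), p, q) z) a"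
        using step[OF D[OF z(1)], of p p q] unfolding z(2)[symmetric] by simp
      then show ?r using z(1) by blast
    next
      assume ?r
      then obtain z where z: "z \<in> lists {..<s}" "\<exists>a<s. (p, p, q) = f (foldl f (init (P q), p, q) z) a" by blast
      obtain x y u where xyu: "(x, y, u) = foldl f (init (P q), p, q) z" by (metis prod_cases3)
      have "triple_step d w q x y u p p q" using step[OF D[OF z(1)], of p p q] z(2) unfolding xyu[symmetric] by simp
      moreover have "x < cap w" "y < cap w" "u < cap w" using D[OF z(1)] in_cap unfolding xyu[symmetric] by auto
      ultimately show ?l using z(1) xyu by blast
    qed
    also have "\<dots> \<longleftrightarrow> (\<exists>v\<in>lists {..<s}. v \<noteq> [] \<and> (p, p, q) = foldl f (init (P q), p, q) v)" (is "?l \<longleftrightarrow> ?r")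
    proof
      assume ?l
      then obtain z a where "z \<in> lists {..<s}" "a < s" "(p, p, q) = f (foldl f (init (P q), p, q) z) a" by blast
      then show ?r by (intro bexI[of _ "z @ [a]"]) auto
    next
      assume ?r
      then obtain v where "v \<in> lists {..<s}" "v \<noteq> []" "(p, p, q) = foldl f (init (P q), p, q) v" by blast
      then show ?l by (cases v rule: rev_cases) auto
    qed
    also have "\<dots> \<longleftrightarrow> idem q p" unfolding idem_def f_def foldl_triple reach_def by auto
    finally show ?thesis .
  qed
  moreover have "p < cp q" if "idem_query d w q p" using that by (simp add: idem_query_def mem_cp[OF q])
  ultimately show ?thesis using p_closed by blast
qed

lemma idem_less: "q < cq \<Longrightarrow> idem q p \<Longrightarrow> p < cp q"
  using idem_query_iff mem_cp by (metis idem_query_def)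

lemma fchain_le: "0 < k \<Longrightarrow> fchain b k \<Longrightarrow> k \<le> length w"
  using fchain_bound cp_bound states_Q unfolding cp_def by fastforce

lemma reach_less: "q \<in> reach Q ` lists {..<s} \<Longrightarrow> q < cq"
  using foldl_closed[of "{..<cq}" "{..<s}" "trans Q" "init Q"] trans_Q init_Q by (auto simp: reach_def)

text \<open>For \<open>k\<close> beyond \<open>length w + 1\<close> both sides fail, one because the
  relation has only small pairs, the other by \<open>fchain_le\<close>. Below, every
  \<open>idem\<close> state is small and the queries agree with the notions they stand for.\<close>

lemma chain_query_iff:
  assumes k: "0 < k"
  shows "chain_query d b w k \<longleftrightarrow> fchain b k"
proof (cases "k < length w + 2")
  case False
  have "\<not> chain_query d b w k"
  proof
    assume "chain_query d b w k"
    then obtain x t R where R: "((x, 1), (t, k)) \<in> (small_rel2 w R)\<^sup>*" unfolding chain_query_def by blast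
    then show False using False by (cases rule: rtranclE) (auto simp: small_rel2_def)
  qed
  then show ?thesis using fchain_le[OF k, of b] False by auto
next
  case True
  have "(\<exists>x<cap w. idem_query d w q x \<and> (is_final d w q x \<longleftrightarrow> b) \<and> (\<exists>i<cap w. i = 1 \<and> (\<exists>t<cap w. ((x, i), (t, k)) \<in>
       (small_rel2 w (\<lambda>s i s' i'. Suc i = i' \<and> above_query d w q s s' \<and> idem_query d w q s' \<and>
         \<not> (is_final d w q s \<longleftrightarrow> is_final d w q s')))\<^sup>*))) \<longleftrightarrow> (\<exists>ss. length ss = k \<and> chain_at q b ss)" if q: "q < cq" for q
  proof -
    let ?T = "\<lambda>x y. above_query d w q x y \<and> idem_query d w q y \<and> \<not> (is_final d w q x \<longleftrightarrow> is_final d w q y)"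
    have T: "?T x y \<longleftrightarrow> above q x y \<and> idem q y \<and> (x \<in> final (P q)) \<noteq> (y \<in> final (P q))" if x: "idem q x" for x y
    proof (cases "idem q y")
      case True
      then show ?thesis
        using above_query_iff[OF q] idem_query_iff[OF q] is_final_eq[OF q] idem_less[OF q] x by blast
    qed (simp add: idem_query_iff[OF q])
    have small: "idem_query d w q y \<Longrightarrow> y < length w + 2" for y
      using idem_query_iff[OF q] idem_less[OF q] p_less[OF q] by blast
    have path: "(\<exists>t<cap w. ((x, 1), (t, k)) \<in> (small_rel2 w (\<lambda>x i y j. Suc i = j \<and> ?T x y))\<^sup>*) \<longleftrightarrow>
        (\<exists>ss. length ss = k \<and> hd ss = x \<and> (\<forall>i. Suc i < length ss \<longrightarrow> ?T (ss ! i) (ss ! Suc i)))"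
      if "idem_query d w q x" for x
      by (rule counted_path[OF small[OF that] _ k True]) (use small in blast)
    have one: "1 < cap w" using length_w_less_cap by linarith
    have at: "idem q x \<and> (x \<in> final (P q) \<longleftrightarrow> b) \<and> length ss = k \<and> hd ss = x \<and>
        (\<forall>i. Suc i < length ss \<longrightarrow> ?T (ss ! i) (ss ! Suc i)) \<longleftrightarrow>
        length ss = k \<and> hd ss = x \<and> chain_at q b ss" for ss x
    proof -
      have "chain_at q b ss" if a: "idem q (hd ss)" "hd ss \<in> final (P q) \<longleftrightarrow> b" "length ss = k"
        "\<forall>i. Suc i < length ss \<longrightarrow> ?T (ss ! i) (ss ! Suc i)"
      proof -
        have ne: "ss \<noteq> []" using a(3) k by auto
        have all: "idem q (ss ! i)" if "i < length ss" for i
          using that a(1,4) ne idem_query_iff[OF q] by (cases i) (auto simp: hd_conv_nth)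
        then have "\<forall>x\<in>set ss. idem q x" by (auto simp: in_set_conv_nth)
        moreover have "above q (ss ! i) (ss ! Suc i) \<and> (ss ! i \<in> final (P q)) \<noteq> (ss ! Suc i \<in> final (P q))"
          if "Suc i < length ss" for i
          using T[OF all[of i], of "ss ! Suc i"] a(4) that by simp
        ultimately show ?thesis unfolding chain_at_def using ne a(2) by blast
      qed
      moreover have "idem q (hd ss) \<and> (hd ss \<in> final (P q) \<longleftrightarrow> b) \<and>
          (\<forall>i. Suc i < length ss \<longrightarrow> ?T (ss ! i) (ss ! Suc i))" if c: "chain_at q b ss"
      proof -
        have all: "idem q (ss ! i)" if "i < length ss" for i
          using c that by (simp add: chain_at_def)
        have "?T (ss ! i) (ss ! Suc i)" if "Suc i < length ss" for i
          using T[OF all[of i], of "ss ! Suc i"] all[OF that] c that unfolding chain_at_def by simp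
        moreover have "idem q (hd ss)" "hd ss \<in> final (P q) \<longleftrightarrow> b" using c by (auto simp: chain_at_def)
        ultimately show ?thesis by blast
      qed
      ultimately show ?thesis by blast
    qed
    have "(\<exists>x<cap w. idem_query d w q x \<and> (is_final d w q x \<longleftrightarrow> b) \<and> (\<exists>i<cap w. i = 1 \<and> (\<exists>t<cap w. ((x, i), (t, k)) \<in>
       (small_rel2 w (\<lambda>x i y j. Suc i = j \<and> ?T x y))\<^sup>*))) \<longleftrightarrow>
       (\<exists>x<cap w. idem q x \<and> (x \<in> final (P q) \<longleftrightarrow> b) \<and>
         (\<exists>ss. length ss = k \<and> hd ss = x \<and> (\<forall>i. Suc i < length ss \<longrightarrow> ?T (ss ! i) (ss ! Suc i))))"
    proof (intro ex_cong1 conj_cong refl)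
      fix x show "idem_query d w q x \<longleftrightarrow> idem q x" by (rule idem_query_iff[OF q])
      assume x: "idem q x"
      show "(is_final d w q x \<longleftrightarrow> b) \<longleftrightarrow> (x \<in> final (P q) \<longleftrightarrow> b)" using is_final_eq[OF q idem_less[OF q x]] by simp
      have "idem_query d w q x" using x idem_query_iff[OF q] by simp
      from path[OF this] show "(\<exists>i<cap w. i = 1 \<and> (\<exists>t<cap w. ((x, i), (t, k)) \<in>
          (small_rel2 w (\<lambda>x i y j. Suc i = j \<and> ?T x y))\<^sup>*)) \<longleftrightarrow>
          (\<exists>ss. length ss = k \<and> hd ss = x \<and> (\<forall>i. Suc i < length ss \<longrightarrow> ?T (ss ! i) (ss ! Suc i)))"
        using one by (simp only: ex_simps simp_thms) auto
    qed
    also have "\<dots> \<longleftrightarrow> (\<exists>x<cap w. \<exists>ss. length ss = k \<and> hd ss = x \<and> chain_at q b ss)" using at by blast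
    also have "\<dots> \<longleftrightarrow> (\<exists>ss. length ss = k \<and> chain_at q b ss)"
    proof -
      have "hd ss < cap w" if "chain_at q b ss" for ss
      proof -
        have "idem q (hd ss)" using that by (auto simp: chain_at_def)
        then show ?thesis using small idem_query_iff[OF q] length_w_less_cap by fastforce
      qed
      then show ?thesis by blast
    qed
    finally show ?thesis .
  qed
  moreover have "q < cap w" if "q < cq" for q using q_less[OF that] length_w_less_cap by linarith
  ultimately show ?thesis
    unfolding chain_query_def fchain_def lead_reachable_iff using reach_less k by (metis (no_types, lifting) less_numeral_extra(3))
qed

end

section \<open>The machines\<close>

definition bounded_query :: "nat \<Rightarrow> wagner_sign \<Rightarrow> sym list \<Rightarrow> nat \<Rightarrow> bool" where
  "bounded_query d sg w k \<longleftrightarrow> (\<exists>l<cap w. Suc k = l \<and> \<not> chain_query d True w (if sg = Minus then k else l) \<and>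
     \<not> chain_query d False w (if sg = Plus then k else l))"

definition class_query :: "wagner_sign \<Rightarrow> sym list \<Rightarrow> bool" where
  "class_query sg w \<longleftrightarrow> (\<exists>k<cap w. mem w 0 = k \<and> bounded_query 1 sg w k)"

definition position_query :: "wagner_sign \<Rightarrow> sym list \<Rightarrow> nat \<Rightarrow> bool" where
  "position_query sg w k \<longleftrightarrow> k \<noteq> 0 \<and> bounded_query 0 sg w k \<and> attained_by (\<lambda>b. chain_query 0 b w) k sg"

lemma dec_bounded_query: "dec (\<lambda>w e. bounded_query d sg w (e i))"
  unfolding bounded_query_def
  by (cases sg) (simp_all only: wagner_sign.distinct simp_thms if_True if_False,
      (intro dec_ex dec_conj dec_not dec_Suc dec_chain_query)+)

lemma dec_class_query: "dec (\<lambda>w e. class_query sg w)"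
  unfolding class_query_def by (intro dec_ex dec_conj dec_bounded_query dec_eq_var dfun_mem dfun_const)

lemma dec_position_query: "dec (\<lambda>w e. position_query sg w (e i))"
  unfolding position_query_def
  by (cases sg) (simp_all only: attained_by.simps, (intro dec_conj dec_not dec_zero dec_bounded_query dec_chain_query)+)

context encoded_fdfa
begin

lemma bounded_query_iff:
  assumes "0 < k" "k \<le> length w + 1"
  shows "bounded_query d sg w k \<longleftrightarrow> bounded_by fchain k sg"
proof -
  have "(length w + 2) * 2 \<le> (length w + 2) ^ 8"
  proof -
    have "(length w + 2) * 2 ^ 7 \<le> (length w + 2) * (length w + 2) ^ 7" by (intro mult_left_mono power_mono) auto
    also have "\<dots> = (length w + 2) ^ 8" by (simp flip: power_Suc)
    finally show ?thesis by simp
  qed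
  then have "(length w + 2) * 2 \<le> cap w" using cap_ge[of w] by (rule order_trans)
  moreover have "Suc k < (length w + 2) * 2" using assms(2) by simp
  ultimately have "Suc k < cap w" by (rule less_le_trans[rotated])
  then show ?thesis unfolding bounded_query_def using assms(1) by (cases sg) (auto simp: chain_query_iff)
qed

text \<open>The given \<open>k\<close> may be huge and is read truncated; since no chain is longer
  than the input, this changes no answer.\<close>

lemma fchain_min: "0 < k \<Longrightarrow> fchain b (min (length w + 1) k) \<longleftrightarrow> fchain b k"
  using fchain_le[of k b] fchain_le[of "length w + 1" b] by (auto simp: min_def)

lemma class_query_iff:
  assumes "pre = [k]" "0 < k"
  shows "class_query sg w \<longleftrightarrow> bounded_by fchain k sg"
proof -
  let ?k = "min (length w + 1) k"
  have mem: "mem w 0 = ?k" using mem_encode[of 0 "pre @ fdfa_code (s, F)"] assms w by simp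
  have "fchain b (Suc ?k) \<longleftrightarrow> fchain b (Suc k)" for b
    using fchain_le[of "Suc ?k" b] fchain_le[of "Suc k" b] by (auto simp: min_def)
  then have "bounded_by fchain ?k sg \<longleftrightarrow> bounded_by fchain k sg"
    using fchain_min[OF assms(2)] by (cases sg) auto
  moreover have "?k < cap w" using length_w_less_cap by linarith
  moreover have "d = 1" using assms(1) d by simp
  ultimately show ?thesis using bounded_query_iff[of ?k sg] assms(2) by (auto simp: class_query_def mem)
qed

lemma position_query_iff:
  assumes "pre = []"
  shows "position_query sg w k \<longleftrightarrow> 0 < k \<and> bounded_by fchain k sg \<and> attained_by fchain k sg"
proof -
  have "d = 0" using assms d by simp
  then have query: "position_query sg w k \<longleftrightarrow>
      k \<noteq> 0 \<and> bounded_query d sg w k \<and> attained_by (\<lambda>b. chain_query d b w) k sg"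
    by (simp only: position_query_def)
  also have "\<dots> \<longleftrightarrow> 0 < k \<and> bounded_by fchain k sg \<and> attained_by fchain k sg"
  proof (cases "0 < k \<and> attained_by fchain k sg")
    case True
    then have "k \<le> length w" using fchain_le by (cases sg) auto
    then show ?thesis using True bounded_query_iff[of k sg] by (cases sg) (auto simp: chain_query_iff)
  next
    case False
    then show ?thesis by (cases sg) (auto simp: chain_query_iff)
  qed
  finally show ?thesis .
qed

end

text \<open>Tests are built over the output alphabet \<open>sym\<close>, deciding machines have
  \<open>unit\<close>; renaming the outputs does not affect the runs.\<close>

lemma map_prog_sem:
  fixes w :: "sym list"
  defines "\<phi> f \<equiv> \<lambda>(h :: nat, r :: nat \<Rightarrow> nat, ys). (h, r, map f ys)"
  shows "(s, t) \<in> sem w p \<Longrightarrow> (\<phi> f s, \<phi> f t) \<in> sem w (map_prog f p)"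
    and "(\<phi> f s, t') \<in> sem w (map_prog f p) \<Longrightarrow> \<exists>t. t' = \<phi> f t \<and> (s, t) \<in> sem w p"
proof (induction p arbitrary: s t t')
  case (Atom a)
  {
    case 1
    then show ?case by (cases s; cases a) (auto simp: \<phi>_def)
  next
    case 2
    then show ?case by (cases s; cases a) (auto simp: \<phi>_def)
  }
next
  case (Seq p q)
  {
    case 1
    then obtain u where "(s, u) \<in> sem w p" "(u, t) \<in> sem w q" by auto
    then show ?case using Seq.IH(1)[of s u] Seq.IH(3)[of u t] by auto
  next
    case 2
    then obtain u where u: "(\<phi> f s, u) \<in> sem w (map_prog f p)" "(u, t') \<in> sem w (map_prog f q)" by auto
    from Seq.IH(2)[OF u(1)] obtain v where v: "u = \<phi> f v" "(s, v) \<in> sem w p" by blast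
    from Seq.IH(4)[of v t'] obtain t where "t' = \<phi> f t" "(v, t) \<in> sem w q" using u v by blast
    then show ?case using v by (intro exI[of _ t]) auto
  }
next
  case (Choice p q)
  {
    case 1
    then show ?case using Choice.IH(1)[of s t] Choice.IH(3)[of s t] by auto
  next
    case 2
    then show ?case using Choice.IH(2)[of s t'] Choice.IH(4)[of s t'] by (simp del: split_paired_Ex) blast
  }
next
  case (Star p)
  {
    case 1
    then have "(s, t) \<in> (sem w p)\<^sup>*" by simp
    then have "(\<phi> f s, \<phi> f t) \<in> (sem w (map_prog f p))\<^sup>*"
      by induction (auto intro: rtrancl_into_rtrancl Star.IH(1))
    then show ?case by simp
  next
    case 2
    then have "(\<phi> f s, t') \<in> (sem w (map_prog f p))\<^sup>*" by simp
    then have "\<exists>t. t' = \<phi> f t \<and> (s, t) \<in> (sem w p)\<^sup>*"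
    proof induction
      case (step u t')
      then obtain v where "u = \<phi> f v" "(s, v) \<in> (sem w p)\<^sup>*" by blast
      moreover from this step(2) obtain t where "t' = \<phi> f t" "(v, t) \<in> sem w p" using Star.IH(2) by blast
      ultimately show ?case by (intro exI[of _ t]) (auto intro: rtrancl_into_rtrancl)
    qed blast
    then show ?case by simp
  }
qed

lemma regs_bound: obtains d where "regs p \<subseteq> {..<d}" "0 < d"
proof
  show "regs p \<subseteq> {..<Suc (Max (insert 0 (regs p)))}" by (auto simp: less_Suc_eq_le finite_regs)
qed simp

lemma nlogspace_decides_query:
  assumes "NL (\<lambda>w e. Q w)" and Q: "\<And>x. x \<in> D \<Longrightarrow> Q (enc x) \<longleftrightarrow> P x"
  shows "nlogspace_decides D enc P"
proof -
  have "\<forall>i. (\<lambda>_ :: nat. 0 :: nat) i < 1" by simp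
  from NL_obtain[OF assms(1) this] obtain p where p: "tests 1 p (\<lambda>w r. Q w)" .
  let ?p = "map_prog (\<lambda>_. ()) p"
  obtain d where d: "regs ?p \<subseteq> {..<d}" "0 < d" by (rule regs_bound)
  have "ntm_accepts (compile d ?p) w \<longleftrightarrow> Q w" for w
  proof
    assume "ntm_accepts (compile d ?p) w"
    then obtain ys where "ntm_outputs (compile d ?p) w ys" by (auto simp: ntm_accepts_def ntm_outputs_def)
    from compile_outputs(1)[OF d this] obtain r h' r' where
      r: "valid_regs w r" "((length w + 1, r, []), (h', r', ys)) \<in> sem w ?p" by blast
    with map_prog_sem(2)[of "\<lambda>_. ()" "(length w + 1, r, [])" "(h', r', ys)" w p] obtain t where
      "((length w + 1, r, []), t) \<in> sem w p" by auto
    then show "Q w" using tests_sound(3)[OF p] r(1) by (cases t) auto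
  next
    assume "Q w"
    from compile_outputs(2)[OF d, of w] obtain r where
      r: "valid_regs w r" "\<And>h' r' ys. ((length w + 1, r, []), (h', r', ys)) \<in> sem w ?p \<Longrightarrow> ntm_outputs (compile d ?p) w ys"
      by blast
    obtain h' r' where "((length w + 1, r, []), (h', r', [])) \<in> sem w p"
      by (rule tests_complete[OF p, of w "length w + 1" r "[]"]) (use r(1) \<open>Q w\<close> in auto)
    from map_prog_sem(1)[OF this, of "\<lambda>_. ()"] have "ntm_outputs (compile d ?p) w []" using r(2) by simp
    then show "ntm_accepts (compile d ?p) w" by (auto simp: ntm_accepts_def ntm_outputs_def)
  qed
  then show ?thesis unfolding nlogspace_decides_def
    using Q ntm_compile[of d ?p] log_space_compile[OF d] by (intro exI[of _ "compile d ?p"]) auto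
qed

lemma binary_append: "0 < v' \<Longrightarrow> v' = v + v + of_bool b \<Longrightarrow> binary v' = binary v @ [Bit b]"
  by (subst binary.simps) auto

text \<open>The number in register 0 is printed by building it up in register 1 from its leading bit.\<close>

lemma binary_program:
  "\<exists>p. \<forall>w h r ys. valid w (h, r, ys) \<longrightarrow>
    (\<forall>h' r' ys'. ((h, r, ys), (h', r', ys')) \<in> sem w p \<longrightarrow> ys' = ys @ binary (r 0)) \<and>
    (\<exists>h' r'. ((h, r, ys), (h', r', ys @ binary (r 0))) \<in> sem w p)"
proof -
  \<comment> \<open>Arguments 0, 1 and 2 become registers 0, 1 and 2; all further arguments are sent
    to register 2 to satisfy the bound.\<close>
  have reg: "\<exists>p. tests 3 p (\<lambda>w r. Q w (\<lambda>i. r (min i 2)))" if "NL Q" for Q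
    using NL_obtain[OF that, of "\<lambda>i. min i 2" 3] by fastforce
  have min: "min 1 2 = (1 :: nat)" "min 2 2 = (2 :: nat)" "min 0 2 = (0 :: nat)" by simp_all
  \<comment> \<open>Register 2 is to become register 1 with the bit \<open>b\<close> appended.
    Demanding a nonzero result rules out leading zeros, and the equation rules out overflow.\<close>
  have "NL (\<lambda>w e. e 1 + e 1 + of_bool b = e 2 + of_bool False * cap w \<and> e 2 \<noteq> 0)" for b
    by (intro NL_conj NL_add_carry dec_NL dec_not dec_zero)
  from reg[OF this] have ex: "\<exists>p. tests 3 p (\<lambda>w r. r 1 + r 1 + of_bool b = r 2 \<and> r 2 \<noteq> 0)" for b
    by (simp only: min of_bool_eq(1) mult_zero_left add_0_right)
  define t where "t b = (SOME p. tests 3 p (\<lambda>w r. r 1 + r 1 + of_bool b = r 2 \<and> r 2 \<noteq> 0))" for b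
  have t: "tests 3 (t b) (\<lambda>w r. r 1 + r 1 + of_bool b = r 2 \<and> r 2 \<noteq> 0)" for b
    unfolding t_def by (rule someI_ex[OF ex])
  from reg[OF dec_NL[OF dec_eq[of 1 2]]] obtain cpy where cpy: "tests 3 cpy (\<lambda>w r. r 1 = r 2)"
    unfolding min by blast
  from reg[OF dec_NL[OF dec_eq[of 1 0]]] obtain done_test where fin: "tests 3 done_test (\<lambda>w r. r 1 = r 0)"
    unfolding min by blast
  from reg[OF dec_NL[OF dec_zero[of 1]]] obtain zero where zero: "tests 3 zero (\<lambda>w r. r 1 = 0)"
    unfolding min by blast
  define bit where "bit b = Seq (t b) (Atom (Out (Bit b)))" for b
  define body where "body = Seq (Atom (Guess 2)) (Seq (Choice (bit False) (bit True)) (Seq (Atom (Guess 1)) cpy))"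
  have body_sound: "\<exists>b. r' 1 = r 1 + r 1 + of_bool b \<and> r' 1 \<noteq> 0 \<and> ys' = ys @ [Bit b] \<and> r' 0 = r 0"
    if v: "valid w (h, r, ys)" and s: "((h, r, ys), (h', r', ys')) \<in> sem w body" for w h r ys h' r' ys'
  proof -
    obtain v1 where v1: "v1 < cap w"
      "((h, r(2 := v1), ys), (h', r', ys')) \<in> sem w (Seq (Choice (bit False) (bit True)) (Seq (Atom (Guess 1)) cpy))"
      using s unfolding body_def sem_Guess by blast
    then obtain h2 r2 ys2 where c: "((h, r(2 := v1), ys), (h2, r2, ys2)) \<in> sem w (Choice (bit False) (bit True))"
      and 2: "((h2, r2, ys2), (h', r', ys')) \<in> sem w (Seq (Atom (Guess 1)) cpy)"
      unfolding sem.simps(2)[of w "Choice (bit False) (bit True)"] by (auto simp del: sem.simps)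
    from c obtain b where "((h, r(2 := v1), ys), (h2, r2, ys2)) \<in> sem w (bit b)" by auto
    then obtain ys1 where 1: "((h, r(2 := v1), ys), (h2, r2, ys1)) \<in> sem w (t b)" "ys2 = ys1 @ [Bit b]"
      by (auto simp: bit_def)
    from 2 obtain v2 where 3: "v2 < cap w" "((h2, r2(1 := v2), ys2), (h', r', ys')) \<in> sem w cpy"
      unfolding sem_Guess by blast
    have valid1: "valid w (h, r(2 := v1), ys)" using v v1(1) by (simp add: valid_regs_upd)
    note s1 = tests_sound[OF t 1(1) valid1]
    have valid2: "valid w (h2, r2(1 := v2), ys2)" using s1(4) 3(1) by (simp add: valid_regs_upd)
    note s2 = tests_sound[OF cpy 3(2) valid2]
    show ?thesis using s1(1,3) s1(2)[of 0] s1(2)[of 2] s2(1,3) s2(2)[of 0] s2(2)[of 1] 1(2)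
      by (intro exI[of _ b]) auto
  qed
  have body_complete: "\<exists>h' r'. ((h, r, ys), (h', r', ys @ [Bit b])) \<in> sem w body \<and> r' 1 = v' \<and> r' 0 = r 0 \<and>
      valid w (h', r', ys @ [Bit b])"
    if v: "valid w (h, r, ys)" and v': "v' = r 1 + r 1 + of_bool b" "v' \<noteq> 0" "v' < cap w" for w h r ys v' b
  proof -
    have valid1: "valid w (h, r(2 := v'), ys)" using v v' by (simp add: valid_regs_upd)
    obtain h2 r2 where 1: "((h, r(2 := v'), ys), (h2, r2, ys)) \<in> sem w (t b)"
      "\<And>j. j < 3 \<Longrightarrow> r2 j = (r(2 := v')) j" "valid w (h2, r2, ys)"
      by (rule tests_complete[OF t[of b] valid1]) (use v' in auto)
    have valid2: "valid w (h2, r2(1 := v'), ys @ [Bit b])" using 1(3) v'(3) by (simp add: valid_regs_upd)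
    obtain h' r' where 2: "((h2, r2(1 := v'), ys @ [Bit b]), (h', r', ys @ [Bit b])) \<in> sem w cpy"
      "\<And>j. j < 3 \<Longrightarrow> r' j = (r2(1 := v')) j" "valid w (h', r', ys @ [Bit b])"
      by (rule tests_complete[OF cpy valid2]) (use 1(2)[of 2] in auto)
    have "((h, r(2 := v'), ys), (h2, r2, ys @ [Bit b])) \<in> sem w (Choice (bit False) (bit True))"
      using 1(1) by (cases b) (auto simp: bit_def)
    moreover have "((h2, r2, ys @ [Bit b]), (h', r', ys @ [Bit b])) \<in> sem w (Seq (Atom (Guess 1)) cpy)"
      using 2(1) v'(3) unfolding sem_Guess by blast
    ultimately have "((h, r(2 := v'), ys), (h', r', ys @ [Bit b])) \<in>
        sem w (Seq (Choice (bit False) (bit True)) (Seq (Atom (Guess 1)) cpy))"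
      unfolding sem.simps(2)[of w "Choice (bit False) (bit True)"] by (rule relcompI)
    then have "((h, r, ys), (h', r', ys @ [Bit b])) \<in> sem w body"
      using v'(3) unfolding body_def sem_Guess by blast
    then show ?thesis using 1(2)[of 0] 2(2)[of 0] 2(2)[of 1] 2(3) by (intro exI[of _ h'] exI[of _ r']) auto
  qed
  define p where "p = Seq (Atom (Guess 1)) (Seq zero (Seq (Star body) done_test))"
  show ?thesis
  proof (intro exI[of _ p] allI impI conjI)
    fix w h r ys h' r' ys'
    assume v: "valid w (h, r, ys)" and s: "((h, r, ys), (h', r', ys')) \<in> sem w p"
    then obtain v1 h1 r1 ys1 h2 r2 ys2 where v1: "v1 < cap w" "((h, r(1 := v1), ys), (h1, r1, ys1)) \<in> sem w zero"
      and loop: "((h1, r1, ys1), (h2, r2, ys2)) \<in> (sem w body)\<^sup>*"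
      and end_test: "((h2, r2, ys2), (h', r', ys')) \<in> sem w done_test"
      unfolding p_def sem_Guess by auto
    have "valid w (h, r(1 := v1), ys)" using v v1 by (simp add: valid_regs_upd)
    note s1 = tests_sound[OF zero v1(2) this]
    have "ys2 = ys1 @ binary (r2 1) \<and> r2 0 = r1 0 \<and> valid w (h2, r2, ys2)"
      using loop
    proof (induction "(h2, r2, ys2)" arbitrary: h2 r2 ys2 rule: rtrancl_induct)
      case base
      have "r1 1 = 0" using s1(2)[of 1] s1(3) by simp
      then show ?case using s1(4) by (simp add: binary.simps[of 0])
    next
      case (step s)
      obtain h3 r3 ys3 where s: "s = (h3, r3, ys3)" by (cases s)
      note IH = step(3)[OF s]
      have b: "((h3, r3, ys3), (h2, r2, ys2)) \<in> sem w body" using step(2) s by simp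
      have v3: "valid w (h3, r3, ys3)" using IH by blast
      from body_sound[OF v3 b] obtain b where b: "r2 1 = r3 1 + r3 1 + of_bool b" "r2 1 \<noteq> 0"
        "ys2 = ys3 @ [Bit b]" "r2 0 = r3 0" by blast
      have "binary (r2 1) = binary (r3 1) @ [Bit b]" using binary_append b(1,2) by blast
      then show ?case using IH b sem_valid[OF \<open>((h3, r3, ys3), (h2, r2, ys2)) \<in> sem w body\<close> v3] by simp
    qed
    moreover from this have "valid w (h2, r2, ys2)" by blast
    note s2 = tests_sound[OF fin end_test this]
    ultimately show "ys' = ys @ binary (r 0)" using s1(1) s1(2)[of 0] s2(1,3) by simp
  next
    fix w h r and ys :: "sym list"
    assume v: "valid w (h, r, ys)"
    have valid1: "valid w (h, r(1 := 0), ys)" using v cap_pos[of w] by (simp add: valid_regs_upd)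
    obtain h1 r1 where 1: "((h, r(1 := 0), ys), (h1, r1, ys)) \<in> sem w zero" "\<And>j. j < 3 \<Longrightarrow> r1 j = (r(1 := 0)) j"
      "valid w (h1, r1, ys)" by (rule tests_complete[OF zero valid1]) auto
    have "\<exists>h2 r2. ((h1, r1, ys), (h2, r2, ys @ binary u)) \<in> (sem w body)\<^sup>* \<and> r2 1 = u \<and> r2 0 = r1 0 \<and>
        valid w (h2, r2, ys @ binary u)" if "u < cap w" for u
      using that
    proof (induction u rule: less_induct)
      case (less u)
      show ?case
      proof (cases "u = 0")
        case True
        then show ?thesis using 1(2)[of 1] 1(3)
          by (intro exI[of _ h1] exI[of _ r1]) (simp add: binary.simps[of 0])
      next
        case False
        then have half: "u div 2 < u" "u div 2 < cap w" using less.prems by auto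
        from less.IH[OF half] obtain h2 r2 where 2: "((h1, r1, ys), (h2, r2, ys @ binary (u div 2))) \<in> (sem w body)\<^sup>*"
          "r2 1 = u div 2" "r2 0 = r1 0" "valid w (h2, r2, ys @ binary (u div 2))" by blast
        have u: "u = r2 1 + r2 1 + of_bool (odd u)" unfolding 2(2) by simp presburger
        from body_complete[OF 2(4) u False less.prems] obtain h3 r3 where 3:
          "((h2, r2, ys @ binary (u div 2)), (h3, r3, (ys @ binary (u div 2)) @ [Bit (odd u)])) \<in> sem w body"
          "r3 1 = u" "r3 0 = r2 0" "valid w (h3, r3, (ys @ binary (u div 2)) @ [Bit (odd u)])" by blast
        have "binary u = binary (u div 2) @ [Bit (odd u)]" using False by (subst binary.simps) simp
        then show ?thesis using 2 3 by (intro exI[of _ h3] exI[of _ r3]) (auto intro: rtrancl_into_rtrancl)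
      qed
    qed
    moreover have "r 0 < cap w" using v by (simp add: valid_regs_def)
    ultimately obtain h2 r2 where 2: "((h1, r1, ys), (h2, r2, ys @ binary (r 0))) \<in> (sem w body)\<^sup>*"
      "r2 1 = r 0" "r2 0 = r1 0" "valid w (h2, r2, ys @ binary (r 0))" by blast
    obtain h3 r3 where 3: "((h2, r2, ys @ binary (r 0)), (h3, r3, ys @ binary (r 0))) \<in> sem w done_test"
      by (rule tests_complete[OF fin 2(4)]) (use 2 1(2)[of 0] in auto)
    have "((h, r, ys), (h3, r3, ys @ binary (r 0))) \<in> sem w p"
      unfolding p_def sem_Guess using 1(1) 2(1) 3 cap_pos[of w] by (intro exI[of _ 0]) auto
    then show "\<exists>h' r'. ((h, r, ys), (h', r', ys @ binary (r 0))) \<in> sem w p" by blast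
  qed
qed

primrec print :: "'o \<Rightarrow> 'o list \<Rightarrow> 'o prog" where
  "print y [] = Atom (Out y)"
| "print y (z # zs) = Seq (Atom (Out y)) (print z zs)"

lemma sem_print: "((h, r, ys), t) \<in> sem w (print y zs) \<longleftrightarrow> t = (h, r, ys @ y # zs)"
  by (induction zs arbitrary: y ys) (auto simp: relcomp_unfold)

lemma encode_pair: "encode [k, l] = binary k @ Sep # binary l @ [Sep]"
  by (simp add: encode_def)

text \<open>The result is guessed and verified before anything is printed, so every run that
  succeeds has a correct output; the sign has only three values and is chosen by branching.\<close>

lemma position_program:
  assumes Q: "\<And>sg. dec (\<lambda>w e. Q sg w (e 0))"
  shows "\<exists>p. \<forall>w h r. valid w (h, r, [] :: sym list) \<longrightarrow>
    (\<forall>h' r' ys. ((h, r, []), (h', r', ys)) \<in> sem w p \<longrightarrow> (\<exists>k sg. ys = encode [k, sign_code sg] \<and> Q sg w k)) \<and>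
    (\<forall>k sg. k < cap w \<longrightarrow> Q sg w k \<longrightarrow> (\<exists>h' r'. ((h, r, []), (h', r', encode [k, sign_code sg])) \<in> sem w p))"
proof -
  obtain b where b: "\<forall>w h r ys. valid w (h, r, ys) \<longrightarrow>
      (\<forall>h' r' ys'. ((h, r, ys), (h', r', ys')) \<in> sem w b \<longrightarrow> ys' = ys @ binary (r 0)) \<and>
      (\<exists>h' r'. ((h, r, ys), (h', r', ys @ binary (r 0))) \<in> sem w b)"
    using binary_program by (rule exE)
  have ex: "\<exists>p. tests 1 p (\<lambda>w r. Q sg w (r 0))" for sg
    by (rule NL_obtain[OF dec_NL[OF Q[of sg]], of "\<lambda>_. 0" 1]) (simp, rule exI)
  define q where "q sg = (SOME p. tests 1 p (\<lambda>w r. Q sg w (r 0)))" for sg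
  have q: "tests 1 (q sg) (\<lambda>w r. Q sg w (r 0))" for sg
    unfolding q_def by (rule someI_ex[OF ex])
  define branch where "branch sg = Seq (q sg) (Seq b (print Sep (binary (sign_code sg) @ [Sep])))" for sg
  define p where "p = Seq (Atom (Guess 0)) (Choice (branch Plus) (Choice (branch Minus) (branch PlusMinus)))"
  have p: "((h, r, []), t) \<in> sem w p \<longleftrightarrow> (\<exists>k<cap w. \<exists>sg. ((h, r(0 := k), []), t) \<in> sem w (branch sg))" for h r w t
  proof -
    have "(\<exists>sg. P sg) \<longleftrightarrow> P Plus \<or> P Minus \<or> P PlusMinus" for P
      using wagner_sign.exhaust by metis
    then show ?thesis unfolding p_def sem_Guess sem.simps(3) Un_iff by simp
  qed
  show ?thesis
  proof (intro exI[of _ p] allI impI conjI)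
    fix w h r h' r' ys
    assume v: "valid w (h, r, [] :: sym list)" and "((h, r, []), (h', r', ys)) \<in> sem w p"
    then obtain k sg where k: "k < cap w" and s: "((h, r(0 := k), []), (h', r', ys)) \<in> sem w (branch sg)"
      unfolding p by blast
    from s obtain h1 r1 ys1 h2 r2 ys2 where 1: "((h, r(0 := k), []), (h1, r1, ys1)) \<in> sem w (q sg)"
      and 2: "((h1, r1, ys1), (h2, r2, ys2)) \<in> sem w b"
      and 3: "((h2, r2, ys2), (h', r', ys)) \<in> sem w (print Sep (binary (sign_code sg) @ [Sep]))"
      unfolding branch_def by auto
    have "valid w (h, r(0 := k), [])" using v k by (simp add: valid_regs_upd)
    note s1 = tests_sound[OF q 1 this]
    have "ys2 = ys1 @ binary (r1 0)" using b s1(4) 2 by blast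
    then have "ys = encode [k, sign_code sg]" using s1(1) s1(2)[of 0] 3 by (simp add: sem_print encode_pair)
    then show "\<exists>k sg. ys = encode [k, sign_code sg] \<and> Q sg w k" using s1(3) by auto
  next
    fix w h r k sg
    assume v: "valid w (h, r, [] :: sym list)" and k: "k < cap w" and Q: "Q sg w k"
    have v1: "valid w (h, r(0 := k), [])" using v k by (simp add: valid_regs_upd)
    obtain h1 r1 where 1: "((h, r(0 := k), []), (h1, r1, [])) \<in> sem w (q sg)" "\<And>j. j < 1 \<Longrightarrow> r1 j = (r(0 := k)) j"
      "valid w (h1, r1, [] :: sym list)"
      by (rule tests_complete[OF q[of sg] v1]) (use Q in auto)
    have "\<exists>h2 r2. ((h1, r1, []), (h2, r2, [] @ binary (r1 0))) \<in> sem w b"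
      using b 1(3) by blast
    moreover have "r1 0 = k" using 1(2)[of 0] by simp
    ultimately obtain h2 r2 where 2: "((h1, r1, []), (h2, r2, binary k)) \<in> sem w b"
      by auto
    have "((h2, r2, binary k), (h2, r2, encode [k, sign_code sg])) \<in>
        sem w (print Sep (binary (sign_code sg) @ [Sep]))" by (simp add: sem_print encode_pair)
    then have "((h, r, []), (h2, r2, encode [k, sign_code sg])) \<in> sem w p"
      unfolding p branch_def using k 1(1) 2 by auto
    then show "\<exists>h' r'. ((h, r, []), (h', r', encode [k, sign_code sg])) \<in> sem w p" by blast
  qed
qed

lemma nlogspace_computes_program:
  fixes p :: "'o::countable prog"
  assumes sound: "\<And>x h r h' r' ys. x \<in> D \<Longrightarrow> valid (enc x) (h, r, [] :: 'o list) \<Longrightarrow>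
      ((h, r, []), (h', r', ys)) \<in> sem (enc x) p \<Longrightarrow> R x ys"
    and complete: "\<And>x h r. x \<in> D \<Longrightarrow> valid (enc x) (h, r, [] :: 'o list) \<Longrightarrow>
      \<exists>h' r' ys. ((h, r, []), (h', r', ys)) \<in> sem (enc x) p"
  shows "nlogspace_computes D enc R"
proof -
  obtain d where d: "regs p \<subseteq> {..<d}" "0 < d" by (rule regs_bound)
  have "(\<exists>out. ntm_outputs (compile d p) (enc x) out) \<and> (\<forall>out. ntm_outputs (compile d p) (enc x) out \<longrightarrow> R x out)"
    if x: "x \<in> D" for x
  proof
    from compile_outputs(2)[OF d, of "enc x"] obtain r where r: "valid_regs (enc x) r"
      "\<And>h' r' ys. ((length (enc x) + 1, r, []), (h', r', ys)) \<in> sem (enc x) p \<Longrightarrow> ntm_outputs (compile d p) (enc x) ys"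
      by blast
    from r(1) have "valid (enc x) (length (enc x) + 1, r, [] :: 'o list)" by simp
    from complete[OF x this] show "\<exists>out. ntm_outputs (compile d p) (enc x) out" using r(2) by blast
    show "\<forall>out. ntm_outputs (compile d p) (enc x) out \<longrightarrow> R x out"
    proof (intro allI impI)
      fix out
      assume "ntm_outputs (compile d p) (enc x) out"
      from compile_outputs(1)[OF d this] obtain r h' r' where
        r: "valid_regs (enc x) r" "((length (enc x) + 1, r, []), (h', r', out)) \<in> sem (enc x) p" by blast
      have "valid (enc x) (length (enc x) + 1, r, [] :: 'o list)" using r(1) by simp
      from sound[OF x this r(2)] show "R x out" .
    qed
  qed
  then show ?thesis unfolding nlogspace_computes_def
    using ntm_compile[of d p] log_space_compile[OF d] by (intro exI[of _ "compile d p"]) auto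
qed

theorem proposition29:
  shows "nlogspace_computes saturated_inputs (\<lambda>I. encode (fdfa_code I))
           (\<lambda>(s, F) out. \<exists>k sg. out = encode [k, sign_code sg] \<and>
              is_wagner_position {..<s} (fdfa_lang {..<s} F) k sg)
       \<and> (\<forall>sg. nlogspace_decides ({1..} \<times> saturated_inputs)
           (\<lambda>(k, I). encode (k # fdfa_code I))
           (\<lambda>(k, s, F). fdfa_lang {..<s} F \<in> wagner_class {..<s} k sg))"
proof (intro conjI allI)
  obtain p where p: "\<forall>w h r. valid w (h, r, [] :: sym list) \<longrightarrow>
      (\<forall>h' r' ys. ((h, r, []), (h', r', ys)) \<in> sem w p \<longrightarrow>
        (\<exists>k sg. ys = encode [k, sign_code sg] \<and> position_query sg w k)) \<and>
      (\<forall>k sg. k < cap w \<longrightarrow> position_query sg w k \<longrightarrow>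
        (\<exists>h' r'. ((h, r, []), (h', r', encode [k, sign_code sg])) \<in> sem w p))"
    using position_program[of position_query, OF dec_position_query] by (rule exE)
  show "nlogspace_computes saturated_inputs (\<lambda>I. encode (fdfa_code I))
      (\<lambda>(s, F) out. \<exists>k sg. out = encode [k, sign_code sg] \<and> is_wagner_position {..<s} (fdfa_lang {..<s} F) k sg)"
  proof (rule nlogspace_computes_program[where p = p])
    fix x h r h' r' ys
    assume x: "x \<in> saturated_inputs" and v: "valid (encode (fdfa_code x)) (h, r, [] :: sym list)"
      and s: "((h, r, []), (h', r', ys)) \<in> sem (encode (fdfa_code x)) p"
    obtain s F where sF: "x = (s, F)" by (cases x)
    interpret encoded_fdfa s F "[]" "encode (fdfa_code (s, F))" 0
      using x sF by unfold_locales auto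
    from p v s obtain k sg where k: "ys = encode [k, sign_code sg]" "position_query sg (encode (fdfa_code x)) k"
      by blast
    from k(2) have "is_wagner_position {..<s} (fdfa_lang {..<s} F) k sg"
      using is_wagner_position_if_attained position_query_iff sF by simp
    then show "(case x of (s, F) \<Rightarrow> \<lambda>out. \<exists>k sg. out = encode [k, sign_code sg] \<and>
        is_wagner_position {..<s} (fdfa_lang {..<s} F) k sg) ys" using k(1) sF by auto
  next
    fix x h r
    assume x: "x \<in> saturated_inputs" and v: "valid (encode (fdfa_code x)) (h, r, [] :: sym list)"
    obtain s F where sF: "x = (s, F)" by (cases x)
    interpret encoded_fdfa s F "[]" "encode (fdfa_code (s, F))" 0
      using x sF by unfold_locales auto
    obtain k sg where k: "1 \<le> k" "bounded_by fchain k sg" "attained_by fchain k sg"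
      using position_exists s_pos by blast
    then have "k \<le> length (encode (fdfa_code (s, F)))" using fchain_le by (cases sg) auto
    then have "k < cap (encode (fdfa_code (s, F)))" using length_w_less_cap by linarith
    moreover have "position_query sg (encode (fdfa_code (s, F))) k" using k position_query_iff by simp
    ultimately show "\<exists>h' r' ys. ((h, r, []), (h', r', ys)) \<in> sem (encode (fdfa_code x)) p"
      using p v sF by blast
  qed
next
  fix sg
  show "nlogspace_decides ({1..} \<times> saturated_inputs) (\<lambda>(k, I). encode (k # fdfa_code I))
      (\<lambda>(k, s, F). fdfa_lang {..<s} F \<in> wagner_class {..<s} k sg)"
  proof (rule nlogspace_decides_query[OF dec_NL[OF dec_class_query[of sg]]])
    fix x :: "nat \<times> nat \<times> input_fdfa"
    assume x: "x \<in> {1..} \<times> saturated_inputs"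
    obtain k s F where ksF: "x = (k, s, F)" by (cases x)
    interpret encoded_fdfa s F "[k]" "encode (k # fdfa_code (s, F))" 1
      using x ksF by unfold_locales auto
    show "class_query sg (case x of (k, I) \<Rightarrow> encode (k # fdfa_code I)) \<longleftrightarrow>
        (case x of (k, s, F) \<Rightarrow> fdfa_lang {..<s} F \<in> wagner_class {..<s} k sg)"
      using class_query_iff[of k sg] x ksF in_wagner_class_iff by simp
  qed
qed

end
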